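(* Let $X'$ be a $C^\infty$-scheme and let $\Phi\colon X\hookrightarrow X'$ be a locally closed subscheme, such that $X$ is an $m$-dimensional and $X'$ is an $n$-dimensional asymptotic manifold with corners. Then $m\le n$.
   Context: **$C^\infty$-schemes.** $C^\infty\mathrm{Sch}$ is the opposite of the category of finitely generated $C^\infty$-rings (quotients $C^\infty(\mathbb R^n)/I$); its objects are called $C^\infty$-schemes; $X\leftrightarrow C^\infty(X)$, $A\leftrightarrow\mathrm{Spec}(A)$, $\emptyset:=\mathrm{Spec}(0)$. For $f\in C^\infty(X)$ the open subscheme defined by $f$ is $X_{f\ne0}:=\mathrm{Spec}(C^\infty(X)\{f^{-1}\})$ (universal inversion of $f$). Closed subschemes are $\mathrm{Spec}(C^\infty(X)/I)$, $I$ an ideal; a locally closed subscheme of $X'$ is a morphism $X\to X'$ factoring through a closed embedding into an open subscheme of $X'$. Intersections are fibre products over the ambient scheme. The closure $\overline U$ of a subscheme $U\subseteq X$ is $\mathrm{Spec}(C^\infty(X)/\mathrm{Ker}(C^\infty(X)\to C^\infty(U)))$. For an ideal $I$, $\sqrt[\infty]I:=\{a\mid(C^\infty(X)/I)\{a^{-1}\}=0\}$; $X_{red}:=\mathrm{Spec}(C^\infty(X)/\sqrt[\infty]0)$. For $f\in C^\infty(X)$, $r\in\mathbb R$ and $\alpha_r\in C^\infty(\mathbb R)$ with zero set $(-\infty,r]$: $X_{f\le r}:=\mathrm{Spec}(C^\infty(X)/\sqrt[\infty]{(\alpha_r(f))})$, $X_{f>r}:=X_{\alpha_r(f)\ne0}$,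 and similarly $X_{f\ge r}$, $X_{f<r}$; $X_{f=r}:=X_{f\le r}\cap X_{f\ge r}$. Manifolds are non-empty, Hausdorff, second countable, identified with the $C^\infty$-schemes $\mathrm{Spec}(C^\infty(M))$. **Manifolds with corners.** For a manifold $M$ and $\{f_1,\dots,f_m\}\subseteq C^\infty(M)$, $0$ is a regular value for $\{f_j\}$ if for each $j$ it is a regular value for $f_j$ and for the restrictions of $f_j$ to $\bigcap_{i\in T}M_{f_i=0}$ for all $T\subseteq\{1,\dots,m\}\setminus\{j\}$. A non-empty $X$ is an $n$-dimensional manifold with corners if $X\cong\bigcap_{j}M_{f_j\le0}=\overline{\bigcap_jM_{f_j<0}}$ for some $n$-dimensional manifold $M$ and $\{f_1,\dots,f_m\}$ having $0$ as a regular value. **Asymptotic manifolds with corners.** A regular system of open subschemes of $M$ is a family $\{U_i\}_{i\in D}$ of non-empty open subschemes indexed by a non-empty directed poset $D$ with $\overline U_j\subseteq U_i$ for all $i<j$; $\bigcap_{i\in D}U_i:=\lim_iU_i$ computed in $C^\infty\mathrm{Sch}$. For $n\ge0$, $X$ is an $n$-dimensional asymptotic manifold with corners if $X_{red}\cong\bigcap_{i\in D}U_i$ for some regular system of open subschemes of an $n$-dimensional manifold with corners. The $-1$-dimensional asymptotic manifold with corners is $\emptyset$. *)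

theory Defs
  imports "HOL-Analysis.Analysis" "HOL-Algebra.QuotRing"
begin

section \<open>Smooth functions on open subsets of Cartesian space\<close>

text \<open>\<open>n\<close>-tuples are extensional functions on \<open>{..<n}\<close>, so that \<open>A\<^sup>n\<close> is \<open>{..<n} \<rightarrow>\<^sub>E A\<close>, and
  \<open>\<real>\<^sup>n\<close> is the underlying set of the topological space \<open>powertop_real {..<n}\<close>.\<close>

abbreviation Rn :: "nat \<Rightarrow> (nat \<Rightarrow> real) set" where
  "Rn n \<equiv> {..<n} \<rightarrow>\<^sub>E UNIV"

definition partial_deriv :: "nat \<Rightarrow> ((nat \<Rightarrow> real) \<Rightarrow> real) \<Rightarrow> (nat \<Rightarrow> real) \<Rightarrow> real" where
  "partial_deriv i f x = deriv (\<lambda>t. f (x(i := t))) (x i)"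

text \<open>Only meaningful for \<open>U\<close> open in \<open>\<real>\<^sup>n\<close>; the values of \<open>f\<close> outside \<open>U\<close> are then irrelevant.\<close>

primrec Ck_on :: "nat \<Rightarrow> nat \<Rightarrow> (nat \<Rightarrow> real) set \<Rightarrow> ((nat \<Rightarrow> real) \<Rightarrow> real) \<Rightarrow> bool" where
  "Ck_on 0 n U f \<longleftrightarrow> continuous_map (subtopology (powertop_real {..<n}) U) euclideanreal f"
| "Ck_on (Suc k) n U f \<longleftrightarrow>
     continuous_map (subtopology (powertop_real {..<n}) U) euclideanreal f \<and>
     (\<forall>i<n. (\<forall>x\<in>U. (\<lambda>t. f (x(i := t))) differentiable (at (x i))) \<and>
            Ck_on k n U (partial_deriv i f))"

definition smooth_on :: "nat \<Rightarrow> (nat \<Rightarrow> real) set \<Rightarrow> ((nat \<Rightarrow> real) \<Rightarrow> real) \<Rightarrow> bool" where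
  "smooth_on n U f \<longleftrightarrow> (\<forall>k. Ck_on k n U f)"

definition smooth_funs :: "nat \<Rightarrow> ((nat \<Rightarrow> real) \<Rightarrow> real) set" where
  "smooth_funs n = {f \<in> extensional (Rn n). smooth_on n (Rn n) f}"


section \<open>Smooth rings\<close>

text \<open>A \<open>C\<^sup>\<infinity>\<close>-ring: a set with an operation \<open>A\<^sup>n \<rightarrow> A\<close> for each smooth \<open>f : \<real>\<^sup>n \<rightarrow> \<real>\<close>,
  compatible with projections and composition.\<close>

record 'a cinf_ring =
  elems :: "'a set"
  sop :: "nat \<Rightarrow> ((nat \<Rightarrow> real) \<Rightarrow> real) \<Rightarrow> (nat \<Rightarrow> 'a) \<Rightarrow> 'a"

locale cinf_ring =
  fixes A :: "'a cinf_ring"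
  assumes sop_closed:
      "\<And>n f a. f \<in> smooth_funs n \<Longrightarrow> a \<in> {..<n} \<rightarrow>\<^sub>E elems A \<Longrightarrow> sop A n f a \<in> elems A"
    and sop_proj:
      "\<And>n i a. i < n \<Longrightarrow> a \<in> {..<n} \<rightarrow>\<^sub>E elems A \<Longrightarrow> sop A n (\<lambda>x\<in>Rn n. x i) a = a i"
    and sop_comp:
      "\<And>m n f g a. f \<in> smooth_funs m \<Longrightarrow> (\<And>j. j < m \<Longrightarrow> g j \<in> smooth_funs n) \<Longrightarrow>
        a \<in> {..<n} \<rightarrow>\<^sub>E elems A \<Longrightarrow>
        sop A n (\<lambda>x\<in>Rn n. f (\<lambda>j\<in>{..<m}. g j x)) a = sop A m f (\<lambda>j\<in>{..<m}. sop A n (g j) a)"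

text \<open>The commutative ring underlying a \<open>C\<^sup>\<infinity>\<close>-ring.\<close>

definition ring_of :: "'a cinf_ring \<Rightarrow> 'a ring" where
  "ring_of A =
    \<lparr>carrier = elems A,
     mult = (\<lambda>a b. sop A 2 (\<lambda>x\<in>Rn 2. x 0 * x 1) (\<lambda>i\<in>{..<2}. if i = 0 then a else b)),
     one = sop A 0 (\<lambda>x\<in>Rn 0. 1) (\<lambda>i\<in>{..<0}. undefined),
     zero = sop A 0 (\<lambda>x\<in>Rn 0. 0) (\<lambda>i\<in>{..<0}. undefined),
     add = (\<lambda>a b. sop A 2 (\<lambda>x\<in>Rn 2. x 0 + x 1) (\<lambda>i\<in>{..<2}. if i = 0 then a else b))\<rparr>"

definition cinf_hom :: "'a cinf_ring \<Rightarrow> 'b cinf_ring \<Rightarrow> ('a \<Rightarrow> 'b) set" where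
  "cinf_hom A B = {h \<in> elems A \<rightarrow>\<^sub>E elems B.
     \<forall>n. \<forall>f\<in>smooth_funs n. \<forall>a\<in>{..<n} \<rightarrow>\<^sub>E elems A.
       h (sop A n f a) = sop B n f (\<lambda>i\<in>{..<n}. h (a i))}"

definition cinf_iso :: "'a cinf_ring \<Rightarrow> 'b cinf_ring \<Rightarrow> ('a \<Rightarrow> 'b) set" where
  "cinf_iso A B = {h \<in> cinf_hom A B. bij_betw h (elems A) (elems B)}"

definition is_zero_ring :: "'a cinf_ring \<Rightarrow> bool" where
  "is_zero_ring A \<longleftrightarrow> elems A = {\<zero>\<^bsub>ring_of A\<^esub>}"

text \<open>The quotient by an ideal of the underlying ring. By Hadamard's lemma the operations do not
  depend on the chosen representatives.\<close>

definition quot :: "'a cinf_ring \<Rightarrow> 'a set \<Rightarrow> 'a set cinf_ring" where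
  "quot A I =
    \<lparr>elems = carrier (ring_of A Quot I),
     sop = (\<lambda>n f c. I +>\<^bsub>ring_of A\<^esub> sop A n f (\<lambda>i\<in>{..<n}. SOME a. a \<in> c i))\<rparr>"

definition quot_map :: "'a cinf_ring \<Rightarrow> 'a set \<Rightarrow> 'a \<Rightarrow> 'a set" where
  "quot_map A I = (\<lambda>a\<in>elems A. I +>\<^bsub>ring_of A\<^esub> a)"

definition free_cinf_ring :: "nat \<Rightarrow> ((nat \<Rightarrow> real) \<Rightarrow> real) cinf_ring" where
  "free_cinf_ring n =
    \<lparr>elems = smooth_funs n, sop = (\<lambda>m f g. \<lambda>x\<in>Rn n. f (\<lambda>j\<in>{..<m}. g j x))\<rparr>"

definition fin_gen :: "'a cinf_ring \<Rightarrow> bool" where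
  "fin_gen A \<longleftrightarrow> cinf_ring A \<and>
     (\<exists>n I. ideal I (ring_of (free_cinf_ring n)) \<and> cinf_iso (quot (free_cinf_ring n) I) A \<noteq> {})"

text \<open>The quotients of the free \<open>C\<^sup>\<infinity>\<close>-rings live on the following type, so every finitely generated
  \<open>C\<^sup>\<infinity>\<close>-ring is isomorphic to one with elements of this type. It therefore suffices to let test
  objects in universal properties, and objects introduced by existential quantification, range over
  this type.\<close>

type_synonym univ = "((nat \<Rightarrow> real) \<Rightarrow> real) set"

text \<open>\<open>A \<rightarrow> B\<close> exhibits \<open>B\<close> as \<open>A{f\<^sup>-\<^sup>1}\<close>. For finitely generated \<open>A\<close> it makes no difference whether the
  test objects are finitely generated, as \<open>A{f\<^sup>-\<^sup>1}\<close> is itself finitely generated.\<close>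

definition universal_inversion ::
    "'a cinf_ring \<Rightarrow> 'a \<Rightarrow> 'b cinf_ring \<Rightarrow> ('a \<Rightarrow> 'b) \<Rightarrow> bool" where
  "universal_inversion A f B \<phi> \<longleftrightarrow>
     fin_gen B \<and> \<phi> \<in> cinf_hom A B \<and> \<phi> f \<in> Units (ring_of B) \<and>
     (\<forall>(C :: univ cinf_ring) \<psi>. fin_gen C \<and> \<psi> \<in> cinf_hom A C \<and> \<psi> f \<in> Units (ring_of C) \<longrightarrow>
        (\<exists>!h. h \<in> cinf_hom B C \<and> compose (elems A) h \<phi> = \<psi>))"

text \<open>\<open>a\<close> belongs to the radical of \<open>I\<close> iff \<open>(A/I){a\<^sup>-\<^sup>1} = 0\<close>.\<close>

definition inf_radical :: "'a cinf_ring \<Rightarrow> 'a set \<Rightarrow> 'a set" where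
  "inf_radical A I = {a \<in> elems A. \<exists>(B :: univ cinf_ring) \<phi>.
     universal_inversion (quot A I) (quot_map A I a) B \<phi> \<and> is_zero_ring B}"


section \<open>Smooth schemes\<close>

datatype 'a spec = Spec (Cinf: "'a cinf_ring")

definition cinf_scheme :: "'a spec \<Rightarrow> bool" where
  "cinf_scheme X \<longleftrightarrow> fin_gen (Cinf X)"

text \<open>A morphism \<open>X \<rightarrow> Y\<close> is given by its pullback \<open>C\<^sup>\<infinity>(Y) \<rightarrow> C\<^sup>\<infinity>(X)\<close>; composition is reversed.\<close>

definition Mor :: "'a spec \<Rightarrow> 'b spec \<Rightarrow> ('b \<Rightarrow> 'a) set" where
  "Mor X Y = cinf_hom (Cinf Y) (Cinf X)"

definition mor_comp :: "'c spec \<Rightarrow> ('c \<Rightarrow> 'b) \<Rightarrow> ('b \<Rightarrow> 'a) \<Rightarrow> ('c \<Rightarrow> 'a)" where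
  "mor_comp Z g f = compose (elems (Cinf Z)) f g"
  \<comment> \<open>\<open>g \<circ> f\<close> for \<open>f : X \<rightarrow> Y\<close> and \<open>g : Y \<rightarrow> Z\<close>\<close>

definition isomorphic :: "'a spec \<Rightarrow> 'b spec \<Rightarrow> bool" where
  "isomorphic X Y \<longleftrightarrow> cinf_iso (Cinf Y) (Cinf X) \<noteq> {}"

definition is_empty_scheme :: "'a spec \<Rightarrow> bool" where
  "is_empty_scheme X \<longleftrightarrow> is_zero_ring (Cinf X)"

definition open_subscheme :: "'a spec \<Rightarrow> 'a \<Rightarrow> 'b spec \<Rightarrow> ('a \<Rightarrow> 'b) \<Rightarrow> bool" where
  "open_subscheme X f U j \<longleftrightarrow> f \<in> elems (Cinf X) \<and> universal_inversion (Cinf X) f (Cinf U) j"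
  \<comment> \<open>\<open>j : U \<rightarrow> X\<close> is the inclusion of \<open>X\<^bsub>f\<noteq>0\<^esub>\<close>\<close>

definition closed_subscheme :: "'a spec \<Rightarrow> 'a set \<Rightarrow> 'a set spec" where
  "closed_subscheme X I = Spec (quot (Cinf X) I)"

definition closed_incl :: "'a spec \<Rightarrow> 'a set \<Rightarrow> 'a \<Rightarrow> 'a set" where
  "closed_incl X I = quot_map (Cinf X) I"

definition closed_embedding :: "'a spec \<Rightarrow> 'b spec \<Rightarrow> ('b \<Rightarrow> 'a) \<Rightarrow> bool" where
  "closed_embedding X Y c \<longleftrightarrow>
     (\<exists>I \<theta>. ideal I (ring_of (Cinf Y)) \<and> \<theta> \<in> cinf_iso (Cinf (closed_subscheme Y I)) (Cinf X) \<and>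
        c = mor_comp Y (closed_incl Y I) \<theta>)"

definition locally_closed_subscheme :: "'a spec \<Rightarrow> 'b spec \<Rightarrow> ('b \<Rightarrow> 'a) \<Rightarrow> bool" where
  "locally_closed_subscheme X X' \<Phi> \<longleftrightarrow>
     (\<exists>f (U :: univ spec) j c. open_subscheme X' f U j \<and> closed_embedding X U c \<and>
        \<Phi> = mor_comp X' j c)"

text \<open>Containment of subschemes \<open>y : Y \<rightarrow> X\<close> and \<open>z : Z \<rightarrow> X\<close>: factorization of \<open>y\<close> through \<open>z\<close>.\<close>

definition subscheme_le ::
    "'a spec \<Rightarrow> 'b spec \<Rightarrow> ('a \<Rightarrow> 'b) \<Rightarrow> 'c spec \<Rightarrow> ('a \<Rightarrow> 'c) \<Rightarrow> bool" where
  "subscheme_le X Y y Z z \<longleftrightarrow> (\<exists>u \<in> Mor Y Z. mor_comp X z u = y)"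

definition closure_ideal :: "'a spec \<Rightarrow> 'b spec \<Rightarrow> ('a \<Rightarrow> 'b) \<Rightarrow> 'a set" where
  "closure_ideal X U j = a_kernel (ring_of (Cinf X)) (ring_of (Cinf U)) j"

definition closure_scheme :: "'a spec \<Rightarrow> 'b spec \<Rightarrow> ('a \<Rightarrow> 'b) \<Rightarrow> 'a set spec" where
  "closure_scheme X U j = closed_subscheme X (closure_ideal X U j)"

definition closure_incl :: "'a spec \<Rightarrow> 'b spec \<Rightarrow> ('a \<Rightarrow> 'b) \<Rightarrow> 'a \<Rightarrow> 'a set" where
  "closure_incl X U j = closed_incl X (closure_ideal X U j)"

definition red :: "'a spec \<Rightarrow> 'a set spec" where
  "red X = closed_subscheme X (inf_radical (Cinf X) {\<zero>\<^bsub>ring_of (Cinf X)\<^esub>})"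

text \<open>\<open>z : Z \<rightarrow> X\<close> is the fibre product over \<open>X\<close> of the \<open>y i : Y i \<rightarrow> X\<close>, \<open>i \<in> J\<close>
  (and so isomorphic to \<open>X\<close> if \<open>J\<close> is empty).\<close>

definition is_intersection ::
    "'a spec \<Rightarrow> 'i set \<Rightarrow> ('i \<Rightarrow> 'b spec) \<Rightarrow> ('i \<Rightarrow> 'a \<Rightarrow> 'b) \<Rightarrow> 'c spec \<Rightarrow> ('a \<Rightarrow> 'c) \<Rightarrow> bool" where
  "is_intersection X J Y y Z z \<longleftrightarrow>
     cinf_scheme Z \<and> z \<in> Mor Z X \<and>
     (\<exists>\<pi>. (\<forall>i\<in>J. \<pi> i \<in> Mor Z (Y i) \<and> mor_comp X (y i) (\<pi> i) = z) \<and>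
       (\<forall>(W :: univ spec) w \<rho>.
          cinf_scheme W \<and> w \<in> Mor W X \<and>
          (\<forall>i\<in>J. \<rho> i \<in> Mor W (Y i) \<and> mor_comp X (y i) (\<rho> i) = w) \<longrightarrow>
          (\<exists>!u. u \<in> Mor W Z \<and> mor_comp X z u = w \<and>
             (\<forall>i\<in>J. mor_comp (Y i) (\<pi> i) u = \<rho> i))))"

definition alpha_le :: "real \<Rightarrow> (nat \<Rightarrow> real) \<Rightarrow> real" where
  "alpha_le r = (SOME \<alpha>. \<alpha> \<in> smooth_funs 1 \<and> (\<forall>x\<in>Rn 1. \<alpha> x = 0 \<longleftrightarrow> x 0 \<le> r))"

definition alpha_ge :: "real \<Rightarrow> (nat \<Rightarrow> real) \<Rightarrow> real" where
  "alpha_ge r = (SOME \<alpha>. \<alpha> \<in> smooth_funs 1 \<and> (\<forall>x\<in>Rn 1. \<alpha> x = 0 \<longleftrightarrow> x 0 \<ge> r))"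

definition apply1 :: "'a cinf_ring \<Rightarrow> ((nat \<Rightarrow> real) \<Rightarrow> real) \<Rightarrow> 'a \<Rightarrow> 'a" where
  "apply1 A \<alpha> f = sop A 1 \<alpha> (\<lambda>i\<in>{..<1}. f)"

text \<open>\<open>X\<^bsub>f\<le>r\<^esub>\<close> is the closed subscheme of \<open>X\<close> defined by \<open>le_ideal X f r\<close>.\<close>

definition le_ideal :: "'a spec \<Rightarrow> 'a \<Rightarrow> real \<Rightarrow> 'a set" where
  "le_ideal X f r =
     inf_radical (Cinf X) (genideal (ring_of (Cinf X)) {apply1 (Cinf X) (alpha_le r) f})"

text \<open>\<open>j : U \<rightarrow> X\<close> is the inclusion of \<open>X\<^bsub>f<r\<^esub>\<close>.\<close>

definition lt_subscheme :: "'a spec \<Rightarrow> 'a \<Rightarrow> real \<Rightarrow> 'b spec \<Rightarrow> ('a \<Rightarrow> 'b) \<Rightarrow> bool" where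
  "lt_subscheme X f r U j \<longleftrightarrow> open_subscheme X (apply1 (Cinf X) (alpha_ge r) f) U j"


section \<open>Manifolds\<close>

text \<open>A manifold is a topological space with a set of charts \<open>(U, \<phi>)\<close>; the atlas need not be
  maximal.\<close>

definition smooth_manifold ::
    "nat \<Rightarrow> 'p topology \<Rightarrow> ('p set \<times> ('p \<Rightarrow> nat \<Rightarrow> real)) set \<Rightarrow> bool" where
  "smooth_manifold n T \<A> \<longleftrightarrow>
     topspace T \<noteq> {} \<and> Hausdorff_space T \<and> second_countable T \<and>
     (\<Union>(U, \<phi>)\<in>\<A>. U) = topspace T \<and>
     (\<forall>(U, \<phi>)\<in>\<A>. openin T U \<and> openin (powertop_real {..<n}) (\<phi> ` U) \<and>
        homeomorphic_map (subtopology T U) (subtopology (powertop_real {..<n}) (\<phi> ` U)) \<phi>) \<and>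
     (\<forall>(U, \<phi>)\<in>\<A>. \<forall>(V, \<psi>)\<in>\<A>. \<forall>i<n.
        smooth_on n (\<phi> ` (U \<inter> V)) (\<lambda>x. \<psi> (inv_into U \<phi> x) i))"

definition manifold_funs ::
    "nat \<Rightarrow> 'p topology \<Rightarrow> ('p set \<times> ('p \<Rightarrow> nat \<Rightarrow> real)) set \<Rightarrow> ('p \<Rightarrow> real) set" where
  "manifold_funs n T \<A> = {g \<in> extensional (topspace T).
     \<forall>(U, \<phi>)\<in>\<A>. smooth_on n (\<phi> ` U) (\<lambda>x. g (inv_into U \<phi> x))}"

definition manifold_scheme ::
    "nat \<Rightarrow> 'p topology \<Rightarrow> ('p set \<times> ('p \<Rightarrow> nat \<Rightarrow> real)) set \<Rightarrow> ('p \<Rightarrow> real) spec" where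
  "manifold_scheme n T \<A> = Spec
     \<lparr>elems = manifold_funs n T \<A>,
      sop = (\<lambda>m f g. \<lambda>p\<in>topspace T. f (\<lambda>j\<in>{..<m}. g j p))\<rparr>"

text \<open>Smooth curves in the manifold \<open>M\<close> with set of points \<open>P\<close> and set of smooth functions \<open>G\<close>,
  that is, morphisms \<open>\<real> \<rightarrow> M\<close>.\<close>

definition smooth_curve :: "'p set \<Rightarrow> ('p \<Rightarrow> real) set \<Rightarrow> (real \<Rightarrow> 'p) \<Rightarrow> bool" where
  "smooth_curve P G \<gamma> \<longleftrightarrow> range \<gamma> \<subseteq> P \<and> (\<forall>g\<in>G. (\<lambda>x\<in>Rn 1. g (\<gamma> (x 0))) \<in> smooth_funs 1)"

text \<open>0 is a regular value of the restriction of \<open>f\<close> to the submanifold \<open>S\<close>: at every zero \<open>p\<close> of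
  \<open>f\<close> in \<open>S\<close>, the differential of \<open>f\<close> does not vanish on \<open>T\<^sub>pS\<close>. Tangent vectors of \<open>S\<close> are represented
  by smooth curves in \<open>S\<close>.\<close>

definition zero_regular_on ::
    "'p set \<Rightarrow> ('p \<Rightarrow> real) set \<Rightarrow> 'p set \<Rightarrow> ('p \<Rightarrow> real) \<Rightarrow> bool" where
  "zero_regular_on P G S f \<longleftrightarrow>
     (\<forall>p\<in>S. f p = 0 \<longrightarrow>
        (\<exists>\<gamma>. smooth_curve P G \<gamma> \<and> range \<gamma> \<subseteq> S \<and> \<gamma> 0 = p \<and> deriv (\<lambda>t. f (\<gamma> t)) 0 \<noteq> 0))"

text \<open>By induction on the size of \<open>T\<close>, this condition makes the zero loci
  \<open>{p \<in> P. \<forall>g\<in>T. g p = 0}\<close> submanifolds. They carry the reduced structure here: the fibre product of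
  \<open>M\<^bsub>g\<le>0\<^esub>\<close> and \<open>M\<^bsub>g\<ge>0\<^esub>\<close> is an infinitesimal thickening of the submanifold \<open>{p. g p = 0}\<close>.
  \<open>T = {}\<close> is the condition on \<open>f\<close> itself.\<close>

definition zero_regular_system ::
    "'p set \<Rightarrow> ('p \<Rightarrow> real) set \<Rightarrow> ('p \<Rightarrow> real) set \<Rightarrow> bool" where
  "zero_regular_system P G F \<longleftrightarrow>
     (\<forall>f\<in>F. \<forall>T\<subseteq>F - {f}. zero_regular_on P G {p \<in> P. \<forall>g\<in>T. g p = 0} f)"

text \<open>The points of the ambient manifold are taken in \<open>nat \<Rightarrow> real\<close>. This is no restriction: a second
  countable Hausdorff space has at most continuum many points.\<close>

definition manifold_with_corners :: "nat \<Rightarrow> 'a spec \<Rightarrow> bool" where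
  "manifold_with_corners n X \<longleftrightarrow>
     cinf_scheme X \<and> \<not> is_empty_scheme X \<and>
     (\<exists>(T :: (nat \<Rightarrow> real) topology) \<A> F.
        smooth_manifold n T \<A> \<and> finite F \<and> F \<subseteq> manifold_funs n T \<A> \<and>
        zero_regular_system (topspace T) (manifold_funs n T \<A>) F \<and>
        (let M = manifold_scheme n T \<A> in
          \<exists>(Y :: univ spec) y (V :: ((nat \<Rightarrow> real) \<Rightarrow> real) \<Rightarrow> univ spec) v (W :: univ spec) w.
            is_intersection M F (\<lambda>f. closed_subscheme M (le_ideal M f 0))
              (\<lambda>f. closed_incl M (le_ideal M f 0)) Y y \<and>
            (\<forall>f\<in>F. lt_subscheme M f 0 (V f) (v f)) \<and>
            is_intersection M F V v W w \<and>
            subscheme_le M Y y (closure_scheme M W w) (closure_incl M W w) \<and>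
            subscheme_le M (closure_scheme M W w) (closure_incl M W w) Y y \<and>
            isomorphic X Y))"


section \<open>Asymptotic manifolds\<close>

definition regular_system ::
    "'a spec \<Rightarrow> 'i set \<Rightarrow> 'i rel \<Rightarrow> ('i \<Rightarrow> 'b spec) \<Rightarrow> ('i \<Rightarrow> 'a \<Rightarrow> 'b) \<Rightarrow> bool" where
  "regular_system M D r U j \<longleftrightarrow>
     D \<noteq> {} \<and> partial_order_on D r \<and>
     (\<forall>i\<in>D. \<forall>k\<in>D. \<exists>l\<in>D. (i, l) \<in> r \<and> (k, l) \<in> r) \<and>
     (\<forall>i\<in>D. (\<exists>f. open_subscheme M f (U i) (j i)) \<and> \<not> is_empty_scheme (U i)) \<and>
     (\<forall>i k. (i, k) \<in> r \<and> i \<noteq> k \<longrightarrow>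
        subscheme_le M (closure_scheme M (U k) (j k)) (closure_incl M (U k) (j k)) (U i) (j i))"

text \<open>Cones over the diagram of the \<open>U i\<close>, whose transition morphisms \<open>U k \<rightarrow> U i\<close> for \<open>i \<le> k\<close> are
  the (unique) morphisms over \<open>M\<close>.\<close>

definition is_cone ::
    "'a spec \<Rightarrow> 'i set \<Rightarrow> 'i rel \<Rightarrow> ('i \<Rightarrow> 'b spec) \<Rightarrow> ('i \<Rightarrow> 'a \<Rightarrow> 'b) \<Rightarrow>
     'c spec \<Rightarrow> ('i \<Rightarrow> 'b \<Rightarrow> 'c) \<Rightarrow> bool" where
  "is_cone M D r U j Z \<pi> \<longleftrightarrow>
     cinf_scheme Z \<and> (\<forall>i\<in>D. \<pi> i \<in> Mor Z (U i)) \<and>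
     (\<forall>i k t. (i, k) \<in> r \<and> t \<in> Mor (U k) (U i) \<and> mor_comp M (j i) t = j k \<longrightarrow>
        mor_comp (U i) t (\<pi> k) = \<pi> i)"

definition is_limit ::
    "'a spec \<Rightarrow> 'i set \<Rightarrow> 'i rel \<Rightarrow> ('i \<Rightarrow> 'b spec) \<Rightarrow> ('i \<Rightarrow> 'a \<Rightarrow> 'b) \<Rightarrow> 'c spec \<Rightarrow> bool" where
  "is_limit M D r U j Z \<longleftrightarrow>
     (\<exists>\<pi>. is_cone M D r U j Z \<pi> \<and>
       (\<forall>(W :: univ spec) \<rho>. is_cone M D r U j W \<rho> \<longrightarrow>
          (\<exists>!u. u \<in> Mor W Z \<and> (\<forall>i\<in>D. mor_comp (U i) (\<pi> i) u = \<rho> i))))"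

text \<open>Since types cannot be quantified in HOL, the type \<open>'i\<close> from which the indices of the regular
  system are taken is a parameter.\<close>

definition asymptotic_manifold_with_corners :: "'i itself \<Rightarrow> int \<Rightarrow> 'a spec \<Rightarrow> bool" where
  "asymptotic_manifold_with_corners I n X \<longleftrightarrow>
     cinf_scheme X \<and>
     (n = -1 \<and> is_empty_scheme X \<or>
      n \<ge> 0 \<and>
      (\<exists>(M :: univ spec) (D :: 'i set) r (U :: 'i \<Rightarrow> univ spec) j (Z :: univ spec).
         manifold_with_corners (nat n) M \<and> regular_system M D r U j \<and>
         is_limit M D r U j Z \<and> isomorphic (red X) Z))"

end

theory Submission
  imports Defs "HOL-Homology.Invariance_of_Domain" "HOL-Computational_Algebra.Polynomial"
begin

text \<open>The intersection of a regular system may have no points. Its role is played by a filter on the interior of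
  the ambient manifold, generated by the open sets of the system: evaluation gives a homomorphism from the
  functions on the intersection to the ring of germs along this filter, and it separates points. Nilpotents
  in the sense of the infinity-radical vanish in germ rings, so such a germ point passes through \<open>red\<close>,
  and it can be pulled back along open and closed embeddings and along the projections of the limit.
  Hence \<open>X\<close> yields a germ point of the manifold with corners around \<open>X'\<close>, along a filter
  every member of which contains a non-empty open subset of an \<open>m\<close>-manifold. In a chart of the
  target this is a continuous injection of a non-empty open subset of \<open>\<real>\<^sup>m\<close> into \<open>\<real>\<^sup>n\<close>, and invariance of
  domain gives \<open>m \<le> n\<close>.\<close>

section \<open>Smooth functions\<close>

text \<open>Two obstacles shape the proof. Universal properties are tested only against finitely
  generated rings on the type \<open>univ\<close>, and a germ ring need not be of this kind; every
  map into a germ ring is therefore first cut down to a subring generated by finitely many elements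
  (\<open>generated_subring\<close>). For a limit, the values of all members of a cone must fit into
  one such subring. The condition on closures provides this: a function on a larger member becomes,
  on a strictly smaller one, the restriction of a function on the ambient scheme. The second
  obstacle is that a germ point of the target has no underlying point, so no chart can be selected
  in advance, and a homomorphism transports only equations between finitely many functions. The
  charts are hence encoded by equations valid on the interior of the target; these are transported
  to the filter, and only then is one source point chosen, together with a chart that works near it.
  Since germs are classes of arbitrary real functions, \<open>tame\<close>,
  \<open>separating\<close> and \<open>thick\<close> record the continuity, the injectivity and the
  room that invariance of domain asks for.\<close>

abbreviation ropen :: "nat \<Rightarrow> (nat \<Rightarrow> real) set \<Rightarrow> bool" where
  "ropen n U \<equiv> openin (powertop_real {..<n}) U"

section \<open>Topology of the spaces of extensional tuples\<close>

lemma Rn_undefined: "x \<in> Rn n \<Longrightarrow> \<not> i < n \<Longrightarrow> x i = undefined"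
  by (auto simp: PiE_def extensional_def)

text \<open>All coordinates from \<open>n\<close> on are frozen at \<open>undefined\<close>, so the
  product topology on \<open>{..<n}\<close> is induced from the full product
  \<open>nat \<Rightarrow> real\<close>. This makes the facts about \<open>continuous_on\<close>
  available for \<open>ropen\<close> sets.\<close>

lemma powertop_real_eq_top_of_set: "powertop_real {..<n} = top_of_set (Rn n)"
proof -
  have "homeomorphic_maps (powertop_real {..<n}) (top_of_set (Rn n)) id id"
    unfolding homeomorphic_maps_def
  proof (intro conjI)
    show "continuous_map (powertop_real {..<n}) (top_of_set (Rn n)) id"
      unfolding continuous_map_in_subtopology
    proof
      show "continuous_map (powertop_real {..<n}) euclidean id"
        unfolding euclidean_product_topology[symmetric]
      proof (rule continuous_map_coordinatewise_then_product)
        fix i :: nat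
        show "continuous_map (powertop_real {..<n}) euclidean (\<lambda>x. id x i)"
        proof (cases "i < n")
          case True
          then show ?thesis by (auto intro: continuous_map_product_projection)
        next
          case False
          then have "undefined = id x i" if "x \<in> topspace (powertop_real {..<n})" for x :: "nat \<Rightarrow> real"
            using that False Rn_undefined by fastforce
          then show ?thesis
            using continuous_map_eq[of "powertop_real {..<n}" euclideanreal "\<lambda>x. undefined" "\<lambda>x. id x i"] by simp
        qed
      qed auto
    qed auto
    show "continuous_map (top_of_set (Rn n)) (powertop_real {..<n}) id"
      by (rule continuous_map_coordinatewise_then_product)
         (auto simp: Rn_undefined intro: continuous_on_subset[OF continuous_on_product_coordinates])
  qed auto
  then show ?thesis by (simp add: homeomorphic_maps_id)
qed

lemma ropen_subset: "ropen n U \<Longrightarrow> U \<subseteq> Rn n"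
  by (metis openin_subset topspace_euclidean_subtopology powertop_real_eq_top_of_set)

lemma continuous_map_powertop_iff:
  assumes "U \<subseteq> Rn n"
  shows "continuous_map (subtopology (powertop_real {..<n}) U) euclideanreal f \<longleftrightarrow> continuous_on U f"
  using assms by (simp add: powertop_real_eq_top_of_set subtopology_subtopology inf.absorb2)

lemma ropen_Rn [simp]: "ropen n (Rn n)"
  using openin_topspace[of "powertop_real {..<n}"] by simp

lemma Rn_upd: "x \<in> Rn n \<Longrightarrow> i < n \<Longrightarrow> x(i := t) \<in> Rn n"
  by (auto simp: PiE_iff extensional_def)

lemma Rn_eqI: "x \<in> Rn n \<Longrightarrow> y \<in> Rn n \<Longrightarrow> (\<And>i. i < n \<Longrightarrow> x i = y i) \<Longrightarrow> x = y"
  by (rule PiE_ext) auto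

lemma ropen_box:
  assumes "ropen n U" "x \<in> U"
  obtains e where "e > 0" "\<And>y. y \<in> Rn n \<Longrightarrow> (\<And>i. i < n \<Longrightarrow> \<bar>y i - x i\<bar> < e) \<Longrightarrow> y \<in> U"
proof -
  obtain V where V: "\<forall>i\<in>{..<n}. openin euclideanreal (V i)" "x \<in> PiE {..<n} V" "PiE {..<n} V \<subseteq> U"
    using assms unfolding openin_product_topology_alt by blast
  have "\<exists>e>0. \<forall>t. \<bar>t - x i\<bar> < e \<longrightarrow> t \<in> V i" if "i < n" for i
  proof -
    have "open (V i)" "x i \<in> V i" using V that by (auto simp: PiE_iff)
    then show ?thesis unfolding open_dist dist_real_def by blast
  qed
  then obtain e where e: "\<And>i. i < n \<Longrightarrow> e i > 0" "\<And>i t. i < n \<Longrightarrow> \<bar>t - x i\<bar> < e i \<Longrightarrow> t \<in> V i"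
    by metis
  \<comment> \<open>The inserted \<open>1\<close> keeps \<open>Min\<close> meaningful for
    \<open>n = 0\<close>.\<close>
  define d where "d = Min (insert 1 (e ` {..<n}))"
  have "d > 0" using e by (auto simp: d_def)
  moreover have "d \<le> e i" if "i < n" for i using that by (auto simp: d_def intro!: Min_le)
  then have "y \<in> U" if "y \<in> Rn n" "\<And>i. i < n \<Longrightarrow> \<bar>y i - x i\<bar> < d" for y
    using V(3) e(2) that by (fastforce simp: PiE_iff extensional_def)
  ultimately show thesis using that by blast
qed

lemma ropen_open_box: "ropen n {y \<in> Rn n. \<forall>i<n. \<bar>y i - x i\<bar> < e}"
proof -
  have "ropen n (PiE {..<n} (\<lambda>i. {t. \<bar>t - x i\<bar> < e}))"
  proof (subst openin_PiE_gen, intro disjI2 conjI ballI)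
    show "openin euclideanreal {t. \<bar>t - x i\<bar> < e}" for i
    proof -
      have "{t. \<bar>t - x i\<bar> < e} = ball (x i) e" by (auto simp: dist_real_def)
      then show ?thesis by simp
    qed
  qed auto
  also have "PiE {..<n} (\<lambda>i. {t. \<bar>t - x i\<bar> < e}) = {y \<in> Rn n. \<forall>i<n. \<bar>y i - x i\<bar> < e}"
    by (auto simp: PiE_def Pi_def)
  finally show ?thesis .
qed

lemma ropen_continuous_preimage:
  assumes "ropen n U" "continuous_on U f" "open B"
  shows "ropen n {x \<in> U. f x \<in> B}"
proof -
  have "openin (top_of_set U) {x \<in> U. f x \<in> B}"
    using continuous_openin_preimage_gen[OF assms(2,3)] by (simp add: vimage_def Int_def)
  then show ?thesis
    using assms(1) ropen_subset[OF assms(1)] unfolding powertop_real_eq_top_of_set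
    by (meson openin_trans)
qed

lemma continuous_box:
  assumes "ropen n U" "continuous_on U f" "x \<in> U" "e > 0"
  obtains d where "d > 0"
    "\<And>y. y \<in> Rn n \<Longrightarrow> (\<And>i. i < n \<Longrightarrow> \<bar>y i - x i\<bar> < d) \<Longrightarrow> y \<in> U \<and> \<bar>f y - f x :: real\<bar> < e"
proof -
  have "ropen n {y \<in> U. f y \<in> ball (f x) e}"
    using assms by (intro ropen_continuous_preimage) auto
  then obtain d where "d > 0"
    "\<And>y. y \<in> Rn n \<Longrightarrow> (\<And>i. i < n \<Longrightarrow> \<bar>y i - x i\<bar> < d) \<Longrightarrow> y \<in> {y \<in> U. f y \<in> ball (f x) e}"
    using assms(3,4) by (elim ropen_box[where x = x]) auto
  then show thesis using that by (fastforce simp: dist_real_def abs_minus_commute)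
qed

section \<open>Partial derivatives and the coinductive view of smoothness\<close>

lemma ropen_slice:
  assumes "ropen n U" "x \<in> U" "i < n"
  shows "eventually (\<lambda>t. x(i := t) \<in> U) (nhds (x i))"
proof -
  obtain e where e: "e > 0" "\<And>y. y \<in> Rn n \<Longrightarrow> (\<And>i. i < n \<Longrightarrow> \<bar>y i - x i\<bar> < e) \<Longrightarrow> y \<in> U"
    using ropen_box[OF assms(1,2)] by blast
  have "x \<in> Rn n" using assms ropen_subset by blast
  show ?thesis unfolding eventually_nhds_metric
    by (intro exI[of _ e] conjI allI impI e) (use \<open>x \<in> Rn n\<close> assms(3) e(1) in \<open>auto simp: Rn_upd dist_real_def\<close>)
qed

lemma partial_deriv_cong:
  assumes "ropen n U" "x \<in> U" "i < n" "\<And>y. y \<in> U \<Longrightarrow> f y = g y"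
  shows "partial_deriv i f x = partial_deriv i g x"
  unfolding partial_deriv_def
  by (rule deriv_cong_ev) (use ropen_slice[OF assms(1-3)] assms(4) in \<open>auto elim!: eventually_mono\<close>)

lemma slice_differentiable_cong:
  fixes f g :: "(nat \<Rightarrow> real) \<Rightarrow> real"
  assumes "ropen n U" "x \<in> U" "i < n" "\<And>y. y \<in> U \<Longrightarrow> f y = g y"
  shows "(\<lambda>t. f (x(i := t))) differentiable (at (x i)) \<longleftrightarrow> (\<lambda>t. g (x(i := t))) differentiable (at (x i))"
proof -
  have ev: "eventually (\<lambda>t. f (x(i := t)) = g (x(i := t))) (nhds (x i))"
    using ropen_slice[OF assms(1-3)] assms(4) by (auto elim!: eventually_mono)
  have "((\<lambda>t. f (x(i := t))) has_real_derivative D) (at (x i)) \<longleftrightarrow>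
    ((\<lambda>t. g (x(i := t))) has_real_derivative D) (at (x i))" for D
    by (rule DERIV_cong_ev) (use ev in auto)
  then show ?thesis
    unfolding real_differentiable_def by simp
qed

lemma Ck_on_cong:
  assumes "ropen n U" "\<And>y. y \<in> U \<Longrightarrow> f y = g y"
  shows "Ck_on k n U f \<longleftrightarrow> Ck_on k n U g"
  using assms(2)
proof (induction k arbitrary: f g)
  case 0
  then show ?case
    using continuous_map_powertop_iff[OF ropen_subset[OF assms(1)]] by (simp cong: continuous_on_cong)
next
  case (Suc k)
  have "continuous_on U f \<longleftrightarrow> continuous_on U g"
    using Suc.prems by (simp cong: continuous_on_cong)
  moreover have "\<forall>i<n. \<forall>x\<in>U. (\<lambda>t. f (x(i := t))) differentiable (at (x i)) \<longleftrightarrow> (\<lambda>t. g (x(i := t))) differentiable (at (x i))"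
    using slice_differentiable_cong[OF assms(1)] Suc.prems by blast
  moreover have "\<forall>i<n. Ck_on k n U (partial_deriv i f) \<longleftrightarrow> Ck_on k n U (partial_deriv i g)"
    using Suc.IH partial_deriv_cong[OF assms(1)] Suc.prems by blast
  ultimately show ?case
    unfolding Ck_on.simps continuous_map_powertop_iff[OF ropen_subset[OF assms(1)]] by blast
qed

lemma smooth_on_cong:
  assumes "ropen n U" "\<And>y. y \<in> U \<Longrightarrow> f y = g y"
  shows "smooth_on n U f \<longleftrightarrow> smooth_on n U g"
  unfolding smooth_on_def using Ck_on_cong[OF assms(1), of f g] assms(2) by blast

lemma smooth_onD:
  assumes "smooth_on n U f" "ropen n U"
  shows "continuous_on U f"
    and "i < n \<Longrightarrow> x \<in> U \<Longrightarrow> ((\<lambda>t. f (x(i := t))) has_real_derivative partial_deriv i f x) (at (x i))"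
    and "i < n \<Longrightarrow> smooth_on n U (partial_deriv i f)"
proof -
  have "Ck_on 0 n U f" using assms by (auto simp: smooth_on_def)
  then show "continuous_on U f" using continuous_map_powertop_iff[OF ropen_subset[OF assms(2)]] by simp
  have *: "Ck_on (Suc k) n U f" for k using assms by (auto simp: smooth_on_def)
  then show "i < n \<Longrightarrow> smooth_on n U (partial_deriv i f)" unfolding smooth_on_def by auto
  show "((\<lambda>t. f (x(i := t))) has_real_derivative partial_deriv i f x) (at (x i))" if "i < n" "x \<in> U"
    using *[of 0] that DERIV_deriv_iff_real_differentiable unfolding partial_deriv_def by auto
qed

text \<open>\<open>partial_deriv\<close> has a value even where the derivative does not exist; the
  relation records existence and value together.\<close>

definition has_partial :: "nat \<Rightarrow> (nat \<Rightarrow> real) set \<Rightarrow> ((nat \<Rightarrow> real) \<Rightarrow> real) \<Rightarrow> ((nat \<Rightarrow> real) \<Rightarrow> real) \<Rightarrow> bool" where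
  "has_partial i U f g \<longleftrightarrow> (\<forall>x\<in>U. ((\<lambda>t. f (x(i := t))) has_real_derivative g x) (at (x i)))"

lemma has_partial_partial_deriv:
  "smooth_on n U f \<Longrightarrow> ropen n U \<Longrightarrow> i < n \<Longrightarrow> has_partial i U f (partial_deriv i f)"
  unfolding has_partial_def using smooth_onD(2) by blast

lemma has_partialD: "has_partial i U f g \<Longrightarrow> x \<in> U \<Longrightarrow> ((\<lambda>t. f (x(i := t))) has_real_derivative g x) (at (x i))"
  unfolding has_partial_def by blast

text \<open>Smoothness is a greatest fixed point: induction on \<open>k\<close> shows that every
  member of a class of continuous functions stable under partial derivatives satisfies
  \<open>Ck_on k\<close>. Closure properties then need one stable class instead of an induction over
  orders.\<close>

lemma smooth_on_coinduct:
  assumes U: "ropen n U" and Q: "Q f"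
    and step: "\<And>f. Q f \<Longrightarrow> continuous_on U f \<and> (\<forall>i<n. \<exists>g. Q g \<and>
       has_partial i U f g)"
  shows "smooth_on n U f"
proof -
  have "Ck_on k n U f" for k
    using Q
  proof (induction k arbitrary: f)
    case 0
    then show ?case using step continuous_map_powertop_iff[OF ropen_subset[OF U]] by simp
  next
    case (Suc k)
    have "(\<forall>x\<in>U. (\<lambda>t. f (x(i := t))) differentiable (at (x i))) \<and> Ck_on k n U (partial_deriv i f)"
      if i: "i < n" for i
    proof -
      obtain g where g: "Q g" "has_partial i U f g"
        using step[OF Suc.prems] i by blast
      then have "\<And>x. x \<in> U \<Longrightarrow> partial_deriv i f x = g x"
        by (auto simp: partial_deriv_def DERIV_imp_deriv has_partial_def)
      then have "Ck_on k n U (partial_deriv i f)"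
        using Ck_on_cong[OF U, of "partial_deriv i f" g] Suc.IH[OF g(1)] by blast
      then show ?thesis using has_partialD[OF g(2)] unfolding real_differentiable_def by blast
    qed
    then show ?case using step[OF Suc.prems] continuous_map_powertop_iff[OF ropen_subset[OF U]] by simp
  qed
  then show ?thesis by (simp add: smooth_on_def)
qed

lemma has_partial_const: "has_partial i U (\<lambda>x. c) (\<lambda>x. 0)"
  by (simp add: has_partial_def)

lemma has_partial_coord: "has_partial i U (\<lambda>x. x j) (\<lambda>x. if i = j then 1 else 0)"
  by (simp add: has_partial_def)

lemma has_partial_add:
  assumes "has_partial i U h h'" "has_partial i U k k'"
  shows "has_partial i U (\<lambda>x. h x + k x) (\<lambda>x. h' x + k' x)"
  unfolding has_partial_def
  by (intro ballI DERIV_add) (simp_all add: has_partialD[OF assms(1)] has_partialD[OF assms(2)])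

lemma has_partial_mult:
  assumes "has_partial i U h h'" "has_partial i U k k'"
  shows "has_partial i U (\<lambda>x. h x * k x) (\<lambda>x. h' x * k x + k' x * h x)"
  unfolding has_partial_def
proof
  fix x assume "x \<in> U"
  from DERIV_mult[OF has_partialD[OF assms(1) this] has_partialD[OF assms(2) this]]
  show "((\<lambda>t. h (x(i := t)) * k (x(i := t))) has_real_derivative h' x * k x + k' x * h x) (at (x i))" by simp
qed

text \<open>The derivative is written with constants, products and inverses only, the operations
  under which \<open>smooth_alg\<close> is closed.\<close>

lemma has_partial_inverse:
  assumes "has_partial i U h h'" "\<And>x. x \<in> U \<Longrightarrow> h x \<noteq> 0"
  shows "has_partial i U (\<lambda>x. inverse (h x)) (\<lambda>x. -1 * (inverse (h x) * h' x * inverse (h x)))"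
  unfolding has_partial_def
proof
  fix x assume "x \<in> U"
  from DERIV_inverse'[OF has_partialD[OF assms(1) this]] assms(2)[OF this]
  show "((\<lambda>t. inverse (h (x(i := t)))) has_real_derivative -1 * (inverse (h x) * h' x * inverse (h x))) (at (x i))"
    by simp
qed

lemma smooth_on_const: "ropen n U \<Longrightarrow> smooth_on n U (\<lambda>x. c)"
proof (rule smooth_on_coinduct[where Q = "\<lambda>f. \<exists>c. f = (\<lambda>x. c)"], assumption)
  fix f :: "(nat \<Rightarrow> real) \<Rightarrow> real"
  assume f: "\<exists>c. f = (\<lambda>x. c)"
  have "\<exists>g. (\<exists>c. g = (\<lambda>x. c)) \<and> has_partial i U f g" for i
    using f has_partial_const by (intro exI[of _ "\<lambda>x. 0"]) auto
  then show "continuous_on U f \<and> (\<forall>i<n. \<exists>g. (\<exists>c. g = (\<lambda>x. c)) \<and> has_partial i U f g)"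
    using f by auto
qed auto

lemma continuous_on_coord: "continuous_on U (\<lambda>x::nat \<Rightarrow> real. x j)"
  by (rule continuous_on_subset[OF continuous_on_product_coordinates]) auto

lemma smooth_on_coord: "ropen n U \<Longrightarrow> smooth_on n U (\<lambda>x. x j)"
proof (rule smooth_on_coinduct[where Q = "\<lambda>f. f = (\<lambda>x. x j) \<or> (\<exists>c. f = (\<lambda>x. c))"], assumption, simp)
  fix f :: "(nat \<Rightarrow> real) \<Rightarrow> real"
  assume "f = (\<lambda>x. x j) \<or> (\<exists>c. f = (\<lambda>x. c))"
  then show "continuous_on U f \<and> (\<forall>i<n. \<exists>g. (g = (\<lambda>x. x j) \<or> (\<exists>c. g = (\<lambda>x. c))) \<and> has_partial i U f g)"
  proof
    assume f: "f = (\<lambda>x. x j)"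
    have "\<exists>g. (g = (\<lambda>x. x j) \<or> (\<exists>c. g = (\<lambda>x. c))) \<and> has_partial i U f g" for i
      unfolding f using has_partial_coord[of i U j] by (intro exI[of _ "\<lambda>x. if i = j then 1 else 0"]) auto
    then show ?thesis using f continuous_on_coord by blast
  next
    assume "\<exists>c. f = (\<lambda>x. c)"
    then show ?thesis using has_partial_const continuous_on_const by blast
  qed
qed

section \<open>Chain rule and closure properties\<close>

lemma MVT_between:
  fixes h h' :: "real \<Rightarrow> real"
  assumes "\<And>s. \<bar>s - a\<bar> \<le> \<bar>b - a\<bar> \<Longrightarrow> (h has_real_derivative h' s) (at s)"
  obtains c where "\<bar>c - a\<bar> \<le> \<bar>b - a\<bar>" "h b - h a = h' c * (b - a)"
proof (cases a b rule: linorder_cases)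
  case less
  then obtain c where "a < c" "c < b" "h b - h a = (b - a) * h' c"
    using MVT2[of a b h h'] assms by (auto simp: )
  then show thesis using that[of c] by (auto simp: algebra_simps)
next
  case equal
  then show thesis using that[of a] by auto
next
  case greater
  then obtain c where "b < c" "c < a" "h a - h b = (a - b) * h' c"
    using MVT2[of b a h h'] assms by (auto simp: )
  then show thesis using that[of c] by (auto simp: algebra_simps)
qed

text \<open>The increment of \<open>f\<close> along the curve is telescoped into steps that change
  one coordinate each, and the mean value theorem handles each step. This works with continuous
  partial derivatives alone.\<close>

lemma chain_rule_curve:
  fixes g :: "real \<Rightarrow> nat \<Rightarrow> real"
  assumes V: "ropen m V"
    and f: "\<And>j x. j < m \<Longrightarrow> x \<in> V \<Longrightarrow> ((\<lambda>t. f (x(j := t))) has_real_derivative f' j x) (at (x j))"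
    and f': "\<And>j. j < m \<Longrightarrow> continuous_on V (f' j)"
    and g0: "g t0 \<in> V" and gR: "\<And>t. g t \<in> Rn m"
    and g': "\<And>j. j < m \<Longrightarrow> ((\<lambda>t. g t j) has_real_derivative g' j) (at t0)"
  shows "((\<lambda>t. f (g t)) has_real_derivative (\<Sum>j<m. f' j (g t0) * g' j)) (at t0)"
proof -
  \<comment> \<open>\<open>z j t\<close> interpolates between \<open>g t0\<close> and
    \<open>g t\<close>: consecutive members differ in coordinate \<open>j\<close> only.\<close>
  define z where "z j t = (\<lambda>i. if i < j then g t i else g t0 i)" for j t
  have z0: "z 0 t = g t0" for t by (auto simp: z_def)
  have zm: "z m t = g t" for t
    using gR[of t] gR[of t0] by (auto simp: z_def PiE_iff extensional_def)
  have zR: "z j t \<in> Rn m" for j t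
    using gR[of t] gR[of t0] by (auto simp: z_def PiE_iff extensional_def)
  have zS: "z (Suc j) t = (z j t)(j := g t j)" for j t by (auto simp: z_def less_Suc_eq)
  obtain e where e: "e > 0" "\<And>y. y \<in> Rn m \<Longrightarrow> (\<And>i. i < m \<Longrightarrow> \<bar>y i - g t0 i\<bar> < e) \<Longrightarrow> y \<in> V"
    using ropen_box[OF V g0] by blast
  have near: "eventually (\<lambda>t. \<forall>i<m. \<bar>g t i - g t0 i\<bar> < r) (at t0)" if "r > 0" for r
  proof -
    have "eventually (\<lambda>t. \<bar>g t i - g t0 i\<bar> < r) (at t0)" if "i < m" for i
    proof -
      have "isCont (\<lambda>t. g t i) t0" using g'[OF that] DERIV_isCont by blast
      then have "((\<lambda>t. g t i) \<longlongrightarrow> g t0 i) (at t0)" by (simp add: isCont_def)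
      from tendstoD[OF this \<open>r > 0\<close>] show ?thesis by (simp add: dist_real_def)
    qed
    then have "eventually (\<lambda>t. \<forall>i\<in>{..<m}. \<bar>g t i - g t0 i\<bar> < r) (at t0)"
      by (intro eventually_ball_finite) auto
    then show ?thesis by (rule eventually_mono) auto
  qed
  have lim: "((\<lambda>t. (f (z (Suc j) t) - f (z j t)) / (t - t0)) \<longlongrightarrow> f' j (g t0) * g' j) (at t0)"
    if j: "j < m" for j
  proof -
    have "\<exists>c. (\<forall>i<m. \<bar>g t i - g t0 i\<bar> < e) \<longrightarrow> \<bar>c - g t0 j\<bar> \<le> \<bar>g t j - g t0 j\<bar> \<and>
       f (z (Suc j) t) - f (z j t) = f' j ((z j t)(j := c)) * (g t j - g t0 j)" for t
    proof (cases "\<forall>i<m. \<bar>g t i - g t0 i\<bar> < e")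
      case True
      have "((\<lambda>s. f ((z j t)(j := s))) has_real_derivative f' j ((z j t)(j := s))) (at s)"
        if s: "\<bar>s - g t0 j\<bar> \<le> \<bar>g t j - g t0 j\<bar>" for s
      proof -
        have "(z j t)(j := s) \<in> V"
          by (rule e(2)) (use True s j zR in \<open>auto simp: Rn_upd z_def e(1) intro: le_less_trans\<close>)
        from f[OF j this] show ?thesis by simp
      qed
      from MVT_between[of "g t0 j" "g t j" "\<lambda>s. f ((z j t)(j := s))" "\<lambda>s. f' j ((z j t)(j := s))", OF this]
      obtain c where "\<bar>c - g t0 j\<bar> \<le> \<bar>g t j - g t0 j\<bar>"
        "f ((z j t)(j := g t j)) - f ((z j t)(j := g t0 j)) = f' j ((z j t)(j := c)) * (g t j - g t0 j)"
        by auto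
      moreover have "(z j t)(j := g t0 j) = z j t" by (auto simp: z_def)
      ultimately show ?thesis using zS by metis
    qed auto
    then obtain c where c: "\<And>t. (\<forall>i<m. \<bar>g t i - g t0 i\<bar> < e) \<Longrightarrow> \<bar>c t - g t0 j\<bar> \<le> \<bar>g t j - g t0 j\<bar>"
       "\<And>t. (\<forall>i<m. \<bar>g t i - g t0 i\<bar> < e) \<Longrightarrow> f (z (Suc j) t) - f (z j t) = f' j ((z j t)(j := c t)) * (g t j - g t0 j)"
      by metis
    \<comment> \<open>The mean value point is no farther from \<open>g t0 j\<close> than
      \<open>g t j\<close> is, so the point at which \<open>f' j\<close> is taken tends to
      \<open>g t0\<close>.\<close>
    have l1: "((\<lambda>t. f' j ((z j t)(j := c t))) \<longlongrightarrow> f' j (g t0)) (at t0)"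
    proof (rule tendstoI)
      fix r :: real assume "r > 0"
      obtain d where d: "d > 0" "\<And>y. y \<in> Rn m \<Longrightarrow> (\<And>i. i < m \<Longrightarrow> \<bar>y i - g t0 i\<bar> < d) \<Longrightarrow> y \<in> V \<and> \<bar>f' j y - f' j (g t0)\<bar> < r"
        using continuous_box[OF V f'[OF j] g0 \<open>r > 0\<close>] by blast
      have "eventually (\<lambda>t. \<forall>i<m. \<bar>g t i - g t0 i\<bar> < min d e) (at t0)"
        by (rule near) (use d(1) e(1) in simp)
      then show "eventually (\<lambda>t. dist (f' j ((z j t)(j := c t))) (f' j (g t0)) < r) (at t0)"
      proof (rule eventually_mono)
        fix t assume t: "\<forall>i<m. \<bar>g t i - g t0 i\<bar> < min d e"
        have "\<bar>c t - g t0 j\<bar> < d" using c(1)[of t] t j by fastforce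
        then have "(z j t)(j := c t) \<in> V \<and> \<bar>f' j ((z j t)(j := c t)) - f' j (g t0)\<bar> < r"
          by (intro d(2)) (use t zR j d(1) in \<open>auto simp: Rn_upd z_def\<close>)
        then show "dist (f' j ((z j t)(j := c t))) (f' j (g t0)) < r" by (simp add: dist_real_def)
      qed
    qed
    have l2: "((\<lambda>t. (g t j - g t0 j) / (t - t0)) \<longlongrightarrow> g' j) (at t0)"
      using g'[OF j] by (simp add: has_field_derivative_iff)
    have "((\<lambda>t. f' j ((z j t)(j := c t)) * ((g t j - g t0 j) / (t - t0))) \<longlongrightarrow> f' j (g t0) * g' j) (at t0)"
      by (rule tendsto_mult[OF l1 l2])
    moreover have "eventually (\<lambda>t. f' j ((z j t)(j := c t)) * ((g t j - g t0 j) / (t - t0)) =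
        (f (z (Suc j) t) - f (z j t)) / (t - t0)) (at t0)"
      using near[OF e(1)] by (rule eventually_mono) (simp add: c(2))
    ultimately show ?thesis by (rule Lim_transform_eventually)
  qed
  have "(\<Sum>j<m. (f (z (Suc j) t) - f (z j t)) / (t - t0)) = (f (g t) - f (g t0)) / (t - t0)" for t
    using sum_lessThan_telescope[of "\<lambda>j. f (z j t)" m] by (simp add: z0 zm sum_divide_distrib[symmetric])
  then show ?thesis
    using tendsto_sum[of "{..<m}" "\<lambda>j t. (f (z (Suc j) t) - f (z j t)) / (t - t0)", OF lim]
    by (simp add: has_field_derivative_iff)
qed

text \<open>Closing the smooth functions under all operations at once makes a single coinduction suffice.\<close>

inductive smooth_alg for n U m V and G :: "(nat \<Rightarrow> real) \<Rightarrow> nat \<Rightarrow> real" where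
  base: "smooth_on n U h \<Longrightarrow> smooth_alg n U m V G h"
| comp: "smooth_on m V f \<Longrightarrow> smooth_alg n U m V G (\<lambda>x. f (G x))"
| add: "smooth_alg n U m V G h \<Longrightarrow> smooth_alg n U m V G k \<Longrightarrow> smooth_alg n U m V G (\<lambda>x. h x + k x)"
| mult: "smooth_alg n U m V G h \<Longrightarrow> smooth_alg n U m V G k \<Longrightarrow> smooth_alg n U m V G (\<lambda>x. h x * k x)"
| inv: "smooth_alg n U m V G h \<Longrightarrow> (\<And>x. x \<in> U \<Longrightarrow> h x \<noteq> 0) \<Longrightarrow> smooth_alg n U m V G (\<lambda>x. inverse (h x))"

lemma smooth_alg_sum:
  assumes "ropen n U" "\<And>j. j < (l::nat) \<Longrightarrow> smooth_alg n U m V G (h j)"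
  shows "smooth_alg n U m V G (\<lambda>x. \<Sum>j<l. h j x)"
  using assms(2)
proof (induction l)
  case 0
  then show ?case using smooth_alg.base[OF smooth_on_const[OF assms(1)]] by simp
next
  case (Suc l)
  then show ?case using smooth_alg.add by force
qed

text \<open>By the chain rule the partial derivatives of \<open>f (G x)\<close> are sums of products
  of \<open>partial_deriv j f (G x)\<close> with smooth functions. The algebra is thus stable under
  differentiation, and \<open>smooth_on_coinduct\<close> applies to all its members at once.\<close>

lemma smooth_alg_smooth:
  assumes U: "ropen n U" and V: "ropen m V" and GV: "\<And>x. x \<in> U \<Longrightarrow> G x \<in> V"
    and GR: "\<And>x. x \<in> Rn n \<Longrightarrow> G x \<in> Rn m"
    and G: "\<And>j. j < m \<Longrightarrow> smooth_on n U (\<lambda>x. G x j)"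
    and h: "smooth_alg n U m V G h"
  shows "smooth_on n U h"
proof (rule smooth_on_coinduct[OF U, where Q = "smooth_alg n U m V G", OF h])
  fix h assume "smooth_alg n U m V G h"
  then show "continuous_on U h \<and> (\<forall>i<n. \<exists>g. smooth_alg n U m V G g \<and>
       has_partial i U h g)"
  proof induction
    case (base h)
    show ?case using smooth_onD(1,3)[OF base U] has_partial_partial_deriv[OF base U] smooth_alg.base by blast
  next
    case (comp f)
    have "continuous_on U G"
    proof (rule continuous_on_coordinatewise_then_product)
      fix j
      show "continuous_on U (\<lambda>x. G x j)"
      \<comment> \<open>Continuity is asked for every natural index; coordinates from
        \<open>m\<close> on are constantly \<open>undefined\<close> on \<open>U\<close>.\<close>
      proof (cases "j < m")
        case True
        then show ?thesis using smooth_onD(1)[OF G U] by blast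
      next
        case False
        have "continuous_on U (\<lambda>x. G x j) \<longleftrightarrow> continuous_on U (\<lambda>x. undefined :: real)"
          using GV ropen_subset[OF V] False by (intro continuous_on_cong) (auto simp: subset_iff intro: Rn_undefined)
        then show ?thesis by simp
      qed
    qed
    then have 1: "continuous_on U (\<lambda>x. f (G x))"
      using continuous_on_compose2[OF smooth_onD(1)[OF comp V]] GV by blast
    have 2: "((\<lambda>t. f (G (x(i := t)))) has_real_derivative
        (\<Sum>j<m. partial_deriv j f (G x) * partial_deriv i (\<lambda>x. G x j) x)) (at (x i))"
      if "i < n" "x \<in> U" for i x
    proof -
      have x: "x \<in> Rn n" using that ropen_subset[OF U] by blast
      have "((\<lambda>t. f (G (x(i := t)))) has_real_derivative
        (\<Sum>j<m. partial_deriv j f (G (x(i := x i))) * partial_deriv i (\<lambda>x. G x j) x)) (at (x i))"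
        using smooth_onD(2)[OF comp V] smooth_onD(1)[OF smooth_onD(3)[OF comp V] V] _ _
          smooth_onD(2)[OF G U that]
      proof (rule chain_rule_curve[OF V])
        show "G (x(i := x i)) \<in> V" using GV that by simp
        show "G (x(i := t)) \<in> Rn m" for t using GR Rn_upd[OF x that(1)] by blast
      qed
      then show ?thesis by simp
    qed
    have 3: "smooth_alg n U m V G (\<lambda>x. \<Sum>j<m. partial_deriv j f (G x) * partial_deriv i (\<lambda>x. G x j) x)" if "i < n" for i
      by (intro smooth_alg_sum[OF U] smooth_alg.mult smooth_alg.comp smooth_alg.base)
         (use that smooth_onD(3)[OF comp V] smooth_onD(3)[OF G U] in auto)
    have "has_partial i U (\<lambda>x. f (G x)) (\<lambda>x. \<Sum>j<m. partial_deriv j f (G x) * partial_deriv i (\<lambda>x. G x j) x)"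
      if "i < n" for i unfolding has_partial_def using 2 that by blast
    then show ?case using 1 3 by blast
  next
    case (add h k)
    have "\<exists>g. smooth_alg n U m V G g \<and> has_partial i U (\<lambda>x. h x + k x) g" if i: "i < n" for i
    proof -
      obtain h' k' where "smooth_alg n U m V G h'" "has_partial i U h h'"
        "smooth_alg n U m V G k'" "has_partial i U k k'" using add.IH i by blast
      then show ?thesis using has_partial_add smooth_alg.add by (intro exI[of _ "\<lambda>x. h' x + k' x"]) auto
    qed
    then show ?case using add.IH continuous_on_add by blast
  next
    case (mult h k)
    have "\<exists>g. smooth_alg n U m V G g \<and> has_partial i U (\<lambda>x. h x * k x) g" if i: "i < n" for i
    proof -
      obtain h' k' where hk: "smooth_alg n U m V G h'" "has_partial i U h h'"
        "smooth_alg n U m V G k'" "has_partial i U k k'" using mult.IH i by blast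
      have "smooth_alg n U m V G (\<lambda>x. h' x * k x + k' x * h x)"
        by (rule smooth_alg.add[OF smooth_alg.mult[OF hk(1) mult.hyps(2)] smooth_alg.mult[OF hk(3) mult.hyps(1)]])
      then show ?thesis using has_partial_mult[OF hk(2,4)] by blast
    qed
    then show ?case using mult.IH continuous_on_mult by blast
  next
    case (inv h)
    have "\<exists>g. smooth_alg n U m V G g \<and> has_partial i U (\<lambda>x. inverse (h x)) g" if i: "i < n" for i
    proof -
      obtain h' where h': "smooth_alg n U m V G h'" "has_partial i U h h'"
        using inv.IH i by blast
      have "smooth_alg n U m V G (\<lambda>x. -1 * (inverse (h x) * h' x * inverse (h x)))"
        by (rule smooth_alg.mult[OF smooth_alg.base[OF smooth_on_const[OF U]] smooth_alg.mult[OF smooth_alg.mult[OF smooth_alg.inv h'(1)] smooth_alg.inv]])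
           (use inv.hyps in blast)+
      then show ?thesis using has_partial_inverse[OF h'(2) inv.hyps(2)] by blast
    qed
    moreover have "continuous_on U (\<lambda>x. inverse (h x))"
      using inv by (intro continuous_on_inverse) auto
    ultimately show ?case by blast
  qed
qed

lemma smooth_on_compose:
  assumes "ropen n U" "ropen m V" "\<And>x. x \<in> U \<Longrightarrow> G x \<in> V"
    and "\<And>j. j < m \<Longrightarrow> smooth_on n U (\<lambda>x. G x j)" "smooth_on m V f"
  shows "smooth_on n U (\<lambda>x. f (G x))"
proof -
  \<comment> \<open>The chain rule runs along curves that may leave \<open>U\<close>, where nothing
    is known about \<open>G\<close>; there it is replaced by a tuple lying in
    \<open>Rn m\<close>.\<close>
  define G' where "G' x = (if x \<in> U then G x else (\<lambda>j\<in>{..<m}. 0))" for x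
  have "smooth_on n U (\<lambda>x. f (G' x))"
  proof (rule smooth_alg_smooth[OF assms(1,2), of G'])
    show "smooth_on n U (\<lambda>x. G' x j)" if "j < m" for j
      using assms(4)[OF that] smooth_on_cong[OF assms(1), of "\<lambda>x. G' x j" "\<lambda>x. G x j"] by (simp add: G'_def)
    show "smooth_alg n U m V G' (\<lambda>x. f (G' x))" by (rule smooth_alg.comp[OF assms(5)])
    show "G' x \<in> Rn m" if "x \<in> Rn n" for x
      using assms(3)[of x] ropen_subset[OF assms(2)] by (auto simp: G'_def)
  qed (use assms(3) in \<open>auto simp: G'_def\<close>)
  then show ?thesis
    using smooth_on_cong[OF assms(1), of "\<lambda>x. f (G' x)" "\<lambda>x. f (G x)"] by (simp add: G'_def)
qed

lemma
  assumes "ropen n U" "smooth_on n U f" "smooth_on n U g"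
  shows smooth_on_add: "smooth_on n U (\<lambda>x. f x + g x)"
    and smooth_on_mult: "smooth_on n U (\<lambda>x. f x * g x)"
    and smooth_on_diff: "smooth_on n U (\<lambda>x. f x - g x)"
proof -
  \<comment> \<open>With \<open>m = 0\<close> the conditions on the substituted map are trivial;
    only the ring operations of \<open>smooth_alg\<close> are of interest here.\<close>
  have *: "smooth_on n U h" if "smooth_alg n U 0 (Rn 0) (\<lambda>x i. undefined) h" for h
    by (rule smooth_alg_smooth[OF assms(1) ropen_Rn _ _ _ that]) auto
  show "smooth_on n U (\<lambda>x. f x + g x)" "smooth_on n U (\<lambda>x. f x * g x)"
    by (rule *, rule smooth_alg.add smooth_alg.mult; rule smooth_alg.base, fact)+
  have "smooth_on n U (\<lambda>x. f x + -1 * g x)"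
    by (rule *, rule smooth_alg.add[OF smooth_alg.base[OF assms(2)]
         smooth_alg.mult[OF smooth_alg.base[OF smooth_on_const[OF assms(1)]] smooth_alg.base[OF assms(3)]]])
  then show "smooth_on n U (\<lambda>x. f x - g x)" by simp
qed

lemma smooth_on_inverse:
  assumes "ropen n U" "smooth_on n U f" "\<And>x. x \<in> U \<Longrightarrow> f x \<noteq> 0"
  shows "smooth_on n U (\<lambda>x. inverse (f x))"
proof (rule smooth_alg_smooth[OF assms(1) ropen_Rn[of 0], of "\<lambda>x i. undefined"])
  show "smooth_alg n U 0 (Rn 0) (\<lambda>x i. undefined) (\<lambda>x. inverse (f x))"
    by (rule smooth_alg.inv[OF smooth_alg.base[OF assms(2)] assms(3)])
qed auto

lemma smooth_on_sum:
  assumes "ropen n U" "finite I" "\<And>i. i \<in> I \<Longrightarrow> smooth_on n U (f i)"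
  shows "smooth_on n U (\<lambda>x. \<Sum>i\<in>I. f i x)"
  using assms(2,3) by (induction I rule: finite_induct) (auto intro: smooth_on_const smooth_on_add assms(1))

lemma smooth_on_prod:
  assumes "ropen n U" "finite I" "\<And>i. i \<in> I \<Longrightarrow> smooth_on n U (f i)"
  shows "smooth_on n U (\<lambda>x. \<Prod>i\<in>I. f i x)"
  using assms(2,3) by (induction I rule: finite_induct) (auto intro: smooth_on_const smooth_on_mult assms(1))

lemma continuous_on_ropen_local:
  assumes U: "ropen n U"
    and loc: "\<And>x. x \<in> U \<Longrightarrow> \<exists>V. ropen n V \<and> x \<in> V \<and> V \<subseteq> U \<and> continuous_on V f"
  shows "continuous_on U f"
  unfolding continuous_on_def
proof
  fix x assume x: "x \<in> U"
  then obtain V where V: "ropen n V" "x \<in> V" "V \<subseteq> U" and c: "continuous_on V f" using loc by blast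
  have "openin (top_of_set U) V"
    using V ropen_subset[OF U] unfolding powertop_real_eq_top_of_set by (meson openin_subset_trans)
  then obtain T where T: "open T" "V = U \<inter> T" by (auto simp: openin_open)
  have "(f \<longlongrightarrow> f x) (at x within V)" using c V(2) by (simp add: continuous_on_def)
  moreover have "at x within V = at x within U"
    by (rule at_within_nhd[of x T]) (use T V(2) in auto)
  ultimately show "(f \<longlongrightarrow> f x) (at x within U)" by simp
qed

text \<open>A partial derivative at a point depends only on a neighbourhood of it, so the class of
  locally smooth functions is itself stable under \<open>partial_deriv\<close>.\<close>

lemma smooth_on_local:
  assumes U: "ropen n U"
    and loc: "\<And>x. x \<in> U \<Longrightarrow> \<exists>V. ropen n V \<and> x \<in> V \<and> V \<subseteq> U \<and> smooth_on n V f"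
  shows "smooth_on n U f"
proof (rule smooth_on_coinduct[OF U, where Q = "\<lambda>f. \<forall>x\<in>U. \<exists>V. ropen n V \<and> x \<in> V \<and> V \<subseteq> U \<and> smooth_on n V f"])
  fix f assume f: "\<forall>x\<in>U. \<exists>V. ropen n V \<and> x \<in> V \<and> V \<subseteq> U \<and> smooth_on n V f"
  then obtain V where V: "\<And>x. x \<in> U \<Longrightarrow> ropen n (V x)" "\<And>x. x \<in> U \<Longrightarrow> x \<in> V x" "\<And>x. x \<in> U \<Longrightarrow> V x \<subseteq> U"
    "\<And>x. x \<in> U \<Longrightarrow> smooth_on n (V x) f" by metis
  have "continuous_on U f"
  proof (rule continuous_on_ropen_local[OF U])
    fix x assume "x \<in> U"
    then show "\<exists>V. ropen n V \<and> x \<in> V \<and> V \<subseteq> U \<and> continuous_on V f"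
      using V smooth_onD(1)[OF V(4) V(1)] by (intro exI[of _ "V x"]) simp
  qed
  moreover have "\<exists>g. (\<forall>x\<in>U. \<exists>V. ropen n V \<and> x \<in> V \<and> V \<subseteq> U \<and> smooth_on n V g) \<and>
       has_partial i U f g" if "i < n" for i
  proof (intro exI[of _ "partial_deriv i f"] conjI ballI)
    show "has_partial i U f (partial_deriv i f)"
      unfolding has_partial_def
    proof
      fix x assume x: "x \<in> U"
      show "((\<lambda>t. f (x(i := t))) has_real_derivative partial_deriv i f x) (at (x i))"
        using smooth_onD(2)[OF V(4)[OF x] V(1)[OF x] that] V(2)[OF x] by blast
    qed
  next
    fix x assume x: "x \<in> U"
    show "\<exists>V. ropen n V \<and> x \<in> V \<and> V \<subseteq> U \<and> smooth_on n V (partial_deriv i f)"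
      using V(1-3)[OF x] smooth_onD(3)[OF V(4)[OF x] V(1)[OF x] that] by blast
  qed
  ultimately show "continuous_on U f \<and> (\<forall>i<n. \<exists>g. (\<forall>x\<in>U. \<exists>V. ropen n V \<and> x \<in> V \<and> V \<subseteq> U \<and> smooth_on n V g) \<and>
       has_partial i U f g)" by (intro conjI allI impI)
next
  show "\<forall>x\<in>U. \<exists>V. ropen n V \<and> x \<in> V \<and> V \<subseteq> U \<and> smooth_on n V f" using loc by (intro ballI)
qed

lemma smooth_on_subset:
  assumes "smooth_on n U f" "ropen n U" "ropen n V" "V \<subseteq> U"
  shows "smooth_on n V f"
  using smooth_on_compose[OF assms(3,2), of "\<lambda>x. x" f] assms smooth_on_coord by auto

lemma smooth_funsI: "smooth_on n (Rn n) f \<Longrightarrow> restrict f (Rn n) \<in> smooth_funs n"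
  using smooth_on_cong[of n "Rn n" "restrict f (Rn n)" f] by (simp add: smooth_funs_def)

lemma smooth_funsD: "f \<in> smooth_funs n \<Longrightarrow> smooth_on n (Rn n) f"
  and smooth_funs_ext: "f \<in> smooth_funs n \<Longrightarrow> f \<in> extensional (Rn n)"
  by (auto simp: smooth_funs_def)

section \<open>Differentiation under the integral sign and Hadamard's lemma\<close>

lemma smooth_on_integral:
  assumes "smooth_on (Suc N) (Rn (Suc N)) \<Gamma>"
  shows "smooth_on N (Rn N) (\<lambda>x. integral {0..1} (\<lambda>t. \<Gamma> (x(N := t))))"
proof (rule smooth_on_coinduct[OF ropen_Rn, where
      Q = "\<lambda>K. \<exists>\<Gamma>. smooth_on (Suc N) (Rn (Suc N)) \<Gamma> \<and> K = (\<lambda>x. integral {0..1} (\<lambda>t. \<Gamma> (x(N := t))))"])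
  fix K assume "\<exists>\<Gamma>. smooth_on (Suc N) (Rn (Suc N)) \<Gamma> \<and> K = (\<lambda>x. integral {0..1} (\<lambda>t. \<Gamma> (x(N := t))))"
  then obtain \<Gamma> where \<Gamma>: "smooth_on (Suc N) (Rn (Suc N)) \<Gamma>"
    and K: "K = (\<lambda>x. integral {0..1} (\<lambda>t. \<Gamma> (x(N := t))))" by blast
  have upd: "x(N := t) \<in> Rn (Suc N)" if "x \<in> Rn N" for x :: "nat \<Rightarrow> real" and t
    using that by (auto simp: PiE_def extensional_def)
  have cont: "continuous_on (Rn N \<times> cbox 0 1) (\<lambda>(x, t). \<Gamma> (x(N := t)))"
  proof -
    have "continuous_on (Rn N \<times> cbox 0 1) (\<lambda>p. (fst p)(N := snd p :: real))"
    proof (rule continuous_on_coordinatewise_then_product)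
      fix i
      have "continuous_on (Rn N \<times> cbox (0::real) 1) (\<lambda>p. fst p i)"
        by (rule continuous_on_product_then_coordinatewise) (intro continuous_intros)
      then show "continuous_on (Rn N \<times> cbox (0::real) 1) (\<lambda>p. ((fst p)(N := snd p)) i)"
        by (cases "i = N") (auto intro: continuous_intros)
    qed
    then have "continuous_on (Rn N \<times> cbox 0 1) (\<lambda>p. \<Gamma> ((fst p)(N := snd p)))"
      by (rule continuous_on_compose2[OF smooth_onD(1)[OF \<Gamma> ropen_Rn]]) (auto intro!: upd simp del: fun_upd_apply)
    then show ?thesis by (simp add: case_prod_beta)
  qed
  have contK: "continuous_on (Rn N) K"
    using integral_continuous_on_param[OF cont] by (simp add: K)
  \<comment> \<open>By Leibniz' rule a partial derivative of such an integral is an integral of the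
    same kind, which makes the class stable.\<close>
  have "has_partial i (Rn N) K (\<lambda>x. integral {0..1} (\<lambda>t. partial_deriv i \<Gamma> (x(N := t))))" if i: "i < N" for i
    unfolding has_partial_def
  proof
    fix x :: "nat \<Rightarrow> real" assume x: "x \<in> Rn N"
    have sm: "smooth_on (Suc N) (Rn (Suc N)) (partial_deriv i \<Gamma>)" using smooth_onD(3)[OF \<Gamma> ropen_Rn] i by simp
    have in2: "(x(i := s))(N := t) \<in> Rn (Suc N)" for s t
      by (intro upd Rn_upd x i)
    have cst: "continuous_on A (\<lambda>p. (x(i := fst p))(N := snd p :: real))" for A :: "(real \<times> real) set"
    proof (rule continuous_on_coordinatewise_then_product)
      show "continuous_on A (\<lambda>p. ((x(i := fst p))(N := snd p)) k)" for k
        by (cases "k = N"; cases "k = i") (auto intro: continuous_intros)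
    qed
    have "((\<lambda>s. integral (cbox 0 1) (\<lambda>t. \<Gamma> ((x(i := s))(N := t)))) has_real_derivative
        integral (cbox 0 1) (\<lambda>t. partial_deriv i \<Gamma> ((x(i := x i))(N := t)))) (at (x i) within UNIV)"
    proof (rule leibniz_rule_field_derivative[where fx = "\<lambda>s t. partial_deriv i \<Gamma> ((x(i := s))(N := t))"])
      fix s t :: real
      have "((\<lambda>s'. \<Gamma> (((x(i := s))(N := t))(i := s'))) has_real_derivative
          partial_deriv i \<Gamma> ((x(i := s))(N := t))) (at (((x(i := s))(N := t)) i))"
        by (rule smooth_onD(2)[OF \<Gamma> ropen_Rn]) (use i in2 in auto)
      moreover have "((x(i := s))(N := t))(i := s') = (x(i := s'))(N := t)" for s'
        using i by (auto simp: fun_upd_def)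
      ultimately show "((\<lambda>s. \<Gamma> ((x(i := s))(N := t))) has_real_derivative
          partial_deriv i \<Gamma> ((x(i := s))(N := t))) (at s within UNIV)"
        using i by simp
    next
      fix s :: real
      have "continuous_on (cbox 0 1) (\<lambda>t. (s, t))" by (intro continuous_intros)
      then have "continuous_on (cbox 0 1) (\<lambda>t. (x(i := s))(N := t))"
        using continuous_on_compose2[OF cst[of UNIV]] by fastforce
      then have "continuous_on (cbox 0 1) (\<lambda>t. \<Gamma> ((x(i := s))(N := t)))"
        by (rule continuous_on_compose2[OF smooth_onD(1)[OF \<Gamma> ropen_Rn]]) (use in2 in blast)
      then show "(\<lambda>t. \<Gamma> ((x(i := s))(N := t))) integrable_on cbox 0 1"
        by (rule integrable_continuous)
    next
      have "continuous_on (UNIV \<times> cbox 0 1) (\<lambda>p. partial_deriv i \<Gamma> ((x(i := fst p))(N := snd p)))"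
        by (rule continuous_on_compose2[OF smooth_onD(1)[OF sm ropen_Rn] cst]) (use in2 in blast)
      then show "continuous_on (UNIV \<times> cbox 0 1) (\<lambda>(s, t). partial_deriv i \<Gamma> ((x(i := s))(N := t)))"
        by (simp add: case_prod_beta)
    qed auto
    then show "((\<lambda>t. K (x(i := t))) has_real_derivative integral {0..1} (\<lambda>t. partial_deriv i \<Gamma> (x(N := t)))) (at (x i))"
      by (simp add: K)
  qed
  moreover have "smooth_on (Suc N) (Rn (Suc N)) (partial_deriv i \<Gamma>)" if "i < N" for i
    using smooth_onD(3)[OF \<Gamma> ropen_Rn] that by simp
  ultimately show "continuous_on (Rn N) K \<and> (\<forall>i<N. \<exists>g. (\<exists>\<Gamma>. smooth_on (Suc N) (Rn (Suc N)) \<Gamma> \<and>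
      g = (\<lambda>x. integral {0..1} (\<lambda>t. \<Gamma> (x(N := t))))) \<and> has_partial i (Rn N) K g)"
    using contK by blast
qed (use assms in blast)

text \<open>The difference is the integral of the derivative of \<open>f\<close> along the segment
  in direction \<open>j\<close>, and the factor \<open>b - x j\<close> splits off. This is what
  makes the smooth operations well defined on quotients by ring ideals.\<close>

lemma Hadamard_one_variable:
  assumes f: "smooth_on n (Rn n) f" and j: "j < n"
  obtains h where "h \<in> smooth_funs (Suc n)"
    "\<And>x b. x \<in> Rn n \<Longrightarrow> f (x(j := b)) - f x = (b - x j) * h (x(n := b))"
proof -
  \<comment> \<open>Coordinate \<open>n\<close> carries the new value \<open>b\<close> and
    coordinate \<open>Suc n\<close> the integration parameter, so that arity \<open>Suc n\<close> is
    left after integrating.\<close>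
  define \<Gamma> where "\<Gamma> v = partial_deriv j f (\<lambda>i\<in>{..<n}. if i = j then v j + v (Suc n) * (v n - v j) else v i)" for v
  have G: "smooth_on (Suc (Suc n)) (Rn (Suc (Suc n))) \<Gamma>"
    unfolding \<Gamma>_def
  proof (rule smooth_on_compose[OF ropen_Rn ropen_Rn _ _ smooth_onD(3)[OF f ropen_Rn j]])
    fix i assume "i < n"
    show "smooth_on (Suc (Suc n)) (Rn (Suc (Suc n)))
       (\<lambda>v. (\<lambda>i\<in>{..<n}. if i = j then v j + v (Suc n) * (v n - v j) else v i) i)"
      using \<open>i < n\<close> by (cases "i = j") (auto intro!: smooth_on_add smooth_on_mult smooth_on_diff smooth_on_coord)
  qed auto
  define h where "h = (\<lambda>x\<in>Rn (Suc n). integral {0..1} (\<lambda>t. \<Gamma> (x(Suc n := t))))"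
  have "h \<in> smooth_funs (Suc n)"
    unfolding h_def by (rule smooth_funsI[OF smooth_on_integral[OF G]])
  moreover have "f (x(j := b)) - f x = (b - x j) * h (x(n := b))" if x: "x \<in> Rn n" for x b
  proof -
    define u where "u t = x j + t * (b - x j)" for t
    have pt: "(\<lambda>i\<in>{..<n}. if i = j then ((x(n := b))(Suc n := t)) j + ((x(n := b))(Suc n := t)) (Suc n) *
         (((x(n := b))(Suc n := t)) n - ((x(n := b))(Suc n := t)) j) else ((x(n := b))(Suc n := t)) i) = x(j := u t)" for t
      using x j by (auto simp: u_def PiE_def extensional_def)
    have "((\<lambda>t. f (x(j := u t))) has_vector_derivative partial_deriv j f (x(j := u t)) * (b - x j)) (at t within {0..1})" for t
    proof -
      have "((\<lambda>s. f ((x(j := u t))(j := s))) has_real_derivative partial_deriv j f (x(j := u t))) (at ((x(j := u t)) j))"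
        by (rule smooth_onD(2)[OF f ropen_Rn j Rn_upd[OF x j]])
      then have "((\<lambda>s. f (x(j := s))) has_real_derivative partial_deriv j f (x(j := u t))) (at (u t))" by simp
      moreover have "(u has_real_derivative (b - x j)) (at t within {0..1})"
        unfolding u_def by (auto intro!: derivative_eq_intros)
      ultimately have "((\<lambda>t. f (x(j := u t))) has_real_derivative partial_deriv j f (x(j := u t)) * (b - x j)) (at t within {0..1})"
        by (rule DERIV_chain2)
      then show ?thesis by (simp add: has_real_derivative_iff_has_vector_derivative)
    qed
    from fundamental_theorem_of_calculus[OF _ this]
    have I: "((\<lambda>t. partial_deriv j f (x(j := u t)) * (b - x j)) has_integral f (x(j := u 1)) - f (x(j := u 0))) {0..1}"
      by auto
    have "integral {0..1} (\<lambda>t. partial_deriv j f (x(j := u t)) * (b - x j)) = f (x(j := b)) - f x"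
      using integral_unique[OF I] by (simp add: u_def)
    moreover have "x(n := b) \<in> Rn (Suc n)" using x by (auto simp: PiE_def extensional_def)
    ultimately show ?thesis unfolding h_def \<Gamma>_def pt by (simp add: pt mult.commute)
  qed
  ultimately show thesis using that by blast
qed

section \<open>Flat functions and cutoffs\<close>

abbreviation smooth1 :: "(real \<Rightarrow> real) \<Rightarrow> bool" where
  "smooth1 \<phi> \<equiv> smooth_on 1 (Rn 1) (\<lambda>x. \<phi> (x 0))"

lemma smooth1_compose:
  assumes "ropen n U" "smooth1 \<phi>" "smooth_on n U g"
  shows "smooth_on n U (\<lambda>x. \<phi> (g x))"
proof -
  have "smooth_on n U (\<lambda>x. \<phi> ((\<lambda>i\<in>{..<1::nat}. g x) 0))"
  proof (rule smooth_on_compose[OF assms(1) ropen_Rn[of 1] _ _ assms(2)])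
    show "(\<lambda>i\<in>{..<1}. g x) \<in> Rn 1" for x by simp
    show "smooth_on n U (\<lambda>x. (\<lambda>i\<in>{..<1}. g x) j)" if "j < 1" for j
      using assms(3) that by simp
  qed
  then show ?thesis by simp
qed

text \<open>A family stable under differentiation that contains the flat function
  \<open>exp(-1/s)\<close>; its smoothness follows by \<open>smooth_on_coinduct\<close> without
  formulas for higher derivatives.\<close>

definition poly_exp :: "real poly \<Rightarrow> real \<Rightarrow> real" where
  "poly_exp p s = (if s > 0 then poly p (1 / s) * exp (- (1 / s)) else 0)"

lemma poly_exp_tendsto_0: "((\<lambda>u. poly q u * exp (- u)) \<longlongrightarrow> 0) at_top" for q :: "real poly"
proof -
  have "((\<lambda>u. \<Sum>i\<le>Polynomial.degree q. Polynomial.coeff q i * (u ^ i / exp u)) \<longlongrightarrow> (\<Sum>i\<le>Polynomial.degree q. Polynomial.coeff q i * 0)) at_top"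
    by (intro tendsto_sum tendsto_mult tendsto_const tendsto_power_div_exp_0)
  then show ?thesis
    by (simp add: poly_altdef sum_distrib_right exp_minus divide_inverse mult.assoc)
qed

text \<open>\<open>[:0, 0, 1:]\<close> is the square of the variable: differentiating
  \<open>p(1/s) exp(-1/s)\<close> produces the factor \<open>1/s^2\<close> and the polynomial
  \<open>p - p'\<close>.\<close>

lemma poly_exp_deriv:
  "(poly_exp p has_real_derivative poly_exp ([:0, 0, 1:] * (p - pderiv p)) s) (at s)"
proof (cases s "0 :: real" rule: linorder_cases)
  case less
  have "(poly_exp p has_real_derivative 0) (at s) \<longleftrightarrow> ((\<lambda>_. 0) has_real_derivative 0) (at s)"
  proof (rule DERIV_cong_ev)
    show "eventually (\<lambda>x. poly_exp p x = 0) (nhds s)"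
      using eventually_nhds_in_open[of "{..<0}" s] less by (auto simp: poly_exp_def elim!: eventually_mono)
  qed auto
  then show ?thesis using less by (simp add: poly_exp_def)
next
  case equal
  \<comment> \<open>With \<open>u = 1/h\<close> the difference quotient at 0 is
    \<open>u p(u) exp(-u)\<close>; \<open>pCons 0 p\<close> is the variable times
    \<open>p\<close>.\<close>
  have "((\<lambda>u. poly (pCons 0 p) u * exp (- u)) \<longlongrightarrow> 0) at_top" by (rule poly_exp_tendsto_0)
  then have "((\<lambda>h. poly (pCons 0 p) (inverse h) * exp (- inverse h)) \<longlongrightarrow> 0) (at_right 0)"
    by (rule filterlim_compose[OF _ filterlim_inverse_at_top_right])
  moreover have "eventually (\<lambda>h. poly (pCons 0 p) (inverse h) * exp (- inverse h) = poly_exp p h / h) (at_right 0)"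
    unfolding eventually_at_right_field by (intro exI[of _ 1]) (auto simp: poly_exp_def field_simps)
  ultimately have "((\<lambda>h. poly_exp p h / h) \<longlongrightarrow> 0) (at_right 0)" by (rule Lim_transform_eventually)
  moreover have "((\<lambda>h. poly_exp p h / h) \<longlongrightarrow> 0) (at_left 0)"
  proof (rule tendsto_eventually)
    show "eventually (\<lambda>h. poly_exp p h / h = 0) (at_left 0)"
      unfolding eventually_at_left_field by (intro exI[of _ "-1"]) (auto simp: poly_exp_def)
  qed
  ultimately have "((\<lambda>h. poly_exp p h / h) \<longlongrightarrow> 0) (at 0)" by (simp add: filterlim_split_at)
  then show ?thesis using equal by (simp add: has_field_derivative_iff poly_exp_def)
next
  case greater
  have "((\<lambda>s. poly p (1 / s) * exp (- (1 / s))) has_real_derivative poly_exp ([:0, 0, 1:] * (p - pderiv p)) s) (at s)"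
    using greater
    by (auto intro!: derivative_eq_intros poly_DERIV DERIV_chain2[where f = "poly p"] simp: poly_exp_def field_simps power2_eq_square)
  moreover have "(poly_exp p has_real_derivative D) (at s) \<longleftrightarrow> ((\<lambda>s. poly p (1 / s) * exp (- (1 / s))) has_real_derivative D) (at s)" for D
  proof (rule DERIV_cong_ev)
    show "eventually (\<lambda>x. poly_exp p x = poly p (1 / x) * exp (- (1 / x))) (nhds s)"
      using eventually_nhds_in_open[of "{0<..}" s] greater by (auto simp: poly_exp_def elim!: eventually_mono)
  qed auto
  ultimately show ?thesis by simp
qed

lemma smooth1_poly_exp: "smooth1 (poly_exp p)"
proof (rule smooth_on_coinduct[OF ropen_Rn, where Q = "\<lambda>f. \<exists>p. f = (\<lambda>x. poly_exp p (x 0))"])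
  fix f :: "(nat \<Rightarrow> real) \<Rightarrow> real"
  assume "\<exists>p. f = (\<lambda>x. poly_exp p (x 0))"
  then obtain p where f: "f = (\<lambda>x. poly_exp p (x 0))" by blast
  have "continuous_on UNIV (poly_exp p)"
    using DERIV_isCont[OF poly_exp_deriv] by (simp add: continuous_on_eq_continuous_at)
  then have "continuous_on (Rn 1) f"
    unfolding f by (rule continuous_on_compose2[OF _ continuous_on_coord]) auto
  moreover have "has_partial 0 (Rn 1) f (\<lambda>x. poly_exp ([:0, 0, 1:] * (p - pderiv p)) (x 0))"
    unfolding has_partial_def f using poly_exp_deriv by auto
  ultimately show "continuous_on (Rn 1) f \<and> (\<forall>i<1. \<exists>g. (\<exists>p. g = (\<lambda>x. poly_exp p (x 0))) \<and> has_partial i (Rn 1) f g)"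
    by auto
qed auto

definition bump1 :: "real \<Rightarrow> real" where "bump1 = poly_exp 1"

lemma bump1: "smooth1 bump1" "bump1 s \<ge> 0" "bump1 s > 0 \<longleftrightarrow> s > 0" "bump1 s = 0 \<longleftrightarrow> s \<le> 0"
  using smooth1_poly_exp[of 1] by (auto simp: bump1_def poly_exp_def)

definition step1 :: "real \<Rightarrow> real" where "step1 s = bump1 s * inverse (bump1 s + bump1 (1 - s))"

lemma step1: "smooth1 step1" "s \<ge> 1 \<Longrightarrow> step1 s = 1" "s \<le> 0 \<Longrightarrow> step1 s = 0"
proof -
  have "smooth1 (\<lambda>s. bump1 (1 - s))"
    by (rule smooth1_compose[OF ropen_Rn bump1(1)]) (intro smooth_on_diff smooth_on_const smooth_on_coord ropen_Rn)
  \<comment> \<open>\<open>s\<close> and \<open>1 - s\<close> are never both non-positive.\<close>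
  moreover have "bump1 s + bump1 (1 - s) \<noteq> 0" for s
    using bump1(2)[of s] bump1(2)[of "1 - s"] bump1(3)[of s] bump1(3)[of "1 - s"] by (cases "s > 0") auto
  ultimately show "smooth1 step1"
    unfolding step1_def using bump1(1)
    by (intro smooth_on_mult smooth_on_inverse smooth_on_add ropen_Rn) auto
  show "s \<ge> 1 \<Longrightarrow> step1 s = 1" using bump1(4)[of "1 - s"] bump1(3)[of s] by (simp add: step1_def)
  show "s \<le> 0 \<Longrightarrow> step1 s = 0" using bump1(4)[of s] by (simp add: step1_def)
qed

text \<open>\<open>alpha_ge\<close> is a Hilbert choice, about which nothing is known before a
  witness exists; \<open>bump1 (r - x 0)\<close> is one.\<close>

lemma alpha_ge_smooth: "alpha_ge r \<in> smooth_funs 1"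
proof -
  have "smooth_on 1 (Rn 1) (\<lambda>x. bump1 (r - x 0))"
    by (rule smooth1_compose[OF ropen_Rn bump1(1)]) (intro smooth_on_diff smooth_on_const smooth_on_coord ropen_Rn)
  from smooth_funsI[OF this]
  have "\<exists>\<alpha>. \<alpha> \<in> smooth_funs 1 \<and> (\<forall>x\<in>Rn 1. \<alpha> x = 0 \<longleftrightarrow> x 0 \<ge> r)"
    by (intro exI[of _ "\<lambda>x\<in>Rn 1. bump1 (r - x 0)"] conjI) (auto simp: bump1(4))
  from someI_ex[OF this] show ?thesis unfolding alpha_ge_def by blast
qed

text \<open>\<open>\<rho>\<close> marks the open box, and \<open>\<kappa>\<close> is 1 there and
  lives in the doubled box. Multiplication by \<open>\<kappa>\<close> turns chart coordinates into
  global functions without changing them where \<open>\<rho>\<close> is non-zero.\<close>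

lemma box_bump:
  assumes "r > 0"
  obtains \<rho> \<kappa> where "smooth_on n (Rn n) \<rho>" "smooth_on n (Rn n) \<kappa>" "\<And>x. \<rho> x \<ge> 0"
    "\<And>x. \<rho> x \<noteq> 0 \<longleftrightarrow> (\<forall>i<n. \<bar>x i - q i\<bar> < r)"
    "\<And>x. (\<And>i. i < n \<Longrightarrow> \<bar>x i - q i\<bar> \<le> r) \<Longrightarrow> \<kappa> x = 1"
    "\<And>x i. \<kappa> x \<noteq> 0 \<Longrightarrow> i < n \<Longrightarrow> \<bar>x i - q i\<bar> < 2 * r"
proof
  show "smooth_on n (Rn n) (\<lambda>x. \<Prod>i<n. bump1 (r * r - (x i - q i) * (x i - q i)))"
    by (intro smooth_on_prod smooth1_compose[OF _ bump1(1)] smooth_on_diff smooth_on_mult smooth_on_const smooth_on_coord ropen_Rn) auto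
  \<comment> \<open>The constant 2 puts the argument of \<open>step1\<close> at 1 or more inside the
    box and at 0 or less from the distance \<open>sqrt 2 * r\<close> on, which is below
    \<open>2 * r\<close>.\<close>
  show "smooth_on n (Rn n) (\<lambda>x. \<Prod>i<n. step1 (2 - (x i - q i) * (x i - q i) * (1 / (r * r))))"
    by (intro smooth_on_prod smooth1_compose[OF _ step1(1)] smooth_on_diff smooth_on_mult smooth_on_const smooth_on_coord ropen_Rn) auto
  show "(\<Prod>i<n. bump1 (r * r - (x i - q i) * (x i - q i))) \<ge> 0" for x
    by (intro prod_nonneg) (simp add: bump1)
  show "(\<Prod>i<n. bump1 (r * r - (x i - q i) * (x i - q i))) \<noteq> 0 \<longleftrightarrow> (\<forall>i<n. \<bar>x i - q i\<bar> < r)" for x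
  proof -
    have "(x i - q i) * (x i - q i) < r * r \<longleftrightarrow> \<bar>x i - q i\<bar> < r" for i
      using abs_square_less_1[of 0] assms by (metis abs_le_square_iff abs_of_pos linorder_not_le power2_eq_square)
    then show ?thesis by (auto simp: bump1(4) not_le)
  qed
  show "(\<Prod>i<n. step1 (2 - (x i - q i) * (x i - q i) * (1 / (r * r)))) = 1" if "\<And>i. i < n \<Longrightarrow> \<bar>x i - q i\<bar> \<le> r" for x
  proof (rule prod.neutral, intro ballI step1(2))
    fix i assume "i \<in> {..<n}"
    then have "(x i - q i) * (x i - q i) \<le> r * r"
      using that[of i] assms by (metis abs_le_square_iff abs_of_pos lessThan_iff power2_eq_square)
    then show "1 \<le> 2 - (x i - q i) * (x i - q i) * (1 / (r * r))" using assms by (simp add: field_simps)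
  qed
  show "\<bar>x i - q i\<bar> < 2 * r" if "(\<Prod>i<n. step1 (2 - (x i - q i) * (x i - q i) * (1 / (r * r)))) \<noteq> 0" "i < n" for x i
  proof (rule ccontr)
    assume "\<not> \<bar>x i - q i\<bar> < 2 * r"
    then have "(2 * r) * (2 * r) \<le> (x i - q i) * (x i - q i)"
      using assms by (metis abs_le_square_iff abs_of_pos linorder_not_le power2_eq_square mult_pos_pos zero_less_numeral)
    moreover have "2 * (r * r) \<le> (2 * r) * (2 * r)" by simp
    ultimately have "2 * (r * r) \<le> (x i - q i) * (x i - q i)" by linarith
    then have "2 - (x i - q i) * (x i - q i) * (1 / (r * r)) \<le> 0" using assms by (simp add: field_simps)
    then have "step1 (2 - (x i - q i) * (x i - q i) * (1 / (r * r))) = 0" by (rule step1(3))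
    then show False using that by auto
  qed
qed

section \<open>Convergent series of smooth functions\<close>

definition iter_partial :: "nat list \<Rightarrow> ((nat \<Rightarrow> real) \<Rightarrow> real) \<Rightarrow> (nat \<Rightarrow> real) \<Rightarrow> real" where
  "iter_partial is f = foldr partial_deriv is f"

lemma iter_partial_simps: "iter_partial [] f = f" "iter_partial (i # is) f = partial_deriv i (iter_partial is f)"
  by (simp_all add: iter_partial_def)

lemma smooth_on_iter_partial:
  assumes "ropen n U" "smooth_on n U f" "set is \<subseteq> {..<n}"
  shows "smooth_on n U (iter_partial is f)"
  using assms(3) by (induction "is") (auto simp: iter_partial_simps assms(2) intro: smooth_onD(3)[OF _ assms(1)])

text \<open>The usual compact exhaustion of an open set: size at most \<open>j\<close> and
  sup-distance at least \<open>1 / (j + 1)\<close> from the complement.\<close>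

definition exhaust_compact :: "nat \<Rightarrow> (nat \<Rightarrow> real) set \<Rightarrow> nat \<Rightarrow> (nat \<Rightarrow> real) set" where
  "exhaust_compact n U j = {x \<in> Rn n. (\<forall>i<n. \<bar>x i\<bar> \<le> real j) \<and>
     (\<forall>y\<in>Rn n. (\<forall>i<n. \<bar>y i - x i\<bar> < inverse (real (Suc j))) \<longrightarrow> y \<in> U)}"

lemma exhaust_compact_subset: "exhaust_compact n U j \<subseteq> U"
  unfolding exhaust_compact_def by auto

lemma compact_exhaust_compact: "compact (exhaust_compact n U j)"
proof -
  have "compactin (powertop_real {..<n}) (PiE {..<n} (\<lambda>i. {- real j..real j}))"
    by (simp add: compactin_PiE)
  then have c: "compact (PiE {..<n} (\<lambda>i. {- real j..real j}))"
    by (simp add: powertop_real_eq_top_of_set compactin_subtopology)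
  \<comment> \<open>The distance condition is an intersection, over the points outside
    \<open>U\<close>, of finite unions of closed conditions.\<close>
  have "closed (\<Inter>y\<in>Rn n - U. \<Union>i<n. {x. inverse (real (Suc j)) \<le> \<bar>y i - x i\<bar>})"
    by (intro closed_INT ballI closed_UN closed_Collect_le continuous_intros continuous_on_coord) auto
  from compact_Int_closed[OF c this]
  show ?thesis
  proof (rule back_subst[where P = compact])
    show "PiE {..<n} (\<lambda>i. {- real j..real j}) \<inter> (\<Inter>y\<in>Rn n - U. \<Union>i<n. {x. inverse (real (Suc j)) \<le> \<bar>y i - x i\<bar>}) =
      exhaust_compact n U j"
    proof (rule Set.set_eqI)
      fix x
      have "x \<in> PiE {..<n} (\<lambda>i. {- real j..real j}) \<longleftrightarrow> x \<in> Rn n \<and> (\<forall>i<n. \<bar>x i\<bar> \<le> real j)"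
        by (auto simp: PiE_iff abs_le_iff minus_le_iff)
      moreover have "x \<in> (\<Inter>y\<in>Rn n - U. \<Union>i<n. {x. inverse (real (Suc j)) \<le> \<bar>y i - x i\<bar>}) \<longleftrightarrow>
        (\<forall>y\<in>Rn n. (\<forall>i<n. \<bar>y i - x i\<bar> < inverse (real (Suc j))) \<longrightarrow> y \<in> U)"
        unfolding INT_iff UN_iff mem_Collect_eq by (meson DiffE DiffI lessThan_iff not_less)
      ultimately show "x \<in> PiE {..<n} (\<lambda>i. {- real j..real j}) \<inter>
          (\<Inter>y\<in>Rn n - U. \<Union>i<n. {x. inverse (real (Suc j)) \<le> \<bar>y i - x i\<bar>}) \<longleftrightarrow> x \<in> exhaust_compact n U j"
        unfolding exhaust_compact_def by blast
    qed
  qed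
qed

text \<open>Local uniform convergence requires a whole neighbourhood of each point inside a single
  member of the exhaustion.\<close>

lemma exhaust_compact_nbhd:
  assumes U: "ropen n U" and x: "x \<in> U"
  obtains j e where "e > 0" "{y \<in> Rn n. \<forall>i<n. \<bar>y i - x i\<bar> < e} \<subseteq> exhaust_compact n U j"
proof -
  obtain e where e: "e > 0" "\<And>y. y \<in> Rn n \<Longrightarrow> (\<And>i. i < n \<Longrightarrow> \<bar>y i - x i\<bar> < e) \<Longrightarrow> y \<in> U"
    using ropen_box[OF U x] by blast
  define B where "B = (\<Sum>i<n. \<bar>x i\<bar>) + e"
  \<comment> \<open>Half of the radius \<open>e\<close> is spent on moving from \<open>x\<close> to
    \<open>y\<close>, the other half on the margin required around \<open>y\<close>.\<close>
  obtain j where j: "real j \<ge> B" "inverse (real (Suc j)) < e / 2"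
  proof -
    obtain a where a: "inverse (real (Suc a)) < e / 2" using reals_Archimedean[of "e/2"] e by auto
    obtain b where b: "real b \<ge> B" using real_arch_simple by blast
    have "inverse (real (Suc (max a b))) \<le> inverse (real (Suc a))" by (intro le_imp_inverse_le) auto
    then have "inverse (real (Suc (max a b))) < e / 2" using a by linarith
    moreover have "B \<le> real (max a b)" using b by simp
    ultimately show thesis using that by blast
  qed
  have "y \<in> exhaust_compact n U j" if y: "y \<in> Rn n" "\<forall>i<n. \<bar>y i - x i\<bar> < e / 2" for y
    unfolding exhaust_compact_def
  proof (intro CollectI conjI y(1) allI impI ballI)
    fix i assume i: "i < n"
    have "\<bar>x i\<bar> \<le> (\<Sum>i<n. \<bar>x i\<bar>)" by (rule member_le_sum) (use i in auto)
    moreover have "\<bar>y i\<bar> < \<bar>x i\<bar> + e" using y(2)[rule_format, OF i] e(1) by linarith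
    ultimately show "\<bar>y i\<bar> \<le> real j" using j(1) unfolding B_def by linarith
  next
    fix z assume z: "z \<in> Rn n" "\<forall>i<n. \<bar>z i - y i\<bar> < inverse (real (Suc j))"
    show "z \<in> U"
    proof (rule e(2)[OF z(1)])
      fix i assume "i < n"
      then have "\<bar>z i - y i\<bar> < e / 2" "\<bar>y i - x i\<bar> < e / 2" using z(2) y(2) j(2) by force+
      then show "\<bar>z i - x i\<bar> < e" by linarith
    qed
  qed
  then show thesis using that[of "e / 2" j] e(1) by auto
qed

text \<open>The requirements \<open>(l, j, is)\<close> (domain, compact piece, derivative) are
  countably many. Coefficients chosen diagonally satisfy each of them from some index on, so all
  differentiated series converge locally uniformly. One sequence serves all domains, since the same
  series will be read on Euclidean space and in every chart.\<close>

lemma smooth_series: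
  fixes d :: "nat \<Rightarrow> nat" and U :: "nat \<Rightarrow> (nat \<Rightarrow> real) set" and f :: "nat \<Rightarrow> nat \<Rightarrow> (nat \<Rightarrow> real) \<Rightarrow> real"
  assumes U: "\<And>l. ropen (d l) (U l)" and f: "\<And>k l. smooth_on (d l) (U l) (f k l)"
  obtains c :: "nat \<Rightarrow> real" where "\<And>k. c k > 0"
    "\<And>l. smooth_on (d l) (U l) (\<lambda>x. suminf (\<lambda>k. c k * f k l x))"
    "\<And>l x. x \<in> U l \<Longrightarrow> summable (\<lambda>k. c k * f k l x)"
proof -
  have "\<exists>B\<ge>0. \<forall>x\<in>exhaust_compact (d l) (U l) j. set is \<subseteq> {..<d l} \<longrightarrow> \<bar>iter_partial is (f k l) x\<bar> \<le> B" for k l j "is"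
  proof (cases "set is \<subseteq> {..<d l}")
    case True
    have "continuous_on (exhaust_compact (d l) (U l) j) (iter_partial is (f k l))"
      using smooth_onD(1)[OF smooth_on_iter_partial[OF U f True] U] exhaust_compact_subset
      by (rule continuous_on_subset)
    then have "bounded (iter_partial is (f k l) ` exhaust_compact (d l) (U l) j)"
      by (intro compact_imp_bounded compact_continuous_image compact_exhaust_compact)
    then obtain B where "\<forall>y\<in>iter_partial is (f k l) ` exhaust_compact (d l) (U l) j. norm y \<le> B"
      unfolding bounded_iff by blast
    then show ?thesis by (intro exI[of _ "max B 0"]) (auto simp: le_max_iff_disj)
  qed auto
  then have ex: "\<forall>p. \<exists>B. case p of (k, l, j, is) \<Rightarrow> B \<ge> 0 \<and> (\<forall>x\<in>exhaust_compact (d l) (U l) j.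
      set is \<subseteq> {..<d l} \<longrightarrow> \<bar>iter_partial is (f k l) x\<bar> \<le> B)" by (simp add: split_paired_all)
  obtain B' where B': "\<forall>p. case p of (k, l, j, is) \<Rightarrow> B' p \<ge> (0::real) \<and> (\<forall>x\<in>exhaust_compact (d l) (U l) j.
      set is \<subseteq> {..<d l} \<longrightarrow> \<bar>iter_partial is (f k l) x\<bar> \<le> B' p)" using choice[OF ex] by blast
  define B where "B k l j is = B' (k, l, j, is)" for k l j "is"
  have B0: "B k l j is \<ge> 0" for k l j "is" using B'[rule_format, of "(k, l, j, is)"] by (simp add: B_def)
  have B: "\<bar>iter_partial is (f k l) x\<bar> \<le> B k l j is"
    if "x \<in> exhaust_compact (d l) (U l) j" "set is \<subseteq> {..<d l}" for k l j "is" x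
    using B'[rule_format, of "(k, l, j, is)"] that by (simp add: B_def)
  \<comment> \<open>\<open>S k\<close> adds up the bounds of all requirements with code at most
    \<open>k\<close>. Division by \<open>1 + S k\<close> leaves the geometric series for a given
    requirement as soon as \<open>k\<close> reaches its code.\<close>
  define S where "S k = (\<Sum>e\<le>k. case from_nat e of (l, j, is) \<Rightarrow> B k l j is)" for k :: nat
  define c where "c k = (1/2) ^ k / (1 + S k)" for k
  have S0: "S k \<ge> 0" for k unfolding S_def by (intro sum_nonneg) (auto simp: B0 split: prod.splits)
  have c0: "c k > 0" for k using S0[of k] by (simp add: c_def)
  have cB: "c k * B k l j is \<le> (1/2) ^ k" if "k \<ge> to_nat (l, j, is)" for k l j "is"
  proof -
    have "(case from_nat (to_nat (l, j, is)) of (l, j, is) \<Rightarrow> B k l j is) \<le> S k"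
      unfolding S_def by (rule member_le_sum) (use that B0 in \<open>auto split: prod.splits\<close>)
    then have "B k l j is \<le> 1 + S k" by simp
    then have "(1/2 :: real) ^ k * (B k l j is / (1 + S k)) \<le> (1/2) ^ k * 1"
      using S0[of k] by (intro mult_left_mono) (auto simp: divide_le_eq)
    then show ?thesis by (simp add: c_def)
  qed
  have sumB: "summable (\<lambda>k. c k * B k l j is)" for l j "is"
  proof (rule summable_comparison_test_ev)
    show "summable (\<lambda>k. (1/2 :: real) ^ k)" by simp
    show "eventually (\<lambda>k. norm (c k * B k l j is) \<le> (1/2) ^ k) sequentially"
      unfolding eventually_sequentially
    proof (intro exI[of _ "to_nat (l, j, is)"] allI impI)
      fix k assume "to_nat (l, j, is) \<le> k"
      then show "norm (c k * B k l j is) \<le> (1/2) ^ k"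
        using cB[of l j "is" k] less_imp_le[OF c0[of k]] B0[of k l j "is"] by (simp add: abs_mult)
    qed
  qed
  have bd: "norm (c k * iter_partial is (f k l) x) \<le> c k * B k l j is"
    if "x \<in> exhaust_compact (d l) (U l) j" "set is \<subseteq> {..<d l}" for k l j "is" x
    using B[OF that, of k] c0[of k] by (simp add: abs_mult)
  have smb: "summable (\<lambda>k. c k * iter_partial is (f k l) x)" if x: "x \<in> U l" and "set is \<subseteq> {..<d l}" for l x "is"
  proof -
    obtain j e where je: "e > 0" "{y \<in> Rn (d l). \<forall>i<d l. \<bar>y i - x i\<bar> < e} \<subseteq> exhaust_compact (d l) (U l) j"
      by (rule exhaust_compact_nbhd[OF U x])
    have "x \<in> exhaust_compact (d l) (U l) j"
      by (rule subsetD[OF je(2)]) (use subsetD[OF ropen_subset[OF U] x] je(1) in simp)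
    from bd[OF this that(2)] show ?thesis
      by (intro summable_comparison_test'[OF sumB[of l j "is"], of 0])
  qed
  have "smooth_on (d l) (U l) (\<lambda>x. suminf (\<lambda>k. c k * f k l x))" for l
  proof (rule smooth_on_coinduct[OF U, where Q = "\<lambda>g. \<exists>is. set is \<subseteq> {..<d l} \<and> g = (\<lambda>x. suminf (\<lambda>k. c k * iter_partial is (f k l) x))"])
    show "\<exists>is. set is \<subseteq> {..<d l} \<and> (\<lambda>x. suminf (\<lambda>k. c k * f k l x)) = (\<lambda>x. suminf (\<lambda>k. c k * iter_partial is (f k l) x))"
      by (rule exI[of _ "[]"]) (simp add: iter_partial_simps)
  next
    fix g assume "\<exists>is. set is \<subseteq> {..<d l} \<and> g = (\<lambda>x. suminf (\<lambda>k. c k * iter_partial is (f k l) x))"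
    then obtain "is" where is_n: "set is \<subseteq> {..<d l}" and g: "g = (\<lambda>x. suminf (\<lambda>k. c k * iter_partial is (f k l) x))" by blast
    have sm: "smooth_on (d l) (U l) (iter_partial is (f k l))" for k by (rule smooth_on_iter_partial[OF U f is_n])
    have "continuous_on (U l) g"
    proof (rule continuous_on_ropen_local[OF U])
      fix x assume x: "x \<in> U l"
      obtain j e where je: "e > 0" "{y \<in> Rn (d l). \<forall>i<d l. \<bar>y i - x i\<bar> < e} \<subseteq> exhaust_compact (d l) (U l) j"
        by (rule exhaust_compact_nbhd[OF U x])
      define V where "V = {y \<in> Rn (d l). \<forall>i<d l. \<bar>y i - x i\<bar> < e}"
      have V: "V \<subseteq> exhaust_compact (d l) (U l) j" "V \<subseteq> U l" using je(2) exhaust_compact_subset unfolding V_def by blast+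
      have "uniform_limit V (\<lambda>m x. \<Sum>k<m. c k * iter_partial is (f k l) x) g sequentially"
        unfolding g by (rule Weierstrass_m_test[OF bd sumB[of l j "is"]]) (use V is_n in auto)
      moreover have "continuous_on V (\<lambda>x. \<Sum>k<m. c k * iter_partial is (f k l) x)" for m
        by (intro continuous_on_sum continuous_on_mult continuous_on_const continuous_on_subset[OF smooth_onD(1)[OF sm U] V(2)])
      ultimately have "continuous_on V g" by (intro uniform_limit_theorem) auto
      moreover have "ropen (d l) V" unfolding V_def by (rule ropen_open_box)
      moreover have "x \<in> V" unfolding V_def using subsetD[OF ropen_subset[OF U] x] je(1) by simp
      ultimately show "\<exists>V. ropen (d l) V \<and> x \<in> V \<and> V \<subseteq> U l \<and> continuous_on V g" using V(2) by blast
    qed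
    \<comment> \<open>Termwise differentiation prepends \<open>i\<close> to the list, which keeps
      the series in the class of the coinduction.\<close>
    moreover have partial: "has_partial i (U l) g (\<lambda>x. suminf (\<lambda>k. c k * iter_partial (i # is) (f k l) x))" if i: "i < d l" for i
      unfolding has_partial_def
    proof
      fix x assume x: "x \<in> U l"
      have xR: "x \<in> Rn (d l)" by (rule subsetD[OF ropen_subset[OF U] x])
      obtain j e where je: "e > 0" "{y \<in> Rn (d l). \<forall>i<d l. \<bar>y i - x i\<bar> < e} \<subseteq> exhaust_compact (d l) (U l) j"
        by (rule exhaust_compact_nbhd[OF U x])
      define I where "I = {x i - e<..<x i + e}"
      have xt: "x(i := t) \<in> exhaust_compact (d l) (U l) j" if "t \<in> I" for t
        by (rule subsetD[OF je(2)]) (use that xR i je(1) in \<open>auto simp: I_def Rn_upd abs_less_iff\<close>)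
      have is_n': "set (i # is) \<subseteq> {..<d l}" using is_n i by simp
      have "((\<lambda>t. suminf (\<lambda>k. c k * iter_partial is (f k l) (x(i := t)))) has_real_derivative
          (suminf (\<lambda>k. c k * iter_partial (i # is) (f k l) (x(i := x i))))) (at (x i))"
      proof (rule has_field_derivative_series'(2)[where S = I and f' = "\<lambda>k t. c k * iter_partial (i # is) (f k l) (x(i := t))"])
        show "convex I" by (simp add: I_def)
        show "x i \<in> I" using je(1) by (simp add: I_def)
        show "x i \<in> interior I" using je(1) by (simp add: I_def interior_open)
        show "summable (\<lambda>k. c k * iter_partial is (f k l) (x(i := x i)))" using smb[OF x is_n] by simp
        show "uniformly_convergent_on I (\<lambda>m t. \<Sum>k<m. c k * iter_partial (i # is) (f k l) (x(i := t)))"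
          by (rule Weierstrass_m_test'[OF bd[OF xt is_n'] sumB])
        fix k t assume t: "t \<in> I"
        have "x(i := t) \<in> U l" using xt[OF t] exhaust_compact_subset by blast
        from smooth_onD(2)[OF sm U i this, of k]
        have "((\<lambda>s. iter_partial is (f k l) (x(i := s))) has_real_derivative iter_partial (i # is) (f k l) (x(i := t))) (at t)"
          by (simp add: iter_partial_simps)
        then show "((\<lambda>t. c k * iter_partial is (f k l) (x(i := t))) has_real_derivative
            c k * iter_partial (i # is) (f k l) (x(i := t))) (at t within I)"
          by (rule has_field_derivative_at_within[OF DERIV_cmult])
      qed
      then show "((\<lambda>t. g (x(i := t))) has_real_derivative (suminf (\<lambda>k. c k * iter_partial (i # is) (f k l) x))) (at (x i))"
        by (simp add: g)
    qed
    have "\<exists>h. (\<exists>is. set is \<subseteq> {..<d l} \<and>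
        h = (\<lambda>x. suminf (\<lambda>k. c k * iter_partial is (f k l) x))) \<and> has_partial i (U l) g h" if i: "i < d l" for i
      by (intro exI[of _ "\<lambda>x. suminf (\<lambda>k. c k * iter_partial (i # is) (f k l) x)"] conjI partial i
          exI[of _ "i # is"] refl) (use is_n i in simp)
    ultimately show "continuous_on (U l) g \<and> (\<forall>i<d l. \<exists>h. (\<exists>is. set is \<subseteq> {..<d l} \<and>
        h = (\<lambda>x. suminf (\<lambda>k. c k * iter_partial is (f k l) x))) \<and> has_partial i (U l) g h)" by blast
  qed
  moreover have "summable (\<lambda>k. c k * f k l x)" if "x \<in> U l" for l x
    using smb[OF that, of "[]"] by (simp add: iter_partial_simps)
  ultimately show thesis using that[of c] c0 by blast
qed

section \<open>Smooth rings\<close>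

abbreviation tup :: "'a cinf_ring \<Rightarrow> nat \<Rightarrow> (nat \<Rightarrow> 'a) set" where
  "tup A n \<equiv> {..<n} \<rightarrow>\<^sub>E elems A"

lemma tupI: "(\<And>i. i < n \<Longrightarrow> a i \<in> elems A) \<Longrightarrow> (\<lambda>i\<in>{..<n}. a i) \<in> tup A n"
  by auto

lemma tup_mem: "a \<in> tup A n \<Longrightarrow> i < n \<Longrightarrow> a i \<in> elems A"
  by auto

lemma restrict_tup: "a \<in> tup A n \<Longrightarrow> (\<lambda>i\<in>{..<n}. a i) = a"
  by (rule PiE_restrict)

lemma carrier_ring_of [simp]: "carrier (ring_of A) = elems A"
  by (simp add: ring_of_def)

text \<open>\<open>sop\<close> expects extensional functions; with \<open>ev\<close> identities
  between plain formulas can be evaluated without carrying restrictions around.\<close>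

definition ev :: "'a cinf_ring \<Rightarrow> nat \<Rightarrow> ((nat \<Rightarrow> real) \<Rightarrow> real) \<Rightarrow> (nat \<Rightarrow> 'a) \<Rightarrow> 'a" where
  "ev A n F a = sop A n (restrict F (Rn n)) a"

lemma ev_smooth_funs: "F \<in> smooth_funs n \<Longrightarrow> ev A n F a = sop A n F a"
  by (simp add: ev_def smooth_funs_def extensional_restrict)

lemma ev_cong: "(\<And>x. x \<in> Rn n \<Longrightarrow> F x = G x) \<Longrightarrow> ev A n F a = ev A n G a"
  unfolding ev_def by (metis restrict_ext)

context cinf_ring
begin

lemma ev_closed: "smooth_on n (Rn n) F \<Longrightarrow> a \<in> tup A n \<Longrightarrow> ev A n F a \<in> elems A"
  unfolding ev_def by (intro sop_closed smooth_funsI)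

lemma ev_coord: "i < n \<Longrightarrow> a \<in> tup A n \<Longrightarrow> ev A n (\<lambda>x. x i) a = a i"
  unfolding ev_def by (rule sop_proj)

lemma ev_comp:
  assumes "smooth_on m (Rn m) F" "\<And>j. j < m \<Longrightarrow> smooth_on n (Rn n) (G j)" "a \<in> tup A n"
  shows "ev A n (\<lambda>x. F (\<lambda>j\<in>{..<m}. G j x)) a = ev A m F (\<lambda>j\<in>{..<m}. ev A n (G j) a)"
proof -
  have "sop A n (\<lambda>x\<in>Rn n. restrict F (Rn m) (\<lambda>j\<in>{..<m}. restrict (G j) (Rn n) x)) a =
    sop A m (restrict F (Rn m)) (\<lambda>j\<in>{..<m}. sop A n (restrict (G j) (Rn n)) a)"
    by (rule sop_comp[OF smooth_funsI[OF assms(1)] smooth_funsI[OF assms(2)] assms(3)])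
  moreover have "(\<lambda>x\<in>Rn n. restrict F (Rn m) (\<lambda>j\<in>{..<m}. restrict (G j) (Rn n) x)) = (\<lambda>x\<in>Rn n. F (\<lambda>j\<in>{..<m}. G j x))"
    by (intro restrict_ext) (auto cong: restrict_cong)
  ultimately show ?thesis by (simp add: ev_def)
qed

text \<open>Addition in \<open>ring_of\<close> is itself a binary smooth operation, so this is an
  instance of compatibility with composition.\<close>

lemma ev_add:
  assumes "smooth_on n (Rn n) F" "smooth_on n (Rn n) G" "a \<in> tup A n"
  shows "ev A n (\<lambda>x. F x + G x) a = ev A n F a \<oplus>\<^bsub>ring_of A\<^esub> ev A n G a"
proof -
  have "ev A n (\<lambda>x. F x + G x) a = ev A n (\<lambda>x. (\<lambda>y. y 0 + y 1) (\<lambda>j\<in>{..<2::nat}. (if j = 0 then F else G) x)) a"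
    by simp
  also have "\<dots> = ev A 2 (\<lambda>y. y 0 + y 1) (\<lambda>j\<in>{..<2::nat}. ev A n (if j = 0 then F else G) a)"
  proof (rule ev_comp[OF _ _ assms(3)])
    show "smooth_on 2 (Rn 2) (\<lambda>y. y 0 + y 1)" by (intro smooth_on_add smooth_on_coord ropen_Rn)
    show "smooth_on n (Rn n) (if j = 0 then F else G)" for j :: nat using assms by simp
  qed
  also have "\<dots> = ev A n F a \<oplus>\<^bsub>ring_of A\<^esub> ev A n G a"
    by (simp add: ring_of_def ev_def if_distrib if_distribR cong: if_cong)
  finally show ?thesis .
qed

lemma ev_mult:
  assumes "smooth_on n (Rn n) F" "smooth_on n (Rn n) G" "a \<in> tup A n"
  shows "ev A n (\<lambda>x. F x * G x) a = ev A n F a \<otimes>\<^bsub>ring_of A\<^esub> ev A n G a"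
proof -
  have "ev A n (\<lambda>x. F x * G x) a = ev A n (\<lambda>x. (\<lambda>y. y 0 * y 1) (\<lambda>j\<in>{..<2::nat}. (if j = 0 then F else G) x)) a"
    by simp
  also have "\<dots> = ev A 2 (\<lambda>y. y 0 * y 1) (\<lambda>j\<in>{..<2::nat}. ev A n (if j = 0 then F else G) a)"
  proof (rule ev_comp[OF _ _ assms(3)])
    show "smooth_on 2 (Rn 2) (\<lambda>y. y 0 * y 1)" by (intro smooth_on_mult smooth_on_coord ropen_Rn)
    show "smooth_on n (Rn n) (if j = 0 then F else G)" for j :: nat using assms by simp
  qed
  also have "\<dots> = ev A n F a \<otimes>\<^bsub>ring_of A\<^esub> ev A n G a"
    by (simp add: ring_of_def ev_def if_distrib if_distribR cong: if_cong)
  finally show ?thesis .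
qed

text \<open>A constant of arity \<open>n\<close> is the nullary constant composed with the empty
  tuple, and zero and one of \<open>ring_of\<close> are nullary.\<close>

lemma ev_const:
  assumes "a \<in> tup A n"
  shows "ev A n (\<lambda>x. c) a = sop A 0 (\<lambda>x\<in>Rn 0. c) (\<lambda>i\<in>{..<0}. undefined)"
proof -
  have "ev A n (\<lambda>x. (\<lambda>y. c) (\<lambda>j\<in>{..<0}. (\<lambda>x. 0) x)) a = ev A 0 (\<lambda>y. c) (\<lambda>j\<in>{..<0}. ev A n (\<lambda>x. 0) a)"
    by (rule ev_comp) (rule smooth_on_const ropen_Rn assms)+
  moreover have "(\<lambda>j\<in>{..<0::nat}. ev A n (\<lambda>x. 0) a) = (\<lambda>i\<in>{..<0}. undefined)" by auto
  ultimately show ?thesis unfolding ev_def by simp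
qed

lemma ev_zero: "a \<in> tup A n \<Longrightarrow> ev A n (\<lambda>x. 0) a = \<zero>\<^bsub>ring_of A\<^esub>"
  and ev_one: "a \<in> tup A n \<Longrightarrow> ev A n (\<lambda>x. 1) a = \<one>\<^bsub>ring_of A\<^esub>"
  by (simp_all add: ev_const ring_of_def)

lemma zero_closed: "\<zero>\<^bsub>ring_of A\<^esub> \<in> elems A" and one_closed: "\<one>\<^bsub>ring_of A\<^esub> \<in> elems A"
proof -
  have t: "(\<lambda>i. undefined) \<in> tup A 0" by simp
  have "ev A 0 (\<lambda>x. c) (\<lambda>i. undefined) \<in> elems A" for c
    by (rule ev_closed[OF smooth_on_const[OF ropen_Rn] t])
  then show "\<zero>\<^bsub>ring_of A\<^esub> \<in> elems A" "\<one>\<^bsub>ring_of A\<^esub> \<in> elems A"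
    using ev_zero[OF t] ev_one[OF t] by metis+
qed

lemma three_variables:
  assumes "a \<in> elems A" "b \<in> elems A" "c \<in> elems A"
  obtains t where "t \<in> tup A 3" "ev A 3 (\<lambda>x. x 0) t = a" "ev A 3 (\<lambda>x. x 1) t = b" "ev A 3 (\<lambda>x. x 2) t = c"
proof -
  define t where "t = (\<lambda>i\<in>{..<3::nat}. if i = 0 then a else if i = 1 then b else c)"
  have "t \<in> tup A 3" unfolding t_def using assms by (intro tupI) auto
  moreover have "t 0 = a" "t 1 = b" "t 2 = c" by (auto simp: t_def)
  ultimately show thesis using that[of t] by (simp add: ev_coord)
qed

text \<open>The ring axioms are identities between smooth functions of three variables. Any three
  elements are the values of the coordinates at one triple, so \<open>ev\<close> carries the
  identities over.\<close>

lemma cring_ring_of: "cring (ring_of A)"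
proof -
  note sm = smooth_on_add[OF ropen_Rn] smooth_on_mult[OF ropen_Rn] smooth_on_coord[OF ropen_Rn] smooth_on_const[OF ropen_Rn]
  have add: "a \<oplus>\<^bsub>ring_of A\<^esub> b \<in> elems A" "a \<oplus>\<^bsub>ring_of A\<^esub> b = b \<oplus>\<^bsub>ring_of A\<^esub> a" 
    "(a \<oplus>\<^bsub>ring_of A\<^esub> b) \<oplus>\<^bsub>ring_of A\<^esub> c = a \<oplus>\<^bsub>ring_of A\<^esub> (b \<oplus>\<^bsub>ring_of A\<^esub> c)"
    "\<zero>\<^bsub>ring_of A\<^esub> \<oplus>\<^bsub>ring_of A\<^esub> a = a" "\<exists>y\<in>elems A. y \<oplus>\<^bsub>ring_of A\<^esub> a = \<zero>\<^bsub>ring_of A\<^esub>"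
    "a \<otimes>\<^bsub>ring_of A\<^esub> b \<in> elems A" "a \<otimes>\<^bsub>ring_of A\<^esub> b = b \<otimes>\<^bsub>ring_of A\<^esub> a" 
    "(a \<otimes>\<^bsub>ring_of A\<^esub> b) \<otimes>\<^bsub>ring_of A\<^esub> c = a \<otimes>\<^bsub>ring_of A\<^esub> (b \<otimes>\<^bsub>ring_of A\<^esub> c)"
    "\<one>\<^bsub>ring_of A\<^esub> \<otimes>\<^bsub>ring_of A\<^esub> a = a"
    "(a \<oplus>\<^bsub>ring_of A\<^esub> b) \<otimes>\<^bsub>ring_of A\<^esub> c = a \<otimes>\<^bsub>ring_of A\<^esub> c \<oplus>\<^bsub>ring_of A\<^esub> b \<otimes>\<^bsub>ring_of A\<^esub> c"
    if "a \<in> elems A" "b \<in> elems A" "c \<in> elems A" for a b c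
  proof -
    obtain t where t: "t \<in> tup A 3" "ev A 3 (\<lambda>x. x 0) t = a" "ev A 3 (\<lambda>x. x 1) t = b" "ev A 3 (\<lambda>x. x 2) t = c"
      using three_variables[OF \<open>a \<in> elems A\<close> \<open>b \<in> elems A\<close> \<open>c \<in> elems A\<close>] by blast
    note evs = ev_add[OF _ _ t(1), symmetric] ev_mult[OF _ _ t(1), symmetric] ev_zero[OF t(1), symmetric] ev_one[OF t(1), symmetric]
    let ?P = "\<lambda>F. ev A 3 F t"
    let ?a = "?P (\<lambda>x. x 0)" and ?b = "?P (\<lambda>x. x 1)" and ?c = "?P (\<lambda>x. x 2)"
    have "?P (\<lambda>x. -1 * x 0) \<in> elems A" by (intro ev_closed t sm)
    moreover have "?P (\<lambda>x. -1 * x 0) \<oplus>\<^bsub>ring_of A\<^esub> ?a = ?P (\<lambda>x. -1 * x 0 + x 0)"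
      by (rule ev_add[symmetric]) (intro t sm)+
    moreover have "?P (\<lambda>x. -1 * x 0 + x 0) = \<zero>\<^bsub>ring_of A\<^esub>" using ev_zero[OF t(1)] by simp
    ultimately show "\<exists>y\<in>elems A. y \<oplus>\<^bsub>ring_of A\<^esub> a = \<zero>\<^bsub>ring_of A\<^esub>" using t(2) by metis
    have "?a \<oplus>\<^bsub>ring_of A\<^esub> ?b \<in> elems A" "?a \<otimes>\<^bsub>ring_of A\<^esub> ?b \<in> elems A"
      by (simp_all add: evs sm ev_closed t(1))
    then show "a \<oplus>\<^bsub>ring_of A\<^esub> b \<in> elems A" "a \<otimes>\<^bsub>ring_of A\<^esub> b \<in> elems A"
      unfolding t(2-4) .
    have "?a \<oplus>\<^bsub>ring_of A\<^esub> ?b = ?b \<oplus>\<^bsub>ring_of A\<^esub> ?a"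
      "(?a \<oplus>\<^bsub>ring_of A\<^esub> ?b) \<oplus>\<^bsub>ring_of A\<^esub> ?c = ?a \<oplus>\<^bsub>ring_of A\<^esub> (?b \<oplus>\<^bsub>ring_of A\<^esub> ?c)"
      "\<zero>\<^bsub>ring_of A\<^esub> \<oplus>\<^bsub>ring_of A\<^esub> ?a = ?a"
      "?a \<otimes>\<^bsub>ring_of A\<^esub> ?b = ?b \<otimes>\<^bsub>ring_of A\<^esub> ?a"
      "(?a \<otimes>\<^bsub>ring_of A\<^esub> ?b) \<otimes>\<^bsub>ring_of A\<^esub> ?c = ?a \<otimes>\<^bsub>ring_of A\<^esub> (?b \<otimes>\<^bsub>ring_of A\<^esub> ?c)"
      "\<one>\<^bsub>ring_of A\<^esub> \<otimes>\<^bsub>ring_of A\<^esub> ?a = ?a"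
      "(?a \<oplus>\<^bsub>ring_of A\<^esub> ?b) \<otimes>\<^bsub>ring_of A\<^esub> ?c = ?a \<otimes>\<^bsub>ring_of A\<^esub> ?c \<oplus>\<^bsub>ring_of A\<^esub> ?b \<otimes>\<^bsub>ring_of A\<^esub> ?c"
      by (simp_all add: evs sm algebra_simps)
    then show "a \<oplus>\<^bsub>ring_of A\<^esub> b = b \<oplus>\<^bsub>ring_of A\<^esub> a"
      "(a \<oplus>\<^bsub>ring_of A\<^esub> b) \<oplus>\<^bsub>ring_of A\<^esub> c = a \<oplus>\<^bsub>ring_of A\<^esub> (b \<oplus>\<^bsub>ring_of A\<^esub> c)"
      "\<zero>\<^bsub>ring_of A\<^esub> \<oplus>\<^bsub>ring_of A\<^esub> a = a"
      "a \<otimes>\<^bsub>ring_of A\<^esub> b = b \<otimes>\<^bsub>ring_of A\<^esub> a"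
      "(a \<otimes>\<^bsub>ring_of A\<^esub> b) \<otimes>\<^bsub>ring_of A\<^esub> c = a \<otimes>\<^bsub>ring_of A\<^esub> (b \<otimes>\<^bsub>ring_of A\<^esub> c)"
      "\<one>\<^bsub>ring_of A\<^esub> \<otimes>\<^bsub>ring_of A\<^esub> a = a"
      "(a \<oplus>\<^bsub>ring_of A\<^esub> b) \<otimes>\<^bsub>ring_of A\<^esub> c = a \<otimes>\<^bsub>ring_of A\<^esub> c \<oplus>\<^bsub>ring_of A\<^esub> b \<otimes>\<^bsub>ring_of A\<^esub> c"
      unfolding t(2-4) .
  qed
  show ?thesis
    by (intro cringI abelian_groupI comm_monoidI) (use add zero_closed one_closed in auto)
qed

lemma ring_ring_of: "ring (ring_of A)"
  using cring_ring_of by (simp add: cring_def)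

lemma ev_diff:
  assumes "smooth_on n (Rn n) F" "smooth_on n (Rn n) G" "a \<in> tup A n"
  shows "ev A n (\<lambda>x. F x - G x) a = ev A n F a \<ominus>\<^bsub>ring_of A\<^esub> ev A n G a"
proof -
  interpret R: cring "ring_of A" by (rule cring_ring_of)
  have FG: "smooth_on n (Rn n) (\<lambda>x. F x - G x)" by (intro smooth_on_diff ropen_Rn assms)
  have "ev A n F a = ev A n (\<lambda>x. (F x - G x) + G x) a" by simp
  also have "\<dots> = ev A n (\<lambda>x. F x - G x) a \<oplus>\<^bsub>ring_of A\<^esub> ev A n G a" by (rule ev_add[OF FG assms(2,3)])
  finally show ?thesis
    using ev_closed[OF FG assms(3)] ev_closed[OF assms(2,3)] unfolding carrier_ring_of[symmetric]
    by (simp add: R.minus_eq R.a_assoc R.r_neg del: carrier_ring_of)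
qed

lemma idealI:
  assumes "I \<subseteq> elems A" "\<zero>\<^bsub>ring_of A\<^esub> \<in> I"
    and "\<And>a b. a \<in> I \<Longrightarrow> b \<in> I \<Longrightarrow> a \<oplus>\<^bsub>ring_of A\<^esub> b \<in> I"
    and m: "\<And>a x. a \<in> I \<Longrightarrow> x \<in> elems A \<Longrightarrow> x \<otimes>\<^bsub>ring_of A\<^esub> a \<in> I"
  shows "ideal I (ring_of A)"
proof -
  interpret R: cring "ring_of A" by (rule cring_ring_of)
  have neg: "\<ominus>\<^bsub>ring_of A\<^esub> a \<in> I" if "a \<in> I" for a
  proof -
    have a: "a \<in> elems A" using that assms(1) by blast
    then have "(\<ominus>\<^bsub>ring_of A\<^esub> \<one>\<^bsub>ring_of A\<^esub>) \<otimes>\<^bsub>ring_of A\<^esub> a = \<ominus>\<^bsub>ring_of A\<^esub> a"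
      using R.l_minus[of "\<one>\<^bsub>ring_of A\<^esub>" a] R.one_closed by simp
    then show ?thesis using m[OF that, of "\<ominus>\<^bsub>ring_of A\<^esub> \<one>\<^bsub>ring_of A\<^esub>"] R.a_inv_closed[OF R.one_closed] by simp
  qed
  show ?thesis
  proof (rule Ideal.idealI[OF ring_ring_of])
    show "subgroup I (add_monoid (ring_of A))"
    proof (rule group.subgroupI[OF R.a_group])
      show "inv\<^bsub>add_monoid (ring_of A)\<^esub> a \<in> I" if "a \<in> I" for a
        using neg[OF that] by (simp add: a_inv_def)
    qed (use assms in auto)
    show "a \<otimes>\<^bsub>ring_of A\<^esub> x \<in> I" if "a \<in> I" "x \<in> carrier (ring_of A)" for a x
      using m[of a x] R.m_comm[of a x] that assms(1) by auto
  qed (use m in auto)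
qed

lemma coset_eq_iff:
  assumes "ideal I (ring_of A)" "a \<in> elems A" "b \<in> elems A"
  shows "I +>\<^bsub>ring_of A\<^esub> a = I +>\<^bsub>ring_of A\<^esub> b \<longleftrightarrow> a \<ominus>\<^bsub>ring_of A\<^esub> b \<in> I"
  using ring.quotient_eq_iff_same_a_r_cos[OF ring_ring_of assms(1)] assms(2,3) by simp

text \<open>Hadamard's identity is evaluated at the tuple extended by \<open>b\<close>: the two
  values differ by a multiple of \<open>b - a j\<close>, which lies in the ideal.\<close>

lemma sop_upd_cong:
  assumes I: "ideal I (ring_of A)" and f: "f \<in> smooth_funs n" and a: "a \<in> tup A n" and j: "j < n" and b: "b \<in> elems A"
    and ab: "b \<ominus>\<^bsub>ring_of A\<^esub> a j \<in> I"
  shows "sop A n f (a(j := b)) \<ominus>\<^bsub>ring_of A\<^esub> sop A n f a \<in> I"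
proof -
  interpret R: cring "ring_of A" by (rule cring_ring_of)
  note sm = smooth_on_diff[OF ropen_Rn] smooth_on_coord[OF ropen_Rn] smooth_on_mult[OF ropen_Rn]
  obtain h where h: "h \<in> smooth_funs (Suc n)"
    "\<And>x b. x \<in> Rn n \<Longrightarrow> f (x(j := b)) - f x = (b - x j) * h (x(n := b))"
    using Hadamard_one_variable[OF smooth_funsD[OF f] j] by blast
  define a' where "a' = a(n := b)"
  have a': "a' \<in> tup A (Suc n)" using a b by (auto simp: a'_def PiE_def extensional_def less_Suc_eq)
  \<comment> \<open>On the extended tuple, \<open>p\<close> recovers the old arguments and
    \<open>q\<close> those whose \<open>j\<close>-th entry is replaced by the last one.\<close>
  define p where "p x = (\<lambda>i\<in>{..<n}. (x :: nat \<Rightarrow> real) i)" for x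
  define q where "q x = (\<lambda>i\<in>{..<n}. if i = j then x n else (x :: nat \<Rightarrow> real) i)" for x
  have fp: "smooth_on (Suc n) (Rn (Suc n)) (\<lambda>x. f (p x))"
    unfolding p_def by (rule smooth_on_compose[OF ropen_Rn ropen_Rn _ _ smooth_funsD[OF f]]) (auto simp: sm)
  have fq: "smooth_on (Suc n) (Rn (Suc n)) (\<lambda>x. f (q x))"
    unfolding q_def
  proof (rule smooth_on_compose[OF ropen_Rn ropen_Rn _ _ smooth_funsD[OF f]])
    show "smooth_on (Suc n) (Rn (Suc n)) (\<lambda>x. (\<lambda>i\<in>{..<n}. if i = j then x n else x i) i)" if "i < n" for i
      using that sm by (cases "i = j") auto
  qed auto
  have 1: "ev A (Suc n) (\<lambda>x. f (p x)) a' = sop A n f a"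
  proof -
    have "ev A (Suc n) (\<lambda>x. f (p x)) a' = ev A n f (\<lambda>i\<in>{..<n}. ev A (Suc n) (\<lambda>x. x i) a')"
      unfolding p_def by (rule ev_comp[OF smooth_funsD[OF f] _ a']) (rule sm)
    also have "(\<lambda>i\<in>{..<n}. ev A (Suc n) (\<lambda>x. x i) a') = a"
    proof -
      have "ev A (Suc n) (\<lambda>x. x i) a' = a i" if "i < n" for i
        using ev_coord[OF _ a', of i] that by (simp add: a'_def)
      then have "(\<lambda>i\<in>{..<n}. ev A (Suc n) (\<lambda>x. x i) a') = (\<lambda>i\<in>{..<n}. a i)"
        by (intro restrict_ext) blast
      then show ?thesis using restrict_tup[OF a] by simp
    qed
    finally show ?thesis unfolding ev_smooth_funs[OF f] .
  qed
  have 2: "ev A (Suc n) (\<lambda>x. f (q x)) a' = sop A n f (a(j := b))"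
  proof -
    have "ev A (Suc n) (\<lambda>x. f (q x)) a' = ev A (Suc n) (\<lambda>x. f (\<lambda>i\<in>{..<n}. (\<lambda>x. x (if i = j then n else i)) x)) a'"
      by (rule ev_cong) (auto simp: q_def if_distrib cong: restrict_cong)
    also have "\<dots> = ev A n f (\<lambda>i\<in>{..<n}. ev A (Suc n) (\<lambda>x. x (if i = j then n else i)) a')"
      by (rule ev_comp[OF smooth_funsD[OF f] _ a']) (rule sm)
    also have "(\<lambda>i\<in>{..<n}. ev A (Suc n) (\<lambda>x. x (if i = j then n else i)) a') = a(j := b)"
    proof -
      have "ev A (Suc n) (\<lambda>x. x (if i = j then n else i)) a' = (a(j := b)) i" if "i < n" for i
        using ev_coord[OF _ a', of "if i = j then n else i"] that by (simp add: a'_def)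
      then have "(\<lambda>i\<in>{..<n}. ev A (Suc n) (\<lambda>x. x (if i = j then n else i)) a') = (\<lambda>i\<in>{..<n}. (a(j := b)) i)"
        by (intro restrict_ext) blast
      moreover have "a(j := b) \<in> tup A n" using a b j by (auto simp: PiE_def extensional_def)
      ultimately show ?thesis using restrict_tup by metis
    qed
    finally show ?thesis unfolding ev_smooth_funs[OF f] .
  qed
  have "sop A n f (a(j := b)) \<ominus>\<^bsub>ring_of A\<^esub> sop A n f a = ev A (Suc n) (\<lambda>x. f (q x) - f (p x)) a'"
    unfolding 1[symmetric] 2[symmetric] by (rule ev_diff[symmetric, OF fq fp a'])
  also have "\<dots> = ev A (Suc n) (\<lambda>x. (x n - x j) * h x) a'"
  proof (rule ev_cong)
    fix x assume x: "x \<in> Rn (Suc n)"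
    have "p x \<in> Rn n" "q x = (p x)(j := x n)" "(p x)(n := x n) = x"
      using x j by (auto simp: p_def q_def PiE_def extensional_def)
    then show "f (q x) - f (p x) = (x n - x j) * h x" using h(2)[of "p x" "x n"] j by (simp add: p_def)
  qed
  also have "\<dots> = ev A (Suc n) (\<lambda>x. x n - x j) a' \<otimes>\<^bsub>ring_of A\<^esub> ev A (Suc n) h a'"
    by (rule ev_mult[OF _ smooth_funsD[OF h(1)] a']) (intro sm)
  also have "ev A (Suc n) (\<lambda>x. x n - x j) a' = b \<ominus>\<^bsub>ring_of A\<^esub> a j"
  proof -
    have "ev A (Suc n) (\<lambda>x. x n) a' = b" "ev A (Suc n) (\<lambda>x. x j) a' = a j"
      using ev_coord[OF _ a', of n] ev_coord[OF _ a', of j] j by (simp_all add: a'_def)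
    then show ?thesis using ev_diff[OF sm(2) sm(2) a', of n j] by simp
  qed
  also have "\<dots> \<otimes>\<^bsub>ring_of A\<^esub> ev A (Suc n) h a' \<in> I"
    by (rule ideal.I_r_closed[OF I ab]) (simp add: ev_closed[OF smooth_funsD[OF h(1)] a'])
  finally show ?thesis .
qed

text \<open>The arguments are exchanged one at a time; \<open>z k\<close> already has the first
  \<open>k\<close> entries of \<open>b\<close>.\<close>

lemma sop_cong_ideal:
  assumes I: "ideal I (ring_of A)" and f: "f \<in> smooth_funs n" and a: "a \<in> tup A n" and b: "b \<in> tup A n"
    and ab: "\<And>i. i < n \<Longrightarrow> I +>\<^bsub>ring_of A\<^esub> b i = I +>\<^bsub>ring_of A\<^esub> a i"
  shows "I +>\<^bsub>ring_of A\<^esub> sop A n f b = I +>\<^bsub>ring_of A\<^esub> sop A n f a"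
proof -
  define z where "z k = (\<lambda>i. if i < k then b i else a i)" for k
  have z: "z k \<in> tup A n" if "k \<le> n" for k
    using a b that by (auto simp: z_def PiE_def extensional_def)
  have "I +>\<^bsub>ring_of A\<^esub> sop A n f (z k) = I +>\<^bsub>ring_of A\<^esub> sop A n f a" if "k \<le> n" for k
    using that
  proof (induction k)
    case (Suc k)
    have zS: "z (Suc k) = (z k)(k := b k)" by (auto simp: z_def less_Suc_eq)
    have k: "k < n" "z k k = a k" using Suc.prems by (auto simp: z_def)
    have el: "b k \<in> elems A" "a k \<in> elems A" using a b k by auto
    have "b k \<ominus>\<^bsub>ring_of A\<^esub> z k k \<in> I"
      using coset_eq_iff[OF I el] ab[OF k(1)] k(2) by simp
    from sop_upd_cong[OF I f z k(1) el(1) this] Suc.prems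
    have "sop A n f (z (Suc k)) \<ominus>\<^bsub>ring_of A\<^esub> sop A n f (z k) \<in> I" by (simp add: zS)
    then have "I +>\<^bsub>ring_of A\<^esub> sop A n f (z (Suc k)) = I +>\<^bsub>ring_of A\<^esub> sop A n f (z k)"
      using coset_eq_iff[OF I sop_closed[OF f z] sop_closed[OF f z]] Suc.prems by simp
    then show ?case using Suc by simp
  qed (simp add: z_def)
  moreover have "z n = b"
    using a b by (auto simp: z_def PiE_def extensional_def)
  ultimately show ?thesis by (metis order_refl)
qed

end


section \<open>Homomorphisms, quotients and generators\<close>

lemma cinf_homD:
  assumes "h \<in> cinf_hom A B"
  shows "h \<in> elems A \<rightarrow>\<^sub>E elems B" "a \<in> elems A \<Longrightarrow> h a \<in> elems B"
    and "f \<in> smooth_funs n \<Longrightarrow> t \<in> tup A n \<Longrightarrow> h (sop A n f t) = sop B n f (\<lambda>i\<in>{..<n}. h (t i))"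
  using assms by (auto simp: cinf_hom_def)

lemma cinf_homI:
  assumes "\<And>a. a \<in> elems A \<Longrightarrow> h a \<in> elems B" "h \<in> extensional (elems A)"
    and "\<And>n f t. f \<in> smooth_funs n \<Longrightarrow> t \<in> tup A n \<Longrightarrow> h (sop A n f t) = sop B n f (\<lambda>i\<in>{..<n}. h (t i))"
  shows "h \<in> cinf_hom A B"
  using assms by (auto simp: cinf_hom_def PiE_def)

lemma hom_tup:
  assumes "h \<in> cinf_hom A B" "a \<in> tup A n"
  shows "(\<lambda>i\<in>{..<n}. h (a i)) \<in> tup B n"
  by (rule tupI, rule cinf_homD(2)[OF assms(1)], rule tup_mem[OF assms(2)])

lemma cinf_hom_compose:
  assumes "cinf_ring A" "g \<in> cinf_hom A B" "h \<in> cinf_hom B C"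
  shows "compose (elems A) h g \<in> cinf_hom A C"
proof (rule cinf_homI)
  fix n f a assume f: "f \<in> smooth_funs n" and a: "a \<in> tup A n"
  have "compose (elems A) h g (sop A n f a) = h (g (sop A n f a))"
    using cinf_ring.sop_closed[OF assms(1) f a] by (simp add: compose_def)
  also have "\<dots> = sop C n f (\<lambda>i\<in>{..<n}. h ((\<lambda>i\<in>{..<n}. g (a i)) i))"
    using cinf_homD(3)[OF assms(2) f a] cinf_homD(3)[OF assms(3) f hom_tup[OF assms(2) a]] by simp
  also have "(\<lambda>i\<in>{..<n}. h ((\<lambda>i\<in>{..<n}. g (a i)) i)) = (\<lambda>i\<in>{..<n}. compose (elems A) h g (a i))"
    using a by (intro restrict_ext) (auto simp: compose_def)
  finally show "compose (elems A) h g (sop A n f a) = sop C n f (\<lambda>i\<in>{..<n}. compose (elems A) h g (a i))" .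
qed (use cinf_homD(2)[OF assms(2)] cinf_homD(2)[OF assms(3)] in \<open>auto simp: compose_def\<close>)

lemma cinf_hom_id:
  assumes "cinf_ring A"
  shows "(\<lambda>a\<in>elems A. a) \<in> cinf_hom A A"
proof (rule cinf_homI)
  fix n f a assume "f \<in> smooth_funs n" and a: "a \<in> tup A n"
  then have "sop A n f a \<in> elems A" by (rule cinf_ring.sop_closed[OF assms])
  moreover have "(\<lambda>i\<in>{..<n}. (\<lambda>a\<in>elems A. a) (a i)) = (\<lambda>i\<in>{..<n}. a i)"
    using a by (intro restrict_ext) auto
  ultimately show "(\<lambda>a\<in>elems A. a) (sop A n f a) = sop A n f (\<lambda>i\<in>{..<n}. (\<lambda>a\<in>elems A. a) (a i))"
    using restrict_tup[OF a] by simp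
qed auto

lemma hom_ev:
  assumes "h \<in> cinf_hom A B" "smooth_on n (Rn n) F" "a \<in> tup A n"
  shows "h (ev A n F a) = ev B n F (\<lambda>i\<in>{..<n}. h (a i))"
  unfolding ev_def by (rule cinf_homD(3)[OF assms(1) smooth_funsI[OF assms(2)] assms(3)])

lemma
  assumes h: "h \<in> cinf_hom A B" and A: "cinf_ring A" and B: "cinf_ring B"
  shows hom_zero: "h \<zero>\<^bsub>ring_of A\<^esub> = \<zero>\<^bsub>ring_of B\<^esub>"
    and hom_one: "h \<one>\<^bsub>ring_of A\<^esub> = \<one>\<^bsub>ring_of B\<^esub>"
    and hom_add: "a \<in> elems A \<Longrightarrow> b \<in> elems A \<Longrightarrow> h (a \<oplus>\<^bsub>ring_of A\<^esub> b) = h a \<oplus>\<^bsub>ring_of B\<^esub> h b"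
    and hom_mult: "a \<in> elems A \<Longrightarrow> b \<in> elems A \<Longrightarrow> h (a \<otimes>\<^bsub>ring_of A\<^esub> b) = h a \<otimes>\<^bsub>ring_of B\<^esub> h b"
    and hom_diff: "a \<in> elems A \<Longrightarrow> b \<in> elems A \<Longrightarrow> h (a \<ominus>\<^bsub>ring_of A\<^esub> b) = h a \<ominus>\<^bsub>ring_of B\<^esub> h b"
proof -
  interpret A: cinf_ring A by fact
  interpret B: cinf_ring B by fact
  note sm = smooth_on_add[OF ropen_Rn] smooth_on_mult[OF ropen_Rn] smooth_on_diff[OF ropen_Rn] smooth_on_coord[OF ropen_Rn] smooth_on_const[OF ropen_Rn]
  have u: "(\<lambda>i. undefined) \<in> tup A 0" by simp
  show "h \<zero>\<^bsub>ring_of A\<^esub> = \<zero>\<^bsub>ring_of B\<^esub>" "h \<one>\<^bsub>ring_of A\<^esub> = \<one>\<^bsub>ring_of B\<^esub>"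
    using hom_ev[OF h sm(5) u] A.ev_zero[OF u] A.ev_one[OF u] B.ev_zero[OF hom_tup[OF h u]] B.ev_one[OF hom_tup[OF h u]] by metis+
  fix a b assume ab: "a \<in> elems A" "b \<in> elems A"
  define t where "t = (\<lambda>i\<in>{..<2::nat}. if i = 0 then a else b)"
  have t: "t \<in> tup A 2" unfolding t_def using ab by (intro tupI) auto
  define s where "s = (\<lambda>i\<in>{..<2}. h (t i))"
  have s: "s \<in> tup B 2" unfolding s_def by (rule hom_tup[OF h t])
  have tt: "ev A 2 (\<lambda>x. x 0) t = a" "ev A 2 (\<lambda>x. x 1) t = b" "ev B 2 (\<lambda>x. x 0) s = h a" "ev B 2 (\<lambda>x. x 1) s = h b"
    using A.ev_coord[OF _ t] B.ev_coord[OF _ s] by (simp_all add: s_def t_def)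
  have "h (ev A 2 (\<lambda>x. x 0 + x 1) t) = ev B 2 (\<lambda>x. x 0 + x 1) s" "h (ev A 2 (\<lambda>x. x 0 * x 1) t) = ev B 2 (\<lambda>x. x 0 * x 1) s"
    "h (ev A 2 (\<lambda>x. x 0 - x 1) t) = ev B 2 (\<lambda>x. x 0 - x 1) s"
    unfolding s_def by (intro hom_ev h t sm)+
  then show "h (a \<oplus>\<^bsub>ring_of A\<^esub> b) = h a \<oplus>\<^bsub>ring_of B\<^esub> h b" "h (a \<otimes>\<^bsub>ring_of A\<^esub> b) = h a \<otimes>\<^bsub>ring_of B\<^esub> h b"
    "h (a \<ominus>\<^bsub>ring_of A\<^esub> b) = h a \<ominus>\<^bsub>ring_of B\<^esub> h b"
    using A.ev_add[OF sm(4) sm(4) t, of 0 1] A.ev_mult[OF sm(4) sm(4) t, of 0 1] A.ev_diff[OF sm(4) sm(4) t, of 0 1]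
      B.ev_add[OF sm(4) sm(4) s, of 0 1] B.ev_mult[OF sm(4) sm(4) s, of 0 1] B.ev_diff[OF sm(4) sm(4) s, of 0 1]
    by (simp_all add: tt del: One_nat_def)
qed

lemma elems_quot: "elems (quot A I) = (\<lambda>a. I +>\<^bsub>ring_of A\<^esub> a) ` elems A"
  by (auto simp: quot_def FactRing_def A_RCOSETS_def')

lemma quot_map_apply: "a \<in> elems A \<Longrightarrow> quot_map A I a = I +>\<^bsub>ring_of A\<^esub> a"
  by (simp add: quot_map_def)

lemma quot_map_image: "quot_map A I ` elems A = elems (quot A I)"
  by (auto simp: elems_quot quot_map_def)

lemma quot_elemE:
  assumes "c \<in> elems (quot A I)"
  obtains a where "a \<in> elems A" "c = quot_map A I a"
  using assms by (auto simp: elems_quot quot_map_def)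

locale cinf_ideal = cinf_ring A for A :: "'a cinf_ring" +
  fixes I assumes ideal: "ideal I (ring_of A)"
begin

lemma quot_map_eq_iff: "a \<in> elems A \<Longrightarrow> b \<in> elems A \<Longrightarrow> quot_map A I a = quot_map A I b \<longleftrightarrow> a \<ominus>\<^bsub>ring_of A\<^esub> b \<in> I"
  by (simp add: quot_map_apply coset_eq_iff[OF ideal])

lemma coset_rep:
  assumes "a \<in> elems A"
  shows "(SOME b. b \<in> I +>\<^bsub>ring_of A\<^esub> a) \<in> elems A"
    and "I +>\<^bsub>ring_of A\<^esub> (SOME b. b \<in> I +>\<^bsub>ring_of A\<^esub> a) = I +>\<^bsub>ring_of A\<^esub> a"
proof -
  interpret R: ring "ring_of A" by (rule ring_ring_of)
  interpret S: abelian_subgroup I "ring_of A"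
    using abelian_subgroupI3 ideal R.is_abelian_group by (simp add: abelian_subgroupI3 ideal.axioms(1))
  have "a \<in> I +>\<^bsub>ring_of A\<^esub> a" using S.a_rcos_self assms by simp
  then have m: "(SOME b. b \<in> I +>\<^bsub>ring_of A\<^esub> a) \<in> I +>\<^bsub>ring_of A\<^esub> a" by (rule someI)
  then show "(SOME b. b \<in> I +>\<^bsub>ring_of A\<^esub> a) \<in> elems A"
    using S.a_elemrcos_carrier assms by auto
  show "I +>\<^bsub>ring_of A\<^esub> (SOME b. b \<in> I +>\<^bsub>ring_of A\<^esub> a) = I +>\<^bsub>ring_of A\<^esub> a"
    using S.a_repr_independence'[OF m] assms by simp
qed

text \<open>The representatives picked by \<open>SOME\<close> in \<open>quot\<close> are congruent
  to the given \<open>a i\<close>, so \<open>sop_cong_ideal\<close> makes the choice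
  immaterial.\<close>

lemma sop_quot:
  assumes f: "f \<in> smooth_funs n" and a: "a \<in> tup A n"
  shows "sop (quot A I) n f (\<lambda>i\<in>{..<n}. quot_map A I (a i)) = quot_map A I (sop A n f a)"
proof -
  let ?b = "\<lambda>i\<in>{..<n}. SOME b. b \<in> (\<lambda>i\<in>{..<n}. quot_map A I (a i)) i"
  have b: "?b i = (SOME b. b \<in> I +>\<^bsub>ring_of A\<^esub> a i)" "a i \<in> elems A" if "i < n" for i
    using that tup_mem[OF a that] by (simp_all add: quot_map_apply)
  have "?b \<in> tup A n"
  proof (rule tupI)
    fix i assume "i < n"
    then show "(SOME b. b \<in> (\<lambda>i\<in>{..<n}. quot_map A I (a i)) i) \<in> elems A" using b coset_rep(1) by simp
  qed
  then have "I +>\<^bsub>ring_of A\<^esub> sop A n f ?b = I +>\<^bsub>ring_of A\<^esub> sop A n f a"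
    using b coset_rep(2) by (intro sop_cong_ideal[OF ideal f a]) auto
  then show ?thesis by (simp add: quot_def quot_map_apply sop_closed[OF f a])
qed

lemma quot_tupE:
  assumes "c \<in> tup (quot A I) n"
  obtains a where "a \<in> tup A n" "c = (\<lambda>i\<in>{..<n}. quot_map A I (a i))"
proof -
  have "\<forall>i. \<exists>a. i < n \<longrightarrow> a \<in> elems A \<and> c i = quot_map A I a"
  proof (intro allI)
    fix i
    show "\<exists>a. i < n \<longrightarrow> a \<in> elems A \<and> c i = quot_map A I a"
    proof (cases "i < n")
      case True
      obtain a where "a \<in> elems A" "c i = quot_map A I a" by (rule quot_elemE[OF tup_mem[OF assms True]])
      then show ?thesis by blast
    qed simp
  qed
  then obtain a where a: "\<And>i. i < n \<Longrightarrow> a i \<in> elems A" "\<And>i. i < n \<Longrightarrow> c i = quot_map A I (a i)" by metis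
  have "c = (\<lambda>i\<in>{..<n}. quot_map A I ((\<lambda>i\<in>{..<n}. a i) i))"
    using restrict_tup[OF assms, symmetric] a(2) by (metis (no_types, lifting) lessThan_iff restrict_apply' restrict_ext)
  moreover have "(\<lambda>i\<in>{..<n}. a i) \<in> tup A n" by (rule tupI[OF a(1)])
  ultimately show thesis by (rule that[rotated])
qed

lemma cinf_ring_quot: "cinf_ring (quot A I)"
proof
  fix n f c assume f: "f \<in> smooth_funs n" and c: "c \<in> tup (quot A I) n"
  obtain a where a: "a \<in> tup A n" "c = (\<lambda>i\<in>{..<n}. quot_map A I (a i))" using quot_tupE[OF c] .
  show "sop (quot A I) n f c \<in> elems (quot A I)"
    unfolding a(2) sop_quot[OF f a(1)] using imageI[OF sop_closed[OF f a(1)], of "quot_map A I"] by (simp add: quot_map_image)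
next
  fix n i c assume i: "i < n" and c: "c \<in> tup (quot A I) n"
  obtain a where a: "a \<in> tup A n" "c = (\<lambda>i\<in>{..<n}. quot_map A I (a i))" using quot_tupE[OF c] .
  show "sop (quot A I) n (\<lambda>x\<in>Rn n. x i) c = c i"
    unfolding a(2) sop_quot[OF smooth_funsI[OF smooth_on_coord[OF ropen_Rn]] a(1)] sop_proj[OF i a(1)] using i by simp
next
  fix m n f g c assume f: "f \<in> smooth_funs m" and g: "\<And>j. j < m \<Longrightarrow> g j \<in> smooth_funs n" and c: "c \<in> tup (quot A I) n"
  obtain a where a: "a \<in> tup A n" "c = (\<lambda>i\<in>{..<n}. quot_map A I (a i))" using quot_tupE[OF c] .
  have "smooth_on n (Rn n) (\<lambda>x. f (\<lambda>j\<in>{..<m}. g j x))"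
  proof (rule smooth_on_compose[OF ropen_Rn ropen_Rn _ _ smooth_funsD[OF f]])
    show "smooth_on n (Rn n) (\<lambda>x. (\<lambda>j\<in>{..<m}. g j x) j)" if "j < m" for j
      using smooth_funsD[OF g[OF that]] that by simp
  qed auto
  then have fg: "(\<lambda>x\<in>Rn n. f (\<lambda>j\<in>{..<m}. g j x)) \<in> smooth_funs n" by (rule smooth_funsI)
  have t: "(\<lambda>j\<in>{..<m}. sop A n (g j) a) \<in> tup A m" by (intro tupI sop_closed g a)
  have "(\<lambda>j\<in>{..<m}. sop (quot A I) n (g j) c) = (\<lambda>j\<in>{..<m}. quot_map A I ((\<lambda>j\<in>{..<m}. sop A n (g j) a) j))"
    unfolding a(2) by (intro restrict_ext) (simp add: sop_quot[OF g a(1)])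
  then show "sop (quot A I) n (\<lambda>x\<in>Rn n. f (\<lambda>j\<in>{..<m}. g j x)) c = sop (quot A I) m f (\<lambda>j\<in>{..<m}. sop (quot A I) n (g j) c)"
    unfolding a(2) sop_quot[OF fg a(1)] using sop_quot[OF f t] sop_comp[OF f g a(1)] by simp
qed

lemma quot_map_hom: "quot_map A I \<in> cinf_hom A (quot A I)"
proof (rule cinf_homI)
  show "quot_map A I a \<in> elems (quot A I)" if "a \<in> elems A" for a using imageI[OF that, of "quot_map A I"] by (simp add: quot_map_image)
  show "quot_map A I \<in> extensional (elems A)" by (simp add: quot_map_def)
qed (simp add: sop_quot)

lemma quot_map_zero_iff: "a \<in> elems A \<Longrightarrow> quot_map A I a = \<zero>\<^bsub>ring_of (quot A I)\<^esub> \<longleftrightarrow> a \<in> I"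
proof -
  interpret R: cring "ring_of A" by (rule cring_ring_of)
  assume a: "a \<in> elems A"
  have "quot_map A I \<zero>\<^bsub>ring_of A\<^esub> = \<zero>\<^bsub>ring_of (quot A I)\<^esub>"
    by (rule hom_zero[OF quot_map_hom cinf_ring_axioms cinf_ring_quot])
  then have "quot_map A I a = \<zero>\<^bsub>ring_of (quot A I)\<^esub> \<longleftrightarrow> a \<ominus>\<^bsub>ring_of A\<^esub> \<zero>\<^bsub>ring_of A\<^esub> \<in> I"
    using quot_map_eq_iff[OF a zero_closed] by simp
  also have "a \<ominus>\<^bsub>ring_of A\<^esub> \<zero>\<^bsub>ring_of A\<^esub> = a" using a R.minus_eq R.minus_zero R.r_zero by simp
  finally show ?thesis .
qed

end

text \<open>Two preimages under \<open>\<sigma>\<close> differ by an element of its kernel, which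
  \<open>\<tau>\<close> kills, so \<open>\<tau>\<close> may be applied to any chosen
  preimage.\<close>

lemma surj_factor:
  assumes A: "cinf_ring A" and B: "cinf_ring B" and C: "cinf_ring C"
    and s: "\<sigma> \<in> cinf_hom A B" and surj: "\<sigma> ` elems A = elems B" and t: "\<tau> \<in> cinf_hom A C"
    and ker: "\<And>a. a \<in> elems A \<Longrightarrow> \<sigma> a = \<zero>\<^bsub>ring_of B\<^esub> \<Longrightarrow> \<tau> a = \<zero>\<^bsub>ring_of C\<^esub>"
  obtains h where "h \<in> cinf_hom B C" "\<And>a. a \<in> elems A \<Longrightarrow> h (\<sigma> a) = \<tau> a"
proof -
  interpret A: cinf_ring A by fact
  interpret RA: cring "ring_of A" by (rule A.cring_ring_of)
  interpret RB: cring "ring_of B" by (rule cinf_ring.cring_ring_of[OF B])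
  interpret RC: cring "ring_of C" by (rule cinf_ring.cring_ring_of[OF C])
  define g where "g b = (SOME a. a \<in> elems A \<and> \<sigma> a = b)" for b
  have g: "g b \<in> elems A" "\<sigma> (g b) = b" if b: "b \<in> elems B" for b
  proof -
    have "b \<in> \<sigma> ` elems A" using b surj by simp
    then have "\<exists>a. a \<in> elems A \<and> \<sigma> a = b" by (elim imageE) (intro exI conjI, assumption, rule sym)
    from someI_ex[OF this] show "g b \<in> elems A" "\<sigma> (g b) = b" by (auto simp: g_def)
  qed
  define h where "h = (\<lambda>b\<in>elems B. \<tau> (g b))"
  have h: "h (\<sigma> a) = \<tau> a" if a: "a \<in> elems A" for a
  proof -
    have sa: "\<sigma> a \<in> elems B" by (rule cinf_homD(2)[OF s a])
    have "\<sigma> (g (\<sigma> a)) \<ominus>\<^bsub>ring_of B\<^esub> \<sigma> a = \<zero>\<^bsub>ring_of B\<^esub>"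
      unfolding g(2)[OF sa] using RB.r_right_minus_eq sa by simp
    then have "\<sigma> (g (\<sigma> a) \<ominus>\<^bsub>ring_of A\<^esub> a) = \<zero>\<^bsub>ring_of B\<^esub>"
      by (simp add: hom_diff[OF s A B g(1)[OF sa] a])
    then have "\<tau> (g (\<sigma> a) \<ominus>\<^bsub>ring_of A\<^esub> a) = \<zero>\<^bsub>ring_of C\<^esub>"
      using RA.minus_closed[of "g (\<sigma> a)" a] g(1)[OF sa] a by (intro ker) auto
    then have "\<tau> (g (\<sigma> a)) = \<tau> a"
      using hom_diff[OF t A C g(1)[OF sa] a] RC.r_right_minus_eq cinf_homD(2)[OF t g(1)[OF sa]] cinf_homD(2)[OF t a] by simp
    then show ?thesis using sa by (simp add: h_def)
  qed
  have "h \<in> cinf_hom B C"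
  proof (rule cinf_homI)
    show "h b \<in> elems C" if "b \<in> elems B" for b
      using that cinf_homD(2)[OF t g(1)[OF that]] by (simp add: h_def)
    show "h \<in> extensional (elems B)" by (simp add: h_def)
    fix n f b assume f: "f \<in> smooth_funs n" and b: "b \<in> tup B n"
    define a where "a = (\<lambda>i\<in>{..<n}. g (b i))"
    have a: "a \<in> tup A n" unfolding a_def by (rule tupI) (rule g(1)[OF tup_mem[OF b]])
    have b_eq: "(\<lambda>i\<in>{..<n}. \<sigma> (a i)) = b"
    proof -
      have "(\<lambda>i\<in>{..<n}. \<sigma> (a i)) = (\<lambda>i\<in>{..<n}. b i)"
        by (rule restrict_ext) (simp add: a_def g(2)[OF tup_mem[OF b]])
      then show ?thesis unfolding restrict_tup[OF b] .
    qed
    have "h (sop B n f b) = \<tau> (sop A n f a)"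
      using h[OF A.sop_closed[OF f a]] cinf_homD(3)[OF s f a] b_eq by simp
    also have "\<dots> = sop C n f (\<lambda>i\<in>{..<n}. \<tau> (a i))" by (rule cinf_homD(3)[OF t f a])
    also have "(\<lambda>i\<in>{..<n}. \<tau> (a i)) = (\<lambda>i\<in>{..<n}. h (b i))"
      using tup_mem[OF b] by (intro restrict_ext) (simp add: a_def h_def)
    finally show "h (sop B n f b) = sop C n f (\<lambda>i\<in>{..<n}. h (b i))" .
  qed
  then show thesis using that h by blast
qed

text \<open>\<open>\<iota>\<close> is inverted on its image, and injectivity reflects the
  homomorphism law of \<open>\<sigma>\<close> back to \<open>B\<close>.\<close>

lemma inj_lift:
  assumes A: "cinf_ring A" and B: "cinf_ring B"
    and i: "\<iota> \<in> cinf_hom B C" and inj: "inj_on \<iota> (elems B)" and s: "\<sigma> \<in> cinf_hom A C"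
    and im: "\<And>a. a \<in> elems A \<Longrightarrow> \<sigma> a \<in> \<iota> ` elems B"
  obtains h where "h \<in> cinf_hom A B" "\<And>a. a \<in> elems A \<Longrightarrow> \<iota> (h a) = \<sigma> a"
proof -
  define h where "h = (\<lambda>a\<in>elems A. inv_into (elems B) \<iota> (\<sigma> a))"
  have h: "h a \<in> elems B" "\<iota> (h a) = \<sigma> a" if "a \<in> elems A" for a
    using inv_into_into[OF im[OF that]] f_inv_into_f[OF im[OF that]] that by (simp_all add: h_def)
  have "h \<in> cinf_hom A B"
  proof (rule cinf_homI)
    show "h \<in> extensional (elems A)" by (simp add: h_def)
    fix n f t assume f: "f \<in> smooth_funs n" and t: "t \<in> tup A n"
    have ft: "sop A n f t \<in> elems A" by (rule cinf_ring.sop_closed[OF A f t])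
    have ht: "(\<lambda>i\<in>{..<n}. h (t i)) \<in> tup B n" by (rule tupI) (rule h(1)[OF tup_mem[OF t]])
    have "\<iota> (h (sop A n f t)) = sop C n f (\<lambda>i\<in>{..<n}. \<sigma> (t i))"
      using h(2)[OF ft] cinf_homD(3)[OF s f t] by simp
    also have "(\<lambda>i\<in>{..<n}. \<sigma> (t i)) = (\<lambda>i\<in>{..<n}. \<iota> ((\<lambda>i\<in>{..<n}. h (t i)) i))"
      using h(2)[OF tup_mem[OF t]] by (intro restrict_ext) simp
    also have "sop C n f \<dots> = \<iota> (sop B n f (\<lambda>i\<in>{..<n}. h (t i)))" by (rule cinf_homD(3)[OF i f ht, symmetric])
    finally show "h (sop A n f t) = sop B n f (\<lambda>i\<in>{..<n}. h (t i))"
      using inj_onD[OF inj] h(1)[OF ft] cinf_ring.sop_closed[OF B f ht] by blast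
  qed (use h in blast)
  then show thesis using that h by blast
qed

lemma iso_inverse:
  assumes A: "cinf_ring A" and B: "cinf_ring B" and h: "h \<in> cinf_iso A B"
  obtains g where "g \<in> cinf_iso B A" "\<And>a. a \<in> elems A \<Longrightarrow> g (h a) = a" "\<And>b. b \<in> elems B \<Longrightarrow> h (g b) = b"
proof -
  have hh: "h \<in> cinf_hom A B" "inj_on h (elems A)" "h ` elems A = elems B"
    using h by (auto simp: cinf_iso_def bij_betw_def)
  obtain g where g: "g \<in> cinf_hom B A" "\<And>b. b \<in> elems B \<Longrightarrow> h (g b) = (\<lambda>b\<in>elems B. b) b"
    using inj_lift[OF B A hh(1,2) cinf_hom_id[OF B]] hh(3) by auto
  have 1: "h (g b) = b" if "b \<in> elems B" for b using g(2)[OF that] that by simp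
  have 2: "g (h a) = a" if "a \<in> elems A" for a
    using 1[OF cinf_homD(2)[OF hh(1) that]] inj_onD[OF hh(2)] that cinf_homD(2)[OF g(1) cinf_homD(2)[OF hh(1) that]] by blast
  have "bij_betw g (elems B) (elems A)"
    by (rule bij_betw_byWitness[where f' = h]) (use 1 2 cinf_homD(2)[OF hh(1)] cinf_homD(2)[OF g(1)] in auto)
  then have "g \<in> cinf_iso B A" using g(1) by (simp add: cinf_iso_def)
  then show thesis using that 1 2 by blast
qed

section \<open>Free rings and generators\<close>

lemma smooth_on_tuple_compose:
  assumes "f \<in> smooth_funs m" "\<And>j. j < m \<Longrightarrow> smooth_on n (Rn n) (g j)"
  shows "smooth_on n (Rn n) (\<lambda>x. f (\<lambda>j\<in>{..<m}. g j x))"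
proof (rule smooth_on_compose[OF ropen_Rn ropen_Rn _ _ smooth_funsD[OF assms(1)]])
  show "smooth_on n (Rn n) (\<lambda>x. (\<lambda>j\<in>{..<m}. g j x) j)" if "j < m" for j
    using assms(2)[OF that] that by simp
qed auto

lemma elems_free [simp]: "elems (free_cinf_ring n) = smooth_funs n"
  by (simp add: free_cinf_ring_def)

lemma sop_free: "sop (free_cinf_ring n) m f g = (\<lambda>x\<in>Rn n. f (\<lambda>j\<in>{..<m}. g j x))"
  by (simp add: free_cinf_ring_def)

lemma cinf_ring_free: "cinf_ring (free_cinf_ring n)"
proof
  fix m f g assume f: "f \<in> smooth_funs m" and g: "g \<in> tup (free_cinf_ring n) m"
  show "sop (free_cinf_ring n) m f g \<in> elems (free_cinf_ring n)"
    unfolding sop_free elems_free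
    by (rule smooth_funsI[OF smooth_on_tuple_compose[OF f smooth_funsD]]) (use tup_mem[OF g] in simp)
next
  fix m i g assume i: "i < m" and g: "g \<in> tup (free_cinf_ring n) m"
  have "g i \<in> extensional (Rn n)" using smooth_funs_ext tup_mem[OF g i] by simp
  then show "sop (free_cinf_ring n) m (\<lambda>x\<in>Rn m. x i) g = g i"
    unfolding sop_free using i by (intro extensionalityI[where A = "Rn n"]) auto
next
  fix m k f g a assume f: "f \<in> smooth_funs m" and g: "\<And>j. j < m \<Longrightarrow> g j \<in> smooth_funs k" and a: "a \<in> tup (free_cinf_ring n) k"
  show "sop (free_cinf_ring n) k (\<lambda>x\<in>Rn k. f (\<lambda>j\<in>{..<m}. g j x)) a =
      sop (free_cinf_ring n) m f (\<lambda>j\<in>{..<m}. sop (free_cinf_ring n) k (g j) a)"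
    unfolding sop_free by (intro restrict_ext) (simp cong: restrict_cong)
qed

definition coords :: "nat \<Rightarrow> nat \<Rightarrow> (nat \<Rightarrow> real) \<Rightarrow> real" where
  "coords n = (\<lambda>i\<in>{..<n}. \<lambda>x\<in>Rn n. x i)"

lemma coords_tup: "coords n \<in> tup (free_cinf_ring n) n"
  unfolding coords_def by (rule tupI) (simp add: smooth_funsI[OF smooth_on_coord[OF ropen_Rn]])

lemma sop_free_coords: "f \<in> smooth_funs n \<Longrightarrow> sop (free_cinf_ring n) n f (coords n) = f"
  unfolding sop_free
proof (rule extensionalityI[where A = "Rn n"])
  fix x assume x: "x \<in> Rn n"
  have "(\<lambda>j\<in>{..<n}. coords n j x) = x" by (rule Rn_eqI[of _ n]) (use x in \<open>auto simp: coords_def\<close>)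
  then show "(\<lambda>x\<in>Rn n. f (\<lambda>j\<in>{..<n}. coords n j x)) x = f x" using x by simp
qed (auto dest: smooth_funs_ext)

text \<open>The universal property of the free ring; compatibility with the operations is exactly
  \<open>sop_comp\<close>.\<close>

lemma eval_hom:
  assumes A: "cinf_ring A" and a: "a \<in> tup A n"
  shows "(\<lambda>F\<in>smooth_funs n. sop A n F a) \<in> cinf_hom (free_cinf_ring n) A"
proof (rule cinf_homI)
  interpret A: cinf_ring A by fact
  show "(\<lambda>F\<in>smooth_funs n. sop A n F a) F \<in> elems A" if "F \<in> elems (free_cinf_ring n)" for F
    using A.sop_closed[of F n a] that a by simp
  show "(\<lambda>F\<in>smooth_funs n. sop A n F a) \<in> extensional (elems (free_cinf_ring n))" by simp
  fix m f t assume f: "f \<in> smooth_funs m" and t: "t \<in> tup (free_cinf_ring n) m"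
  have tj: "t j \<in> smooth_funs n" if "j < m" for j using tup_mem[OF t that] by simp
  have "sop A n (\<lambda>x\<in>Rn n. f (\<lambda>j\<in>{..<m}. t j x)) a = sop A m f (\<lambda>j\<in>{..<m}. sop A n (t j) a)"
    by (rule A.sop_comp[OF f tj a])
  moreover have "(\<lambda>x\<in>Rn n. f (\<lambda>j\<in>{..<m}. t j x)) \<in> smooth_funs n"
    by (rule smooth_funsI[OF smooth_on_tuple_compose[OF f smooth_funsD[OF tj]]])
  moreover have "(\<lambda>j\<in>{..<m}. sop A n (t j) a) = (\<lambda>i\<in>{..<m}. (\<lambda>F\<in>smooth_funs n. sop A n F a) (t i))"
    using tj by (intro restrict_ext) simp
  ultimately show "(\<lambda>F\<in>smooth_funs n. sop A n F a) (sop (free_cinf_ring n) m f t) =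
      sop A m f (\<lambda>i\<in>{..<m}. (\<lambda>F\<in>smooth_funs n. sop A n F a) (t i))"
    by (simp add: sop_free)
qed

lemma kernel_ideal:
  assumes A: "cinf_ring A" and B: "cinf_ring B" and h: "h \<in> cinf_hom A B"
  shows "ideal {a \<in> elems A. h a = \<zero>\<^bsub>ring_of B\<^esub>} (ring_of A)"
proof -
  interpret A: cinf_ring A by fact
  interpret B: cinf_ring B by fact
  interpret RA: cring "ring_of A" by (rule A.cring_ring_of)
  interpret RB: cring "ring_of B" by (rule B.cring_ring_of)
  show ?thesis
  proof (rule A.idealI)
    show "a \<oplus>\<^bsub>ring_of A\<^esub> b \<in> {a \<in> elems A. h a = \<zero>\<^bsub>ring_of B\<^esub>}"
      if "a \<in> {a \<in> elems A. h a = \<zero>\<^bsub>ring_of B\<^esub>}" "b \<in> {a \<in> elems A. h a = \<zero>\<^bsub>ring_of B\<^esub>}" for a b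
      using that hom_add[OF h A B, of a b] RA.a_closed[of a b] RB.r_zero[OF RB.zero_closed] by simp
    show "x \<otimes>\<^bsub>ring_of A\<^esub> a \<in> {a \<in> elems A. h a = \<zero>\<^bsub>ring_of B\<^esub>}"
      if "a \<in> {a \<in> elems A. h a = \<zero>\<^bsub>ring_of B\<^esub>}" "x \<in> elems A" for a x
      using that hom_mult[OF h A B, of x a] RA.m_closed[of x a] RB.r_null[of "h x"] cinf_homD(2)[OF h, of x] by simp
  qed (use A.zero_closed hom_zero[OF h A B] in auto)
qed

text \<open>Generation by smooth rather than polynomial expressions. Composites of operations are
  operations, so one application of \<open>sop\<close> reaches the whole generated subring.\<close>

definition gens :: "'a cinf_ring \<Rightarrow> nat \<Rightarrow> (nat \<Rightarrow> 'a) \<Rightarrow> bool" where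
  "gens A n a \<longleftrightarrow> a \<in> tup A n \<and> (\<forall>b\<in>elems A. \<exists>F\<in>smooth_funs n. b = sop A n F a)"

lemma gens_tup: "gens A n a \<Longrightarrow> a \<in> tup A n"
  by (simp add: gens_def)

lemma gensE:
  assumes "gens A n a" "b \<in> elems A"
  obtains F where "F \<in> smooth_funs n" "b = sop A n F a"
  using assms by (auto simp: gens_def)

lemma gens_hom_image:
  assumes g: "gens A n a" and h: "h \<in> cinf_hom A B" and surj: "h ` elems A = elems B"
  shows "gens B n (\<lambda>i\<in>{..<n}. h (a i))"
  unfolding gens_def
proof (intro conjI ballI)
  show "(\<lambda>i\<in>{..<n}. h (a i)) \<in> tup B n" by (rule hom_tup[OF h gens_tup[OF g]])
  fix b assume "b \<in> elems B"
  then have "b \<in> h ` elems A" by (simp add: surj)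
  then obtain c where c: "c \<in> elems A" "b = h c" by (rule imageE) simp
  obtain F where F: "F \<in> smooth_funs n" "c = sop A n F a" by (rule gensE[OF g c(1)])
  show "\<exists>F\<in>smooth_funs n. b = sop B n F (\<lambda>i\<in>{..<n}. h (a i))"
    by (rule bexI[OF _ F(1)]) (simp add: c(2) F(2) cinf_homD(3)[OF h F(1) gens_tup[OF g]])
qed

lemma gens_free: "gens (free_cinf_ring n) n (coords n)"
  unfolding gens_def using coords_tup sop_free_coords by force

lemma cinf_ideal_free: "ideal I (ring_of (free_cinf_ring n)) \<Longrightarrow> cinf_ideal (free_cinf_ring n) I"
  by (simp add: cinf_ideal_def cinf_ideal_axioms_def cinf_ring_free)

lemma fin_gen_cinf_ring: "fin_gen A \<Longrightarrow> cinf_ring A"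
  by (simp add: fin_gen_def)

lemma fin_gen_gens:
  assumes "fin_gen A"
  obtains n a where "gens A n a"
proof -
  obtain n I \<theta> where I: "ideal I (ring_of (free_cinf_ring n))" and t: "\<theta> \<in> cinf_iso (quot (free_cinf_ring n) I) A"
    using assms unfolding fin_gen_def by blast
  interpret Q: cinf_ideal "free_cinf_ring n" I by (rule cinf_ideal_free[OF I])
  have "gens (quot (free_cinf_ring n) I) n (\<lambda>i\<in>{..<n}. quot_map (free_cinf_ring n) I (coords n i))"
    by (rule gens_hom_image[OF gens_free Q.quot_map_hom quot_map_image])
  from gens_hom_image[OF this, of \<theta> A] t show thesis
    using that by (auto simp: cinf_iso_def bij_betw_def)
qed

lemma cinf_iso_id: "cinf_ring A \<Longrightarrow> (\<lambda>a\<in>elems A. a) \<in> cinf_iso A A"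
  by (simp add: cinf_iso_def cinf_hom_id) (simp add: bij_betw_def inj_on_def)

lemma fin_gen_quot_free: "ideal I (ring_of (free_cinf_ring n)) \<Longrightarrow> fin_gen (quot (free_cinf_ring n) I)"
  using cinf_iso_id[OF cinf_ideal.cinf_ring_quot[OF cinf_ideal_free]] cinf_ideal.cinf_ring_quot[OF cinf_ideal_free]
  unfolding fin_gen_def by blast

text \<open>By the homomorphism theorem the image of evaluation at \<open>b\<close> is a quotient of
  the free ring, hence finitely generated and realised on \<open>univ\<close>. Where
  \<open>B\<close> is a germ ring, \<open>G\<close> is the part of it that may serve as a test
  object in universal properties.\<close>

lemma generated_subring:
  assumes B: "cinf_ring B" and b: "b \<in> tup B n"
  obtains G :: "univ cinf_ring" and \<iota> where "fin_gen G" "\<iota> \<in> cinf_hom G B" "inj_on \<iota> (elems G)"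
    "\<iota> ` elems G = (\<lambda>F. sop B n F b) ` smooth_funs n"
proof -
  interpret B: cinf_ring B by fact
  interpret RB: cring "ring_of B" by (rule B.cring_ring_of)
  let ?A = "free_cinf_ring n"
  let ?e = "\<lambda>F\<in>smooth_funs n. sop B n F b"
  have e: "?e \<in> cinf_hom ?A B" by (rule eval_hom[OF B b])
  define I where "I = {F \<in> elems ?A. ?e F = \<zero>\<^bsub>ring_of B\<^esub>}"
  have I: "ideal I (ring_of ?A)" unfolding I_def by (rule kernel_ideal[OF cinf_ring_free B e])
  interpret Q: cinf_ideal ?A I by (rule cinf_ideal_free[OF I])
  obtain \<iota> where i: "\<iota> \<in> cinf_hom (quot ?A I) B" "\<And>F. F \<in> elems ?A \<Longrightarrow> \<iota> (quot_map ?A I F) = ?e F"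
  proof -
    have "?e F = \<zero>\<^bsub>ring_of B\<^esub>" if "F \<in> elems ?A" "quot_map ?A I F = \<zero>\<^bsub>ring_of (quot ?A I)\<^esub>" for F
      using that Q.quot_map_zero_iff[OF that(1)] by (simp add: I_def)
    from surj_factor[OF cinf_ring_free Q.cinf_ring_quot B Q.quot_map_hom quot_map_image e this] that
    show thesis by blast
  qed
  have "inj_on \<iota> (elems (quot ?A I))"
  proof (rule inj_onI)
    fix c d assume "c \<in> elems (quot ?A I)" "d \<in> elems (quot ?A I)" and eq: "\<iota> c = \<iota> d"
    then obtain F G where FG: "F \<in> elems ?A" "c = quot_map ?A I F" "G \<in> elems ?A" "d = quot_map ?A I G"
      by (metis quot_elemE)
    have "?e F = ?e G" using eq FG i(2) by simp
    then have "?e (F \<ominus>\<^bsub>ring_of ?A\<^esub> G) = \<zero>\<^bsub>ring_of B\<^esub>"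
      using hom_diff[OF e cinf_ring_free B FG(1,3)] RB.r_right_minus_eq cinf_homD(2)[OF e FG(1)] cinf_homD(2)[OF e FG(3)] by simp
    moreover have "F \<ominus>\<^bsub>ring_of ?A\<^esub> G \<in> elems ?A"
      using ring.ring_simprules(4)[OF Q.ring_ring_of, of F G] FG by simp
    ultimately show "c = d" using Q.quot_map_eq_iff[OF FG(1,3)] FG by (simp add: I_def)
  qed
  moreover have "\<iota> ` elems (quot ?A I) = (\<lambda>F. sop B n F b) ` smooth_funs n"
    unfolding quot_map_image[symmetric] image_image using i(2) by (intro image_cong) auto
  ultimately show thesis using that[of "quot ?A I" \<iota>] fin_gen_quot_free[OF I] i(1) by blast
qed

text \<open>A dummy last variable keeps old elements expressible after a further generator has been
  appended.\<close>

lemma sop_snoc: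
  assumes A: "cinf_ring A" and F: "F \<in> smooth_funs n" and a: "a \<in> tup A n" and b: "b \<in> elems A"
  obtains F' where "F' \<in> smooth_funs (Suc n)" "sop A (Suc n) F' (a(n := b)) = sop A n F a"
proof -
  interpret A: cinf_ring A by fact
  have a': "a(n := b) \<in> tup A (Suc n)" using a b by (auto simp: PiE_def extensional_def less_Suc_eq)
  have 1: "smooth_on (Suc n) (Rn (Suc n)) (\<lambda>x. F (\<lambda>i\<in>{..<n}. x i))"
    by (rule smooth_on_tuple_compose[OF F smooth_on_coord[OF ropen_Rn]])
  have "ev A (Suc n) (\<lambda>x. F (\<lambda>i\<in>{..<n}. x i)) (a(n := b)) = ev A n F (\<lambda>i\<in>{..<n}. ev A (Suc n) (\<lambda>x. x i) (a(n := b)))"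
    by (rule A.ev_comp[OF smooth_funsD[OF F] smooth_on_coord[OF ropen_Rn] a'])
  also have "(\<lambda>i\<in>{..<n}. ev A (Suc n) (\<lambda>x. x i) (a(n := b))) = a"
  proof -
    have "(\<lambda>i\<in>{..<n}. ev A (Suc n) (\<lambda>x. x i) (a(n := b))) = (\<lambda>i\<in>{..<n}. a i)"
      by (rule restrict_ext) (simp add: A.ev_coord[OF _ a'])
    then show ?thesis unfolding restrict_tup[OF a] .
  qed
  finally have "sop A (Suc n) (\<lambda>x\<in>Rn (Suc n). F (\<lambda>i\<in>{..<n}. x i)) (a(n := b)) = sop A n F a"
    unfolding ev_smooth_funs[OF F] unfolding ev_def .
  then show thesis by (rule that[OF smooth_funsI[OF 1]])
qed

section \<open>Units and universal inversion\<close>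

lemma Units_inverseE:
  assumes A: "cinf_ring A" "a \<in> Units (ring_of A)"
  obtains b where "b \<in> elems A" "b \<otimes>\<^bsub>ring_of A\<^esub> a = \<one>\<^bsub>ring_of A\<^esub>" "a \<in> elems A"
  using assms(2) by (auto simp: Units_def)

lemma hom_Units:
  assumes A: "cinf_ring A" and B: "cinf_ring B" and h: "h \<in> cinf_hom A B" and a: "a \<in> Units (ring_of A)"
  shows "h a \<in> Units (ring_of B)"
proof -
  interpret RB: cring "ring_of B" by (rule cinf_ring.cring_ring_of[OF B])
  obtain b where b: "b \<in> elems A" "b \<otimes>\<^bsub>ring_of A\<^esub> a = \<one>\<^bsub>ring_of A\<^esub>" "a \<in> elems A"
    by (rule Units_inverseE[OF A a])
  have "h b \<otimes>\<^bsub>ring_of B\<^esub> h a = \<one>\<^bsub>ring_of B\<^esub>"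
    using hom_mult[OF h A B b(1,3)] hom_one[OF h A B] b(2) by simp
  then show ?thesis
    using cinf_homD(2)[OF h] b RB.m_comm[of "h b" "h a"] by (auto simp: Units_def)
qed

lemma universal_inversionD:
  assumes "universal_inversion A f B \<phi>"
  shows "fin_gen B" "\<phi> \<in> cinf_hom A B" "\<phi> f \<in> Units (ring_of B)"
    and "fin_gen (C :: univ cinf_ring) \<Longrightarrow> \<psi> \<in> cinf_hom A C \<Longrightarrow> \<psi> f \<in> Units (ring_of C) \<Longrightarrow>
      \<exists>!h. h \<in> cinf_hom B C \<and> compose (elems A) h \<phi> = \<psi>"
  using assms unfolding universal_inversion_def by blast+

lemma compose_eqI:
  assumes "\<psi> \<in> cinf_hom A C" "\<And>a. a \<in> elems A \<Longrightarrow> h (\<phi> a) = \<psi> a"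
  shows "compose (elems A) h \<phi> = \<psi>"
  using cinf_homD(1)[OF assms(1)] assms(2)
  by (intro extensionalityI[where A = "elems A"]) (auto simp: compose_def PiE_def)

lemma composeD: "compose S h \<phi> = \<psi> \<Longrightarrow> a \<in> S \<Longrightarrow> h (\<phi> a) = \<psi> a"
  by (auto simp: compose_def)

lemma universal_inversion_extend:
  fixes C :: "univ cinf_ring"
  assumes "universal_inversion A f B \<phi>" "fin_gen C" "\<psi> \<in> cinf_hom A C" "\<psi> f \<in> Units (ring_of C)"
  obtains h where "h \<in> cinf_hom B C" "\<And>a. a \<in> elems A \<Longrightarrow> h (\<phi> a) = \<psi> a"
  using universal_inversionD(4)[OF assms(1-4)] composeD by metis

lemma universal_inversion_unique:
  fixes C :: "univ cinf_ring"
  assumes u: "universal_inversion A f B \<phi>" and A: "cinf_ring A" and f: "f \<in> elems A" and C: "fin_gen C"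
    and g: "g \<in> cinf_hom B C" and h: "h \<in> cinf_hom B C" and eq: "\<And>a. a \<in> elems A \<Longrightarrow> g (\<phi> a) = h (\<phi> a)"
  shows "g = h"
proof -
  note B = fin_gen_cinf_ring[OF universal_inversionD(1)[OF u]]
  have gc: "compose (elems A) g \<phi> \<in> cinf_hom A C" by (rule cinf_hom_compose[OF A universal_inversionD(2)[OF u] g])
  moreover have "compose (elems A) g \<phi> f \<in> Units (ring_of C)"
    using hom_Units[OF B fin_gen_cinf_ring[OF C] g universal_inversionD(3)[OF u]] f by (simp add: compose_def)
  ultimately have "\<exists>!k. k \<in> cinf_hom B C \<and> compose (elems A) k \<phi> = compose (elems A) g \<phi>"
    using universal_inversionD(4)[OF u C] by blast
  moreover have "compose (elems A) h \<phi> = compose (elems A) g \<phi>"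
    by (rule compose_eqI[OF gc]) (simp add: compose_def eq)
  ultimately show ?thesis using g h by blast
qed

text \<open>The subring generated by the image of \<open>A\<close> and the inverse of \<open>f\<close> has the universal property, so it is everything.\<close>

lemma universal_inversion_gens:
  fixes B :: "univ cinf_ring"
  assumes u: "universal_inversion A f B \<phi>" and A: "cinf_ring A" and f: "f \<in> elems A" and g: "gens A n a"
    and y: "y \<in> elems B" "y \<otimes>\<^bsub>ring_of B\<^esub> \<phi> f = \<one>\<^bsub>ring_of B\<^esub>"
  shows "gens B (Suc n) ((\<lambda>i\<in>{..<n}. \<phi> (a i))(n := y))"
proof -
  note uD = universal_inversionD[OF u]
  note B = fin_gen_cinf_ring[OF uD(1)]
  interpret B: cinf_ring B by (rule B)
  define b where "b = (\<lambda>i\<in>{..<n}. \<phi> (a i))"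
  have b: "b \<in> tup B n" unfolding b_def by (rule hom_tup[OF uD(2) gens_tup[OF g]])
  have b': "b(n := y) \<in> tup B (Suc n)" using b y by (auto simp: PiE_def extensional_def less_Suc_eq)
  obtain G :: "univ cinf_ring" and \<iota> where G: "fin_gen G" "\<iota> \<in> cinf_hom G B" "inj_on \<iota> (elems G)"
    "\<iota> ` elems G = (\<lambda>F. sop B (Suc n) F (b(n := y))) ` smooth_funs (Suc n)"
    by (rule generated_subring[OF B b'])
  note GR = fin_gen_cinf_ring[OF G(1)]
  interpret RG: cring "ring_of G" by (rule cinf_ring.cring_ring_of[OF GR])
  have im: "\<phi> c \<in> \<iota> ` elems G" if c: "c \<in> elems A" for c
  proof -
    obtain F where F: "F \<in> smooth_funs n" "c = sop A n F a" by (rule gensE[OF g c])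
    have "\<phi> c = sop B n F b" unfolding F(2) b_def by (rule cinf_homD(3)[OF uD(2) F(1) gens_tup[OF g]])
    moreover obtain F' where F': "F' \<in> smooth_funs (Suc n)" "sop B (Suc n) F' (b(n := y)) = sop B n F b"
      by (rule sop_snoc[OF B F(1) b y(1)])
    ultimately show ?thesis unfolding G(4) by (intro image_eqI[OF _ F'(1)]) simp
  qed
  obtain \<phi>' where p: "\<phi>' \<in> cinf_hom A G" "\<And>c. c \<in> elems A \<Longrightarrow> \<iota> (\<phi>' c) = \<phi> c"
    using inj_lift[OF A GR G(2,3) uD(2) im] by metis
  have "y \<in> \<iota> ` elems G"
    unfolding G(4)
  proof (rule image_eqI)
    show "y = sop B (Suc n) (\<lambda>x\<in>Rn (Suc n). x n) (b(n := y))" using B.sop_proj[OF _ b', of n] by simp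
  qed (rule smooth_funsI[OF smooth_on_coord[OF ropen_Rn]])
  then obtain z where z: "z \<in> elems G" "\<iota> z = y" by blast
  have fe: "\<phi>' f \<in> elems G" by (rule cinf_homD(2)[OF p(1) f])
  have zf: "z \<otimes>\<^bsub>ring_of G\<^esub> \<phi>' f \<in> elems G" using RG.m_closed z(1) fe by simp
  have "\<iota> (z \<otimes>\<^bsub>ring_of G\<^esub> \<phi>' f) = \<iota> \<one>\<^bsub>ring_of G\<^esub>"
    using hom_mult[OF G(2) GR B z(1) fe] hom_one[OF G(2) GR B] z(2) p(2)[OF f] y(2) by simp
  then have "z \<otimes>\<^bsub>ring_of G\<^esub> \<phi>' f = \<one>\<^bsub>ring_of G\<^esub>"
    using inj_onD[OF G(3)] zf cinf_ring.one_closed[OF GR] by blast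
  then have "\<phi>' f \<in> Units (ring_of G)"
    using z(1) fe RG.m_comm[of z "\<phi>' f"] by (auto simp: Units_def)
  then obtain h where h: "h \<in> cinf_hom B G" "\<And>c. c \<in> elems A \<Longrightarrow> h (\<phi> c) = \<phi>' c"
    using universal_inversion_extend[OF u G(1) p(1)] by metis
  \<comment> \<open>Both sides are endomorphisms of \<open>B\<close> that fix the image of
    \<open>A\<close>. Uniqueness identifies them, and \<open>\<iota>\<close> is therefore
    surjective.\<close>
  have ih: "compose (elems B) \<iota> h = (\<lambda>c\<in>elems B. c)"
  proof (rule universal_inversion_unique[OF u A f uD(1) cinf_hom_compose[OF B h(1) G(2)] cinf_hom_id[OF B]])
    show "compose (elems B) \<iota> h (\<phi> c) = (\<lambda>c\<in>elems B. c) (\<phi> c)" if "c \<in> elems A" for c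
      using cinf_homD(2)[OF uD(2) that] h(2)[OF that] p(2)[OF that] by (simp add: compose_def)
  qed
  have "c \<in> \<iota> ` elems G" if c: "c \<in> elems B" for c
  proof (rule image_eqI)
    show "c = \<iota> (h c)" using composeD[OF ih c] c by simp
  qed (rule cinf_homD(2)[OF h(1) c])
  then have im: "c \<in> (\<lambda>F. sop B (Suc n) F (b(n := y))) ` smooth_funs (Suc n)" if "c \<in> elems B" for c
    using that unfolding G(4) .
  show ?thesis unfolding gens_def b_def[symmetric]
  proof (intro conjI ballI b')
    fix c assume "c \<in> elems B"
    from im[OF this] show "\<exists>F\<in>smooth_funs (Suc n). c = sop B (Suc n) F (b(n := y))" by (rule imageE) (rule bexI)
  qed
qed

lemma tup_snoc:
  assumes "a \<in> tup A n" "b \<in> elems A"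
  shows "a(n := b) \<in> tup A (Suc n)"
  using assms by (auto simp: PiE_def extensional_def less_Suc_eq)

section \<open>Rings of germs\<close>

text \<open>No regularity is imposed, so an element may be given by evaluating at each point
  separately; continuity is recorded afterwards by \<open>tame\<close>.\<close>

definition fun_ring :: "('p \<Rightarrow> real) cinf_ring" where
  "fun_ring = \<lparr>elems = UNIV, sop = (\<lambda>n f g p. f (\<lambda>i\<in>{..<n}. g i p))\<rparr>"

lemma elems_fun_ring [simp]: "elems fun_ring = UNIV"
  and sop_fun_ring: "sop fun_ring n f g = (\<lambda>p. f (\<lambda>i\<in>{..<n}. g i p))"
  by (simp_all add: fun_ring_def)

lemma cinf_ring_fun_ring: "cinf_ring fun_ring"
proof
  fix n i :: nat and a :: "nat \<Rightarrow> 'a \<Rightarrow> real" assume "i < n"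
  then show "sop fun_ring n (\<lambda>x\<in>Rn n. x i) a = a i"
    by (auto simp: sop_fun_ring)
next
  fix m n :: nat and f g and a :: "nat \<Rightarrow> 'a \<Rightarrow> real"
  show "sop fun_ring n (\<lambda>x\<in>Rn n. f (\<lambda>j\<in>{..<m}. g j x)) a = sop fun_ring m f (\<lambda>j\<in>{..<m}. sop fun_ring n (g j) a)"
    by (auto simp: sop_fun_ring cong: restrict_cong)
qed auto

lemma fun_ring_ops:
  "a \<oplus>\<^bsub>ring_of fun_ring\<^esub> b = (\<lambda>p. a p + b p)" "a \<otimes>\<^bsub>ring_of fun_ring\<^esub> b = (\<lambda>p. a p * b p)"
  "\<zero>\<^bsub>ring_of fun_ring\<^esub> = (\<lambda>p. 0)" "\<one>\<^bsub>ring_of fun_ring\<^esub> = (\<lambda>p. 1)"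
proof -
  have "(\<lambda>i\<in>{..<0::nat}. g i) \<in> Rn 0" for g :: "nat \<Rightarrow> real" by (simp add: restrict_def)
  then show "\<zero>\<^bsub>ring_of fun_ring\<^esub> = (\<lambda>p. 0)" "\<one>\<^bsub>ring_of fun_ring\<^esub> = (\<lambda>p. 1)"
    unfolding ring_of_def by (simp_all only: sop_fun_ring ring.simps monoid.simps restrict_apply' simp_thms if_True)
qed (auto simp: ring_of_def sop_fun_ring)

lemma fun_ring_diff: "a \<ominus>\<^bsub>ring_of fun_ring\<^esub> b = (\<lambda>p. a p - b p)"
proof -
  interpret R: cring "ring_of fun_ring" by (rule cinf_ring.cring_ring_of[OF cinf_ring_fun_ring])
  have c: "a \<in> carrier (ring_of fun_ring)" "b \<in> carrier (ring_of fun_ring)" by simp_all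
  have "(a \<ominus>\<^bsub>ring_of fun_ring\<^esub> b) \<oplus>\<^bsub>ring_of fun_ring\<^esub> b = a"
    unfolding R.minus_eq R.a_assoc[OF c(1) R.a_inv_closed[OF c(2)] c(2)] R.l_neg[OF c(2)] by (rule R.r_zero[OF c(1)])
  then have "(a \<ominus>\<^bsub>ring_of fun_ring\<^esub> b) p + b p = a p" for p by (metis fun_ring_ops(1))
  then show ?thesis by (auto simp: algebra_simps)
qed

definition vanishing :: "'p filter \<Rightarrow> ('p \<Rightarrow> real) set" where
  "vanishing F = {g. eventually (\<lambda>p. g p = 0) F}"

lemma vanishing_ideal: "ideal (vanishing F) (ring_of fun_ring)"
proof (rule cinf_ring.idealI[OF cinf_ring_fun_ring])
  show "a \<oplus>\<^bsub>ring_of fun_ring\<^esub> b \<in> vanishing F" if "a \<in> vanishing F" "b \<in> vanishing F" for a b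
    using that by (auto simp: vanishing_def fun_ring_ops elim: eventually_elim2)
  show "x \<otimes>\<^bsub>ring_of fun_ring\<^esub> a \<in> vanishing F" if "a \<in> vanishing F" for a x
    using that by (auto simp: vanishing_def fun_ring_ops elim: eventually_mono)
qed (auto simp: vanishing_def fun_ring_ops)

interpretation vanishing: cinf_ideal fun_ring "vanishing F"
  by (simp add: cinf_ideal_def cinf_ideal_axioms_def cinf_ring_fun_ring vanishing_ideal)

text \<open>Neighbourhood filters give the usual germs, principal filters the functions on a set;
  the filters of interest here lie in between and need not have a limit point.\<close>

definition germ_ring :: "'p filter \<Rightarrow> ('p \<Rightarrow> real) set cinf_ring" where
  "germ_ring F = quot fun_ring (vanishing F)"

definition germ :: "'p filter \<Rightarrow> ('p \<Rightarrow> real) \<Rightarrow> ('p \<Rightarrow> real) set" where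
  "germ F = quot_map fun_ring (vanishing F)"

lemma cinf_ring_germ_ring: "cinf_ring (germ_ring F)"
  unfolding germ_ring_def by (rule vanishing.cinf_ring_quot)

lemma germ_hom: "germ F \<in> cinf_hom fun_ring (germ_ring F)"
  unfolding germ_ring_def germ_def by (rule vanishing.quot_map_hom)

lemma germ_in: "germ F g \<in> elems (germ_ring F)"
  by (rule cinf_homD(2)[OF germ_hom]) simp

lemma germ_surj: "germ F ` elems fun_ring = elems (germ_ring F)"
  unfolding germ_ring_def germ_def by (rule quot_map_image)

lemma germE:
  assumes "c \<in> elems (germ_ring F)"
  obtains g where "c = germ F g"
  using assms by (auto simp: germ_surj[symmetric])

lemma germ_eq_iff: "germ F g = germ F h \<longleftrightarrow> eventually (\<lambda>p. g p = h p) F"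
  unfolding germ_def using vanishing.quot_map_eq_iff[of g h F] by (simp add: vanishing_def fun_ring_diff)

lemma sop_germ:
  assumes "f \<in> smooth_funs n"
  shows "sop (germ_ring F) n f (\<lambda>i\<in>{..<n}. germ F (g i)) = germ F (\<lambda>p. f (\<lambda>i\<in>{..<n}. g i p))"
proof -
  have "(\<lambda>i\<in>{..<n}. g i) \<in> tup fun_ring n" by (rule tupI) simp
  from cinf_homD(3)[OF germ_hom assms this]
  show ?thesis by (simp add: sop_fun_ring cong: restrict_cong)
qed

lemma germ_ring_ops:
  "\<zero>\<^bsub>ring_of (germ_ring F)\<^esub> = germ F (\<lambda>p. 0)" "\<one>\<^bsub>ring_of (germ_ring F)\<^esub> = germ F (\<lambda>p. 1)"
  "germ F g \<otimes>\<^bsub>ring_of (germ_ring F)\<^esub> germ F h = germ F (\<lambda>p. g p * h p)"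
proof -
  note h = germ_hom[of F] cinf_ring_fun_ring cinf_ring_germ_ring
  show "\<zero>\<^bsub>ring_of (germ_ring F)\<^esub> = germ F (\<lambda>p. 0)" "\<one>\<^bsub>ring_of (germ_ring F)\<^esub> = germ F (\<lambda>p. 1)"
    by (rule hom_zero[OF h, unfolded fun_ring_ops, symmetric] hom_one[OF h, unfolded fun_ring_ops, symmetric])+
  have "germ F (g \<otimes>\<^bsub>ring_of fun_ring\<^esub> h) = germ F g \<otimes>\<^bsub>ring_of (germ_ring F)\<^esub> germ F h"
    by (rule hom_mult[OF h]) simp_all
  then show "germ F g \<otimes>\<^bsub>ring_of (germ_ring F)\<^esub> germ F h = germ F (\<lambda>p. g p * h p)"
    by (simp only: fun_ring_ops)
qed

lemma germ_Units_iff: "germ F g \<in> Units (ring_of (germ_ring F)) \<longleftrightarrow> eventually (\<lambda>p. g p \<noteq> 0) F"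
proof
  assume "germ F g \<in> Units (ring_of (germ_ring F))"
  then obtain c where c: "c \<in> elems (germ_ring F)" "c \<otimes>\<^bsub>ring_of (germ_ring F)\<^esub> germ F g = \<one>\<^bsub>ring_of (germ_ring F)\<^esub>"
    by (rule Units_inverseE[OF cinf_ring_germ_ring])
  from c(1) obtain h where h: "c = germ F h" by (rule germE)
  have "eventually (\<lambda>p. h p * g p = 1) F" using c(2) by (simp add: h germ_ring_ops germ_eq_iff)
  then show "eventually (\<lambda>p. g p \<noteq> 0) F" by (rule eventually_mono) auto
next
  assume "eventually (\<lambda>p. g p \<noteq> 0) F"
  then have "eventually (\<lambda>p. g p * inverse (g p) = 1) F" "eventually (\<lambda>p. inverse (g p) * g p = 1) F"
    by (auto elim: eventually_mono)
  then have "germ F (\<lambda>p. inverse (g p)) \<otimes>\<^bsub>ring_of (germ_ring F)\<^esub> germ F g = \<one>\<^bsub>ring_of (germ_ring F)\<^esub>"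
    "germ F g \<otimes>\<^bsub>ring_of (germ_ring F)\<^esub> germ F (\<lambda>p. inverse (g p)) = \<one>\<^bsub>ring_of (germ_ring F)\<^esub>"
    by (simp_all add: germ_ring_ops germ_eq_iff)
  then show "germ F g \<in> Units (ring_of (germ_ring F))" unfolding Units_def using germ_in by auto
qed

lemma hom_germ_sop:
  assumes h: "\<Psi> \<in> cinf_hom A (germ_ring F)" and f: "f \<in> smooth_funs n" and a: "a \<in> tup A n"
    and g: "\<And>i. i < n \<Longrightarrow> \<Psi> (a i) = germ F (g i)"
  shows "\<Psi> (sop A n f a) = germ F (\<lambda>p. f (\<lambda>i\<in>{..<n}. g i p))"
proof -
  have "(\<lambda>i\<in>{..<n}. \<Psi> (a i)) = (\<lambda>i\<in>{..<n}. germ F (g i))" by (rule restrict_ext) (simp add: g)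
  then show ?thesis using cinf_homD(3)[OF h f a] sop_germ[OF f] by simp
qed

lemma germ_restrict:
  assumes "F' \<le> F"
  obtains h where "h \<in> cinf_hom (germ_ring F) (germ_ring F')" "\<And>g. h (germ F g) = germ F' g"
proof -
  have "germ F' g = \<zero>\<^bsub>ring_of (germ_ring F')\<^esub>" if "germ F g = \<zero>\<^bsub>ring_of (germ_ring F)\<^esub>" for g
    using that assms by (auto simp: germ_ring_ops germ_eq_iff intro: filter_leD)
  with surj_factor[OF cinf_ring_fun_ring cinf_ring_germ_ring cinf_ring_germ_ring germ_hom germ_surj germ_hom, of F F']
  show thesis using that by auto
qed

section \<open>The radical\<close>

lemma zero_ideal: "cinf_ring A \<Longrightarrow> cinf_ideal A {\<zero>\<^bsub>ring_of A\<^esub>}"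
  using ring.zeroideal[OF cinf_ring.ring_ring_of] by (auto simp: cinf_ideal_def cinf_ideal_axioms_def)

lemma zero_ring_one_eq_zero:
  assumes "cinf_ring A"
  shows "is_zero_ring A \<longleftrightarrow> \<one>\<^bsub>ring_of A\<^esub> = \<zero>\<^bsub>ring_of A\<^esub>"
proof
  interpret A: cinf_ring A by fact
  interpret R: cring "ring_of A" by (rule A.cring_ring_of)
  show "\<one>\<^bsub>ring_of A\<^esub> = \<zero>\<^bsub>ring_of A\<^esub>" if "is_zero_ring A" using that A.one_closed by (auto simp: is_zero_ring_def)
  assume 1: "\<one>\<^bsub>ring_of A\<^esub> = \<zero>\<^bsub>ring_of A\<^esub>"
  have "a = \<zero>\<^bsub>ring_of A\<^esub>" if "a \<in> elems A" for a
    using R.l_one[of a] R.l_null[of a] that 1 by simp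
  then show "is_zero_ring A" unfolding is_zero_ring_def using A.zero_closed by blast
qed

lemma hom_from_zero_ring:
  assumes "cinf_ring A" "cinf_ring B" "h \<in> cinf_hom A B" "is_zero_ring A"
  shows "is_zero_ring B"
  using assms hom_one[OF assms(3,1,2)] hom_zero[OF assms(3,1,2)] by (simp add: zero_ring_one_eq_zero)

lemma germ_ring_zero_iff: "is_zero_ring (germ_ring F) \<longleftrightarrow> F = bot"
  by (simp add: zero_ring_one_eq_zero[OF cinf_ring_germ_ring] germ_ring_ops germ_eq_iff trivial_limit_def)

text \<open>If the germ \<open>g\<close> of \<open>a\<close> did not vanish, it would be invertible
  along the non-trivial filter obtained by adding the set where \<open>g\<close> is non-zero. The
  map into these germs would then factor through the zero ring that inverts \<open>a\<close>, which
  makes the germ ring zero and the filter trivial.\<close>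

lemma germ_kills_radical:
  assumes A: "fin_gen A" and h: "\<Psi> \<in> cinf_hom A (germ_ring F)" and a: "a \<in> inf_radical A {\<zero>\<^bsub>ring_of A\<^esub>}"
  shows "\<Psi> a = \<zero>\<^bsub>ring_of (germ_ring F)\<^esub>"
proof (rule ccontr)
  assume neq: "\<Psi> a \<noteq> \<zero>\<^bsub>ring_of (germ_ring F)\<^esub>"
  note AR = fin_gen_cinf_ring[OF A]
  interpret Z: cinf_ideal A "{\<zero>\<^bsub>ring_of A\<^esub>}" by (rule zero_ideal[OF AR])
  let ?Q = "quot A {\<zero>\<^bsub>ring_of A\<^esub>}" and ?q = "quot_map A {\<zero>\<^bsub>ring_of A\<^esub>}"
  obtain B :: "univ cinf_ring" and \<phi> where aA: "a \<in> elems A" and u: "universal_inversion ?Q (?q a) B \<phi>" and B0: "is_zero_ring B"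
    using a unfolding inf_radical_def by blast
  obtain g where g: "\<Psi> a = germ F g" by (rule germE[OF cinf_homD(2)[OF h aA]])
  define F' where "F' = inf F (principal {p. g p \<noteq> 0})"
  have "F' \<noteq> bot"
    using neq by (auto simp: g germ_ring_ops germ_eq_iff F'_def trivial_limit_def eventually_inf_principal elim: eventually_mono)
  obtain r where r: "r \<in> cinf_hom (germ_ring F) (germ_ring F')" "\<And>g. r (germ F g) = germ F' g"
    using germ_restrict[of F' F] by (auto simp: F'_def)
  define \<Psi>' where "\<Psi>' = compose (elems A) r \<Psi>"
  have h': "\<Psi>' \<in> cinf_hom A (germ_ring F')" unfolding \<Psi>'_def by (rule cinf_hom_compose[OF AR h r(1)])
  have ga: "\<Psi>' a = germ F' g" using aA by (simp add: \<Psi>'_def compose_def g r(2))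
  obtain n c where c: "gens A n c" by (rule fin_gen_gens[OF A])
  \<comment> \<open>The test object must be finitely generated and contain an inverse of the image
    of \<open>a\<close>, so the germ of \<open>1/g\<close> is adjoined as last generator.\<close>
  define b where "b = (\<lambda>i\<in>{..<n}. \<Psi>' (c i))(n := germ F' (\<lambda>p. inverse (g p)))"
  have b0: "(\<lambda>i\<in>{..<n}. \<Psi>' (c i)) \<in> tup (germ_ring F') n" by (rule hom_tup[OF h' gens_tup[OF c]])
  have b: "b \<in> tup (germ_ring F') (Suc n)" unfolding b_def by (rule tup_snoc[OF b0 germ_in])
  obtain G :: "univ cinf_ring" and \<iota> where G: "fin_gen G" "\<iota> \<in> cinf_hom G (germ_ring F')" "inj_on \<iota> (elems G)"
    "\<iota> ` elems G = (\<lambda>H. sop (germ_ring F') (Suc n) H b) ` smooth_funs (Suc n)"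
    by (rule generated_subring[OF cinf_ring_germ_ring b])
  note GR = fin_gen_cinf_ring[OF G(1)]
  interpret RG: cring "ring_of G" by (rule cinf_ring.cring_ring_of[OF GR])
  interpret L: cinf_ring "germ_ring F'" by (rule cinf_ring_germ_ring)
  have "\<Psi>' x \<in> \<iota> ` elems G" if x: "x \<in> elems A" for x
  proof -
    obtain H where H: "H \<in> smooth_funs n" "x = sop A n H c" by (rule gensE[OF c x])
    have "\<Psi>' x = sop (germ_ring F') n H (\<lambda>i\<in>{..<n}. \<Psi>' (c i))"
      unfolding H(2) by (rule cinf_homD(3)[OF h' H(1) gens_tup[OF c]])
    moreover obtain H' where "H' \<in> smooth_funs (Suc n)"
      "sop (germ_ring F') (Suc n) H' b = sop (germ_ring F') n H (\<lambda>i\<in>{..<n}. \<Psi>' (c i))"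
      unfolding b_def by (rule sop_snoc[OF cinf_ring_germ_ring H(1) b0 germ_in])
    ultimately show ?thesis unfolding G(4) by (metis imageI)
  qed
  then obtain \<psi> where p: "\<psi> \<in> cinf_hom A G" "\<And>x. x \<in> elems A \<Longrightarrow> \<iota> (\<psi> x) = \<Psi>' x"
    using inj_lift[OF AR GR G(2,3) h'] by metis
  have "\<psi> \<zero>\<^bsub>ring_of A\<^esub> = \<zero>\<^bsub>ring_of G\<^esub>" by (rule hom_zero[OF p(1) AR GR])
  then obtain \<psi>' where p': "\<psi>' \<in> cinf_hom ?Q G" "\<And>x. x \<in> elems A \<Longrightarrow> \<psi>' (?q x) = \<psi> x"
    using surj_factor[OF AR Z.cinf_ring_quot GR Z.quot_map_hom quot_map_image p(1)] Z.quot_map_zero_iff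
    by (metis singletonD)
  have "germ F' (\<lambda>p. inverse (g p)) \<in> \<iota> ` elems G"
    unfolding G(4)
  proof (rule image_eqI)
    show "germ F' (\<lambda>p. inverse (g p)) = sop (germ_ring F') (Suc n) (\<lambda>x\<in>Rn (Suc n). x n) b"
      using L.sop_proj[OF _ b, of n] by (simp add: b_def)
  qed (rule smooth_funsI[OF smooth_on_coord[OF ropen_Rn]])
  then obtain z where z: "z \<in> elems G" "\<iota> z = germ F' (\<lambda>p. inverse (g p))" by (metis imageE)
  have pa: "\<psi> a \<in> elems G" by (rule cinf_homD(2)[OF p(1) aA])
  have "eventually (\<lambda>p. inverse (g p) * g p = 1) F'"
    unfolding F'_def eventually_inf_principal by (rule always_eventually) auto
  then have "\<iota> (z \<otimes>\<^bsub>ring_of G\<^esub> \<psi> a) = \<iota> \<one>\<^bsub>ring_of G\<^esub>"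
    using hom_mult[OF G(2) GR cinf_ring_germ_ring z(1) pa] hom_one[OF G(2) GR cinf_ring_germ_ring]
    by (simp add: z(2) p(2)[OF aA] ga germ_ring_ops germ_eq_iff)
  then have "z \<otimes>\<^bsub>ring_of G\<^esub> \<psi> a = \<one>\<^bsub>ring_of G\<^esub>"
    using inj_onD[OF G(3)] RG.m_closed[of z "\<psi> a"] z(1) pa cinf_ring.one_closed[OF GR] by simp
  then have "\<psi>' (?q a) \<in> Units (ring_of G)"
    using z(1) pa RG.m_comm[of z "\<psi> a"] by (auto simp: Units_def p'(2)[OF aA])
  then obtain k where "k \<in> cinf_hom B G" using universal_inversion_extend[OF u G(1) p'(1)] by metis
  then have "is_zero_ring G" by (rule hom_from_zero_ring[OF fin_gen_cinf_ring[OF universal_inversionD(1)[OF u]] GR _ B0])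
  then have "is_zero_ring (germ_ring F')" by (rule hom_from_zero_ring[OF GR cinf_ring_germ_ring G(2)])
  then show False using \<open>F' \<noteq> bot\<close> by (simp add: germ_ring_zero_iff)
qed

lemma eventually_INF_directed:
  assumes "I \<noteq> {}" "\<And>i j. i \<in> I \<Longrightarrow> j \<in> I \<Longrightarrow> \<exists>k\<in>I. S k \<subseteq> S i \<inter> S j"
  shows "eventually P (INF i\<in>I. principal (S i)) \<longleftrightarrow> (\<exists>i\<in>I. \<forall>x\<in>S i. P x)"
  using eventually_INF_base[of I "\<lambda>i. principal (S i)" P] assms by (simp add: eventually_principal)

text \<open>The filter is generated by the zero sets of the relations between the generators. None
  of them is empty, as a relation without zeros would be a unit equal to zero. Their intersection
  may be empty, so in general there is a filter but no point.\<close>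

lemma exists_germ_point:
  assumes C: "fin_gen C" and nz: "\<not> is_zero_ring C"
  obtains F :: "(nat \<Rightarrow> real) filter" and \<Psi> where "F \<noteq> bot" "\<Psi> \<in> cinf_hom C (germ_ring F)"
proof -
  note CR = fin_gen_cinf_ring[OF C]
  interpret C: cinf_ring C by (rule CR)
  interpret RC: cring "ring_of C" by (rule C.cring_ring_of)
  obtain n c where c: "gens C n c" by (rule fin_gen_gens[OF C])
  note ct = gens_tup[OF c]
  define J where "J = {H \<in> smooth_funs n. sop C n H c = \<zero>\<^bsub>ring_of C\<^esub>}"
  define S where "S H = {x \<in> Rn n. H x = (0::real)}" for H
  have J0: "(\<lambda>x\<in>Rn n. 0) \<in> J"
    using smooth_funsI[OF smooth_on_const[OF ropen_Rn]] C.ev_zero[OF ct] by (simp add: J_def ev_def)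
  have JS: "\<exists>k\<in>J. S k \<subseteq> S H \<inter> S H'" if "H \<in> J" "H' \<in> J" for H H'
  proof (intro bexI)
    have H: "smooth_on n (Rn n) H" "smooth_on n (Rn n) H'" using that by (auto simp: J_def dest: smooth_funsD)
    have sm: "smooth_on n (Rn n) (\<lambda>x. H x * H x)" "smooth_on n (Rn n) (\<lambda>x. H' x * H' x)"
      by (intro smooth_on_mult ropen_Rn H)+
    have "ev C n H c = \<zero>\<^bsub>ring_of C\<^esub>" "ev C n H' c = \<zero>\<^bsub>ring_of C\<^esub>" using that by (auto simp: J_def ev_smooth_funs)
    then have "ev C n (\<lambda>x. H x * H x + H' x * H' x) c = \<zero>\<^bsub>ring_of C\<^esub>"
      using C.ev_add[OF sm ct] C.ev_mult[OF H(1) H(1) ct] C.ev_mult[OF H(2) H(2) ct] C.zero_closed by simp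
    \<comment> \<open>The sum of squares is again a relation, and its zeros are the common zeros of
      both.\<close>
    then show "(\<lambda>x\<in>Rn n. H x * H x + H' x * H' x) \<in> J"
      using smooth_funsI[OF smooth_on_add[OF ropen_Rn sm]] by (simp add: J_def ev_def)
    show "S (\<lambda>x\<in>Rn n. H x * H x + H' x * H' x) \<subseteq> S H \<inter> S H'"
      by (auto simp: S_def add_nonneg_eq_0_iff)
  qed
  have Sne: "S H \<noteq> {}" if "H \<in> J" for H
  proof
    assume "S H = {}"
    then have nz': "H x \<noteq> 0" if "x \<in> Rn n" for x using that by (auto simp: S_def)
    have H: "smooth_on n (Rn n) H" using that by (auto simp: J_def dest: smooth_funsD)
    have i: "smooth_on n (Rn n) (\<lambda>x. inverse (H x))" by (rule smooth_on_inverse[OF ropen_Rn H nz'])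
    have "ev C n (\<lambda>x. 1) c = ev C n (\<lambda>x. inverse (H x) * H x) c" by (rule ev_cong) (simp add: nz')
    also have "\<dots> = ev C n (\<lambda>x. inverse (H x)) c \<otimes>\<^bsub>ring_of C\<^esub> ev C n H c" by (rule C.ev_mult[OF i H ct])
    also have "\<dots> = \<zero>\<^bsub>ring_of C\<^esub>"
      using that C.ev_closed[OF i ct] by (auto simp: J_def ev_smooth_funs)
    finally show False using nz by (simp add: C.ev_one[OF ct] zero_ring_one_eq_zero[OF CR])
  qed
  define F where "F = (INF H\<in>J. principal (S H))"
  have ev: "eventually P F \<longleftrightarrow> (\<exists>H\<in>J. \<forall>x\<in>S H. P x)" for P
    unfolding F_def by (rule eventually_INF_directed) (use J0 JS in auto)
  have "F \<noteq> bot" unfolding trivial_limit_def ev using Sne by auto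
  have evR: "eventually (\<lambda>x. x \<in> Rn n) F" unfolding ev using J0 by (auto simp: S_def)
  let ?e = "\<lambda>H\<in>smooth_funs n. sop C n H c" and ?g = "\<lambda>H\<in>smooth_funs n. germ F H"
  have e: "?e \<in> cinf_hom (free_cinf_ring n) C" by (rule eval_hom[OF CR ct])
  have surj: "?e ` elems (free_cinf_ring n) = elems C"
  proof
    show "elems C \<subseteq> ?e ` elems (free_cinf_ring n)"
    proof
      fix x assume "x \<in> elems C"
      then obtain H where "H \<in> smooth_funs n" "x = sop C n H c" by (rule gensE[OF c])
      then show "x \<in> ?e ` elems (free_cinf_ring n)" by (intro image_eqI[of _ _ H]) auto
    qed
  qed (use cinf_homD(2)[OF e] in blast)
  have g: "?g \<in> cinf_hom (free_cinf_ring n) (germ_ring F)"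
  proof (rule cinf_homI)
    fix m f t assume f: "f \<in> smooth_funs m" and t: "t \<in> tup (free_cinf_ring n) m"
    have "?g (sop (free_cinf_ring n) m f t) = germ F (\<lambda>x\<in>Rn n. f (\<lambda>j\<in>{..<m}. t j x))"
      using cinf_ring.sop_closed[OF cinf_ring_free f t] by (simp add: sop_free)
    also have "\<dots> = germ F (\<lambda>x. f (\<lambda>j\<in>{..<m}. t j x))"
      unfolding germ_eq_iff using evR by (rule eventually_mono) simp
    also have "\<dots> = sop (germ_ring F) m f (\<lambda>j\<in>{..<m}. germ F (t j))" by (rule sop_germ[OF f, symmetric])
    also have "(\<lambda>j\<in>{..<m}. germ F (t j)) = (\<lambda>j\<in>{..<m}. ?g (t j))"
      using tup_mem[OF t] by (intro restrict_ext) simp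
    finally show "?g (sop (free_cinf_ring n) m f t) = sop (germ_ring F) m f (\<lambda>j\<in>{..<m}. ?g (t j))" .
  qed (auto simp: germ_in)
  have "?g H = \<zero>\<^bsub>ring_of (germ_ring F)\<^esub>" if "H \<in> elems (free_cinf_ring n)" "?e H = \<zero>\<^bsub>ring_of C\<^esub>" for H
  proof -
    have "H \<in> J" using that by (simp add: J_def)
    then have "eventually (\<lambda>x. H x = 0) F" unfolding ev by (auto simp: S_def)
    then show ?thesis using that by (simp add: germ_ring_ops germ_eq_iff)
  qed
  with surj_factor[OF cinf_ring_free CR cinf_ring_germ_ring e surj g] show thesis
    using that \<open>F \<noteq> bot\<close> by metis
qed

text \<open>\<open>inf_radical\<close> asks for an explicit zero ring on \<open>univ\<close>; the
  free ring on no generators modulo itself supplies one.\<close>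

lemma zero_ring_exists:
  obtains B :: "univ cinf_ring" where "fin_gen B" "is_zero_ring B"
proof -
  let ?I = "smooth_funs 0"
  interpret A: cinf_ring "free_cinf_ring 0" by (rule cinf_ring_free)
  have I: "ideal ?I (ring_of (free_cinf_ring 0))" using ring.oneideal[OF A.ring_ring_of] by simp
  interpret Q: cinf_ideal "free_cinf_ring 0" ?I by (rule cinf_ideal_free[OF I])
  have "c = \<zero>\<^bsub>ring_of (quot (free_cinf_ring 0) ?I)\<^esub>" if "c \<in> elems (quot (free_cinf_ring 0) ?I)" for c
    using that Q.quot_map_zero_iff by (auto elim!: quot_elemE)
  then have "is_zero_ring (quot (free_cinf_ring 0) ?I)"
    using cinf_ring.zero_closed[OF Q.cinf_ring_quot] unfolding is_zero_ring_def by blast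
  then show thesis using that fin_gen_quot_free[OF I] by blast
qed

lemma hom_to_zero_ring:
  assumes "cinf_ring B" "is_zero_ring B" "cinf_ring A"
  shows "h \<in> cinf_hom A B \<longleftrightarrow> h = (\<lambda>a\<in>elems A. \<zero>\<^bsub>ring_of B\<^esub>)"
proof
  have el: "elems B = {\<zero>\<^bsub>ring_of B\<^esub>}" using assms(2) by (simp add: is_zero_ring_def)
  show "h = (\<lambda>a\<in>elems A. \<zero>\<^bsub>ring_of B\<^esub>)" if "h \<in> cinf_hom A B"
    using cinf_homD(1)[OF that] unfolding el by (intro extensionalityI[where A = "elems A"]) (auto simp: PiE_def)
  show "h \<in> cinf_hom A B" if "h = (\<lambda>a\<in>elems A. \<zero>\<^bsub>ring_of B\<^esub>)"
  proof (rule cinf_homI)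
    fix n f t assume f: "f \<in> smooth_funs n" and t: "t \<in> tup A n"
    have "(\<lambda>i\<in>{..<n}. h (t i)) \<in> tup B n"
      by (rule tupI) (use tup_mem[OF t] in \<open>simp add: that el\<close>)
    from cinf_ring.sop_closed[OF assms(1) f this]
    have "sop B n f (\<lambda>i\<in>{..<n}. h (t i)) = \<zero>\<^bsub>ring_of B\<^esub>" by (simp add: el)
    moreover have "h (sop A n f t) = \<zero>\<^bsub>ring_of B\<^esub>"
      using cinf_ring.sop_closed[OF assms(3) f t] by (simp add: that)
    ultimately show "h (sop A n f t) = sop B n f (\<lambda>i\<in>{..<n}. h (t i))" by simp
  qed (auto simp: that el)
qed

text \<open>If a ring in which such an \<open>a\<close> becomes invertible were non-zero, it would
  have a germ point, at which \<open>a\<close> is both invertible and zero. So the zero ring has the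
  universal property of the inversion.\<close>

lemma radical_eq:
  assumes A: "fin_gen A"
  shows "inf_radical A {\<zero>\<^bsub>ring_of A\<^esub>} =
    {a \<in> elems A. \<forall>(F :: (nat \<Rightarrow> real) filter) \<Psi>. \<Psi> \<in> cinf_hom A (germ_ring F) \<longrightarrow> \<Psi> a = \<zero>\<^bsub>ring_of (germ_ring F)\<^esub>}"
proof (intro subset_antisym subsetI)
  fix a assume a: "a \<in> inf_radical A {\<zero>\<^bsub>ring_of A\<^esub>}"
  then show "a \<in> {a \<in> elems A. \<forall>(F :: (nat \<Rightarrow> real) filter) \<Psi>. \<Psi> \<in> cinf_hom A (germ_ring F) \<longrightarrow> \<Psi> a = \<zero>\<^bsub>ring_of (germ_ring F)\<^esub>}"
    using germ_kills_radical[OF A _ a] by (auto simp: inf_radical_def)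
next
  fix a assume "a \<in> {a \<in> elems A. \<forall>(F :: (nat \<Rightarrow> real) filter) \<Psi>. \<Psi> \<in> cinf_hom A (germ_ring F) \<longrightarrow> \<Psi> a = \<zero>\<^bsub>ring_of (germ_ring F)\<^esub>}"
  then have a: "a \<in> elems A"
    and kill: "\<And>(F :: (nat \<Rightarrow> real) filter) \<Psi>. \<Psi> \<in> cinf_hom A (germ_ring F) \<Longrightarrow> \<Psi> a = \<zero>\<^bsub>ring_of (germ_ring F)\<^esub>" by auto
  note AR = fin_gen_cinf_ring[OF A]
  interpret Z: cinf_ideal A "{\<zero>\<^bsub>ring_of A\<^esub>}" by (rule zero_ideal[OF AR])
  let ?Q = "quot A {\<zero>\<^bsub>ring_of A\<^esub>}" and ?q = "quot_map A {\<zero>\<^bsub>ring_of A\<^esub>}"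
  obtain B :: "univ cinf_ring" where B: "fin_gen B" "is_zero_ring B" by (rule zero_ring_exists)
  note BR = fin_gen_cinf_ring[OF B(1)]
  have Bel: "elems B = {\<zero>\<^bsub>ring_of B\<^esub>}" using B(2) by (simp add: is_zero_ring_def)
  define \<phi> where "\<phi> = (\<lambda>c\<in>elems ?Q. \<zero>\<^bsub>ring_of B\<^esub>)"
  have phi: "\<phi> \<in> cinf_hom ?Q B" unfolding \<phi>_def using hom_to_zero_ring[OF BR B(2) Z.cinf_ring_quot] by blast
  have un: "x \<in> Units (ring_of B)" if "x \<in> elems B" for x
  proof -
    have "x \<otimes>\<^bsub>ring_of B\<^esub> x \<in> elems B"
      using cring.cring_simprules(5)[OF cinf_ring.cring_ring_of[OF BR]] that by simp
    then show ?thesis using that cinf_ring.one_closed[OF BR] by (auto simp: Units_def Bel)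
  qed
  have "universal_inversion ?Q (?q a) B \<phi>"
    unfolding universal_inversion_def
  proof (intro conjI allI impI B phi un cinf_homD(2)[OF phi] cinf_homD(2)[OF Z.quot_map_hom a])
    fix C :: "univ cinf_ring" and \<psi>
    assume C: "fin_gen C \<and> \<psi> \<in> cinf_hom ?Q C \<and> \<psi> (?q a) \<in> Units (ring_of C)"
    then have CR: "cinf_ring C" and p: "\<psi> \<in> cinf_hom ?Q C" by (auto dest: fin_gen_cinf_ring)
    have C0: "is_zero_ring C"
    proof (rule ccontr)
      assume "\<not> is_zero_ring C"
      then obtain F :: "(nat \<Rightarrow> real) filter" and \<Psi> where F: "F \<noteq> bot" and h: "\<Psi> \<in> cinf_hom C (germ_ring F)"
        using exists_germ_point C by metis
      define h1 where "h1 = compose (elems ?Q) \<Psi> \<psi>"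
      have h1: "h1 \<in> cinf_hom ?Q (germ_ring F)" unfolding h1_def by (rule cinf_hom_compose[OF Z.cinf_ring_quot p h])
      have "compose (elems A) h1 ?q a = \<zero>\<^bsub>ring_of (germ_ring F)\<^esub>"
        by (rule kill[OF cinf_hom_compose[OF AR Z.quot_map_hom h1]])
      then have "\<Psi> (\<psi> (?q a)) = germ F (\<lambda>p. 0)"
        using a cinf_homD(2)[OF Z.quot_map_hom a] by (simp add: compose_def h1_def germ_ring_ops)
      moreover have "\<Psi> (\<psi> (?q a)) \<in> Units (ring_of (germ_ring F))"
        using hom_Units[OF CR cinf_ring_germ_ring h] C by blast
      ultimately show False using F by (simp add: germ_Units_iff trivial_limit_def)
    qed
    show "\<exists>!h. h \<in> cinf_hom B C \<and> compose (elems ?Q) h \<phi> = \<psi>"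
    proof (rule ex1I[of _ "\<lambda>b\<in>elems B. \<zero>\<^bsub>ring_of C\<^esub>"])
      have "\<psi> = (\<lambda>c\<in>elems ?Q. \<zero>\<^bsub>ring_of C\<^esub>)" using p hom_to_zero_ring[OF CR C0 Z.cinf_ring_quot] by blast
      then show "(\<lambda>b\<in>elems B. \<zero>\<^bsub>ring_of C\<^esub>) \<in> cinf_hom B C \<and> compose (elems ?Q) (\<lambda>b\<in>elems B. \<zero>\<^bsub>ring_of C\<^esub>) \<phi> = \<psi>"
        using hom_to_zero_ring[OF CR C0 BR] by (auto simp: compose_def \<phi>_def Bel cong: restrict_cong)
    qed (use hom_to_zero_ring[OF CR C0 BR] in blast)
  qed
  then show "a \<in> inf_radical A {\<zero>\<^bsub>ring_of A\<^esub>}" unfolding inf_radical_def using a B(2) by blast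
qed

text \<open>By \<open>radical_eq\<close> the radical is an intersection of kernels. This makes
  \<open>red\<close> the quotient by a genuine ideal.\<close>

lemma radical_ideal:
  assumes A: "fin_gen A"
  shows "cinf_ideal A (inf_radical A {\<zero>\<^bsub>ring_of A\<^esub>})"
proof -
  note AR = fin_gen_cinf_ring[OF A]
  interpret A: cinf_ring A by (rule AR)
  have I: "ideal {a \<in> elems A. \<Psi> a = \<zero>\<^bsub>ring_of (germ_ring F)\<^esub>} (ring_of A)" if "\<Psi> \<in> cinf_hom A (germ_ring F)"
    for F :: "(nat \<Rightarrow> real) filter" and \<Psi> by (rule kernel_ideal[OF AR cinf_ring_germ_ring that])
  let ?R = "inf_radical A {\<zero>\<^bsub>ring_of A\<^esub>}"
  have memI: "a \<in> ?R" if "a \<in> elems A"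
    "\<And>(F :: (nat \<Rightarrow> real) filter) \<Psi>. \<Psi> \<in> cinf_hom A (germ_ring F) \<Longrightarrow> a \<in> {a \<in> elems A. \<Psi> a = \<zero>\<^bsub>ring_of (germ_ring F)\<^esub>}" for a
    using that unfolding radical_eq[OF A] by blast
  have memD: "a \<in> elems A" "\<Psi> \<in> cinf_hom A (germ_ring F) \<Longrightarrow> a \<in> {a \<in> elems A. \<Psi> a = \<zero>\<^bsub>ring_of (germ_ring F)\<^esub>}"
    if "a \<in> ?R" for a and F :: "(nat \<Rightarrow> real) filter" and \<Psi>
    using that unfolding radical_eq[OF A] by blast+
  have "ideal ?R (ring_of A)"
  proof (rule A.idealI)
    show "?R \<subseteq> elems A" using memD(1) by blast
    show "\<zero>\<^bsub>ring_of A\<^esub> \<in> ?R"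
      by (rule memI[OF A.zero_closed additive_subgroup.zero_closed[OF ideal.axioms(1)[OF I]]])
    show "a \<oplus>\<^bsub>ring_of A\<^esub> b \<in> ?R" if "a \<in> ?R" "b \<in> ?R" for a b
    proof (rule memI)
      show "a \<oplus>\<^bsub>ring_of A\<^esub> b \<in> elems A"
        using memD(1)[OF that(1)] memD(1)[OF that(2)] cring.cring_simprules(1)[OF A.cring_ring_of, of a b] by simp
    qed (rule additive_subgroup.a_closed[OF ideal.axioms(1)[OF I] memD(2)[OF that(1)] memD(2)[OF that(2)]])
    show "x \<otimes>\<^bsub>ring_of A\<^esub> a \<in> ?R" if "a \<in> ?R" and x: "x \<in> elems A" for a x
    proof (rule memI)
      show "x \<otimes>\<^bsub>ring_of A\<^esub> a \<in> elems A"
        using memD(1)[OF that(1)] x cring.cring_simprules(5)[OF A.cring_ring_of, of x a] by simp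
    qed (rule ideal.I_l_closed[OF I memD(2)[OF that(1)]], simp_all add: x)
  qed
  then show ?thesis by (simp add: cinf_ideal_def cinf_ideal_axioms_def AR)
qed

section \<open>Points\<close>

text \<open>A copy of the real numbers, read off by \<open>val\<close>; as a germ ring it inherits
  all facts about germs.\<close>

abbreviation point_ring :: "'p \<Rightarrow> ('p \<Rightarrow> real) set cinf_ring" where
  "point_ring p \<equiv> germ_ring (principal {p})"

definition val :: "'p \<Rightarrow> ('p \<Rightarrow> real) set \<Rightarrow> real" where
  "val p c = (SOME g. c = germ (principal {p}) g) p"

lemma val_germ [simp]: "val p (germ (principal {p}) g) = g p"
proof -
  have "germ (principal {p}) g = germ (principal {p}) (SOME h. germ (principal {p}) g = germ (principal {p}) h)"
    by (rule someI[of "\<lambda>h. germ (principal {p}) g = germ (principal {p}) h"]) simp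
  then show ?thesis unfolding val_def germ_eq_iff by (simp add: eventually_principal)
qed

lemma point_ring_elem: "c \<in> elems (point_ring p) \<Longrightarrow> c = germ (principal {p}) (\<lambda>_. val p c)"
  by (elim germE) (simp add: germ_eq_iff eventually_principal)

lemma val_hom_sop:
  assumes h: "h \<in> cinf_hom A (point_ring p)" and f: "f \<in> smooth_funs n" and a: "a \<in> tup A n"
  shows "val p (h (sop A n f a)) = f (\<lambda>i\<in>{..<n}. val p (h (a i)))"
proof -
  have "h (a i) = germ (principal {p}) (\<lambda>_. val p (h (a i)))" if "i < n" for i
    by (rule point_ring_elem[OF cinf_homD(2)[OF h tup_mem[OF a that]]])
  from hom_germ_sop[OF h f a this] show ?thesis by simp
qed

lemma val_Units: "c \<in> elems (point_ring p) \<Longrightarrow> c \<in> Units (ring_of (point_ring p)) \<longleftrightarrow> val p c \<noteq> 0"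
  by (elim germE) (simp add: germ_Units_iff eventually_principal)

text \<open>The nullary operations already yield all constants, so this copy of the reals is
  generated by the empty tuple. It is thus isomorphic to a test object, and universal properties can
  be applied to evaluation at points.\<close>

lemma point_ring_univ:
  obtains G :: "univ cinf_ring" and \<iota> where "fin_gen G" "\<iota> \<in> cinf_iso G (point_ring p)"
proof -
  have t: "(\<lambda>i. undefined) \<in> tup (point_ring p) 0" by simp
  obtain G :: "univ cinf_ring" and \<iota> where G: "fin_gen G" "\<iota> \<in> cinf_hom G (point_ring p)" "inj_on \<iota> (elems G)"
    "\<iota> ` elems G = (\<lambda>F. sop (point_ring p) 0 F (\<lambda>i. undefined)) ` smooth_funs 0"
    by (rule generated_subring[OF cinf_ring_germ_ring t])
  have "c \<in> \<iota> ` elems G" if c: "c \<in> elems (point_ring p)" for c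
    unfolding G(4)
  proof (rule image_eqI)
    have f: "(\<lambda>x\<in>Rn 0. val p c) \<in> smooth_funs 0" by (rule smooth_funsI[OF smooth_on_const[OF ropen_Rn]])
    then show "(\<lambda>x\<in>Rn 0. val p c) \<in> smooth_funs 0" .
    have "(\<lambda>i\<in>{..<0::nat}. germ (principal {p}) (undefined i)) = (\<lambda>i. undefined)" by (simp add: restrict_def)
    then have "sop (point_ring p) 0 (\<lambda>x\<in>Rn 0. val p c) (\<lambda>i. undefined) =
        germ (principal {p}) (\<lambda>q. (\<lambda>x\<in>Rn 0. val p c) (\<lambda>i\<in>{..<0}. undefined i q))"
      using sop_germ[OF f, of "principal {p}" undefined] by simp
    also have "\<dots> = germ (principal {p}) (\<lambda>_. val p c)" by (simp add: restrict_def)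
    finally show "c = sop (point_ring p) 0 (\<lambda>x\<in>Rn 0. val p c) (\<lambda>i. undefined)" using point_ring_elem[OF c] by simp
  qed
  then have "\<iota> ` elems G = elems (point_ring p)" using cinf_homD(2)[OF G(2)] by blast
  then show thesis using that[OF G(1), of \<iota>] G(2,3) by (simp add: cinf_iso_def bij_betw_def)
qed

text \<open>Geometrically, a point at which \<open>f\<close> does not vanish lies in the open
  subscheme defined by \<open>f\<close>.\<close>

lemma universal_inversion_point:
  assumes u: "universal_inversion A f B \<phi>" and A: "cinf_ring A" and f: "f \<in> elems A"
    and h: "\<Psi> \<in> cinf_hom A (point_ring p)" and nz: "val p (\<Psi> f) \<noteq> 0"
  obtains k where "k \<in> cinf_hom B (point_ring p)" "\<And>a. a \<in> elems A \<Longrightarrow> k (\<phi> a) = \<Psi> a"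
proof -
  note BR = fin_gen_cinf_ring[OF universal_inversionD(1)[OF u]]
  obtain G :: "univ cinf_ring" and \<iota> where G: "fin_gen G" "\<iota> \<in> cinf_iso G (point_ring p)" by (rule point_ring_univ)
  note GR = fin_gen_cinf_ring[OF G(1)]
  have i: "\<iota> \<in> cinf_hom G (point_ring p)" using G(2) by (simp add: cinf_iso_def)
  obtain g where g: "g \<in> cinf_iso (point_ring p) G" "\<And>b. b \<in> elems (point_ring p) \<Longrightarrow> \<iota> (g b) = b"
    using iso_inverse[OF GR cinf_ring_germ_ring G(2)] by metis
  have gh: "g \<in> cinf_hom (point_ring p) G" using g(1) by (simp add: cinf_iso_def)
  have "\<Psi> f \<in> Units (ring_of (point_ring p))" using nz val_Units[OF cinf_homD(2)[OF h f]] by blast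
  then have "compose (elems A) g \<Psi> f \<in> Units (ring_of G)"
    using hom_Units[OF cinf_ring_germ_ring GR gh] f by (simp add: compose_def)
  then obtain k where k: "k \<in> cinf_hom B G" "\<And>a. a \<in> elems A \<Longrightarrow> k (\<phi> a) = compose (elems A) g \<Psi> a"
    using universal_inversion_extend[OF u G(1) cinf_hom_compose[OF A h gh]] by metis
  show thesis
  proof (rule that[OF cinf_hom_compose[OF BR k(1) i]])
    fix a assume a: "a \<in> elems A"
    show "compose (elems B) \<iota> k (\<phi> a) = \<Psi> a"
      using cinf_homD(2)[OF universal_inversionD(2)[OF u] a] k(2)[OF a] g(2)[OF cinf_homD(2)[OF h a]] a
      by (simp add: compose_def)
  qed
qed

lemma universal_inversion_point_unique:
  assumes u: "universal_inversion A f B \<phi>" and A: "cinf_ring A" and f: "f \<in> elems A"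
    and h: "h \<in> cinf_hom B (point_ring p)" "k \<in> cinf_hom B (point_ring p)"
    and eq: "\<And>a. a \<in> elems A \<Longrightarrow> h (\<phi> a) = k (\<phi> a)"
  shows "h = k"
proof -
  note BR = fin_gen_cinf_ring[OF universal_inversionD(1)[OF u]]
  obtain G :: "univ cinf_ring" and \<iota> where G: "fin_gen G" "\<iota> \<in> cinf_iso G (point_ring p)" by (rule point_ring_univ)
  note GR = fin_gen_cinf_ring[OF G(1)]
  obtain g where g: "g \<in> cinf_iso (point_ring p) G" "\<And>b. b \<in> elems (point_ring p) \<Longrightarrow> \<iota> (g b) = b"
    using iso_inverse[OF GR cinf_ring_germ_ring G(2)] by metis
  have gh: "g \<in> cinf_hom (point_ring p) G" using g(1) by (simp add: cinf_iso_def)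
  have "compose (elems B) g h = compose (elems B) g k"
  proof (rule universal_inversion_unique[OF u A f G(1) cinf_hom_compose[OF BR h(1) gh] cinf_hom_compose[OF BR h(2) gh]])
    show "compose (elems B) g h (\<phi> a) = compose (elems B) g k (\<phi> a)" if "a \<in> elems A" for a
      using eq[OF that] cinf_homD(2)[OF universal_inversionD(2)[OF u] that] by (simp add: compose_def)
  qed
  then have "h b = k b" if b: "b \<in> elems B" for b
    using g(2)[OF cinf_homD(2)[OF h(1) b]] g(2)[OF cinf_homD(2)[OF h(2) b]] b by (metis compose_eq)
  then show ?thesis
    using cinf_homD(1)[OF h(1)] cinf_homD(1)[OF h(2)] by (intro extensionalityI[where A = "elems B"]) (auto simp: PiE_def)
qed

section \<open>The smooth functions on a manifold\<close>

locale smooth_mfd =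
  fixes n :: nat and T :: "'p topology" and \<A> :: "('p set \<times> ('p \<Rightarrow> nat \<Rightarrow> real)) set"
  assumes mfd: "smooth_manifold n T \<A>"
begin

abbreviation R :: "('p \<Rightarrow> real) cinf_ring" where "R \<equiv> Cinf (manifold_scheme n T \<A>)"

lemma elems_R: "elems R = manifold_funs n T \<A>"
  and sop_R: "sop R m f g = (\<lambda>p\<in>topspace T. f (\<lambda>j\<in>{..<m}. g j p))"
  by (simp_all add: manifold_scheme_def)

lemma chart:
  assumes "(U, \<phi>) \<in> \<A>"
  shows "openin T U" "ropen n (\<phi> ` U)" "U \<subseteq> topspace T"
    "homeomorphic_map (subtopology T U) (subtopology (powertop_real {..<n}) (\<phi> ` U)) \<phi>" "inj_on \<phi> U"
proof -
  show *: "openin T U" "ropen n (\<phi> ` U)"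
    "homeomorphic_map (subtopology T U) (subtopology (powertop_real {..<n}) (\<phi> ` U)) \<phi>"
    using mfd assms unfolding smooth_manifold_def by blast+
  show "U \<subseteq> topspace T" using *(1) by (rule openin_subset)
  then have "topspace (subtopology T U) = U" by auto
  then show "inj_on \<phi> U" using homeomorphic_imp_injective_map[OF *(3)] by simp
qed

lemma chart_cover:
  assumes "p \<in> topspace T"
  obtains U \<phi> where "(U, \<phi>) \<in> \<A>" "p \<in> U"
proof -
  have "(\<Union>(U, \<phi>)\<in>\<A>. U) = topspace T" using mfd unfolding smooth_manifold_def by blast
  then show thesis using assms that by blast
qed

lemma transition:
  assumes "(U, \<phi>) \<in> \<A>" "(V, \<psi>) \<in> \<A>" "i < n"
  shows "smooth_on n (\<phi> ` (U \<inter> V)) (\<lambda>x. \<psi> (inv_into U \<phi> x) i)"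
  using mfd assms unfolding smooth_manifold_def by blast

lemma chart_image_open:
  assumes c: "(U, \<phi>) \<in> \<A>" and S: "openin T S"
  shows "ropen n (\<phi> ` (U \<inter> S))"
proof -
  have "openin (subtopology T U) (U \<inter> S)" using S by (auto simp: openin_subtopology)
  then have "openin (subtopology (powertop_real {..<n}) (\<phi> ` U)) (\<phi> ` (U \<inter> S))"
    using homeomorphic_imp_open_map[OF chart(4)[OF c]] by (simp add: open_map_def)
  then show ?thesis using openin_trans_full[OF _ chart(2)[OF c]] by blast
qed

lemma chart_preimage_open:
  assumes c: "(U, \<phi>) \<in> \<A>" and W: "ropen n W"
  shows "openin T {p \<in> U. \<phi> p \<in> W}"
proof -
  have cm: "continuous_map (subtopology T U) (powertop_real {..<n}) \<phi>"
    using homeomorphic_imp_continuous_map[OF chart(4)[OF c]] by (simp add: continuous_map_in_subtopology)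
  have "topspace (subtopology T U) = U" using chart(3)[OF c] by auto
  then have "openin (subtopology T U) {p \<in> U. \<phi> p \<in> W}" using openin_continuous_map_preimage[OF cm W] by simp
  then show ?thesis using openin_trans_full[OF _ chart(1)[OF c]] by blast
qed

lemma inv_chart: "(U, \<phi>) \<in> \<A> \<Longrightarrow> p \<in> U \<Longrightarrow> inv_into U \<phi> (\<phi> p) = p"
  using chart(5) by (rule inv_into_f_f)

lemma funD: "g \<in> elems R \<Longrightarrow> (U, \<phi>) \<in> \<A> \<Longrightarrow> smooth_on n (\<phi> ` U) (\<lambda>x. g (inv_into U \<phi> x))"
  and fun_ext: "g \<in> elems R \<Longrightarrow> g \<in> extensional (topspace T)"
  by (auto simp: elems_R manifold_funs_def)

lemma funI:
  assumes "\<And>U \<phi>. (U, \<phi>) \<in> \<A> \<Longrightarrow> smooth_on n (\<phi> ` U) (\<lambda>x. g (inv_into U \<phi> x))"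
  shows "restrict g (topspace T) \<in> elems R"
  unfolding elems_R manifold_funs_def
proof (intro CollectI conjI ballI)
  fix c assume "c \<in> \<A>"
  then obtain U \<phi> where c: "c = (U, \<phi>)" "(U, \<phi>) \<in> \<A>" by (cases c) auto
  have "smooth_on n (\<phi> ` U) (\<lambda>x. restrict g (topspace T) (inv_into U \<phi> x))"
    using smooth_on_cong[OF chart(2)[OF c(2)], of "\<lambda>x. restrict g (topspace T) (inv_into U \<phi> x)" "\<lambda>x. g (inv_into U \<phi> x)"]
      assms[OF c(2)] chart(3)[OF c(2)] by (auto simp: inv_into_into subset_iff)
  then show "case c of (U, \<phi>) \<Rightarrow> smooth_on n (\<phi> ` U) (\<lambda>x. restrict g (topspace T) (inv_into U \<phi> x))"
    by (simp add: c(1))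
qed auto

lemma cinf_ring_R: "cinf_ring R"
proof
  fix m f g assume f: "f \<in> smooth_funs m" and g: "g \<in> tup R m"
  show "sop R m f g \<in> elems R"
    unfolding sop_R
  proof (rule funI)
    fix U \<phi> assume c: "(U, \<phi>) \<in> \<A>"
    show "smooth_on n (\<phi> ` U) (\<lambda>x. f (\<lambda>j\<in>{..<m}. g j (inv_into U \<phi> x)))"
    proof (rule smooth_on_compose[OF chart(2)[OF c] ropen_Rn _ _ smooth_funsD[OF f]])
      show "smooth_on n (\<phi> ` U) (\<lambda>x. (\<lambda>j\<in>{..<m}. g j (inv_into U \<phi> x)) j)" if "j < m" for j
        using funD[OF tup_mem[OF g that] c] that by simp
    qed auto
  qed
next
  fix m i g assume i: "i < m" and g: "g \<in> tup R m"
  show "sop R m (\<lambda>x\<in>Rn m. x i) g = g i"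
    unfolding sop_R using i fun_ext[OF tup_mem[OF g i]] by (intro extensionalityI[where A = "topspace T"]) auto
next
  fix m k :: nat and f g and a :: "nat \<Rightarrow> 'p \<Rightarrow> real"
  show "sop R k (\<lambda>x\<in>Rn k. f (\<lambda>j\<in>{..<m}. g j x)) a = sop R m f (\<lambda>j\<in>{..<m}. sop R k (g j) a)"
    unfolding sop_R by (intro restrict_ext) (simp cong: restrict_cong)
qed

lemma restriction_hom:
  assumes "eventually (\<lambda>p. p \<in> topspace T) F"
  shows "(\<lambda>g\<in>elems R. germ F g) \<in> cinf_hom R (germ_ring F)"
proof (rule cinf_homI)
  fix m f g assume f: "f \<in> smooth_funs m" and g: "g \<in> tup R m"
  have "germ F (sop R m f g) = germ F (\<lambda>p. f (\<lambda>j\<in>{..<m}. g j p))"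
    unfolding sop_R germ_eq_iff using assms by (rule eventually_mono) simp
  also have "\<dots> = sop (germ_ring F) m f (\<lambda>j\<in>{..<m}. germ F (g j))" by (rule sop_germ[OF f, symmetric])
  also have "(\<lambda>j\<in>{..<m}. germ F (g j)) = (\<lambda>j\<in>{..<m}. (\<lambda>g\<in>elems R. germ F g) (g j))"
    using tup_mem[OF g] by (intro restrict_ext) simp
  finally show "(\<lambda>g\<in>elems R. germ F g) (sop R m f g) = sop (germ_ring F) m f (\<lambda>i\<in>{..<m}. (\<lambda>g\<in>elems R. germ F g) (g i))"
    unfolding restrict_apply'[OF cinf_ring.sop_closed[OF cinf_ring_R f g]] .
qed (auto simp: germ_in)

lemma R_mult:
  assumes "g \<in> elems R" "h \<in> elems R" "p \<in> topspace T"
  shows "(g \<otimes>\<^bsub>ring_of R\<^esub> h) p = g p * h p"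
  using assms by (simp_all add: ring_of_def sop_R)

lemma R_zero: "\<zero>\<^bsub>ring_of R\<^esub> = (\<lambda>p\<in>topspace T. 0)" and R_one: "\<one>\<^bsub>ring_of R\<^esub> = (\<lambda>p\<in>topspace T. 1)"
proof -
  have "(\<lambda>i\<in>{..<0::nat}. g i) \<in> Rn 0" for g :: "nat \<Rightarrow> real" by (simp add: restrict_def)
  then show "\<zero>\<^bsub>ring_of R\<^esub> = (\<lambda>p\<in>topspace T. 0)" "\<one>\<^bsub>ring_of R\<^esub> = (\<lambda>p\<in>topspace T. 1)"
    unfolding ring_of_def by (simp_all only: sop_R ring.simps monoid.simps restrict_apply' simp_thms if_True)
qed

lemma fun_continuous:
  assumes g: "g \<in> elems R"
  shows "continuous_map T euclideanreal g"
  unfolding continuous_map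
proof (intro conjI allI impI)
  fix B :: "real set" assume B: "openin euclideanreal B"
  show "openin T {p \<in> topspace T. g p \<in> B}"
  proof (subst openin_subopen, intro ballI)
    fix p assume p: "p \<in> {p \<in> topspace T. g p \<in> B}"
    then obtain U \<phi> where c: "(U, \<phi>) \<in> \<A>" "p \<in> U" using chart_cover by blast
    have "ropen n {x \<in> \<phi> ` U. g (inv_into U \<phi> x) \<in> B}"
      using ropen_continuous_preimage[OF chart(2)[OF c(1)] smooth_onD(1)[OF funD[OF g c(1)] chart(2)[OF c(1)]]] B by simp
    from chart_preimage_open[OF c(1) this]
    have "openin T {q \<in> U. \<phi> q \<in> {x \<in> \<phi> ` U. g (inv_into U \<phi> x) \<in> B}}" .
    also have "{q \<in> U. \<phi> q \<in> {x \<in> \<phi> ` U. g (inv_into U \<phi> x) \<in> B}} = {q \<in> U. g q \<in> B}"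
      by (auto simp: inv_chart[OF c(1)] dest: inj_onD[OF chart(5)[OF c(1)]])
    finally have "openin T {q \<in> U. g q \<in> B}" .
    then show "\<exists>S. openin T S \<and> p \<in> S \<and> S \<subseteq> {p \<in> topspace T. g p \<in> B}"
      using c p chart(3)[OF c(1)] by (intro exI[of _ "{q \<in> U. g q \<in> B}"]) auto
  qed
qed auto

text \<open>Near a point outside \<open>U\<close> the extension must vanish on a neighbourhood. The
  preimage \<open>K\<close> of the closed box is compact, hence closed in a Hausdorff space, and its
  complement is such a neighbourhood.\<close>

lemma extend_by_zero:
  assumes c: "(U, \<phi>) \<in> \<A>" and g: "smooth_on n (\<phi> ` U) g"
    and Q: "{x \<in> Rn n. \<forall>i<n. \<bar>x i - q i\<bar> \<le> r} \<subseteq> \<phi> ` U"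
    and supp: "\<And>x. x \<in> \<phi> ` U \<Longrightarrow> g x \<noteq> 0 \<Longrightarrow> \<forall>i<n. \<bar>x i - q i\<bar> \<le> r"
  shows "(\<lambda>p\<in>topspace T. if p \<in> U then g (\<phi> p) else 0) \<in> elems R"
proof (rule funI)
  define B where "B = {x \<in> Rn n. \<forall>i<n. \<bar>x i - q i\<bar> \<le> r}"
  define K where "K = inv_into U \<phi> ` B"
  have "compactin (powertop_real {..<n}) (PiE {..<n} (\<lambda>i. {q i - r..q i + r}))" by (simp add: compactin_PiE)
  moreover have "PiE {..<n} (\<lambda>i. {q i - r..q i + r}) = B"
    by (auto simp: B_def PiE_def Pi_def abs_le_iff)
  ultimately have "compactin (subtopology (powertop_real {..<n}) (\<phi> ` U)) B"
    using Q by (simp add: compactin_subtopology B_def)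
  moreover obtain \<psi> where \<psi>: "homeomorphic_maps (subtopology T U) (subtopology (powertop_real {..<n}) (\<phi> ` U)) \<phi> \<psi>"
    using chart(4)[OF c] homeomorphic_map_maps by blast
  ultimately have "compactin (subtopology T U) (\<psi> ` B)"
    unfolding homeomorphic_maps_def using image_compactin by blast
  moreover have "\<psi> ` B = K"
    unfolding K_def
  proof (rule image_cong)
    fix x assume "x \<in> B"
    then obtain p where p: "p \<in> U" "x = \<phi> p" using Q unfolding B_def by blast
    have "\<psi> (\<phi> p) = p" using \<psi> p(1) chart(3)[OF c] unfolding homeomorphic_maps_def by auto
    then show "\<psi> x = inv_into U \<phi> x" using p inv_chart[OF c p(1)] by simp
  qed simp
  ultimately have "compactin T K" by (simp add: compactin_subtopology)
  moreover have "Hausdorff_space T" using mfd by (simp add: smooth_manifold_def)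
  ultimately have K: "closedin T K" by (rule compactin_imp_closedin[rotated])
  let ?g = "\<lambda>p. if p \<in> U then g (\<phi> p) else 0"
  have zero: "?g p = 0" if "p \<notin> K" for p
  proof (rule ccontr)
    assume "?g p \<noteq> 0"
    then have p: "p \<in> U" "g (\<phi> p) \<noteq> 0" by (auto split: if_splits)
    then have "\<phi> p \<in> B" using supp[of "\<phi> p"] ropen_subset[OF chart(2)[OF c]] unfolding B_def by blast
    then show False using that inv_chart[OF c p(1)] unfolding K_def by (metis imageI)
  qed
  fix V \<psi> assume d: "(V, \<psi>) \<in> \<A>"
  show "smooth_on n (\<psi> ` V) (\<lambda>x. ?g (inv_into V \<psi> x))"
  proof (rule smooth_on_local[OF chart(2)[OF d]])
    fix x assume "x \<in> \<psi> ` V"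
    then obtain p where p: "p \<in> V" "x = \<psi> p" by blast
    show "\<exists>W. ropen n W \<and> x \<in> W \<and> W \<subseteq> \<psi> ` V \<and> smooth_on n W (\<lambda>x. ?g (inv_into V \<psi> x))"
    proof (cases "p \<in> U")
      case True
      have W: "ropen n (\<psi> ` (V \<inter> U))" by (rule chart_image_open[OF d chart(1)[OF c]])
      have iv: "inv_into V \<psi> y \<in> U" if "y \<in> \<psi> ` (V \<inter> U)" for y using that inv_chart[OF d] by auto
      have "smooth_on n (\<psi> ` (V \<inter> U)) (\<lambda>x. g (\<phi> (inv_into V \<psi> x)))"
        by (rule smooth_on_compose[OF W chart(2)[OF c] _ transition[OF d c] g]) (use iv in blast)
      moreover have "smooth_on n (\<psi> ` (V \<inter> U)) (\<lambda>x. ?g (inv_into V \<psi> x)) \<longleftrightarrow> smooth_on n (\<psi> ` (V \<inter> U)) (\<lambda>x. g (\<phi> (inv_into V \<psi> x)))"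
        by (rule smooth_on_cong[OF W]) (simp add: iv)
      ultimately show ?thesis using W p True by (intro exI[of _ "\<psi> ` (V \<inter> U)"]) auto
    next
      case False
      have pK: "p \<notin> K"
      proof
        assume "p \<in> K"
        then obtain y where "y \<in> B" "p = inv_into U \<phi> y" unfolding K_def by blast
        then show False using False Q inv_into_into[of y \<phi> U] unfolding B_def by blast
      qed
      have "openin T (topspace T - K)" using K by (rule openin_diff[OF openin_topspace])
      then have W: "ropen n (\<psi> ` (V \<inter> (topspace T - K)))" by (rule chart_image_open[OF d])
      have "smooth_on n (\<psi> ` (V \<inter> (topspace T - K))) (\<lambda>x. ?g (inv_into V \<psi> x)) \<longleftrightarrow>
          smooth_on n (\<psi> ` (V \<inter> (topspace T - K))) (\<lambda>x. 0)"
      proof (rule smooth_on_cong[OF W])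
        fix y assume "y \<in> \<psi> ` (V \<inter> (topspace T - K))"
        then have "inv_into V \<psi> y \<notin> K" using inv_chart[OF d] by auto
        then show "?g (inv_into V \<psi> y) = 0" by (rule zero)
      qed
      then have "smooth_on n (\<psi> ` (V \<inter> (topspace T - K))) (\<lambda>x. ?g (inv_into V \<psi> x))"
        using smooth_on_const[OF W] by blast
      then show ?thesis using W p pK chart(3)[OF d] by (intro exI[of _ "\<psi> ` (V \<inter> (topspace T - K))"]) auto
    qed
  qed
qed

lemma bump_function:
  assumes S: "openin T S" and p: "p \<in> S"
  obtains \<rho> where "\<rho> \<in> elems R" "\<rho> p \<noteq> 0" "\<And>x. x \<in> topspace T \<Longrightarrow> \<rho> x \<noteq> 0 \<Longrightarrow> x \<in> S"
proof -
  have pT: "p \<in> topspace T" using S p openin_subset by blast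
  obtain U \<phi> where c: "(U, \<phi>) \<in> \<A>" "p \<in> U" using chart_cover[OF pT] by blast
  have "ropen n (\<phi> ` (U \<inter> S))" by (rule chart_image_open[OF c(1) S])
  moreover have "\<phi> p \<in> \<phi> ` (U \<inter> S)" using c(2) p by blast
  ultimately obtain e where e: "e > 0" "\<And>y. y \<in> Rn n \<Longrightarrow> (\<And>i. i < n \<Longrightarrow> \<bar>y i - \<phi> p i\<bar> < e) \<Longrightarrow> y \<in> \<phi> ` (U \<inter> S)"
    using ropen_box by metis
  obtain \<rho> where \<rho>: "smooth_on n (Rn n) \<rho>" "\<And>x. \<rho> x \<noteq> 0 \<longleftrightarrow> (\<forall>i<n. \<bar>x i - \<phi> p i\<bar> < e / 2)"
    using box_bump[of "e / 2" n "\<phi> p"] e(1) by (metis half_gt_zero)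
  have sub: "y \<in> \<phi> ` (U \<inter> S)" if "y \<in> Rn n" "\<forall>i<n. \<bar>y i - \<phi> p i\<bar> \<le> e / 2" for y
    by (rule e(2)[OF that(1)]) (use that(2) e(1) in fastforce)
  have "(\<lambda>q\<in>topspace T. if q \<in> U then \<rho> (\<phi> q) else 0) \<in> elems R"
  proof (rule extend_by_zero[OF c(1), where q = "\<phi> p" and r = "e / 2"])
    show "smooth_on n (\<phi> ` U) \<rho>"
      by (rule smooth_on_subset[OF \<rho>(1) ropen_Rn chart(2)[OF c(1)] ropen_subset[OF chart(2)[OF c(1)]]])
    show "{x \<in> Rn n. \<forall>i<n. \<bar>x i - \<phi> p i\<bar> \<le> e / 2} \<subseteq> \<phi> ` U" using sub by blast
  qed (use \<rho>(2) in fastforce)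
  moreover have "(\<lambda>q\<in>topspace T. if q \<in> U then \<rho> (\<phi> q) else 0) p \<noteq> 0" using pT c(2) \<rho>(2)[of "\<phi> p"] e(1) by simp
  moreover have "x \<in> S" if "x \<in> topspace T" "(\<lambda>q\<in>topspace T. if q \<in> U then \<rho> (\<phi> q) else 0) x \<noteq> 0" for x
  proof -
    have x: "x \<in> U" "\<rho> (\<phi> x) \<noteq> 0" using that by (auto split: if_splits)
    then have "\<phi> x \<in> \<phi> ` (U \<inter> S)"
      using sub[of "\<phi> x"] \<rho>(2)[of "\<phi> x"] ropen_subset[OF chart(2)[OF c(1)]] by fastforce
    then show "x \<in> S" using inj_onD[OF chart(5)[OF c(1)]] x(1) by blast
  qed
  ultimately show thesis using that by blast
qed

end

section \<open>Manifolds with corners\<close>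

lemma Mor_eq: "Mor X Y = cinf_hom (Cinf Y) (Cinf X)"
  by (simp add: Mor_def)

lemma is_intersectionE:
  assumes "is_intersection X J Y y Z z"
  obtains \<pi> where "\<forall>i\<in>J. \<pi> i \<in> Mor Z (Y i) \<and> mor_comp X (y i) (\<pi> i) = z"
    "\<forall>(W :: univ spec) w \<rho>. cinf_scheme W \<and> w \<in> Mor W X \<and>
       (\<forall>i\<in>J. \<rho> i \<in> Mor W (Y i) \<and> mor_comp X (y i) (\<rho> i) = w) \<longrightarrow>
       (\<exists>!u. u \<in> Mor W Z \<and> mor_comp X z u = w \<and> (\<forall>i\<in>J. mor_comp (Y i) (\<pi> i) u = \<rho> i))"
    "cinf_scheme Z" "z \<in> Mor Z X"
  using assms unfolding is_intersection_def by (elim conjE exE) (rule that)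

lemma mor_compD: "mor_comp Z g f = h \<Longrightarrow> a \<in> elems (Cinf Z) \<Longrightarrow> f (g a) = h a"
  unfolding mor_comp_def by (rule composeD)

context smooth_mfd
begin

abbreviation evpt :: "'p \<Rightarrow> ('p \<Rightarrow> real) \<Rightarrow> ('p \<Rightarrow> real) set" where
  "evpt p \<equiv> (\<lambda>g\<in>elems R. germ (principal {p}) g)"

lemma evpt_hom: "p \<in> topspace T \<Longrightarrow> evpt p \<in> cinf_hom R (point_ring p)"
  by (rule restriction_hom) (simp add: eventually_principal)

text \<open>Evaluation at \<open>p\<close> inverts every \<open>a f\<close>, so it factors through
  each \<open>V f\<close> and then through their fibre product. A function that becomes zero on
  \<open>W\<close> is therefore zero at \<open>p\<close>.\<close>

lemma intersection_point:
  fixes V :: "('p \<Rightarrow> real) \<Rightarrow> univ spec" and W :: "univ spec"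
  assumes a: "\<And>f. f \<in> F \<Longrightarrow> a f \<in> elems R"
    and V: "\<And>f. f \<in> F \<Longrightarrow> universal_inversion R (a f) (Cinf (V f)) (v f)"
    and W: "is_intersection (manifold_scheme n T \<A>) F V v W w"
    and p: "p \<in> topspace T" "\<And>f. f \<in> F \<Longrightarrow> a f p \<noteq> 0"
    and h: "h \<in> elems R" "w h = \<zero>\<^bsub>ring_of (Cinf W)\<^esub>"
  shows "h p = 0"
proof -
  \<comment> \<open>The fibre product is tested only with schemes on \<open>univ\<close>, so
    evaluation at \<open>p\<close> is moved to the copy \<open>G\<close> of the reals.\<close>
  obtain G :: "univ cinf_ring" and \<iota> where G: "fin_gen G" "\<iota> \<in> cinf_iso G (point_ring p)" by (rule point_ring_univ)
  note GR = fin_gen_cinf_ring[OF G(1)]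
  have i: "\<iota> \<in> cinf_hom G (point_ring p)" using G(2) by (simp add: cinf_iso_def)
  obtain g where g: "g \<in> cinf_iso (point_ring p) G" "\<And>b. b \<in> elems (point_ring p) \<Longrightarrow> \<iota> (g b) = b"
    using iso_inverse[OF GR cinf_ring_germ_ring G(2)] by metis
  have gh: "g \<in> cinf_hom (point_ring p) G" using g(1) by (simp add: cinf_iso_def)
  let ?e = "compose (elems R) g (evpt p)"
  have e: "?e \<in> cinf_hom R G" by (rule cinf_hom_compose[OF cinf_ring_R evpt_hom[OF p(1)] gh])
  have "\<exists>k. k \<in> cinf_hom (Cinf (V f)) G \<and> compose (elems R) k (v f) = ?e" if f: "f \<in> F" for f
  proof -
    have "evpt p (a f) \<in> Units (ring_of (point_ring p))"
      using a[OF f] p(2)[OF f] by (simp add: germ_Units_iff eventually_principal)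
    then have "?e (a f) \<in> Units (ring_of G)" using hom_Units[OF cinf_ring_germ_ring GR gh] a[OF f] by (simp add: compose_def)
    then show ?thesis using universal_inversionD(4)[OF V[OF f] G(1) e] by blast
  qed
  then obtain \<rho> where \<rho>: "\<And>f. f \<in> F \<Longrightarrow> \<rho> f \<in> cinf_hom (Cinf (V f)) G" "\<And>f. f \<in> F \<Longrightarrow> compose (elems R) (\<rho> f) (v f) = ?e" by metis
  obtain \<pi> where \<pi>: "\<forall>i\<in>F. \<pi> i \<in> Mor W (V i) \<and> mor_comp (manifold_scheme n T \<A>) (v i) (\<pi> i) = w"
    and un: "\<forall>(W' :: univ spec) w' \<rho>. cinf_scheme W' \<and> w' \<in> Mor W' (manifold_scheme n T \<A>) \<and>
      (\<forall>i\<in>F. \<rho> i \<in> Mor W' (V i) \<and> mor_comp (manifold_scheme n T \<A>) (v i) (\<rho> i) = w') \<longrightarrow>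
      (\<exists>!u. u \<in> Mor W' W \<and> mor_comp (manifold_scheme n T \<A>) w u = w' \<and> (\<forall>i\<in>F. mor_comp (V i) (\<pi> i) u = \<rho> i))"
    and "cinf_scheme W"
    by (rule is_intersectionE[OF W]) (rule that)
  then have WR: "fin_gen (Cinf W)" by (simp add: cinf_scheme_def)
  have "\<exists>!u. u \<in> Mor (Spec G) W \<and> mor_comp (manifold_scheme n T \<A>) w u = ?e \<and> (\<forall>i\<in>F. mor_comp (V i) (\<pi> i) u = \<rho> i)"
  proof (rule un[THEN spec[of _ "Spec G"], THEN spec[of _ ?e], THEN spec[of _ \<rho>], THEN mp], intro conjI ballI)
    show "cinf_scheme (Spec G)" unfolding cinf_scheme_def spec.sel by (rule G(1))
    show "?e \<in> Mor (Spec G) (manifold_scheme n T \<A>)" unfolding Mor_def spec.sel by (rule e)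
    show "\<rho> i \<in> Mor (Spec G) (V i)" if "i \<in> F" for i unfolding Mor_def spec.sel by (rule \<rho>(1)[OF that])
    show "mor_comp (manifold_scheme n T \<A>) (v i) (\<rho> i) = ?e" if "i \<in> F" for i
      unfolding mor_comp_def by (rule \<rho>(2)[OF that])
  qed
  then obtain u where u: "u \<in> cinf_hom (Cinf W) G" "mor_comp (manifold_scheme n T \<A>) w u = ?e"
    unfolding Mor_def by auto
  have "?e h = \<zero>\<^bsub>ring_of G\<^esub>"
    using mor_compD[OF u(2) h(1)] h(2) hom_zero[OF u(1) fin_gen_cinf_ring[OF WR] GR] by simp
  then have "g (evpt p h) = \<zero>\<^bsub>ring_of G\<^esub>" using h(1) by (simp add: compose_def)
  then have "evpt p h = \<zero>\<^bsub>ring_of (point_ring p)\<^esub>"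
    using g(2)[OF cinf_homD(2)[OF evpt_hom[OF p(1)] h(1)]] hom_zero[OF i GR cinf_ring_germ_ring] by simp
  then show "h p = 0" using h(1) by (simp add: germ_ring_ops germ_eq_iff eventually_principal)
qed

text \<open>The product of \<open>h\<close> with all \<open>a f\<close> is the zero function on the
  manifold, and the \<open>a f\<close> become units on \<open>W\<close>. The induction cancels one
  factor at a time.\<close>

lemma intersection_kernel:
  fixes V :: "('p \<Rightarrow> real) \<Rightarrow> univ spec" and W :: "univ spec"
  assumes fin: "finite F" and a: "\<And>f. f \<in> F \<Longrightarrow> a f \<in> elems R"
    and V: "\<And>f. f \<in> F \<Longrightarrow> universal_inversion R (a f) (Cinf (V f)) (v f)"
    and W: "is_intersection (manifold_scheme n T \<A>) F V v W w"
    and h: "h \<in> elems R" "\<And>p. p \<in> topspace T \<Longrightarrow> (\<And>f. f \<in> F \<Longrightarrow> a f p \<noteq> 0) \<Longrightarrow> h p = 0"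
  shows "w h = \<zero>\<^bsub>ring_of (Cinf W)\<^esub>"
proof -
  have WR: "cinf_ring (Cinf W)" and wh: "w \<in> cinf_hom R (Cinf W)"
    using W by (auto simp: is_intersection_def cinf_scheme_def Mor_def fin_gen_cinf_ring)
  interpret RW: cring "ring_of (Cinf W)" by (rule cinf_ring.cring_ring_of[OF WR])
  interpret RR: cring "ring_of R" by (rule cinf_ring.cring_ring_of[OF cinf_ring_R])
  have unit: "w (a f) \<in> Units (ring_of (Cinf W))" if f: "f \<in> F" for f
  proof -
    obtain \<pi> where \<pi>: "\<pi> f \<in> cinf_hom (Cinf (V f)) (Cinf W)" "mor_comp (manifold_scheme n T \<A>) (v f) (\<pi> f) = w"
      using W f unfolding is_intersection_def Mor_def by blast
    show ?thesis
      using hom_Units[OF fin_gen_cinf_ring[OF universal_inversionD(1)[OF V[OF f]]] WR \<pi>(1) universal_inversionD(3)[OF V[OF f]]]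
        mor_compD[OF \<pi>(2) a[OF f]] by simp
  qed
  have "w h = \<zero>\<^bsub>ring_of (Cinf W)\<^esub>" if "finite F'" "F' \<subseteq> F" "h \<in> elems R"
    "\<And>p. p \<in> topspace T \<Longrightarrow> (\<And>f. f \<in> F' \<Longrightarrow> a f p \<noteq> 0) \<Longrightarrow> h p = 0" for F' h
    using that
  proof (induction F' arbitrary: h rule: finite_induct)
    case empty
    have "h = \<zero>\<^bsub>ring_of R\<^esub>"
      unfolding R_zero using fun_ext[OF empty.prems(2)] empty.prems(3) by (intro extensionalityI[where A = "topspace T"]) auto
    then show ?case using hom_zero[OF wh cinf_ring_R WR] by simp
  next
    case (insert f F')
    have f: "f \<in> F" "a f \<in> elems R" using insert.prems(1) a by auto
    have ha: "h \<otimes>\<^bsub>ring_of R\<^esub> a f \<in> elems R" using RR.m_closed[of h "a f"] insert.prems(2) f(2) by simp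
    have "w (h \<otimes>\<^bsub>ring_of R\<^esub> a f) = \<zero>\<^bsub>ring_of (Cinf W)\<^esub>"
    proof (rule insert.IH[OF _ ha])
      fix p assume p: "p \<in> topspace T" "\<And>f. f \<in> F' \<Longrightarrow> a f p \<noteq> 0"
      show "(h \<otimes>\<^bsub>ring_of R\<^esub> a f) p = 0"
        using R_mult[OF insert.prems(2) f(2) p(1)] insert.prems(3)[OF p(1)] p(2) by (cases "a f p = 0") auto
    qed (use insert.prems in auto)
    then have prod0: "w h \<otimes>\<^bsub>ring_of (Cinf W)\<^esub> w (a f) = \<zero>\<^bsub>ring_of (Cinf W)\<^esub>"
      using hom_mult[OF wh cinf_ring_R WR insert.prems(2) f(2)] by simp
    obtain b where b: "b \<in> elems (Cinf W)" "b \<otimes>\<^bsub>ring_of (Cinf W)\<^esub> w (a f) = \<one>\<^bsub>ring_of (Cinf W)\<^esub>"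
      by (rule Units_inverseE[OF WR unit[OF f(1)]])
    have c: "w h \<in> carrier (ring_of (Cinf W))" "w (a f) \<in> carrier (ring_of (Cinf W))" "b \<in> carrier (ring_of (Cinf W))"
      using cinf_homD(2)[OF wh] insert.prems(2) f(2) b(1) by simp_all
    have "w h = w h \<otimes>\<^bsub>ring_of (Cinf W)\<^esub> (w (a f) \<otimes>\<^bsub>ring_of (Cinf W)\<^esub> b)"
      using b(2) RW.m_comm[OF c(3,2)] RW.r_one[OF c(1)] by simp
    also have "\<dots> = \<zero>\<^bsub>ring_of (Cinf W)\<^esub>"
      using prod0 RW.m_assoc[OF c(1,2,3)] RW.l_null[OF c(3)] by simp
    finally show ?case .
  qed
  from this[OF fin order_refl h] show ?thesis .
qed

end

text \<open>The two containments compose to an endomorphism of the fibre product over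
  \<open>M\<close>. It respects the projections because the closed inclusions are surjective on
  functions, so uniqueness makes it the identity.\<close>

lemma intersection_quotient:
  fixes M :: "('p \<Rightarrow> real) spec" and Y :: "univ spec" and I :: "'i \<Rightarrow> ('p \<Rightarrow> real) set"
  assumes MR: "cinf_ring (Cinf M)" and K: "cinf_ideal (Cinf M) K"
    and Y: "is_intersection M F (\<lambda>f. closed_subscheme M (I f)) (\<lambda>f. closed_incl M (I f)) Y y"
    and le1: "subscheme_le M Y y (closed_subscheme M K) (closed_incl M K)"
    and le2: "subscheme_le M (closed_subscheme M K) (closed_incl M K) Y y"
  shows "y ` elems (Cinf M) = elems (Cinf Y)"
    and "r \<in> elems (Cinf M) \<Longrightarrow> y r = \<zero>\<^bsub>ring_of (Cinf Y)\<^esub> \<longleftrightarrow> r \<in> K"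
proof -
  interpret K: cinf_ideal "Cinf M" K by (rule K)
  let ?Q = "quot (Cinf M) K" and ?q = "quot_map (Cinf M) K"
  have YR: "fin_gen (Cinf Y)" and yh: "y \<in> cinf_hom (Cinf M) (Cinf Y)"
    using Y by (auto simp: is_intersection_def cinf_scheme_def Mor_def)
  note YR' = fin_gen_cinf_ring[OF YR]
  obtain u where u: "u \<in> cinf_hom ?Q (Cinf Y)" "mor_comp M ?q u = y"
    using le1 by (auto simp: subscheme_le_def Mor_def closed_subscheme_def closed_incl_def)
  obtain u' where u': "u' \<in> cinf_hom (Cinf Y) ?Q" "mor_comp M y u' = ?q"
    using le2 by (auto simp: subscheme_le_def Mor_def closed_subscheme_def closed_incl_def)
  note uq = mor_compD[OF u(2)] and u'y = mor_compD[OF u'(2)]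
  obtain \<pi> where \<pi>': "\<forall>i\<in>F. \<pi> i \<in> Mor Y (closed_subscheme M (I i)) \<and> mor_comp M (closed_incl M (I i)) (\<pi> i) = y"
    and un: "\<forall>(W :: univ spec) w \<rho>. cinf_scheme W \<and> w \<in> Mor W M \<and>
      (\<forall>i\<in>F. \<rho> i \<in> Mor W (closed_subscheme M (I i)) \<and> mor_comp M (closed_incl M (I i)) (\<rho> i) = w) \<longrightarrow>
      (\<exists>!u. u \<in> Mor W Y \<and> mor_comp M y u = w \<and> (\<forall>i\<in>F. mor_comp (closed_subscheme M (I i)) (\<pi> i) u = \<rho> i))"
    by (rule is_intersectionE[OF Y]) (rule that)
  have \<pi>: "\<pi> f \<in> Mor Y (closed_subscheme M (I f))" "mor_comp M (closed_incl M (I f)) (\<pi> f) = y" if "f \<in> F" for f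
    using \<pi>' that by blast+
  have ex: "\<exists>!k. k \<in> Mor Y Y \<and> mor_comp M y k = y \<and> (\<forall>i\<in>F. mor_comp (closed_subscheme M (I i)) (\<pi> i) k = \<pi> i)"
  proof (rule un[THEN spec[of _ Y], THEN spec[of _ y], THEN spec[of _ \<pi>], THEN mp], intro conjI ballI)
    show "cinf_scheme Y" unfolding cinf_scheme_def by (rule YR)
    show "y \<in> Mor Y M" unfolding Mor_def by (rule yh)
  qed (rule \<pi>, assumption)+
  have good: "k \<in> Mor Y Y \<and> mor_comp M y k = y \<and> (\<forall>i\<in>F. mor_comp (closed_subscheme M (I i)) (\<pi> i) k = \<pi> i)"
    if k: "k \<in> cinf_hom (Cinf Y) (Cinf Y)" "\<And>r. r \<in> elems (Cinf M) \<Longrightarrow> k (y r) = y r" for k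
  proof (intro conjI ballI)
    show "k \<in> Mor Y Y" using k(1) by (simp add: Mor_def)
    show "mor_comp M y k = y" unfolding mor_comp_def by (rule compose_eqI[OF yh]) (rule k(2))
    fix i assume i: "i \<in> F"
    show "mor_comp (closed_subscheme M (I i)) (\<pi> i) k = \<pi> i"
      unfolding mor_comp_def
    proof (rule compose_eqI)
      show "\<pi> i \<in> cinf_hom (Cinf (closed_subscheme M (I i))) (Cinf Y)" using \<pi>(1)[OF i] by (simp add: Mor_def)
      fix c assume "c \<in> elems (Cinf (closed_subscheme M (I i)))"
      then obtain r where r: "r \<in> elems (Cinf M)" "c = quot_map (Cinf M) (I i) r"
        by (auto simp: closed_subscheme_def elim: quot_elemE)
      have "\<pi> i c = y r" using mor_compD[OF \<pi>(2)[OF i] r(1)] r(2) by (simp add: closed_incl_def)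
      then show "k (\<pi> i c) = \<pi> i c" using k(2)[OF r(1)] by simp
    qed
  qed
  have idc: "compose (elems (Cinf Y)) u u' = (\<lambda>c\<in>elems (Cinf Y). c)"
  proof -
    have "compose (elems (Cinf Y)) u u' (y r) = y r" if "r \<in> elems (Cinf M)" for r
      using u'y[OF that] uq[OF that] cinf_homD(2)[OF yh that] by (simp add: compose_def)
    note g1 = good[OF cinf_hom_compose[OF YR' u'(1) u(1)] this]
    have "(\<lambda>c\<in>elems (Cinf Y). c) (y r) = y r" if "r \<in> elems (Cinf M)" for r
      using cinf_homD(2)[OF yh that] by simp
    note g2 = good[OF cinf_hom_id[OF YR'] this]
    show ?thesis using ex g1 g2 by blast
  qed
  have uu: "u (u' c) = c" if "c \<in> elems (Cinf Y)" for c using composeD[OF idc that] that by simp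
  show "y ` elems (Cinf M) = elems (Cinf Y)"
  proof
    show "elems (Cinf Y) \<subseteq> y ` elems (Cinf M)"
    proof
      fix c assume c: "c \<in> elems (Cinf Y)"
      obtain r where r: "r \<in> elems (Cinf M)" "u' c = ?q r" by (rule quot_elemE[OF cinf_homD(2)[OF u'(1) c]])
      then have "c = y r" using uu[OF c] uq[OF r(1)] by simp
      then show "c \<in> y ` elems (Cinf M)" using r(1) by (rule image_eqI)
    qed
  qed (use cinf_homD(2)[OF yh] in blast)
  assume r: "r \<in> elems (Cinf M)"
  have "y r = \<zero>\<^bsub>ring_of (Cinf Y)\<^esub> \<longleftrightarrow> ?q r = \<zero>\<^bsub>ring_of ?Q\<^esub>"
    using u'y[OF r] uq[OF r] hom_zero[OF u(1) K.cinf_ring_quot YR'] hom_zero[OF u'(1) YR' K.cinf_ring_quot] by metis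
  then show "y r = \<zero>\<^bsub>ring_of (Cinf Y)\<^esub> \<longleftrightarrow> r \<in> K" using K.quot_map_zero_iff[OF r] by simp
qed

text \<open>What is kept of a manifold with corners: it is the closure of its interior
  \<open>W\<close>, so its functions are the ambient ones up to agreement on \<open>W\<close>, and
  interior points see everything.\<close>

locale corner_ring = smooth_mfd n T \<A>
  for n and T :: "'p topology" and \<A> +
  fixes W and q :: "('p \<Rightarrow> real) \<Rightarrow> 'c" and C :: "'c cinf_ring"
  assumes W: "openin T W" and C: "fin_gen C" and q: "q \<in> cinf_hom R C" and surj: "q ` elems R = elems C"
    and q_zero_iff: "h \<in> elems R \<Longrightarrow> q h = \<zero>\<^bsub>ring_of C\<^esub> \<longleftrightarrow> (\<forall>p\<in>W. h p = 0)"

lemma corner_ring_exists: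
  fixes X :: "'a spec"
  assumes "manifold_with_corners n X"
  obtains T :: "(nat \<Rightarrow> real) topology" and \<A> W q where "corner_ring n T \<A> W q (Cinf X)"
proof -
  obtain T :: "(nat \<Rightarrow> real) topology" and \<A> F and Y :: "univ spec" and y and V :: "((nat \<Rightarrow> real) \<Rightarrow> real) \<Rightarrow> univ spec" and v
      and W :: "univ spec" and w where
    X: "cinf_scheme X" and mfd: "smooth_manifold n T \<A>" and F: "finite F" "F \<subseteq> manifold_funs n T \<A>"
    and Y: "is_intersection (manifold_scheme n T \<A>) F (\<lambda>f. closed_subscheme (manifold_scheme n T \<A>) (le_ideal (manifold_scheme n T \<A>) f 0))
              (\<lambda>f. closed_incl (manifold_scheme n T \<A>) (le_ideal (manifold_scheme n T \<A>) f 0)) Y y"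
    and V: "\<forall>f\<in>F. lt_subscheme (manifold_scheme n T \<A>) f 0 (V f) (v f)"
    and W: "is_intersection (manifold_scheme n T \<A>) F V v W w"
    and le: "subscheme_le (manifold_scheme n T \<A>) Y y (closure_scheme (manifold_scheme n T \<A>) W w) (closure_incl (manifold_scheme n T \<A>) W w)"
      "subscheme_le (manifold_scheme n T \<A>) (closure_scheme (manifold_scheme n T \<A>) W w) (closure_incl (manifold_scheme n T \<A>) W w) Y y"
    and iso: "isomorphic X Y"
    using assms unfolding manifold_with_corners_def Let_def by (elim conjE exE) (rule that)
  interpret smooth_mfd n T \<A> by (rule smooth_mfd.intro[OF mfd])
  let ?M = "manifold_scheme n T \<A>"
  define K where "K = closure_ideal ?M W w"
  have WR: "cinf_ring (Cinf W)" and wh: "w \<in> cinf_hom R (Cinf W)"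
    using W by (auto simp: is_intersection_def cinf_scheme_def Mor_def fin_gen_cinf_ring)
  have K_eq: "K = {h \<in> elems R. w h = \<zero>\<^bsub>ring_of (Cinf W)\<^esub>}"
    by (simp add: K_def closure_ideal_def a_kernel_def')
  have K: "cinf_ideal R K"
    unfolding K_eq using kernel_ideal[OF cinf_ring_R WR wh] cinf_ring_R
    by (simp add: cinf_ideal_def cinf_ideal_axioms_def)
  let ?a = "\<lambda>f. apply1 R (alpha_ge 0) f"
  have a: "?a f \<in> elems R" if "f \<in> F" for f
    unfolding apply1_def
    by (rule cinf_ring.sop_closed[OF cinf_ring_R alpha_ge_smooth]) (use that F(2) in \<open>auto simp: elems_R intro!: tupI\<close>)
  have V': "universal_inversion R (?a f) (Cinf (V f)) (v f)" if "f \<in> F" for f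
    using V that by (auto simp: lt_subscheme_def open_subscheme_def)
  \<comment> \<open>\<open>alpha_ge 0\<close> vanishes exactly on the non-negative numbers, so
    \<open>W0\<close> is the open set where all members of \<open>F\<close> are negative.\<close>
  define W0 where "W0 = {p \<in> topspace T. \<forall>f\<in>F. ?a f p \<noteq> 0}"
  have "openin T {p \<in> topspace T. ?a f p \<in> - {0}}" if "f \<in> F" for f
    using openin_continuous_map_preimage[OF fun_continuous[OF a[OF that]], of "- {0}"] by (simp add: open_Compl)
  then have "openin T (topspace T \<inter> (\<Inter>f\<in>F. {p \<in> topspace T. ?a f p \<in> - {0}}))"
    by (cases "F = {}") (auto intro!: openin_Int openin_INT F(1) simp: openin_Inter)
  moreover have "topspace T \<inter> (\<Inter>f\<in>F. {p \<in> topspace T. ?a f p \<in> - {0}}) = W0" by (auto simp: W0_def)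
  ultimately have W0: "openin T W0" by simp
  have K_iff: "h \<in> K \<longleftrightarrow> (\<forall>p\<in>W0. h p = 0)" if h: "h \<in> elems R" for h
  proof
    assume "h \<in> K"
    then have "w h = \<zero>\<^bsub>ring_of (Cinf W)\<^esub>" by (simp add: K_eq)
    then show "\<forall>p\<in>W0. h p = 0" using intersection_point[OF a V' W _ _ h] unfolding W0_def by blast
  next
    assume "\<forall>p\<in>W0. h p = 0"
    then have "w h = \<zero>\<^bsub>ring_of (Cinf W)\<^esub>"
      by (intro intersection_kernel[OF F(1) a V' W h]) (auto simp: W0_def)
    then show "h \<in> K" using h by (simp add: K_eq)
  qed
  have le': "subscheme_le ?M Y y (closed_subscheme ?M K) (closed_incl ?M K)"
      "subscheme_le ?M (closed_subscheme ?M K) (closed_incl ?M K) Y y"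
    using le by (simp_all add: closure_scheme_def closure_incl_def K_def)
  note yq = intersection_quotient[OF cinf_ring_R K Y le']
  have YR: "cinf_ring (Cinf Y)" and yh: "y \<in> cinf_hom R (Cinf Y)"
    using Y by (auto simp: is_intersection_def cinf_scheme_def Mor_def fin_gen_cinf_ring)
  have XR: "fin_gen (Cinf X)" using X by (simp add: cinf_scheme_def)
  note XR' = fin_gen_cinf_ring[OF XR]
  obtain \<theta> where \<theta>: "\<theta> \<in> cinf_iso (Cinf Y) (Cinf X)" using iso by (auto simp: isomorphic_def)
  then have th: "\<theta> \<in> cinf_hom (Cinf Y) (Cinf X)" "inj_on \<theta> (elems (Cinf Y))" "\<theta> ` elems (Cinf Y) = elems (Cinf X)"
    by (auto simp: cinf_iso_def bij_betw_def)
  define q where "q = compose (elems R) \<theta> y"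
  have "corner_ring n T \<A> W0 q (Cinf X)"
  proof
    show "openin T W0" by (rule W0)
    show "fin_gen (Cinf X)" by (rule XR)
    show "q \<in> cinf_hom R (Cinf X)" unfolding q_def by (rule cinf_hom_compose[OF cinf_ring_R yh th(1)])
    have "q ` elems R = \<theta> ` y ` elems R" unfolding q_def image_image by (rule image_cong) (auto simp: compose_def)
    then show "q ` elems R = elems (Cinf X)" by (simp add: yq(1) th(3))
    fix h assume h: "h \<in> elems R"
    have "q h = \<zero>\<^bsub>ring_of (Cinf X)\<^esub> \<longleftrightarrow> \<theta> (y h) = \<theta> \<zero>\<^bsub>ring_of (Cinf Y)\<^esub>"
      using h hom_zero[OF th(1) YR XR'] by (simp add: q_def compose_def)
    also have "\<dots> \<longleftrightarrow> y h = \<zero>\<^bsub>ring_of (Cinf Y)\<^esub>"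
      using inj_on_eq_iff[OF th(2) cinf_homD(2)[OF yh h] cinf_ring.zero_closed[OF YR]] .
    also have "\<dots> \<longleftrightarrow> (\<forall>p\<in>W0. h p = 0)" using yq(2)[OF h] K_iff[OF h] by simp
    finally show "q h = \<zero>\<^bsub>ring_of (Cinf X)\<^esub> \<longleftrightarrow> (\<forall>p\<in>W0. h p = 0)" .
  qed
  then show thesis by (rule that)
qed

section \<open>Regular systems\<close>

lemma is_coneD:
  assumes "is_cone M D r U j Z \<pi>"
  shows "fin_gen (Cinf Z)" "i \<in> D \<Longrightarrow> \<pi> i \<in> cinf_hom (Cinf (U i)) (Cinf Z)"
    "(i, k) \<in> r \<Longrightarrow> t \<in> cinf_hom (Cinf (U i)) (Cinf (U k)) \<Longrightarrow> mor_comp M (j i) t = j k \<Longrightarrow>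
      e \<in> elems (Cinf (U i)) \<Longrightarrow> \<pi> k (t e) = \<pi> i e"
  using assms unfolding is_cone_def cinf_scheme_def Mor_eq by (blast, blast, metis mor_compD)

lemma is_limitE:
  assumes "is_limit M D r U j Z"
  obtains \<pi> where "is_cone M D r U j Z \<pi>"
    "\<forall>(W :: univ spec) \<rho>. is_cone M D r U j W \<rho> \<longrightarrow> (\<exists>!u. u \<in> Mor W Z \<and> (\<forall>i\<in>D. mor_comp (U i) (\<pi> i) u = \<rho> i))"
  using assms unfolding is_limit_def by (elim conjE exE) (rule that)

locale regular_sys =
  fixes M :: "'c spec" and D :: "'i set" and r and U :: "'i \<Rightarrow> univ spec" and j :: "'i \<Rightarrow> 'c \<Rightarrow> univ"
  assumes rs: "regular_system M D r U j" and M_fin_gen: "fin_gen (Cinf M)"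
begin

lemmas M_ring = fin_gen_cinf_ring[OF M_fin_gen]

lemma order: "(i, k) \<in> r \<Longrightarrow> i \<in> D \<and> k \<in> D" "i \<in> D \<Longrightarrow> (i, i) \<in> r"
    "(i, k) \<in> r \<Longrightarrow> (k, l) \<in> r \<Longrightarrow> (i, l) \<in> r" "(i, k) \<in> r \<Longrightarrow> (k, i) \<in> r \<Longrightarrow> i = k"
  and D_ne: "D \<noteq> {}"
  and directed: "i \<in> D \<Longrightarrow> k \<in> D \<Longrightarrow> \<exists>l\<in>D. (i, l) \<in> r \<and> (k, l) \<in> r"
proof -
  have po: "partial_order_on D r" and "D \<noteq> {}" and dir: "\<forall>i\<in>D. \<forall>k\<in>D. \<exists>l\<in>D. (i, l) \<in> r \<and> (k, l) \<in> r"
    using rs[unfolded regular_system_def] by - (elim conjE, assumption)+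
  then show "D \<noteq> {}" "i \<in> D \<Longrightarrow> k \<in> D \<Longrightarrow> \<exists>l\<in>D. (i, l) \<in> r \<and> (k, l) \<in> r" by blast+
  show "(i, k) \<in> r \<Longrightarrow> i \<in> D \<and> k \<in> D" using po unfolding partial_order_on_def preorder_on_def by blast
  show "i \<in> D \<Longrightarrow> (i, i) \<in> r" using po unfolding partial_order_on_def preorder_on_def refl_on_def by blast
  show "(i, k) \<in> r \<Longrightarrow> (k, l) \<in> r \<Longrightarrow> (i, l) \<in> r" using po unfolding partial_order_on_def preorder_on_def by (meson transD)
  show "(i, k) \<in> r \<Longrightarrow> (k, i) \<in> r \<Longrightarrow> i = k" using po unfolding partial_order_on_def by (meson antisymD)
qed

definition g :: "'i \<Rightarrow> 'c" where
  "g i = (SOME f. open_subscheme M f (U i) (j i))"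

lemma
  assumes "i \<in> D"
  shows g_in: "g i \<in> elems (Cinf M)" and inversion: "universal_inversion (Cinf M) (g i) (Cinf (U i)) (j i)"
    and U_nonzero: "\<not> is_zero_ring (Cinf (U i))"
proof -
  have "\<exists>f. open_subscheme M f (U i) (j i)" and ne: "\<not> is_empty_scheme (U i)"
    using rs assms unfolding regular_system_def by blast+
  from someI_ex[OF this(1)] show "g i \<in> elems (Cinf M)" "universal_inversion (Cinf M) (g i) (Cinf (U i)) (j i)"
    unfolding g_def[symmetric] by (simp_all add: open_subscheme_def)
  show "\<not> is_zero_ring (Cinf (U i))" using ne by (simp add: is_empty_scheme_def)
qed

lemma U_fin_gen: "i \<in> D \<Longrightarrow> fin_gen (Cinf (U i))"
  and j_hom: "i \<in> D \<Longrightarrow> j i \<in> cinf_hom (Cinf M) (Cinf (U i))"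
  using universal_inversionD[OF inversion] by blast+

lemma U_ring: "i \<in> D \<Longrightarrow> cinf_ring (Cinf (U i))"
  using U_fin_gen fin_gen_cinf_ring by blast

text \<open>The transition morphisms of the diagram, on the level of functions.\<close>

definition over :: "'i \<Rightarrow> 'i \<Rightarrow> (univ \<Rightarrow> univ) \<Rightarrow> bool" where
  "over i k t \<longleftrightarrow> t \<in> cinf_hom (Cinf (U i)) (Cinf (U k)) \<and> mor_comp M (j i) t = j k"

lemma overD: "over i k t \<Longrightarrow> a \<in> elems (Cinf M) \<Longrightarrow> t (j i a) = j k a"
  unfolding over_def by (auto dest: mor_compD)

lemma over_refl: "i \<in> D \<Longrightarrow> over i i (\<lambda>e\<in>elems (Cinf (U i)). e)"
  unfolding over_def mor_comp_def
  by (intro conjI cinf_hom_id U_ring compose_eqI[OF j_hom]) (auto dest: cinf_homD(2)[OF j_hom])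

text \<open>The condition on closures enters here. A function on \<open>U i\<close> restricts to the
  closure of \<open>U k\<close>, a closed subscheme of \<open>M\<close>, where it is the class of a
  function on \<open>M\<close>. At a strictly later index it therefore comes from the ambient
  scheme.\<close>

lemma over_strict:
  assumes ik: "(i, k) \<in> r" "i \<noteq> k"
  obtains t where "over i k t" "t ` elems (Cinf (U i)) \<subseteq> j k ` elems (Cinf M)"
proof -
  have D: "i \<in> D" "k \<in> D" using order(1)[OF ik(1)] by auto
  let ?K = "closure_ideal M (U k) (j k)"
  have K_eq: "?K = {a \<in> elems (Cinf M). j k a = \<zero>\<^bsub>ring_of (Cinf (U k))\<^esub>}"
    by (simp add: closure_ideal_def a_kernel_def')
  interpret K: cinf_ideal "Cinf M" ?K
    unfolding K_eq using kernel_ideal[OF M_ring U_ring[OF D(2)] j_hom[OF D(2)]] M_ring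
    by (simp add: cinf_ideal_def cinf_ideal_axioms_def)
  let ?q = "quot_map (Cinf M) ?K"
  have "subscheme_le M (closure_scheme M (U k) (j k)) (closure_incl M (U k) (j k)) (U i) (j i)"
    using rs ik unfolding regular_system_def by blast
  then obtain u where u: "u \<in> cinf_hom (Cinf (U i)) (quot (Cinf M) ?K)" "mor_comp M (j i) u = ?q"
    by (auto simp: subscheme_le_def Mor_def closure_scheme_def closure_incl_def closed_subscheme_def closed_incl_def)
  obtain s where s: "s \<in> cinf_hom (quot (Cinf M) ?K) (Cinf (U k))" "\<And>a. a \<in> elems (Cinf M) \<Longrightarrow> s (?q a) = j k a"
  proof -
    have "j k a = \<zero>\<^bsub>ring_of (Cinf (U k))\<^esub>" if "a \<in> elems (Cinf M)" "?q a = \<zero>\<^bsub>ring_of (quot (Cinf M) ?K)\<^esub>" for a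
      using that K.quot_map_zero_iff[OF that(1)] by (simp add: K_eq)
    from surj_factor[OF M_ring K.cinf_ring_quot U_ring[OF D(2)] K.quot_map_hom quot_map_image j_hom[OF D(2)] this] that
    show thesis by blast
  qed
  let ?t = "compose (elems (Cinf (U i))) s u"
  have "over i k ?t"
    unfolding over_def mor_comp_def
  proof (intro conjI cinf_hom_compose[OF U_ring[OF D(1)] u(1) s(1)] compose_eqI[OF j_hom[OF D(2)]])
    show "?t (j i a) = j k a" if "a \<in> elems (Cinf M)" for a
      using that cinf_homD(2)[OF j_hom[OF D(1)] that] mor_compD[OF u(2) that] s(2)[OF that] by (simp add: compose_def)
  qed
  moreover have "?t ` elems (Cinf (U i)) \<subseteq> j k ` elems (Cinf M)"
  proof (rule image_subsetI)
    fix e assume e: "e \<in> elems (Cinf (U i))"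
    obtain a where a: "a \<in> elems (Cinf M)" "u e = ?q a" by (rule quot_elemE[OF cinf_homD(2)[OF u(1) e]])
    then have "?t e = j k a" using e s(2)[OF a(1)] by (simp add: compose_def)
    then show "?t e \<in> j k ` elems (Cinf M)" using a(1) by (rule image_eqI)
  qed
  ultimately show thesis by (rule that)
qed

lemma over_exists:
  assumes "(i, k) \<in> r"
  obtains t where "over i k t"
  using over_strict[OF assms] over_refl order(1)[OF assms] that by metis

text \<open>A cone over all of \<open>D\<close> has to fit into one finitely generated ring; an
  index that dominates all others lets a single \<open>U i0\<close> supply every value of the
  cone.\<close>

definition dominates :: "'i \<Rightarrow> 'i \<Rightarrow> bool" where
  "dominates i0 i \<longleftrightarrow> (\<exists>k t t0. (i, k) \<in> r \<and> (i0, k) \<in> r \<and> over i k t \<and> over i0 k t0 \<and>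
     t ` elems (Cinf (U i)) \<subseteq> t0 ` elems (Cinf (U i0)))"

text \<open>A cone in terms of elements, which may also take values in a germ ring, where
  \<open>is_cone\<close> would demand finite generation.\<close>

definition compatible :: "('i \<Rightarrow> univ \<Rightarrow> 'b) \<Rightarrow> bool" where
  "compatible L \<longleftrightarrow> (\<forall>i k t. (i, k) \<in> r \<longrightarrow> over i k t \<longrightarrow> (\<forall>e\<in>elems (Cinf (U i)). L k (t e) = L i e))"

lemma compatibleD: "compatible L \<Longrightarrow> (i, k) \<in> r \<Longrightarrow> over i k t \<Longrightarrow> e \<in> elems (Cinf (U i)) \<Longrightarrow> L k (t e) = L i e"
  unfolding compatible_def by blast

text \<open>A greatest index dominates directly. Otherwise every index has a strictly later one,
  where by \<open>over_strict\<close> all functions come from \<open>M\<close>, and these also come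
  from an arbitrary \<open>U i0\<close>.\<close>

lemma dominating:
  obtains i0 where "i0 \<in> D"
    "\<And>i. i \<in> D \<Longrightarrow> dominates i0 i"
proof (cases "\<exists>i0\<in>D. \<forall>i\<in>D. (i, i0) \<in> r")
  case True
  then obtain i0 where i0: "i0 \<in> D" "\<And>i. i \<in> D \<Longrightarrow> (i, i0) \<in> r" by blast
  show thesis
  proof (rule that[OF i0(1)])
    fix i assume i: "i \<in> D"
    obtain t where t: "over i i0 t" by (rule over_exists[OF i0(2)[OF i]])
    have "(\<lambda>e\<in>elems (Cinf (U i0)). e) ` elems (Cinf (U i0)) = elems (Cinf (U i0))" by (simp cong: image_cong)
    moreover have "t ` elems (Cinf (U i)) \<subseteq> elems (Cinf (U i0))"
      using t unfolding over_def by (intro image_subsetI) (auto intro: cinf_homD(2))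
    ultimately have "t ` elems (Cinf (U i)) \<subseteq> (\<lambda>e\<in>elems (Cinf (U i0)). e) ` elems (Cinf (U i0))" by simp
    then show "dominates i0 i" unfolding dominates_def
      using i0(2)[OF i] order(2)[OF i0(1)] t over_refl[OF i0(1)] by (intro exI conjI)
  qed
next
  case False
  obtain i0 where i0: "i0 \<in> D" using D_ne by blast
  show thesis
  proof (rule that[OF i0])
    fix i assume i: "i \<in> D"
    obtain l where l: "l \<in> D" "(i, l) \<in> r" "(i0, l) \<in> r" using directed[OF i i0] by blast
    obtain m where m: "m \<in> D" "(m, l) \<notin> r" using False l(1) by blast
    obtain k where k: "k \<in> D" "(l, k) \<in> r" "(m, k) \<in> r" using directed[OF l(1) m(1)] by blast
    have "k \<noteq> l" using k m by blast
    then have "i \<noteq> k" using l(2) k(2) order(4) by blast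
    have ik: "(i, k) \<in> r" "(i0, k) \<in> r" using order(3) l k by blast+
    obtain t where t: "over i k t" "t ` elems (Cinf (U i)) \<subseteq> j k ` elems (Cinf M)"
      by (rule over_strict[OF ik(1) \<open>i \<noteq> k\<close>])
    obtain t0 where t0: "over i0 k t0" by (rule over_exists[OF ik(2)])
    have "j k ` elems (Cinf M) \<subseteq> t0 ` elems (Cinf (U i0))"
    proof (rule image_subsetI)
      fix a assume a: "a \<in> elems (Cinf M)"
      show "j k a \<in> t0 ` elems (Cinf (U i0))"
        using imageI[OF cinf_homD(2)[OF j_hom[OF i0] a], of t0] unfolding overD[OF t0 a] .
    qed
    then have "t ` elems (Cinf (U i)) \<subseteq> t0 ` elems (Cinf (U i0))" using t(2) by (rule order_trans[rotated])
    then show "dominates i0 i" unfolding dominates_def using ik t(1) t0 by (intro exI conjI)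
  qed
qed

lemma compatible_image:
  assumes i0: "\<And>i. i \<in> D \<Longrightarrow> dominates i0 i"
    and L: "compatible L"
    and i: "i \<in> D" and e: "e \<in> elems (Cinf (U i))"
  shows "L i e \<in> L i0 ` elems (Cinf (U i0))"
proof -
  obtain k t t0 where kt: "(i, k) \<in> r" "(i0, k) \<in> r" "over i k t" "over i0 k t0"
    "t ` elems (Cinf (U i)) \<subseteq> t0 ` elems (Cinf (U i0))" using i0[OF i] unfolding dominates_def by blast
  then obtain e' where e': "e' \<in> elems (Cinf (U i0))" "t e = t0 e'" using e by blast
  have "L i e = L i0 e'" using compatibleD[OF L kt(1,3) e] compatibleD[OF L kt(2,4) e'(1)] e'(2) by simp
  then show ?thesis using e'(1) by (rule image_eqI)
qed

text \<open>Once the values lie in a subring of test type, the family corestricts to a genuine cone;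
  injectivity of \<open>\<iota>\<close> carries compatibility over.\<close>

lemma lift_cone:
  assumes ZR: "cinf_ring B" and G: "fin_gen (G :: univ cinf_ring)" and i: "\<iota> \<in> cinf_hom G B" "inj_on \<iota> (elems G)"
    and L: "\<And>i. i \<in> D \<Longrightarrow> L i \<in> cinf_hom (Cinf (U i)) B"
      "compatible L"
      "\<And>i e. i \<in> D \<Longrightarrow> e \<in> elems (Cinf (U i)) \<Longrightarrow> L i e \<in> \<iota> ` elems G"
  obtains \<rho> where "is_cone M D r U j (Spec G) \<rho>" "\<And>i e. i \<in> D \<Longrightarrow> e \<in> elems (Cinf (U i)) \<Longrightarrow> \<iota> (\<rho> i e) = L i e"
proof -
  note GR = fin_gen_cinf_ring[OF G]
  have "\<exists>\<rho>. \<rho> \<in> cinf_hom (Cinf (U i)) G \<and> (\<forall>e\<in>elems (Cinf (U i)). \<iota> (\<rho> e) = L i e)" if D: "i \<in> D" for i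
    using inj_lift[OF U_ring[OF D] GR i L(1)[OF D] L(3)[OF D]] by metis
  then obtain \<rho> where \<rho>: "\<And>i. i \<in> D \<Longrightarrow> \<rho> i \<in> cinf_hom (Cinf (U i)) G"
    "\<And>i e. i \<in> D \<Longrightarrow> e \<in> elems (Cinf (U i)) \<Longrightarrow> \<iota> (\<rho> i e) = L i e" by metis
  have "is_cone M D r U j (Spec G) \<rho>"
    unfolding is_cone_def
  proof (intro conjI ballI allI impI)
    show "cinf_scheme (Spec G)" using G by (simp add: cinf_scheme_def)
    show "\<rho> i \<in> Mor (Spec G) (U i)" if "i \<in> D" for i using \<rho>(1)[OF that] by (simp add: Mor_def)
    fix i k t assume a: "(i, k) \<in> r \<and> t \<in> Mor (U k) (U i) \<and> mor_comp M (j i) t = j k"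
    then have ik: "(i, k) \<in> r" and ov: "over i k t" by (auto simp: over_def Mor_def)
    then have D: "i \<in> D" "k \<in> D" using order(1) by blast+
    have t: "t \<in> cinf_hom (Cinf (U i)) (Cinf (U k))" using ov by (simp add: over_def)
    show "mor_comp (U i) t (\<rho> k) = \<rho> i"
      unfolding mor_comp_def
    proof (rule compose_eqI[OF \<rho>(1)[OF D(1)]])
      fix e assume e: "e \<in> elems (Cinf (U i))"
      have te: "t e \<in> elems (Cinf (U k))" by (rule cinf_homD(2)[OF t e])
      have "\<iota> (\<rho> k (t e)) = \<iota> (\<rho> i e)" using \<rho>(2)[OF D(2) te] \<rho>(2)[OF D(1) e] compatibleD[OF L(2) ik ov e] by simp
      then show "\<rho> k (t e) = \<rho> i e"
        using inj_onD[OF i(2)] cinf_homD(2)[OF \<rho>(1)[OF D(2)] te] cinf_homD(2)[OF \<rho>(1)[OF D(1)] e] by blast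
    qed
  qed
  then show thesis using that \<rho>(2) by blast
qed

text \<open>The limit is a closed subscheme of a dominating \<open>U i0\<close>: the functions
  coming from \<open>U i0\<close> form a finitely generated subring that receives the whole cone,
  and uniqueness of maps into the limit makes its inclusion surjective.\<close>

lemma limit_surj:
  fixes Z :: "univ spec"
  assumes lim: "is_limit M D r U j Z"
  obtains i0 p where "i0 \<in> D" "p \<in> cinf_hom (Cinf (U i0)) (Cinf Z)" "p ` elems (Cinf (U i0)) = elems (Cinf Z)"
proof -
  obtain \<pi> where cone: "is_cone M D r U j Z \<pi>"
    and un: "\<forall>(W :: univ spec) \<rho>. is_cone M D r U j W \<rho> \<longrightarrow> (\<exists>!u. u \<in> Mor W Z \<and> (\<forall>i\<in>D. mor_comp (U i) (\<pi> i) u = \<rho> i))"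
    by (rule is_limitE[OF lim])
  note ZR = fin_gen_cinf_ring[OF is_coneD(1)[OF cone]]
  note \<pi> = is_coneD(2)[OF cone]
  have L: "compatible \<pi>"
    unfolding compatible_def over_def using is_coneD(3)[OF cone] by (intro allI impI ballI) blast
  obtain i0 where i0: "i0 \<in> D" and dom: "\<And>i. i \<in> D \<Longrightarrow> dominates i0 i" using dominating by metis
  obtain n b where b: "gens (Cinf (U i0)) n b" by (rule fin_gen_gens[OF U_fin_gen[OF i0]])
  obtain G :: "univ cinf_ring" and \<iota> where G: "fin_gen G" "\<iota> \<in> cinf_hom G (Cinf Z)" "inj_on \<iota> (elems G)"
    "\<iota> ` elems G = (\<lambda>F. sop (Cinf Z) n F (\<lambda>i\<in>{..<n}. \<pi> i0 (b i))) ` smooth_funs n"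
    by (rule generated_subring[OF ZR hom_tup[OF \<pi>[OF i0] gens_tup[OF b]]])
  have im0: "\<pi> i0 ` elems (Cinf (U i0)) = \<iota> ` elems G"
  proof
    show "\<pi> i0 ` elems (Cinf (U i0)) \<subseteq> \<iota> ` elems G"
    proof (rule image_subsetI)
      fix e assume "e \<in> elems (Cinf (U i0))"
      then obtain F where F: "F \<in> smooth_funs n" "e = sop (Cinf (U i0)) n F b" by (rule gensE[OF b])
      show "\<pi> i0 e \<in> \<iota> ` elems G"
        unfolding G(4) F(2) cinf_homD(3)[OF \<pi>[OF i0] F(1) gens_tup[OF b]] using F(1) by (rule imageI)
    qed
    show "\<iota> ` elems G \<subseteq> \<pi> i0 ` elems (Cinf (U i0))"
      unfolding G(4)
    proof (rule image_subsetI)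
      fix F assume F: "F \<in> smooth_funs n"
      show "sop (Cinf Z) n F (\<lambda>i\<in>{..<n}. \<pi> i0 (b i)) \<in> \<pi> i0 ` elems (Cinf (U i0))"
        unfolding cinf_homD(3)[OF \<pi>[OF i0] F gens_tup[OF b], symmetric]
        by (rule imageI) (rule cinf_ring.sop_closed[OF U_ring[OF i0] F gens_tup[OF b]])
    qed
  qed
  have im: "\<pi> i e \<in> \<iota> ` elems G" if "i \<in> D" "e \<in> elems (Cinf (U i))" for i e
    using compatible_image[OF dom L that] unfolding im0 .
  obtain \<rho> where \<rho>: "is_cone M D r U j (Spec G) \<rho>" "\<And>i e. i \<in> D \<Longrightarrow> e \<in> elems (Cinf (U i)) \<Longrightarrow> \<iota> (\<rho> i e) = \<pi> i e"
    using lift_cone[OF ZR G(1-3) \<pi> L im] by metis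
  obtain u where u: "u \<in> cinf_hom (Cinf Z) G" "\<And>i. i \<in> D \<Longrightarrow> mor_comp (U i) (\<pi> i) u = \<rho> i"
    using un[THEN spec[of _ "Spec G"], THEN spec[of _ \<rho>], THEN mp, OF \<rho>(1)] unfolding Mor_eq spec.sel by blast
  have id: "compose (elems (Cinf Z)) \<iota> u = (\<lambda>c\<in>elems (Cinf Z). c)"
  proof -
    have ex: "\<exists>!u. u \<in> Mor Z Z \<and> (\<forall>i\<in>D. mor_comp (U i) (\<pi> i) u = \<pi> i)"
      by (rule un[THEN spec[of _ Z], THEN spec[of _ \<pi>], THEN mp, OF cone])
    have good: "k \<in> Mor Z Z \<and> (\<forall>i\<in>D. mor_comp (U i) (\<pi> i) k = \<pi> i)"
      if "k \<in> cinf_hom (Cinf Z) (Cinf Z)" "\<And>i e. i \<in> D \<Longrightarrow> e \<in> elems (Cinf (U i)) \<Longrightarrow> k (\<pi> i e) = \<pi> i e" for k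
      using that \<pi> unfolding Mor_eq mor_comp_def by (auto intro!: compose_eqI)
    have "compose (elems (Cinf Z)) \<iota> u (\<pi> i e) = \<pi> i e" if "i \<in> D" "e \<in> elems (Cinf (U i))" for i e
      using that cinf_homD(2)[OF \<pi>[OF that(1)] that(2)] mor_compD[OF u(2)[OF that(1)] that(2)] \<rho>(2)[OF that]
      by (simp add: compose_def)
    note g1 = good[OF cinf_hom_compose[OF ZR u(1) G(2)] this]
    have "(\<lambda>c\<in>elems (Cinf Z). c) (\<pi> i e) = \<pi> i e" if "i \<in> D" "e \<in> elems (Cinf (U i))" for i e
      using cinf_homD(2)[OF \<pi>[OF that(1)] that(2)] by simp
    note g2 = good[OF cinf_hom_id[OF ZR] this]
    show ?thesis using ex g1 g2 by blast
  qed
  have "elems (Cinf Z) \<subseteq> \<iota> ` elems G"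
  proof
    fix c assume c: "c \<in> elems (Cinf Z)"
    show "c \<in> \<iota> ` elems G"
      by (rule image_eqI[OF _ cinf_homD(2)[OF u(1) c]]) (use composeD[OF id c] c in simp)
  qed
  moreover have "\<iota> ` elems G \<subseteq> elems (Cinf Z)" by (rule image_subsetI) (rule cinf_homD(2)[OF G(2)])
  ultimately have "\<pi> i0 ` elems (Cinf (U i0)) = elems (Cinf Z)" using im0 by simp
  then show thesis by (rule that[OF i0 \<pi>[OF i0]])
qed

end

section \<open>Germ points\<close>

text \<open>Germs are classes of arbitrary functions, whereas invariance of domain requires
  continuous representatives.\<close>

definition tame :: "'p topology \<Rightarrow> 'p filter \<Rightarrow> 'a cinf_ring \<Rightarrow> ('a \<Rightarrow> ('p \<Rightarrow> real) set) \<Rightarrow> bool" where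
  "tame T F A \<Psi> \<longleftrightarrow> (\<forall>a\<in>elems A. \<exists>g S. \<Psi> a = germ F g \<and> openin T S \<and> eventually (\<lambda>p. p \<in> S) F \<and>
     continuous_map (subtopology T S) euclideanreal g)"

text \<open>The substitute for the injectivity of an embedding. Leaving the tuple existential makes
  the property easy to transport; \<open>separating_gens\<close> passes to fixed generators.\<close>

definition separating :: "'p filter \<Rightarrow> 'a cinf_ring \<Rightarrow> ('a \<Rightarrow> ('p \<Rightarrow> real) set) \<Rightarrow> bool" where
  "separating F A \<Psi> \<longleftrightarrow> (\<exists>n a g S. a \<in> tup A n \<and> (\<forall>i<n. \<Psi> (a i) = germ F (g i)) \<and> eventually (\<lambda>p. p \<in> S) F \<and>
     (\<forall>p\<in>S. \<forall>p'\<in>S. (\<forall>i<n. g i p = g i p') \<longrightarrow> p = p'))"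

text \<open>The open sets are those on which the dimension argument takes place; in particular the
  filter is not trivial.\<close>

definition thick :: "'p topology \<Rightarrow> 'p filter \<Rightarrow> bool" where
  "thick T F \<longleftrightarrow> (\<forall>P. eventually P F \<longrightarrow> (\<exists>S. openin T S \<and> S \<noteq> {} \<and> (\<forall>p\<in>S. P p)))"

lemma val_mult:
  assumes "c \<in> elems (point_ring p)" "d \<in> elems (point_ring p)"
  shows "val p (c \<otimes>\<^bsub>ring_of (point_ring p)\<^esub> d) = val p c * val p d"
  using assms by (elim germE) (simp add: germ_ring_ops)

lemma val_one: "val p \<one>\<^bsub>ring_of (point_ring p)\<^esub> = 1"
  by (simp add: germ_ring_ops)

context smooth_mfd
begin

lemma separate_points:
  assumes "p \<in> topspace T" "p' \<in> topspace T" "p \<noteq> p'"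
  obtains h where "h \<in> elems R" "h p \<noteq> h p'"
proof -
  have "Hausdorff_space T" using mfd by (simp add: smooth_manifold_def)
  then obtain S S' where S: "openin T S" "openin T S'" "p \<in> S" "p' \<in> S'" "disjnt S S'"
    using assms unfolding Hausdorff_space_def by blast
  obtain h where h: "h \<in> elems R" "h p \<noteq> 0" "\<And>x. x \<in> topspace T \<Longrightarrow> h x \<noteq> 0 \<Longrightarrow> x \<in> S"
    using bump_function[OF S(1,3)] by blast
  have "h p' = 0" using h(3)[OF assms(2)] S(4,5) by (auto simp: disjnt_iff)
  then show thesis using that[OF h(1)] h(2) by simp
qed

end

lemma continuous_map_smooth_tuple:
  assumes f: "f \<in> smooth_funs n" and g: "\<And>i. i < n \<Longrightarrow> continuous_map X euclideanreal (g i)"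
  shows "continuous_map X euclideanreal (\<lambda>p. f (\<lambda>i\<in>{..<n}. g i p))"
proof -
  have "continuous_map (powertop_real {..<n}) euclideanreal f"
  proof -
    have "continuous_map (subtopology (powertop_real {..<n}) (Rn n)) euclideanreal f"
      using smooth_onD(1)[OF smooth_funsD[OF f] ropen_Rn] by (simp add: continuous_map_powertop_iff)
    moreover have "subtopology (powertop_real {..<n}) (Rn n) = powertop_real {..<n}"
      using subtopology_topspace[of "powertop_real {..<n}"] by simp
    ultimately show ?thesis by simp
  qed
  moreover have "continuous_map X (powertop_real {..<n}) (\<lambda>p. \<lambda>i\<in>{..<n}. g i p)"
    by (rule continuous_map_coordinatewise_then_product) (use g in auto)
  ultimately show ?thesis using continuous_map_compose[of X _ _ euclideanreal f] by (simp add: o_def)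
qed

section \<open>Evaluation at interior points and along a regular system\<close>

context corner_ring
begin

lemmas C_ring = fin_gen_cinf_ring[OF C]

lemma W_sub: "W \<subseteq> topspace T" by (rule openin_subset[OF W])

text \<open>Evaluation at an interior point descends to \<open>C\<close>, since the kernel of
  \<open>q\<close> consists of functions vanishing on \<open>W\<close>.\<close>

definition eC :: "'p \<Rightarrow> 'c \<Rightarrow> ('p \<Rightarrow> real) set" where
  "eC p = (SOME e. e \<in> cinf_hom C (point_ring p) \<and> (\<forall>h\<in>elems R. e (q h) = evpt p h))"

lemma eC:
  assumes "p \<in> W"
  shows "eC p \<in> cinf_hom C (point_ring p)" "h \<in> elems R \<Longrightarrow> val p (eC p (q h)) = h p"
proof -
  have p: "p \<in> topspace T" using assms W_sub by blast
  have "evpt p h = \<zero>\<^bsub>ring_of (point_ring p)\<^esub>" if "h \<in> elems R" "q h = \<zero>\<^bsub>ring_of C\<^esub>" for h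
    using that q_zero_iff[OF that(1)] assms by (simp add: germ_ring_ops germ_eq_iff eventually_principal)
  from surj_factor[OF cinf_ring_R C_ring cinf_ring_germ_ring q surj evpt_hom[OF p] this]
  have "\<exists>e. e \<in> cinf_hom C (point_ring p) \<and> (\<forall>h\<in>elems R. e (q h) = evpt p h)" by metis
  from someI_ex[OF this] show "eC p \<in> cinf_hom C (point_ring p)" "h \<in> elems R \<Longrightarrow> val p (eC p (q h)) = h p"
    unfolding eC_def[symmetric] by auto
qed

lemma q_preimage:
  assumes "c \<in> elems C"
  obtains h where "h \<in> elems R" "q h = c"
proof -
  have "c \<in> q ` elems R" using assms surj by simp
  then show thesis using that by blast
qed

text \<open>An extension to the ambient manifold; only its values on \<open>W\<close> are determined
  by \<open>c\<close>.\<close>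

definition lift :: "'c \<Rightarrow> 'p \<Rightarrow> real" where
  "lift c = (SOME h. h \<in> elems R \<and> q h = c)"

lemma lift:
  assumes "c \<in> elems C"
  shows "lift c \<in> elems R" "q (lift c) = c" "p \<in> W \<Longrightarrow> val p (eC p c) = lift c p"
proof -
  have "\<exists>h. h \<in> elems R \<and> q h = c" using q_preimage[OF assms] by metis
  from someI_ex[OF this] show 1: "lift c \<in> elems R" "q (lift c) = c" unfolding lift_def[symmetric] by auto
  then show "p \<in> W \<Longrightarrow> val p (eC p c) = lift c p" using eC(2) by metis
qed

end

locale corner_system = corner_ring n T \<A> W q "Cinf M" + regular_sys M D r U j
  for n and T :: "'p topology" and \<A> W q and M :: "'c spec" and D :: "'i set" and r U j
begin

text \<open>The points of the open subscheme \<open>U i\<close> that lie in the interior.\<close>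

definition S :: "'i \<Rightarrow> 'p set" where
  "S i = {p \<in> W. lift (g i) p \<noteq> 0}"

lemma S_open: "i \<in> D \<Longrightarrow> openin T (S i)"
proof -
  assume i: "i \<in> D"
  have "openin T {p \<in> topspace T. lift (g i) p \<in> - {0}}"
    using openin_continuous_map_preimage[OF fun_continuous[OF lift(1)[OF g_in[OF i]]], of "- {0}"] by (simp add: open_Compl)
  from openin_Int[OF W this] show "openin T (S i)"
    by (rule back_subst[where P = "openin T"]) (use W_sub in \<open>auto simp: S_def\<close>)
qed

text \<open>A function on the manifold with corners is determined by its values on \<open>W\<close>.
  If \<open>g i\<close> vanished there it would be zero, and inverting it would give the zero
  ring.\<close>

lemma S_ne: "i \<in> D \<Longrightarrow> S i \<noteq> {}"
proof
  assume i: "i \<in> D" and "S i = {}"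
  then have "g i = \<zero>\<^bsub>ring_of (Cinf M)\<^esub>"
    using q_zero_iff[OF lift(1)[OF g_in[OF i]]] lift(2)[OF g_in[OF i]] by (auto simp: S_def)
  then have z: "j i (g i) = \<zero>\<^bsub>ring_of (Cinf (U i))\<^esub>" using hom_zero[OF j_hom[OF i] M_ring U_ring[OF i]] by simp
  obtain b where b: "b \<in> elems (Cinf (U i))" "b \<otimes>\<^bsub>ring_of (Cinf (U i))\<^esub> j i (g i) = \<one>\<^bsub>ring_of (Cinf (U i))\<^esub>"
    by (rule Units_inverseE[OF U_ring[OF i] universal_inversionD(3)[OF inversion[OF i]]])
  interpret RU: cring "ring_of (Cinf (U i))" by (rule cinf_ring.cring_ring_of[OF U_ring[OF i]])
  have "\<one>\<^bsub>ring_of (Cinf (U i))\<^esub> = \<zero>\<^bsub>ring_of (Cinf (U i))\<^esub>" using b RU.r_null[of b] z by simp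
  then show False using U_nonzero[OF i] zero_ring_one_eq_zero[OF U_ring[OF i]] by simp
qed

definition pt :: "'i \<Rightarrow> 'p \<Rightarrow> univ \<Rightarrow> ('p \<Rightarrow> real) set" where
  "pt i p = (SOME k. k \<in> cinf_hom (Cinf (U i)) (point_ring p) \<and> (\<forall>a\<in>elems (Cinf M). k (j i a) = eC p a))"

lemma pt:
  assumes i: "i \<in> D" and p: "p \<in> S i"
  shows "pt i p \<in> cinf_hom (Cinf (U i)) (point_ring p)" "a \<in> elems (Cinf M) \<Longrightarrow> pt i p (j i a) = eC p a"
proof -
  have W: "p \<in> W" using p by (simp add: S_def)
  have "val p (eC p (g i)) \<noteq> 0" using p lift(3)[OF g_in[OF i]] by (simp add: S_def)
  from universal_inversion_point[OF inversion[OF i] M_ring g_in[OF i] eC(1)[OF W] this]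
  have "\<exists>k. k \<in> cinf_hom (Cinf (U i)) (point_ring p) \<and> (\<forall>a\<in>elems (Cinf M). k (j i a) = eC p a)" by metis
  from someI_ex[OF this] show "pt i p \<in> cinf_hom (Cinf (U i)) (point_ring p)" "a \<in> elems (Cinf M) \<Longrightarrow> pt i p (j i a) = eC p a"
    unfolding pt_def[symmetric] by auto
qed

text \<open>\<open>g i\<close> becomes a unit on \<open>U k\<close>, so it does not vanish at
  \<open>p\<close>. The two evaluations on \<open>U i\<close> agree on functions from
  \<open>M\<close> and hence everywhere, by uniqueness for the inversion.\<close>

lemma pt_over:
  assumes ik: "(i, k) \<in> r" and t: "over i k t" and p: "p \<in> S k"
  shows "p \<in> S i" "e \<in> elems (Cinf (U i)) \<Longrightarrow> pt k p (t e) = pt i p e"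
proof -
  have D: "i \<in> D" "k \<in> D" using order(1)[OF ik] by auto
  have pW: "p \<in> W" using p by (simp add: S_def)
  have th: "t \<in> cinf_hom (Cinf (U i)) (Cinf (U k))" using t by (simp add: over_def)
  let ?h = "compose (elems (Cinf (U i))) (pt k p) t"
  have h: "?h \<in> cinf_hom (Cinf (U i)) (point_ring p)" by (rule cinf_hom_compose[OF U_ring[OF D(1)] th pt(1)[OF D(2) p]])
  have hj: "?h (j i a) = eC p a" if "a \<in> elems (Cinf M)" for a
    using that cinf_homD(2)[OF j_hom[OF D(1)] that] overD[OF t that] pt(2)[OF D(2) p that] by (simp add: compose_def)
  have "?h (j i (g i)) \<in> Units (ring_of (point_ring p))"
    by (rule hom_Units[OF U_ring[OF D(1)] cinf_ring_germ_ring h universal_inversionD(3)[OF inversion[OF D(1)]]])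
  then have "val p (eC p (g i)) \<noteq> 0"
    using val_Units[OF cinf_homD(2)[OF eC(1)[OF pW] g_in[OF D(1)]]] hj[OF g_in[OF D(1)]] by simp
  then show pi: "p \<in> S i" using lift(3)[OF g_in[OF D(1)] pW] pW by (simp add: S_def)
  have "?h = pt i p"
    by (rule universal_inversion_point_unique[OF inversion[OF D(1)] M_ring g_in[OF D(1)] h pt(1)[OF D(1) pi]])
       (simp add: hj pt(2)[OF D(1) pi])
  then show "pt k p (t e) = pt i p e" if "e \<in> elems (Cinf (U i))" using that composeD by metis
qed

definition F :: "'p filter" where
  "F = (INF i\<in>D. principal (S i))"

lemma eventually_F: "eventually P F \<longleftrightarrow> (\<exists>i\<in>D. \<forall>p\<in>S i. P p)"
  unfolding F_def
proof (rule eventually_INF_directed[OF D_ne])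
  fix i k assume "i \<in> D" "k \<in> D"
  then obtain l where l: "l \<in> D" "(i, l) \<in> r" "(k, l) \<in> r" using directed by blast
  obtain t where t: "over i l t" by (rule over_exists[OF l(2)])
  obtain t' where t': "over k l t'" by (rule over_exists[OF l(3)])
  have "S l \<subseteq> S i \<inter> S k" using pt_over(1)[OF l(2) t] pt_over(1)[OF l(3) t'] by blast
  then show "\<exists>l\<in>D. S l \<subseteq> S i \<inter> S k" using l(1) by blast
qed

lemma eventually_S: "i \<in> D \<Longrightarrow> eventually (\<lambda>p. p \<in> S i) F"
  unfolding eventually_F by blast

lemma thick_F: "thick T F"
  unfolding thick_def eventually_F
proof (intro allI impI)
  fix P assume "\<exists>i\<in>D. \<forall>p\<in>S i. P p"
  then obtain i where i: "i \<in> D" "\<forall>p\<in>S i. P p" by blast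
  show "\<exists>S. openin T S \<and> S \<noteq> {} \<and> (\<forall>p\<in>S. P p)"
    using S_open[OF i(1)] S_ne[OF i(1)] i(2) by (intro exI[of _ "S i"] conjI)
qed

text \<open>\<open>pt i p\<close> is meaningful only for \<open>p\<close> in \<open>S i\<close>.
  This set belongs to the filter, so the arbitrary values elsewhere do not affect the germ.\<close>

definition L :: "'i \<Rightarrow> univ \<Rightarrow> ('p \<Rightarrow> real) set" where
  "L i = (\<lambda>e\<in>elems (Cinf (U i)). germ F (\<lambda>p. val p (pt i p e)))"

lemma L_hom:
  assumes i: "i \<in> D"
  shows "L i \<in> cinf_hom (Cinf (U i)) (germ_ring F)"
proof (rule cinf_homI)
  fix m f t assume f: "f \<in> smooth_funs m" and t: "t \<in> tup (Cinf (U i)) m"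
  have "L i (sop (Cinf (U i)) m f t) = germ F (\<lambda>p. val p (pt i p (sop (Cinf (U i)) m f t)))"
    using cinf_ring.sop_closed[OF U_ring[OF i] f t] by (simp add: L_def)
  also have "\<dots> = germ F (\<lambda>p. f (\<lambda>l\<in>{..<m}. val p (pt i p (t l))))"
    unfolding germ_eq_iff using eventually_S[OF i] by (rule eventually_mono) (rule val_hom_sop[OF pt(1)[OF i] f t])
  also have "\<dots> = sop (germ_ring F) m f (\<lambda>l\<in>{..<m}. germ F (\<lambda>p. val p (pt i p (t l))))"
    by (rule sop_germ[OF f, symmetric])
  also have "(\<lambda>l\<in>{..<m}. germ F (\<lambda>p. val p (pt i p (t l)))) = (\<lambda>l\<in>{..<m}. L i (t l))"
    using tup_mem[OF t] by (intro restrict_ext) (simp add: L_def)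
  finally show "L i (sop (Cinf (U i)) m f t) = sop (germ_ring F) m f (\<lambda>l\<in>{..<m}. L i (t l))" .
qed (auto simp: L_def germ_in)

lemma L_compatible: "compatible L"
  unfolding compatible_def
proof (intro allI impI ballI)
  fix i k t e assume ik: "(i, k) \<in> r" and t: "over i k t" and e: "e \<in> elems (Cinf (U i))"
  have D: "i \<in> D" "k \<in> D" using order(1)[OF ik] by auto
  have te: "t e \<in> elems (Cinf (U k))" using t cinf_homD(2)[OF _ e] unfolding over_def by blast
  have "germ F (\<lambda>p. val p (pt k p (t e))) = germ F (\<lambda>p. val p (pt i p e))"
    unfolding germ_eq_iff using eventually_S[OF D(2)] by (rule eventually_mono) (simp add: pt_over(2)[OF ik t _ e])
  then show "L k (t e) = L i e" using e te by (simp add: L_def)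
qed

text \<open>Every function on \<open>U i\<close> is a smooth expression in restrictions from
  \<open>M\<close> and the inverse of \<open>g i\<close>, and all of these are continuous on
  \<open>S i\<close>, where \<open>g i\<close> does not vanish.\<close>

lemma L_tame:
  assumes i: "i \<in> D" and e: "e \<in> elems (Cinf (U i))"
  shows "continuous_map (subtopology T (S i)) euclideanreal (\<lambda>p. val p (pt i p e))"
proof -
  obtain m c where c: "gens (Cinf M) m c" by (rule fin_gen_gens[OF M_fin_gen])
  obtain y where y: "y \<in> elems (Cinf (U i))" "y \<otimes>\<^bsub>ring_of (Cinf (U i))\<^esub> j i (g i) = \<one>\<^bsub>ring_of (Cinf (U i))\<^esub>"
    by (rule Units_inverseE[OF U_ring[OF i] universal_inversionD(3)[OF inversion[OF i]]])
  define b where "b = (\<lambda>l\<in>{..<m}. j i (c l))(m := y)"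
  have b: "gens (Cinf (U i)) (Suc m) b"
    unfolding b_def by (rule universal_inversion_gens[OF inversion[OF i] M_ring g_in[OF i] c y])
  have cR: "continuous_map (subtopology T (S i)) euclideanreal h" if "h \<in> elems R" for h
    by (rule continuous_map_from_subtopology[OF fun_continuous[OF that]])
  have SW: "p \<in> W" if "p \<in> topspace (subtopology T (S i))" for p using that by (auto simp: S_def)
  have Si: "p \<in> S i" if "p \<in> topspace (subtopology T (S i))" for p using that by auto
  have cont: "continuous_map (subtopology T (S i)) euclideanreal (\<lambda>p. val p (pt i p (b l)))" if l: "l < Suc m" for l
  proof (cases "l < m")
    case True
    have cl: "c l \<in> elems (Cinf M)" by (rule tup_mem[OF gens_tup[OF c] True])
    have eq: "lift (c l) p = val p (pt i p (b l))" if "p \<in> topspace (subtopology T (S i))" for p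
      using pt(2)[OF i Si[OF that] cl] lift(3)[OF cl SW[OF that]] True by (simp add: b_def)
    show ?thesis by (rule continuous_map_eq[OF cR[OF lift(1)[OF cl]]]) (rule eq)
  next
    case False
    then have bl: "b l = y" using l by (auto simp: b_def less_Suc_eq)
    have eq: "inverse (lift (g i) p) = val p (pt i p (b l))" if p: "p \<in> topspace (subtopology T (S i))" for p
    proof -
      have h: "pt i p \<in> cinf_hom (Cinf (U i)) (point_ring p)" by (rule pt(1)[OF i Si[OF p]])
      have jg: "j i (g i) \<in> elems (Cinf (U i))" by (rule cinf_homD(2)[OF j_hom[OF i] g_in[OF i]])
      have prod: "pt i p y \<otimes>\<^bsub>ring_of (point_ring p)\<^esub> pt i p (j i (g i)) = \<one>\<^bsub>ring_of (point_ring p)\<^esub>"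
        using hom_mult[OF h U_ring[OF i] cinf_ring_germ_ring y(1) jg] hom_one[OF h U_ring[OF i] cinf_ring_germ_ring] y(2) by simp
      have "val p (pt i p y) * val p (pt i p (j i (g i))) = 1"
        using val_mult[OF cinf_homD(2)[OF h y(1)] cinf_homD(2)[OF h jg]] prod val_one[of p] by simp
      then have "val p (pt i p y) * lift (g i) p = 1"
        using pt(2)[OF i Si[OF p] g_in[OF i]] lift(3)[OF g_in[OF i] SW[OF p]] by simp
      moreover from this have "lift (g i) p \<noteq> 0" by auto
      ultimately show ?thesis unfolding bl by (simp add: field_simps)
    qed
    have "continuous_map (subtopology T (S i)) euclideanreal (\<lambda>p. inverse (lift (g i) p))"
      using cR[OF lift(1)[OF g_in[OF i]]] by (intro continuous_map_real_inverse) (auto simp: S_def)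
    then show ?thesis by (rule continuous_map_eq) (rule eq)
  qed
  obtain H where H: "H \<in> smooth_funs (Suc m)" "e = sop (Cinf (U i)) (Suc m) H b" by (rule gensE[OF b e])
  have eq: "H (\<lambda>l\<in>{..<Suc m}. val p (pt i p (b l))) = val p (pt i p e)" if "p \<in> topspace (subtopology T (S i))" for p
    unfolding H(2) by (rule val_hom_sop[OF pt(1)[OF i Si[OF that]] H(1) gens_tup[OF b], symmetric])
  show ?thesis by (rule continuous_map_eq[OF continuous_map_smooth_tuple[where g = "\<lambda>l p. val p (pt i p (b l))", OF H(1) cont]])
      (simp_all add: eq)
qed

text \<open>The family \<open>L\<close> takes its values in the finitely generated image of one
  \<open>U i0\<close>, so it corestricts to a cone and factors through the limit. Continuity is read
  off at \<open>i0\<close>. Generators of the ring of \<open>M\<close> separate points, because on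
  \<open>W\<close> every ambient function is a smooth function of them.\<close>

theorem limit_germ_point:
  fixes Z :: "univ spec"
  assumes lim: "is_limit M D r U j Z"
  obtains \<Psi> where "\<Psi> \<in> cinf_hom (Cinf Z) (germ_ring F)" "tame T F (Cinf Z) \<Psi>" "separating F (Cinf Z) \<Psi>"
proof -
  obtain \<pi> where cone: "is_cone M D r U j Z \<pi>"
    and un: "\<forall>(W :: univ spec) \<rho>. is_cone M D r U j W \<rho> \<longrightarrow> (\<exists>!u. u \<in> Mor W Z \<and> (\<forall>i\<in>D. mor_comp (U i) (\<pi> i) u = \<rho> i))"
    by (rule is_limitE[OF lim])
  note ZR = fin_gen_cinf_ring[OF is_coneD(1)[OF cone]]
  obtain i0 where i0: "i0 \<in> D" and dom: "\<And>i. i \<in> D \<Longrightarrow> dominates i0 i" using dominating by metis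
  obtain m b where b: "gens (Cinf (U i0)) m b" by (rule fin_gen_gens[OF U_fin_gen[OF i0]])
  obtain G :: "univ cinf_ring" and \<iota> where G: "fin_gen G" "\<iota> \<in> cinf_hom G (germ_ring F)" "inj_on \<iota> (elems G)"
    "\<iota> ` elems G = (\<lambda>H. sop (germ_ring F) m H (\<lambda>i\<in>{..<m}. L i0 (b i))) ` smooth_funs m"
    by (rule generated_subring[OF cinf_ring_germ_ring hom_tup[OF L_hom[OF i0] gens_tup[OF b]]])
  have im0: "L i0 ` elems (Cinf (U i0)) = \<iota> ` elems G"
  proof
    show "L i0 ` elems (Cinf (U i0)) \<subseteq> \<iota> ` elems G"
    proof (rule image_subsetI)
      fix e assume "e \<in> elems (Cinf (U i0))"
      then obtain H where H: "H \<in> smooth_funs m" "e = sop (Cinf (U i0)) m H b" by (rule gensE[OF b])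
      show "L i0 e \<in> \<iota> ` elems G"
        unfolding G(4) H(2) cinf_homD(3)[OF L_hom[OF i0] H(1) gens_tup[OF b]] using H(1) by (rule imageI)
    qed
    show "\<iota> ` elems G \<subseteq> L i0 ` elems (Cinf (U i0))"
      unfolding G(4)
    proof (rule image_subsetI)
      fix H assume H: "H \<in> smooth_funs m"
      show "sop (germ_ring F) m H (\<lambda>i\<in>{..<m}. L i0 (b i)) \<in> L i0 ` elems (Cinf (U i0))"
        unfolding cinf_homD(3)[OF L_hom[OF i0] H gens_tup[OF b], symmetric]
        by (rule imageI) (rule cinf_ring.sop_closed[OF U_ring[OF i0] H gens_tup[OF b]])
    qed
  qed
  have im: "L i e \<in> \<iota> ` elems G" if "i \<in> D" "e \<in> elems (Cinf (U i))" for i e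
    using compatible_image[OF dom L_compatible that] unfolding im0 .
  obtain \<rho> where \<rho>: "is_cone M D r U j (Spec G) \<rho>" "\<And>i e. i \<in> D \<Longrightarrow> e \<in> elems (Cinf (U i)) \<Longrightarrow> \<iota> (\<rho> i e) = L i e"
    using lift_cone[OF cinf_ring_germ_ring G(1-3) L_hom L_compatible im] by metis
  obtain u where u: "u \<in> cinf_hom (Cinf Z) G" "\<And>i. i \<in> D \<Longrightarrow> mor_comp (U i) (\<pi> i) u = \<rho> i"
    using un[THEN spec[of _ "Spec G"], THEN spec[of _ \<rho>], THEN mp, OF \<rho>(1)] unfolding Mor_eq spec.sel by blast
  define \<Psi> where "\<Psi> = compose (elems (Cinf Z)) \<iota> u"
  have \<Psi>: "\<Psi> \<in> cinf_hom (Cinf Z) (germ_ring F)" unfolding \<Psi>_def by (rule cinf_hom_compose[OF ZR u(1) G(2)])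
  have "tame T F (Cinf Z) \<Psi>"
    unfolding tame_def
  proof
    fix z assume z: "z \<in> elems (Cinf Z)"
    have "\<Psi> z \<in> L i0 ` elems (Cinf (U i0))"
      unfolding im0 using z cinf_homD(2)[OF u(1) z] by (simp add: \<Psi>_def compose_def)
    then obtain e where e: "e \<in> elems (Cinf (U i0))" "\<Psi> z = L i0 e" by blast
    show "\<exists>g S. \<Psi> z = germ F g \<and> openin T S \<and> eventually (\<lambda>p. p \<in> S) F \<and> continuous_map (subtopology T S) euclideanreal g"
      by (intro exI[of _ "\<lambda>p. val p (pt i0 p e)"] exI[of _ "S i0"] conjI S_open[OF i0] eventually_S[OF i0] L_tame[OF i0 e(1)])
         (use e in \<open>simp add: L_def\<close>)
  qed
  moreover have "separating F (Cinf Z) \<Psi>"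
  proof -
    obtain k c where c: "gens (Cinf M) k c" by (rule fin_gen_gens[OF M_fin_gen])
    note ct = tup_mem[OF gens_tup[OF c]]
    have jc: "j i0 (c l) \<in> elems (Cinf (U i0))" if "l < k" for l by (rule cinf_homD(2)[OF j_hom[OF i0] ct[OF that]])
    \<comment> \<open>The separating tuple consists of generators of the ring of \<open>M\<close>,
      pulled back to the limit through \<open>U i0\<close>; their germs are those of their
      extensions \<open>lift (c l)\<close>.\<close>
    define a where "a = (\<lambda>l\<in>{..<k}. \<pi> i0 (j i0 (c l)))"
    have pj: "\<pi> i0 (j i0 (c l)) \<in> elems (Cinf Z)" if "l < k" for l
      by (rule cinf_homD(2)[OF is_coneD(2)[OF cone i0] jc[OF that]])
    have a: "a \<in> tup (Cinf Z) k" unfolding a_def by (rule tupI) (rule pj)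
    have "\<Psi> (a l) = germ F (lift (c l))" if l: "l < k" for l
    proof -
      have "\<Psi> (a l) = L i0 (j i0 (c l))"
        using l pj[OF l] mor_compD[OF u(2)[OF i0] jc[OF l]] \<rho>(2)[OF i0 jc[OF l]] by (simp add: a_def \<Psi>_def compose_def)
      also have "\<dots> = germ F (\<lambda>p. val p (pt i0 p (j i0 (c l))))" using jc[OF l] by (simp add: L_def)
      also have "\<dots> = germ F (lift (c l))"
        unfolding germ_eq_iff using eventually_S[OF i0]
        by (rule eventually_mono) (use pt(2)[OF i0 _ ct[OF l]] lift(3)[OF ct[OF l]] in \<open>simp add: S_def\<close>)
      finally show ?thesis .
    qed
    moreover have "p = p'" if p: "p \<in> S i0" "p' \<in> S i0" and eq: "\<forall>l<k. lift (c l) p = lift (c l) p'" for p p'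
    proof (rule ccontr)
      assume "p \<noteq> p'"
      have pW: "p \<in> W" "p' \<in> W" using p by (auto simp: S_def)
      then obtain h where h: "h \<in> elems R" "h p \<noteq> h p'" using separate_points[of p p'] W_sub \<open>p \<noteq> p'\<close> by blast
      obtain H where H: "H \<in> smooth_funs k" "q h = sop (Cinf M) k H c" by (rule gensE[OF c cinf_homD(2)[OF q h(1)]])
      have "h x = H (\<lambda>l\<in>{..<k}. lift (c l) x)" if x: "x \<in> W" for x
      proof -
        have "h x = val x (eC x (sop (Cinf M) k H c))" using eC(2)[OF x h(1)] H(2) by simp
        also have "\<dots> = H (\<lambda>l\<in>{..<k}. val x (eC x (c l)))" by (rule val_hom_sop[OF eC(1)[OF x] H(1) gens_tup[OF c]])
        also have "(\<lambda>l\<in>{..<k}. val x (eC x (c l))) = (\<lambda>l\<in>{..<k}. lift (c l) x)"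
          using lift(3)[OF ct _ ] x by (intro restrict_ext) simp
        finally show ?thesis .
      qed
      moreover have "(\<lambda>l\<in>{..<k}. lift (c l) p) = (\<lambda>l\<in>{..<k}. lift (c l) p')" using eq by (intro restrict_ext) simp
      ultimately show False using h(2) pW by simp
    qed
    ultimately show ?thesis
      unfolding separating_def using a eventually_S[OF i0]
      by (intro exI[of _ k] exI[of _ a] exI[of _ "\<lambda>l. lift (c l)"] exI[of _ "S i0"] conjI) blast+
  qed
  ultimately show thesis using that \<Psi> by blast
qed

end

section \<open>Transport of germ points along morphisms\<close>

lemma tame_compose:
  assumes "tame T F B \<Psi>" "\<And>a. a \<in> elems A \<Longrightarrow> \<exists>b\<in>elems B. \<Psi>' a = \<Psi> b"
  shows "tame T F A \<Psi>'"
  unfolding tame_def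
proof
  fix a assume "a \<in> elems A"
  then obtain b where b: "b \<in> elems B" "\<Psi>' a = \<Psi> b" using assms(2) by blast
  then show "\<exists>g S. \<Psi>' a = germ F g \<and> openin T S \<and> eventually (\<lambda>p. p \<in> S) F \<and> continuous_map (subtopology T S) euclideanreal g"
    using assms(1) unfolding tame_def b(2) by blast
qed

lemma separatingE:
  assumes "separating F A \<Psi>"
  obtains n a g S where "a \<in> tup A n" "\<And>i. i < n \<Longrightarrow> \<Psi> (a i) = germ F (g i)" "eventually (\<lambda>p. p \<in> S) F"
    "\<And>p p'. p \<in> S \<Longrightarrow> p' \<in> S \<Longrightarrow> (\<And>i. i < n \<Longrightarrow> g i p = g i p') \<Longrightarrow> p = p'"
  using assms unfolding separating_def by blast

lemma separatingI:
  assumes "a \<in> tup A n" "\<And>i. i < n \<Longrightarrow> \<Psi> (a i) = germ F (g i)" "eventually (\<lambda>p. p \<in> S) F"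
    "\<And>p p'. p \<in> S \<Longrightarrow> p' \<in> S \<Longrightarrow> (\<And>i. i < n \<Longrightarrow> g i p = g i p') \<Longrightarrow> p = p'"
  shows "separating F A \<Psi>"
  unfolding separating_def
proof (intro exI[of _ n] exI[of _ a] exI[of _ g] exI[of _ S] conjI assms(1,3) allI ballI impI)
  show "\<Psi> (a i) = germ F (g i)" if "i < n" for i by (rule assms(2)[OF that])
  show "p = p'" if p: "p \<in> S" "p' \<in> S" "\<forall>i<n. g i p = g i p'" for p p'
    by (rule assms(4)[OF p(1,2)]) (use p(3) in simp)
qed

lemma separating_lift:
  assumes "separating F B \<Psi>" and lift: "\<And>b. b \<in> elems B \<Longrightarrow> \<exists>a\<in>elems A. \<Psi>' a = \<Psi> b"
  shows "separating F A \<Psi>'"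
proof -
  obtain n b g S where b: "b \<in> tup B n" "\<And>i. i < n \<Longrightarrow> \<Psi> (b i) = germ F (g i)" "eventually (\<lambda>p. p \<in> S) F"
    "\<And>p p'. p \<in> S \<Longrightarrow> p' \<in> S \<Longrightarrow> (\<And>i. i < n \<Longrightarrow> g i p = g i p') \<Longrightarrow> p = p'"
    using separatingE[OF assms(1)] by metis
  have "\<exists>a\<in>elems A. \<Psi>' a = \<Psi> (b i)" if "i < n" for i by (rule lift[OF tup_mem[OF b(1) that]])
  then obtain a where a: "\<And>i. i < n \<Longrightarrow> a i \<in> elems A" "\<And>i. i < n \<Longrightarrow> \<Psi>' (a i) = \<Psi> (b i)" by metis
  show ?thesis
  proof (rule separatingI[where a = "\<lambda>i\<in>{..<n}. a i" and g = g and S = S])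
    show "(\<lambda>i\<in>{..<n}. a i) \<in> tup A n" by (rule tupI) (rule a(1))
    show "\<Psi>' ((\<lambda>i\<in>{..<n}. a i) i) = germ F (g i)" if "i < n" for i using that a(2) b(2) by simp
  qed (rule b(3), rule b(4))
qed

text \<open>Each member of the given separating tuple is a smooth expression in the generators, as a
  germ. On the filter set where these finitely many identities hold pointwise, equal generators
  force equal tuples.\<close>

lemma separating_gens:
  assumes h: "\<Psi> \<in> cinf_hom A (germ_ring F)" and sep: "separating F A \<Psi>" and c: "gens A m c"
    and g: "\<And>i. i < m \<Longrightarrow> \<Psi> (c i) = germ F (g i)"
  obtains S where "eventually (\<lambda>p. p \<in> S) F"
    "\<And>p p'. p \<in> S \<Longrightarrow> p' \<in> S \<Longrightarrow> (\<And>i. i < m \<Longrightarrow> g i p = g i p') \<Longrightarrow> p = p'"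
proof -
  obtain n a k S where a: "a \<in> tup A n" "\<And>i. i < n \<Longrightarrow> \<Psi> (a i) = germ F (k i)" "eventually (\<lambda>p. p \<in> S) F"
    "\<And>p p'. p \<in> S \<Longrightarrow> p' \<in> S \<Longrightarrow> (\<And>i. i < n \<Longrightarrow> k i p = k i p') \<Longrightarrow> p = p'"
    using separatingE[OF sep] by metis
  have "\<exists>H. H \<in> smooth_funs m \<and> a i = sop A m H c" if "i < n" for i
    using gensE[OF c tup_mem[OF a(1) that]] by metis
  then obtain H where H: "\<And>i. i < n \<Longrightarrow> H i \<in> smooth_funs m" "\<And>i. i < n \<Longrightarrow> a i = sop A m (H i) c" by metis
  have "eventually (\<lambda>p. k i p = H i (\<lambda>l\<in>{..<m}. g l p)) F" if i: "i < n" for i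
    using hom_germ_sop[OF h H(1)[OF i] gens_tup[OF c] g] a(2)[OF i] H(2)[OF i] by (simp add: germ_eq_iff eq_commute)
  then have "eventually (\<lambda>p. \<forall>i\<in>{..<n}. k i p = H i (\<lambda>l\<in>{..<m}. g l p)) F"
    by (intro eventually_ball_finite) auto
  then have ev: "eventually (\<lambda>p. p \<in> {p \<in> S. \<forall>i<n. k i p = H i (\<lambda>l\<in>{..<m}. g l p)}) F"
    using a(3) by eventually_elim auto
  show thesis
  proof (rule that[OF ev])
    fix p p' assume p: "p \<in> {p \<in> S. \<forall>i<n. k i p = H i (\<lambda>l\<in>{..<m}. g l p)}"
      "p' \<in> {p \<in> S. \<forall>i<n. k i p = H i (\<lambda>l\<in>{..<m}. g l p)}" and eq: "\<And>i. i < m \<Longrightarrow> g i p = g i p'"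
    have "(\<lambda>l\<in>{..<m}. g l p) = (\<lambda>l\<in>{..<m}. g l p')" by (rule restrict_ext) (simp add: eq)
    then show "p = p'" using p by (intro a(4)) auto
  qed
qed

text \<open>\<open>B\<close> has one generator more than \<open>A\<close>, the inverse of
  \<open>f\<close>. Where the equation for the inverse holds pointwise, its value is determined by
  the generators of \<open>A\<close>, so these already separate.\<close>

lemma separating_inversion:
  fixes B :: "univ cinf_ring"
  assumes u: "universal_inversion A f B \<phi>" and A: "fin_gen A" and f: "f \<in> elems A"
    and h: "\<Psi> \<in> cinf_hom B (germ_ring F)" and sep: "separating F B \<Psi>"
  shows "separating F A (compose (elems A) \<Psi> \<phi>)"
proof -
  note AR = fin_gen_cinf_ring[OF A]
  note BR = fin_gen_cinf_ring[OF universal_inversionD(1)[OF u]]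
  note phi = universal_inversionD(2)[OF u]
  let ?P = "compose (elems A) \<Psi> \<phi>"
  have P: "?P \<in> cinf_hom A (germ_ring F)" by (rule cinf_hom_compose[OF AR phi h])
  obtain m c where c: "gens A m c" by (rule fin_gen_gens[OF A])
  note ct = tup_mem[OF gens_tup[OF c]]
  obtain y where y: "y \<in> elems B" "y \<otimes>\<^bsub>ring_of B\<^esub> \<phi> f = \<one>\<^bsub>ring_of B\<^esub>"
    by (rule Units_inverseE[OF BR universal_inversionD(3)[OF u]])
  define b where "b = (\<lambda>i\<in>{..<m}. \<phi> (c i))(m := y)"
  have b: "gens B (Suc m) b" unfolding b_def by (rule universal_inversion_gens[OF u AR f c y])
  have "\<exists>g. ?P (c i) = germ F g" if "i < m" for i using germE[OF cinf_homD(2)[OF P ct[OF that]]] by metis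
  then obtain g where g: "\<And>i. i < m \<Longrightarrow> ?P (c i) = germ F (g i)" by metis
  obtain gy where gy: "\<Psi> y = germ F gy" by (rule germE[OF cinf_homD(2)[OF h y(1)]])
  define g' where "g' i = (if i < m then g i else gy)" for i
  have "\<Psi> (b i) = germ F (g' i)" if "i < Suc m" for i
    using g[of i] ct[of i] gy that by (auto simp: b_def g'_def compose_def less_Suc_eq)
  from separating_gens[OF h sep b this] obtain S where S: "eventually (\<lambda>p. p \<in> S) F"
    "\<And>p p'. p \<in> S \<Longrightarrow> p' \<in> S \<Longrightarrow> (\<And>i. i < Suc m \<Longrightarrow> g' i p = g' i p') \<Longrightarrow> p = p'" by metis
  obtain H where H: "H \<in> smooth_funs m" "f = sop A m H c" by (rule gensE[OF c f])
  have "?P f = germ F (\<lambda>p. H (\<lambda>l\<in>{..<m}. g l p))" unfolding H(2) by (rule hom_germ_sop[OF P H(1) gens_tup[OF c] g])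
  moreover have "\<Psi> y \<otimes>\<^bsub>ring_of (germ_ring F)\<^esub> ?P f = \<one>\<^bsub>ring_of (germ_ring F)\<^esub>"
    using hom_mult[OF h BR cinf_ring_germ_ring y(1) cinf_homD(2)[OF phi f]] hom_one[OF h BR cinf_ring_germ_ring] y(2) f
    by (simp add: compose_def)
  ultimately have "eventually (\<lambda>p. gy p * H (\<lambda>l\<in>{..<m}. g l p) = 1) F"
    by (simp add: gy germ_ring_ops germ_eq_iff)
  then have ev: "eventually (\<lambda>p. p \<in> {p \<in> S. gy p * H (\<lambda>l\<in>{..<m}. g l p) = 1}) F" using S(1) by eventually_elim auto
  show ?thesis
  proof (rule separatingI[where n = m and a = c and g = g and S = "{p \<in> S. gy p * H (\<lambda>l\<in>{..<m}. g l p) = 1}"])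
    show "c \<in> tup A m" by (rule gens_tup[OF c])
    show "?P (c i) = germ F (g i)" if "i < m" for i by (rule g[OF that])
    show "eventually (\<lambda>p. p \<in> {p \<in> S. gy p * H (\<lambda>l\<in>{..<m}. g l p) = 1}) F" by (rule ev)
  next
    fix p p' assume p: "p \<in> {p \<in> S. gy p * H (\<lambda>l\<in>{..<m}. g l p) = 1}" "p' \<in> {p \<in> S. gy p * H (\<lambda>l\<in>{..<m}. g l p) = 1}"
      and eq: "\<And>i. i < m \<Longrightarrow> g i p = g i p'"
    have "(\<lambda>l\<in>{..<m}. g l p) = (\<lambda>l\<in>{..<m}. g l p')" by (rule restrict_ext) (simp add: eq)
    then have "gy p * H (\<lambda>l\<in>{..<m}. g l p) = gy p' * H (\<lambda>l\<in>{..<m}. g l p)" "H (\<lambda>l\<in>{..<m}. g l p) \<noteq> 0" using p by auto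
    then have "gy p = gy p'" by simp
    then show "p = p'" using p eq by (intro S(2)) (auto simp: g'_def)
  qed
qed

lemma separating_compose_surj:
  assumes "separating F B \<Psi>" "h ` elems A = elems B"
  shows "separating F A (compose (elems A) \<Psi> h)"
proof (rule separating_lift[OF assms(1)])
  fix b assume "b \<in> elems B"
  then have "b \<in> h ` elems A" using assms(2) by simp
  then show "\<exists>a\<in>elems A. compose (elems A) \<Psi> h a = \<Psi> b" by (auto simp: compose_def)
qed

lemma tame_compose_hom:
  assumes "tame T F B \<Psi>" "h \<in> cinf_hom A B"
  shows "tame T F A (compose (elems A) \<Psi> h)"
  by (rule tame_compose[OF assms(1)]) (auto simp: compose_def intro: cinf_homD(2)[OF assms(2)])

lemma locally_closed_germ_point:
  assumes X': "fin_gen (Cinf X')" and lc: "locally_closed_subscheme X X' \<Phi>"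
    and h: "\<Psi> \<in> cinf_hom (Cinf X) (germ_ring F)" "tame T F (Cinf X) \<Psi>" "separating F (Cinf X) \<Psi>"
  obtains \<Psi>' where "\<Psi>' \<in> cinf_hom (Cinf X') (germ_ring F)" "tame T F (Cinf X') \<Psi>'" "separating F (Cinf X') \<Psi>'"
proof -
  obtain f and U :: "univ spec" and j c where op: "open_subscheme X' f U j" and ce: "closed_embedding X U c"
    using lc unfolding locally_closed_subscheme_def by blast
  have f: "f \<in> elems (Cinf X')" and u: "universal_inversion (Cinf X') f (Cinf U) j" using op by (auto simp: open_subscheme_def)
  note X'R = fin_gen_cinf_ring[OF X'] and UR = fin_gen_cinf_ring[OF universal_inversionD(1)[OF u]]
  obtain I \<theta> where I: "ideal I (ring_of (Cinf U))" and t: "\<theta> \<in> cinf_iso (quot (Cinf U) I) (Cinf X)"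
    and c: "c = compose (elems (Cinf U)) \<theta> (quot_map (Cinf U) I)"
    using ce unfolding closed_embedding_def closed_subscheme_def closed_incl_def mor_comp_def by auto
  interpret I: cinf_ideal "Cinf U" I using I UR by (simp add: cinf_ideal_def cinf_ideal_axioms_def)
  have th: "\<theta> \<in> cinf_hom (quot (Cinf U) I) (Cinf X)" "\<theta> ` elems (quot (Cinf U) I) = elems (Cinf X)"
    using t by (auto simp: cinf_iso_def bij_betw_def)
  have ch: "c \<in> cinf_hom (Cinf U) (Cinf X)" unfolding c by (rule cinf_hom_compose[OF UR I.quot_map_hom th(1)])
  have "c ` elems (Cinf U) = \<theta> ` quot_map (Cinf U) I ` elems (Cinf U)"
    unfolding c image_image by (rule image_cong) (auto simp: compose_def)
  then have cs: "c ` elems (Cinf U) = elems (Cinf X)" by (simp add: quot_map_image th(2))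
  let ?h = "compose (elems (Cinf U)) \<Psi> c"
  have 1: "?h \<in> cinf_hom (Cinf U) (germ_ring F)" "tame T F (Cinf U) ?h" "separating F (Cinf U) ?h"
    by (rule cinf_hom_compose[OF UR ch h(1)] tame_compose_hom[OF h(2) ch] separating_compose_surj[OF h(3) cs])+
  show thesis
    by (rule that[OF cinf_hom_compose[OF X'R universal_inversionD(2)[OF u] 1(1)]
          tame_compose_hom[OF 1(2) universal_inversionD(2)[OF u]] separating_inversion[OF u X' f 1(1,3)]])
qed

lemma red_germ_point:
  assumes X: "fin_gen (Cinf X)" and Z: "fin_gen (Cinf Z)" and iso: "isomorphic (red X) Z"
    and h: "\<Psi> \<in> cinf_hom (Cinf Z) (germ_ring F)" "tame T F (Cinf Z) \<Psi>" "separating F (Cinf Z) \<Psi>"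
  obtains \<Psi>' where "\<Psi>' \<in> cinf_hom (Cinf X) (germ_ring F)" "tame T F (Cinf X) \<Psi>'" "separating F (Cinf X) \<Psi>'"
proof -
  let ?I = "inf_radical (Cinf X) {\<zero>\<^bsub>ring_of (Cinf X)\<^esub>}"
  interpret I: cinf_ideal "Cinf X" ?I by (rule radical_ideal[OF X])
  obtain k where k: "k \<in> cinf_iso (Cinf Z) (quot (Cinf X) ?I)"
    using iso by (auto simp: isomorphic_def red_def closed_subscheme_def)
  obtain k' where k': "k' \<in> cinf_iso (quot (Cinf X) ?I) (Cinf Z)"
    using iso_inverse[OF fin_gen_cinf_ring[OF Z] I.cinf_ring_quot k] by metis
  then have kh: "k' \<in> cinf_hom (quot (Cinf X) ?I) (Cinf Z)" "k' ` elems (quot (Cinf X) ?I) = elems (Cinf Z)"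
    by (auto simp: cinf_iso_def bij_betw_def)
  let ?h = "compose (elems (quot (Cinf X) ?I)) \<Psi> k'"
  have 1: "?h \<in> cinf_hom (quot (Cinf X) ?I) (germ_ring F)" "tame T F (quot (Cinf X) ?I) ?h" "separating F (quot (Cinf X) ?I) ?h"
    by (rule cinf_hom_compose[OF I.cinf_ring_quot kh(1) h(1)] tame_compose_hom[OF h(2) kh(1)] separating_compose_surj[OF h(3) kh(2)])+
  show thesis
    by (rule that[OF cinf_hom_compose[OF I.cinf_ring_axioms I.quot_map_hom 1(1)]
          tame_compose_hom[OF 1(2) I.quot_map_hom] separating_compose_surj[OF 1(3) quot_map_image]])
qed

text \<open>Opposite to \<open>red_germ_point\<close>, the germ point has to factor through the
  reduction, which works since germs annihilate the radical. The same germs occur as values, so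
  tameness and separation persist.\<close>

lemma germ_point_red:
  assumes X: "fin_gen (Cinf X)" and Z: "fin_gen (Cinf Z)" and iso: "isomorphic (red X) Z"
    and h: "\<Psi> \<in> cinf_hom (Cinf X) (germ_ring F)" "tame T F (Cinf X) \<Psi>" "separating F (Cinf X) \<Psi>"
  obtains \<Psi>' where "\<Psi>' \<in> cinf_hom (Cinf Z) (germ_ring F)" "tame T F (Cinf Z) \<Psi>'" "separating F (Cinf Z) \<Psi>'"
proof -
  let ?I = "inf_radical (Cinf X) {\<zero>\<^bsub>ring_of (Cinf X)\<^esub>}" and ?Q = "quot (Cinf X) (inf_radical (Cinf X) {\<zero>\<^bsub>ring_of (Cinf X)\<^esub>})"
  interpret I: cinf_ideal "Cinf X" ?I by (rule radical_ideal[OF X])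
  note XR = fin_gen_cinf_ring[OF X] and ZR = fin_gen_cinf_ring[OF Z]
  obtain k where k: "k \<in> cinf_iso (Cinf Z) ?Q"
    using iso by (auto simp: isomorphic_def red_def closed_subscheme_def)
  then have kh: "k \<in> cinf_hom (Cinf Z) ?Q" "k ` elems (Cinf Z) = elems ?Q"
    by (auto simp: cinf_iso_def bij_betw_def)
  have "\<Psi> a = \<zero>\<^bsub>ring_of (germ_ring F)\<^esub>" if "a \<in> elems (Cinf X)" "quot_map (Cinf X) ?I a = \<zero>\<^bsub>ring_of ?Q\<^esub>" for a
    using germ_kills_radical[OF X h(1)] that I.quot_map_zero_iff[OF that(1)] by blast
  from surj_factor[OF XR I.cinf_ring_quot cinf_ring_germ_ring I.quot_map_hom quot_map_image h(1) this]
  obtain b where b: "b \<in> cinf_hom ?Q (germ_ring F)" "\<And>a. a \<in> elems (Cinf X) \<Longrightarrow> b (quot_map (Cinf X) ?I a) = \<Psi> a" by metis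
  let ?h = "compose (elems (Cinf Z)) b k"
  have hk: "\<exists>a\<in>elems (Cinf X). ?h z = \<Psi> a" if z: "z \<in> elems (Cinf Z)" for z
  proof -
    obtain a where a: "a \<in> elems (Cinf X)" "k z = quot_map (Cinf X) ?I a" by (rule quot_elemE[OF cinf_homD(2)[OF kh(1) z]])
    then show ?thesis using b(2)[OF a(1)] z by (auto simp: compose_def)
  qed
  have kh': "\<exists>z\<in>elems (Cinf Z). ?h z = \<Psi> a" if a: "a \<in> elems (Cinf X)" for a
  proof -
    have "quot_map (Cinf X) ?I a \<in> k ` elems (Cinf Z)" using kh(2) cinf_homD(2)[OF I.quot_map_hom a] by simp
    then obtain z where z: "z \<in> elems (Cinf Z)" "k z = quot_map (Cinf X) ?I a" by auto
    then show ?thesis using b(2)[OF a] by (intro bexI[of _ z]) (auto simp: compose_def)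
  qed
  show thesis
    by (rule that[OF cinf_hom_compose[OF ZR kh(1) b(1)] tame_compose[OF h(2) hk] separating_lift[OF h(3) kh']])
qed

text \<open>A single stage suffices: by \<open>limit_surj\<close> the limit is closed in some
  \<open>U i\<close>, and separation survives the open inclusion of \<open>U i\<close> by
  \<open>separating_inversion\<close>.\<close>

lemma (in regular_sys) limit_descend:
  fixes Z :: "univ spec"
  assumes lim: "is_limit M D r U j Z"
    and h: "\<Psi> \<in> cinf_hom (Cinf Z) (germ_ring F)" "tame T F (Cinf Z) \<Psi>" "separating F (Cinf Z) \<Psi>"
  obtains \<Psi>' where "\<Psi>' \<in> cinf_hom (Cinf M) (germ_ring F)" "tame T F (Cinf M) \<Psi>'" "separating F (Cinf M) \<Psi>'"
proof -
  obtain i p where i: "i \<in> D" and p: "p \<in> cinf_hom (Cinf (U i)) (Cinf Z)" "p ` elems (Cinf (U i)) = elems (Cinf Z)"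
    by (rule limit_surj[OF lim])
  let ?h = "compose (elems (Cinf (U i))) \<Psi> p"
  have 1: "?h \<in> cinf_hom (Cinf (U i)) (germ_ring F)" "tame T F (Cinf (U i)) ?h" "separating F (Cinf (U i)) ?h"
    by (rule cinf_hom_compose[OF U_ring[OF i] p(1) h(1)] tame_compose_hom[OF h(2) p(1)] separating_compose_surj[OF h(3) p(2)])+
  show thesis
    by (rule that[OF cinf_hom_compose[OF M_ring j_hom[OF i] 1(1)] tame_compose_hom[OF 1(2) j_hom[OF i]]
          separating_inversion[OF inversion[OF i] M_fin_gen g_in[OF i] 1(1,3)]])
qed

section \<open>The dimension estimate\<close>

text \<open>If \<open>n < m\<close>, padding with zeros turns \<open>f\<close> into an injection of
  an open set of \<open>R^m\<close> into a hyperplane. Invariance of domain makes the image open,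
  but a line transversal to the hyperplane meets it in one point only.\<close>

lemma continuous_injection_dimension:
  assumes O: "ropen m O'" "O' \<noteq> {}" and f: "continuous_map (subtopology (powertop_real {..<m}) O') (powertop_real {..<n}) f"
    and inj: "inj_on f O'"
  shows "m \<le> n"
proof (rule ccontr)
  assume "\<not> m \<le> n"
  then have nm: "n < m" by simp
  \<comment> \<open>\<open>Euclidean_space m\<close> has zeros where \<open>Rn m\<close> has
    \<open>undefined\<close>; \<open>O1\<close> and \<open>h\<close> are \<open>O'\<close> and the
    padded \<open>f\<close> in that convention.\<close>
  define O1 where "O1 = {y \<in> topspace (Euclidean_space m). restrict y {..<m} \<in> O'}"
  define h where "h y = (\<lambda>i. if i < m then (if i < n then f (restrict y {..<m}) i else 0) else 0)" for y
  have coord: "continuous_map (Euclidean_space m) euclideanreal (\<lambda>y. y i)" for i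
    unfolding Euclidean_space_def by (intro continuous_map_from_subtopology continuous_map_product_projection) simp
  have r: "continuous_map (Euclidean_space m) (powertop_real {..<m}) (\<lambda>y. restrict y {..<m})"
  proof (rule continuous_map_coordinatewise_then_product)
    fix i assume "i \<in> {..<m}"
    then show "continuous_map (Euclidean_space m) euclideanreal (\<lambda>x. restrict x {..<m} i)" using coord by simp
  qed auto
  have O1: "openin (Euclidean_space m) O1" unfolding O1_def by (rule openin_continuous_map_preimage[OF r O(1)])
  have r1: "continuous_map (subtopology (Euclidean_space m) O1) (subtopology (powertop_real {..<m}) O') (\<lambda>y. restrict y {..<m})"
    unfolding continuous_map_in_subtopology
    using continuous_map_from_subtopology[OF r, of O1] by (auto simp: O1_def)
  have fr: "continuous_map (subtopology (Euclidean_space m) O1) euclideanreal (\<lambda>y. f (restrict y {..<m}) i)" if "i < n" for i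
  proof -
    have "continuous_map (subtopology (powertop_real {..<m}) O') euclideanreal (\<lambda>y. f y i)"
      using continuous_map_compose[OF f continuous_map_product_projection[of i "{..<n}" "\<lambda>_. euclideanreal"]] that by (simp add: o_def)
    from continuous_map_compose[OF r1 this] show ?thesis by (simp add: o_def)
  qed
  have "continuous_map (subtopology (Euclidean_space m) O1) (Euclidean_space m) h"
    unfolding h_def continuous_map_componentwise_Euclidean_space
  proof (intro allI impI)
    fix i assume "i < m"
    show "continuous_map (subtopology (Euclidean_space m) O1) euclideanreal (\<lambda>x. if i < n then f (restrict x {..<m}) i else 0)"
      using fr[of i] by (cases "i < n") auto
  qed
  moreover have "inj_on h O1"
  proof (rule inj_onI)
    fix y y' assume y: "y \<in> O1" "y' \<in> O1" and eq: "h y = h y'"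
    have yO: "restrict y {..<m} \<in> O'" "restrict y' {..<m} \<in> O'" using y by (simp_all add: O1_def)
    have fR: "f z \<in> Rn n" if "z \<in> O'" for z
      using continuous_map_funspace[OF f] that openin_subset[OF O(1)] by auto
    have "f (restrict y {..<m}) = f (restrict y' {..<m})"
    proof (rule Rn_eqI[OF fR[OF yO(1)] fR[OF yO(2)]])
      fix i assume "i < n"
      then show "f (restrict y {..<m}) i = f (restrict y' {..<m}) i" using fun_cong[OF eq, of i] nm by (simp add: h_def)
    qed
    then have r: "restrict y {..<m} = restrict y' {..<m}" by (rule inj_onD[OF inj _ yO])
    show "y = y'"
    proof
      fix i
      show "y i = y' i" using fun_cong[OF r, of i] y by (cases "i < m") (auto simp: O1_def topspace_Euclidean_space)
    qed
  qed
  ultimately have op: "openin (Euclidean_space m) (h ` O1)" by (rule invariance_of_domain_Euclidean_space[OF O1])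
  obtain x where x: "x \<in> O'" using O(2) by blast
  then have xR: "x \<in> Rn m" using openin_subset[OF O(1)] by auto
  define y where "y i = (if i < m then x i else 0)" for i
  have "restrict y {..<m} = x" using Rn_undefined[OF xR] by (auto simp: y_def)
  then have yO: "y \<in> O1" using x by (simp add: O1_def topspace_Euclidean_space) (simp add: y_def)
  \<comment> \<open>Coordinate \<open>n\<close> exists because \<open>n < m\<close>, and it vanishes
    on the image because \<open>f\<close> fills only the coordinates below \<open>n\<close>.\<close>
  define \<gamma> where "\<gamma> t = (\<lambda>i. if i < m then (if i = n then t else h y i) else 0)" for t :: real
  have "continuous_map euclideanreal (Euclidean_space m) \<gamma>"
    unfolding \<gamma>_def continuous_map_componentwise_Euclidean_space
  proof (intro allI impI)
    fix i assume "i < m"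
    show "continuous_map euclideanreal euclideanreal (\<lambda>x. if i = n then x else h y i)" by (cases "i = n") auto
  qed
  from openin_continuous_map_preimage[OF this op] have "open {t. \<gamma> t \<in> h ` O1}" by simp
  moreover have "{t. \<gamma> t \<in> h ` O1} = {0}"
  proof
    show "{t. \<gamma> t \<in> h ` O1} \<subseteq> {0}"
    proof
      fix t assume "t \<in> {t. \<gamma> t \<in> h ` O1}"
      then obtain z where "\<gamma> t = h z" by blast
      then have "\<gamma> t n = h z n" by (rule fun_cong)
      then show "t \<in> {0}" using nm by (simp add: \<gamma>_def h_def)
    qed
    have "\<gamma> 0 = h y" by (auto simp: \<gamma>_def h_def)
    then show "{0} \<subseteq> {t. \<gamma> t \<in> h ` O1}" using yO by auto
  qed
  ultimately have "open {0::real}" by simp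
  then show False using not_open_singleton by blast
qed

context smooth_mfd
begin

lemma inv_chart_continuous:
  assumes c: "(U, \<phi>) \<in> \<A>"
  shows "continuous_map (subtopology (powertop_real {..<n}) (\<phi> ` U)) T (inv_into U \<phi>)"
proof -
  obtain \<psi> where h: "homeomorphic_maps (subtopology T U) (subtopology (powertop_real {..<n}) (\<phi> ` U)) \<phi> \<psi>"
    using chart(4)[OF c] homeomorphic_map_maps by blast
  have eq: "\<psi> x = inv_into U \<phi> x" if "x \<in> topspace (subtopology (powertop_real {..<n}) (\<phi> ` U))" for x
  proof -
    have "x \<in> \<phi> ` U" using that by simp
    then obtain p where p: "p \<in> U" "x = \<phi> p" by blast
    have "\<psi> (\<phi> p) = p" using h p(1) chart(3)[OF c] unfolding homeomorphic_maps_def by auto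
    then show ?thesis using inv_chart[OF c p(1)] p(2) by simp
  qed
  have "continuous_map (subtopology (powertop_real {..<n}) (\<phi> ` U)) T \<psi>"
    using h unfolding homeomorphic_maps_def continuous_map_in_subtopology by blast
  from continuous_map_eq[OF this eq] show ?thesis .
qed

lemma continuous_injection_dim_le:
  assumes S: "openin T S" "S \<noteq> {}" and f: "continuous_map (subtopology T S) (powertop_real {..<k}) f" and inj: "inj_on f S"
  shows "n \<le> k"
proof -
  obtain p where p: "p \<in> S" using S(2) by blast
  then have "p \<in> topspace T" using openin_subset[OF S(1)] by blast
  then obtain U \<phi> where c: "(U, \<phi>) \<in> \<A>" "p \<in> U" by (rule chart_cover)
  let ?O = "\<phi> ` (U \<inter> S)"
  have O: "ropen n ?O" by (rule chart_image_open[OF c(1) S(1)])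
  have iv: "inv_into U \<phi> x \<in> U \<inter> S" "\<phi> (inv_into U \<phi> x) = x" if "x \<in> ?O" for x
    using that inv_chart[OF c(1)] by auto
  have sub: "continuous_map (subtopology (powertop_real {..<n}) ?O) T (inv_into U \<phi>)"
    by (rule continuous_map_from_subtopology_mono[OF inv_chart_continuous[OF c(1)]]) blast
  have "continuous_map (subtopology (powertop_real {..<n}) ?O) (subtopology T S) (inv_into U \<phi>)"
    unfolding continuous_map_in_subtopology
    using sub iv(1) by auto
  from continuous_map_compose[OF this f]
  have cm: "continuous_map (subtopology (powertop_real {..<n}) ?O) (powertop_real {..<k}) (\<lambda>x. f (inv_into U \<phi> x))"
    by (simp add: o_def)
  have "inj_on (\<lambda>x. f (inv_into U \<phi> x)) ?O"
  proof (rule inj_onI)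
    fix x y assume x: "x \<in> ?O" "y \<in> ?O" and eq: "f (inv_into U \<phi> x) = f (inv_into U \<phi> y)"
    have "inv_into U \<phi> x = inv_into U \<phi> y"
      by (rule inj_onD[OF inj eq]) (use iv(1)[OF x(1)] iv(1)[OF x(2)] in blast)+
    then show "x = y" using iv(2)[OF x(1)] iv(2)[OF x(2)] by metis
  qed
  moreover have "?O \<noteq> {}" using p c(2) by blast
  ultimately show "n \<le> k" using continuous_injection_dimension[OF O _ cm] by blast
qed

section \<open>Charts expressed through finitely many global functions\<close>

lemma funI_cover:
  assumes cov: "\<And>p. p \<in> topspace T \<Longrightarrow> \<exists>U \<phi>. (U, \<phi>) \<in> \<A> \<and> p \<in> U \<and> smooth_on n (\<phi> ` U) (\<lambda>x. g (inv_into U \<phi> x))"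
  shows "restrict g (topspace T) \<in> elems R"
proof (rule funI)
  fix V \<psi> assume d: "(V, \<psi>) \<in> \<A>"
  show "smooth_on n (\<psi> ` V) (\<lambda>x. g (inv_into V \<psi> x))"
  proof (rule smooth_on_local[OF chart(2)[OF d]])
    fix x assume "x \<in> \<psi> ` V"
    then obtain p where p: "p \<in> V" "x = \<psi> p" by blast
    have "p \<in> topspace T" using p(1) chart(3)[OF d] by blast
    then obtain U \<phi> where c: "(U, \<phi>) \<in> \<A>" "p \<in> U" and g: "smooth_on n (\<phi> ` U) (\<lambda>x. g (inv_into U \<phi> x))"
      using cov by blast
    have W: "ropen n (\<psi> ` (V \<inter> U))" by (rule chart_image_open[OF d chart(1)[OF c(1)]])
    have iv: "inv_into V \<psi> y \<in> U" if "y \<in> \<psi> ` (V \<inter> U)" for y using that inv_chart[OF d] by auto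
    have "smooth_on n (\<psi> ` (V \<inter> U)) (\<lambda>x. g (inv_into U \<phi> (\<phi> (inv_into V \<psi> x))))"
      by (rule smooth_on_compose[OF W chart(2)[OF c(1)] _ transition[OF d c(1)] g]) (use iv in blast)
    moreover have "smooth_on n (\<psi> ` (V \<inter> U)) (\<lambda>x. g (inv_into V \<psi> x)) \<longleftrightarrow>
        smooth_on n (\<psi> ` (V \<inter> U)) (\<lambda>x. g (inv_into U \<phi> (\<phi> (inv_into V \<psi> x))))"
      by (rule smooth_on_cong[OF W]) (simp add: inv_chart[OF c(1) iv])
    ultimately show "\<exists>W. ropen n W \<and> x \<in> W \<and> W \<subseteq> \<psi> ` V \<and> smooth_on n W (\<lambda>x. g (inv_into V \<psi> x))"
      using W p c(2) by (intro exI[of _ "\<psi> ` (V \<inter> U)"]) auto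
  qed
qed

text \<open>Multiplied by \<open>\<kappa>\<close>, the chart coordinates become global functions
  \<open>u l\<close>, and the chart expression of \<open>x a\<close> becomes a smooth function
  \<open>G a\<close> on Euclidean space. Where \<open>\<rho>\<close> is non-zero,
  \<open>\<kappa>\<close> is 1 and nothing has been changed.\<close>

lemma chart_relation:
  assumes p: "p \<in> topspace T" and x: "\<And>a. a < N \<Longrightarrow> x a \<in> elems R"
  obtains U \<phi> \<rho> u G where "(U, \<phi>) \<in> \<A>" "p \<in> U" "\<rho> \<in> elems R" "\<rho> p \<noteq> 0" "\<And>s. s \<in> topspace T \<Longrightarrow> \<rho> s \<noteq> 0 \<Longrightarrow> s \<in> U"
    "\<And>l. l < n \<Longrightarrow> u l \<in> elems R" "\<And>a. a < N \<Longrightarrow> G a \<in> smooth_funs n"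
    "\<And>s a. s \<in> topspace T \<Longrightarrow> \<rho> s \<noteq> 0 \<Longrightarrow> a < N \<Longrightarrow> x a s = G a (\<lambda>l\<in>{..<n}. u l s)"
proof -
  obtain U \<phi> where c: "(U, \<phi>) \<in> \<A>" "p \<in> U" by (rule chart_cover[OF p])
  let ?q = "\<phi> p"
  have \<phi>R: "\<phi> s \<in> Rn n" if "s \<in> U" for s using that ropen_subset[OF chart(2)[OF c(1)]] by blast
  have "?q \<in> \<phi> ` U" using c(2) by blast
  then obtain e where e: "e > 0" "\<And>y. y \<in> Rn n \<Longrightarrow> (\<And>i. i < n \<Longrightarrow> \<bar>y i - ?q i\<bar> < e) \<Longrightarrow> y \<in> \<phi> ` U"
    using ropen_box[OF chart(2)[OF c(1)]] by metis
  \<comment> \<open>The box of radius \<open>e\<close> lies in the chart. \<open>\<rho>\<close>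
    lives at radius \<open>e / 4\<close> and \<open>\<kappa>\<close> at radius \<open>e / 2\<close>,
    so closed boxes containing both supports stay inside the chart, as \<open>extend_by_zero\<close>
    requires.\<close>
  have e4: "e / 4 > 0" using e(1) by simp
  show thesis
  proof (rule box_bump[OF e4, of n ?q])
    fix \<rho> \<kappa>
    assume b1: "smooth_on n (Rn n) \<rho>" "smooth_on n (Rn n) \<kappa>" and "\<And>x. \<rho> x \<ge> 0"
      and b2: "\<And>x. \<rho> x \<noteq> 0 \<longleftrightarrow> (\<forall>i<n. \<bar>x i - ?q i\<bar> < e / 4)"
      "\<And>x. (\<And>i. i < n \<Longrightarrow> \<bar>x i - ?q i\<bar> \<le> e / 4) \<Longrightarrow> \<kappa> x = 1"
      "\<And>x i. \<kappa> x \<noteq> 0 \<Longrightarrow> i < n \<Longrightarrow> \<bar>x i - ?q i\<bar> < 2 * (e / 4)"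
    note b = b1 b2
    have \<phi>U: "smooth_on n (\<phi> ` U) f" if "smooth_on n (Rn n) f" for f
      by (rule smooth_on_subset[OF that ropen_Rn chart(2)[OF c(1)] ropen_subset[OF chart(2)[OF c(1)]]])
    have sub: "{y \<in> Rn n. \<forall>i<n. \<bar>y i - ?q i\<bar> \<le> e'} \<subseteq> \<phi> ` U" if "e' < e" for e'
    proof
      fix y assume "y \<in> {y \<in> Rn n. \<forall>i<n. \<bar>y i - ?q i\<bar> \<le> e'}"
      then have y: "y \<in> Rn n" "\<forall>i<n. \<bar>y i - ?q i\<bar> \<le> e'" by simp_all
      show "y \<in> \<phi> ` U"
      proof (rule e(2)[OF y(1)])
        fix i assume "i < n"
        then have "\<bar>y i - ?q i\<bar> \<le> e'" using y(2) by simp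
        then show "\<bar>y i - ?q i\<bar> < e" using that by simp
      qed
    qed
    let ?\<rho> = "\<lambda>s\<in>topspace T. if s \<in> U then \<rho> (\<phi> s) else 0"
    let ?u = "\<lambda>l. \<lambda>s\<in>topspace T. if s \<in> U then \<kappa> (\<phi> s) * \<phi> s l else 0"
    let ?g = "\<lambda>a y. if y \<in> \<phi> ` U then \<kappa> y * x a (inv_into U \<phi> y) else 0"
    have 1: "?\<rho> \<in> elems R"
    proof (rule extend_by_zero[OF c(1) \<phi>U[OF b(1)], where q = ?q and r = "e / 4"])
      show "{y \<in> Rn n. \<forall>i<n. \<bar>y i - ?q i\<bar> \<le> e / 4} \<subseteq> \<phi> ` U" by (rule sub) (use e(1) in simp)
      fix y assume "\<rho> y \<noteq> 0"
      then show "\<forall>i<n. \<bar>y i - ?q i\<bar> \<le> e / 4" using b(3)[of y] by (simp add: less_imp_le)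
    qed
    have 2: "?u l \<in> elems R" for l
    proof (rule extend_by_zero[OF c(1), where q = ?q and r = "e / 2"])
      show "smooth_on n (\<phi> ` U) (\<lambda>y. \<kappa> y * y l)"
        by (intro smooth_on_mult \<phi>U[OF b(2)] smooth_on_coord chart(2)[OF c(1)])
      show "{y \<in> Rn n. \<forall>i<n. \<bar>y i - ?q i\<bar> \<le> e / 2} \<subseteq> \<phi> ` U" by (rule sub) (use e(1) in simp)
      fix y assume "\<kappa> y * y l \<noteq> 0"
      then have "\<kappa> y \<noteq> 0" by simp
      from b(5)[OF this] show "\<forall>i<n. \<bar>y i - ?q i\<bar> \<le> e / 2" by (auto intro: less_imp_le)
    qed
    have 3: "restrict (?g a) (Rn n) \<in> smooth_funs n" if a: "a < N" for a
    proof (rule smooth_funsI, rule smooth_on_local[OF ropen_Rn])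
      fix y :: "nat \<Rightarrow> real" assume y: "y \<in> Rn n"
      show "\<exists>V. ropen n V \<and> y \<in> V \<and> V \<subseteq> Rn n \<and> smooth_on n V (?g a)"
      proof (cases "\<forall>i<n. \<bar>y i - ?q i\<bar> < e")
        case True
        then have "y \<in> \<phi> ` U" using e(2)[OF y] by blast
        moreover have "smooth_on n (\<phi> ` U) (?g a) \<longleftrightarrow> smooth_on n (\<phi> ` U) (\<lambda>y. \<kappa> y * x a (inv_into U \<phi> y))"
          by (rule smooth_on_cong[OF chart(2)[OF c(1)]]) simp
        moreover have "smooth_on n (\<phi> ` U) (\<lambda>y. \<kappa> y * x a (inv_into U \<phi> y))"
          by (intro smooth_on_mult \<phi>U[OF b(2)] funD[OF x[OF a] c(1)] chart(2)[OF c(1)])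
        ultimately show ?thesis using chart(2)[OF c(1)] ropen_subset[OF chart(2)[OF c(1)]] by blast
      next
        case False
        \<comment> \<open>Outside the box of radius \<open>e\<close> some coordinate is off by more
          than \<open>e / 2\<close>; on the open set defined by this condition
          \<open>\<kappa>\<close> vanishes.\<close>
        then obtain i where i: "i < n" "\<not> \<bar>y i - ?q i\<bar> < e" by blast
        let ?B = "{t. \<bar>t - ?q i\<bar> > e / 2}"
        have "open ?B" by (intro open_Collect_less continuous_intros)
        then have V: "ropen n {z \<in> Rn n. z i \<in> ?B}"
          by (rule ropen_continuous_preimage[OF ropen_Rn continuous_on_coord])
        have "smooth_on n {z \<in> Rn n. z i \<in> ?B} (?g a) \<longleftrightarrow> smooth_on n {z \<in> Rn n. z i \<in> ?B} (\<lambda>_. 0)"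
        proof (rule smooth_on_cong[OF V])
          fix z assume "z \<in> {z \<in> Rn n. z i \<in> ?B}"
          then have "\<not> \<bar>z i - ?q i\<bar> < 2 * (e / 4)" by simp
          then have "\<kappa> z = 0" using b(5)[of z i] i(1) by blast
          then show "?g a z = 0" by simp
        qed
        then have "smooth_on n {z \<in> Rn n. z i \<in> ?B} (?g a)" using smooth_on_const[OF V] by simp
        then show ?thesis using V y i(2) e(1) by (intro exI[of _ "{z \<in> Rn n. z i \<in> ?B}"]) auto
      qed
    qed
    have near: "s \<in> U \<and> (\<forall>i<n. \<bar>\<phi> s i - ?q i\<bar> < e / 4)" if "s \<in> topspace T" "?\<rho> s \<noteq> 0" for s
      using that b(3)[of "\<phi> s"] by (auto split: if_splits)
    have 4: "x a s = restrict (?g a) (Rn n) (\<lambda>l\<in>{..<n}. ?u l s)" if s: "s \<in> topspace T" "?\<rho> s \<noteq> 0" for s a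
    proof -
      have sU: "s \<in> U" and "\<kappa> (\<phi> s) = 1" using near[OF s] by (auto intro!: b(4) less_imp_le)
      then have "(\<lambda>l\<in>{..<n}. ?u l s) = \<phi> s"
        by (intro Rn_eqI[OF _ \<phi>R[OF sU]]) (auto simp: s(1))
      then show ?thesis using \<phi>R[OF sU] sU inv_chart[OF c(1) sU] \<open>\<kappa> (\<phi> s) = 1\<close> by simp
    qed
    have 5: "?\<rho> p \<noteq> 0" using p c(2) b(3)[of ?q] e(1) by simp
    have 6: "s \<in> U" if "s \<in> topspace T" "?\<rho> s \<noteq> 0" for s using near[OF that] by blast
    show thesis by (rule that[OF c 1 5 6 2 3 4])
  qed
qed

text \<open>A second countable space is Lindelof, so countably many of the sets where a
  \<open>\<rho>\<close> is non-zero cover the manifold. Countability is what permits summing over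
  the charts.\<close>

lemma countable_chart_relations:
  assumes x: "\<And>a. a < N \<Longrightarrow> x a \<in> elems R"
  obtains U \<phi> \<rho> u G where "\<And>k::nat. (U k, \<phi> k) \<in> \<A>" "\<And>k. \<rho> k \<in> elems R"
    "\<And>s. s \<in> topspace T \<Longrightarrow> \<exists>k. s \<in> U k \<and> \<rho> k s \<noteq> 0"
    "\<And>k l. l < n \<Longrightarrow> u k l \<in> elems R" "\<And>k a. a < N \<Longrightarrow> G k a \<in> smooth_funs n"
    "\<And>k s a. s \<in> topspace T \<Longrightarrow> \<rho> k s \<noteq> 0 \<Longrightarrow> a < N \<Longrightarrow> x a s = G k a (\<lambda>l\<in>{..<n}. u k l s)"
proof -
  let ?ok = "\<lambda>p (U, \<phi>, \<rho>, u, G). (U, \<phi>) \<in> \<A> \<and> \<rho> \<in> elems R \<and> \<rho> p \<noteq> 0 \<and>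
    (\<forall>s\<in>topspace T. \<rho> s \<noteq> 0 \<longrightarrow> s \<in> U) \<and> (\<forall>l<n. u l \<in> elems R) \<and> (\<forall>a<N. G a \<in> smooth_funs n) \<and>
    (\<forall>s\<in>topspace T. \<rho> s \<noteq> 0 \<longrightarrow> (\<forall>a<N. x a s = G a (\<lambda>l\<in>{..<n}. u l s)))"
  have "\<exists>d. ?ok p d" if p: "p \<in> topspace T" for p
  proof (rule chart_relation[where x = x and N = N, OF p])
    show "x a \<in> elems R" if "a < N" for a by (rule x[OF that])
  next
    fix U \<phi> \<rho> u G
    assume a: "(U, \<phi>) \<in> \<A>" "\<rho> \<in> elems R" "\<rho> p \<noteq> 0" "\<And>s. s \<in> topspace T \<Longrightarrow> \<rho> s \<noteq> 0 \<Longrightarrow> s \<in> U"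
      "\<And>l. l < n \<Longrightarrow> u l \<in> elems R" "\<And>a. a < N \<Longrightarrow> G a \<in> smooth_funs n"
      "\<And>s a. s \<in> topspace T \<Longrightarrow> \<rho> s \<noteq> 0 \<Longrightarrow> a < N \<Longrightarrow> x a s = G a (\<lambda>l\<in>{..<n}. u l s)"
    show ?thesis by (rule exI[of _ "(U, \<phi>, \<rho>, u, G)"]) (simp add: a)
  qed
  then have "\<forall>p\<in>topspace T. \<exists>d. ?ok p d" by (intro ballI)
  from bchoice[OF this] obtain d where "\<forall>p\<in>topspace T. ?ok p (d p)" ..
  note d = this
  define \<rho> where "\<rho> p = fst (snd (snd (d p)))" for p
  have \<rho>: "\<rho> p \<in> elems R" "\<rho> p p \<noteq> 0" if "p \<in> topspace T" for p
    using bspec[OF d that] by (auto simp: \<rho>_def split: prod.splits)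
  have op: "openin T {s \<in> topspace T. \<rho> p s \<noteq> 0}" if "p \<in> topspace T" for p
  proof -
    have "openin T {s \<in> topspace T. \<rho> p s \<in> - {0}}"
      by (rule openin_continuous_map_preimage[OF fun_continuous[OF \<rho>(1)[OF that]]]) (simp add: open_Compl)
    then show ?thesis by simp
  qed
  let ?\<U> = "(\<lambda>p. {s \<in> topspace T. \<rho> p s \<noteq> 0}) ` topspace T"
  have lin: "Lindelof_space T"
    using mfd by (auto simp: smooth_manifold_def intro: second_countable_imp_Lindelof_space)
  have "\<exists>\<V>. countable \<V> \<and> \<V> \<subseteq> ?\<U> \<and> \<Union>\<V> = topspace T"
  proof (rule Lindelof_spaceD[OF lin])
    show "\<Union> ?\<U> = topspace T" using \<rho>(2) by blast
    show "openin T V" if "V \<in> ?\<U>" for V using that op by auto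
  qed
  then obtain \<V> where V: "countable \<V> \<and> \<V> \<subseteq> ?\<U>" "\<Union>\<V> = topspace T" by (elim exE conjE) simp
  have ne: "topspace T \<noteq> {}" using mfd by (simp add: smooth_manifold_def)
  obtain Q where Q: "countable Q" "Q \<subseteq> topspace T" "\<V> = (\<lambda>p. {s \<in> topspace T. \<rho> p s \<noteq> 0}) ` Q"
    using V(1) unfolding countable_subset_image by (elim exE conjE)
  \<comment> \<open>\<open>from_nat_into\<close> enumerates exactly \<open>Q\<close> only if
    \<open>Q\<close> is not empty; repetitions are harmless.\<close>
  have "Q \<noteq> {}"
  proof
    assume "Q = {}"
    then show False using Q(3) V(2) ne by simp
  qed
  then have rQ: "range (from_nat_into Q) = Q" using Q(1) by (rule range_from_nat_into)
  define pt where "pt = from_nat_into Q"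
  have pt: "pt k \<in> topspace T" for k using rQ Q(2) unfolding pt_def by blast
  have dk: "?ok (pt k) (d (pt k))" for k
    using d pt by (rule bspec)
  have cov: "\<exists>k. \<rho> (pt k) s \<noteq> 0" if s: "s \<in> topspace T" for s
  proof -
    have "s \<in> \<Union>\<V>" using s V(2) by simp
    then obtain p where "p \<in> Q" "\<rho> p s \<noteq> 0" unfolding Q(3) by blast
    moreover obtain k where "pt k = p" using rQ \<open>p \<in> Q\<close> unfolding pt_def by (metis imageE)
    ultimately show ?thesis by blast
  qed
  define U \<phi> u G where "U k = fst (d (pt k))" "\<phi> k = fst (snd (d (pt k)))"
    "u k = fst (snd (snd (snd (d (pt k)))))" "G k = snd (snd (snd (snd (d (pt k)))))" for k
  note defs = \<rho>_def U_\<phi>_u_G_def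
  have dk': "(U k, \<phi> k) \<in> \<A> \<and> \<rho> (pt k) \<in> elems R \<and>
    (\<forall>s\<in>topspace T. \<rho> (pt k) s \<noteq> 0 \<longrightarrow> s \<in> U k) \<and> (\<forall>l<n. u k l \<in> elems R) \<and> (\<forall>a<N. G k a \<in> smooth_funs n) \<and>
    (\<forall>s\<in>topspace T. \<rho> (pt k) s \<noteq> 0 \<longrightarrow> (\<forall>a<N. x a s = G k a (\<lambda>l\<in>{..<n}. u k l s)))" for k
    using dk[of k] unfolding defs by (auto split: prod.splits)
  show thesis
  proof (rule that[of U \<phi> "\<lambda>k. \<rho> (pt k)" u G])
    show "\<exists>k. s \<in> U k \<and> \<rho> (pt k) s \<noteq> 0" if s: "s \<in> topspace T" for s
      using cov[OF s] dk' s by blast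
    show "x a s = G k a (\<lambda>l\<in>{..<n}. u k l s)" if "s \<in> topspace T" "\<rho> (pt k) s \<noteq> 0" "a < N" for k s a
      using dk'[of k] that by simp
  qed (simp_all add: dk')
qed

end

context corner_ring
begin

text \<open>The image of \<open>e\<close> under \<open>q\<close> is a smooth expression in the
  generators, and evaluation at interior points turns this into an identity of functions on
  \<open>W\<close>.\<close>

lemma fun_of_gens:
  assumes c: "gens C N c" and e: "e \<in> elems R"
  obtains H where "H \<in> smooth_funs N" "\<And>w. w \<in> W \<Longrightarrow> e w = H (\<lambda>a\<in>{..<N}. lift (c a) w)"
proof -
  obtain H where H: "H \<in> smooth_funs N" "q e = sop C N H c" by (rule gensE[OF c cinf_homD(2)[OF q e]])
  have "e w = H (\<lambda>a\<in>{..<N}. lift (c a) w)" if w: "w \<in> W" for w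
  proof -
    have "e w = H (\<lambda>a\<in>{..<N}. val w (eC w (c a)))"
      using val_hom_sop[OF eC(1)[OF w] H(1) gens_tup[OF c]] eC(2)[OF w e] H(2) by simp
    also have "(\<lambda>a\<in>{..<N}. val w (eC w (c a))) = (\<lambda>a\<in>{..<N}. lift (c a) w)"
      by (rule restrict_ext) (simp add: lift(3)[OF tup_mem[OF gens_tup[OF c]] w])
    finally show ?thesis .
  qed
  then show thesis using that H(1) by blast
qed

text \<open>The kernel of \<open>q\<close> consists of the functions vanishing on \<open>W\<close>,
  so a smooth relation between the lifted generators that holds on \<open>W\<close> holds in
  \<open>C\<close> and then along the filter. Through this channel the charts of the target reach
  the germ point.\<close>

lemma germ_point_relation:
  assumes c: "gens C N c" and \<Psi>: "\<Psi> \<in> cinf_hom C (germ_ring F)" and \<xi>: "\<And>a. a < N \<Longrightarrow> \<Psi> (c a) = germ F (\<xi> a)"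
    and H: "smooth_on N (Rn N) H" and zero: "\<And>w. w \<in> W \<Longrightarrow> H (\<lambda>a\<in>{..<N}. lift (c a) w) = 0"
  shows "eventually (\<lambda>p. H (\<lambda>a\<in>{..<N}. \<xi> a p) = 0) F"
proof -
  define K where "K = restrict H (Rn N)"
  have K: "K \<in> smooth_funs N" unfolding K_def by (rule smooth_funsI[OF H])
  have KH: "K (\<lambda>a\<in>{..<N}. f a) = H (\<lambda>a\<in>{..<N}. f a)" for f by (simp add: K_def)
  note ct = tup_mem[OF gens_tup[OF c]]
  let ?x = "\<lambda>a\<in>{..<N}. lift (c a)"
  have x: "?x \<in> tup R N" by (rule tupI) (rule lift(1)[OF ct])
  have h: "sop R N K ?x \<in> elems R" by (rule cinf_ring.sop_closed[OF cinf_ring_R K x])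
  have "sop R N K ?x w = 0" if w: "w \<in> W" for w
  proof -
    have "(\<lambda>a\<in>{..<N}. ?x a w) = (\<lambda>a\<in>{..<N}. lift (c a) w)" by (rule restrict_ext) simp
    moreover have "w \<in> topspace T" using w W_sub by blast
    ultimately show ?thesis using zero[OF w] by (simp add: sop_R KH)
  qed
  then have "q (sop R N K ?x) = \<zero>\<^bsub>ring_of C\<^esub>" unfolding q_zero_iff[OF h] by blast
  moreover have "q (sop R N K ?x) = sop C N K (\<lambda>a\<in>{..<N}. q (?x a))" by (rule cinf_homD(3)[OF q K x])
  moreover have "(\<lambda>a\<in>{..<N}. q (?x a)) = (\<lambda>a\<in>{..<N}. c a)"
    by (rule restrict_ext) (simp add: lift(2)[OF ct])
  ultimately have "sop C N K c = \<zero>\<^bsub>ring_of C\<^esub>" by (simp only: restrict_tup[OF gens_tup[OF c]])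
  then have "germ F (\<lambda>p. K (\<lambda>a\<in>{..<N}. \<xi> a p)) = \<zero>\<^bsub>ring_of (germ_ring F)\<^esub>"
    using hom_germ_sop[OF \<Psi> K gens_tup[OF c] \<xi>] hom_zero[OF \<Psi> C_ring cinf_ring_germ_ring] by simp
  then show ?thesis by (simp add: germ_ring_ops germ_eq_iff KH)
qed

text \<open>A germ point only sees finitely many functions at a time. The countably many charts are therefore
  packed into two convergent series of squares, one expressing that the charts cover and one expressing
  the coordinates through each chart.\<close>

lemma germ_point_charts:
  assumes c: "gens C N c" and \<Psi>: "\<Psi> \<in> cinf_hom C (germ_ring F)" and \<xi>: "\<And>a. a < N \<Longrightarrow> \<Psi> (c a) = germ F (\<xi> a)"
  obtains P :: "nat \<Rightarrow> (nat \<Rightarrow> real) \<Rightarrow> real" and H G where "\<And>k. P k \<in> smooth_funs N" "\<And>k l. l < n \<Longrightarrow> H k l \<in> smooth_funs N"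
    "eventually (\<lambda>p. (\<exists>k. P k (\<lambda>a\<in>{..<N}. \<xi> a p) \<noteq> 0) \<and>
       (\<forall>k. P k (\<lambda>a\<in>{..<N}. \<xi> a p) \<noteq> 0 \<longrightarrow>
          (\<forall>a<N. \<xi> a p = G k a (\<lambda>l\<in>{..<n}. H k l (\<lambda>a\<in>{..<N}. \<xi> a p))))) F"
proof -
  note ct = tup_mem[OF gens_tup[OF c]]
  define x where "x a = lift (c a)" for a
  have x: "x a \<in> elems R" if "a < N" for a unfolding x_def by (rule lift(1)[OF ct[OF that]])
  define X where "X w = (\<lambda>a\<in>{..<N}. x a w)" for w
  have XR: "X w \<in> Rn N" for w by (auto simp: X_def)
  have Xa: "X w a = x a w" if "a < N" for w a using that by (simp add: X_def)
  show thesis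
  proof (rule countable_chart_relations[where x = x and N = N])
    show "x a \<in> elems R" if "a < N" for a by (rule x[OF that])
  next
    fix U \<phi> \<rho> u G
    assume chr: "\<And>k::nat. (U k, \<phi> k) \<in> \<A>" and \<rho>: "\<And>k. \<rho> k \<in> elems R"
      and cov: "\<And>s. s \<in> topspace T \<Longrightarrow> \<exists>k. s \<in> U k \<and> \<rho> k s \<noteq> 0"
      and u: "\<And>k l. l < n \<Longrightarrow> u k l \<in> elems R" and G: "\<And>k a. a < N \<Longrightarrow> G k a \<in> smooth_funs n"
      and rel: "\<And>k s a. s \<in> topspace T \<Longrightarrow> \<rho> k s \<noteq> 0 \<Longrightarrow> a < N \<Longrightarrow> x a s = G k a (\<lambda>l\<in>{..<n}. u k l s)"
    have "\<exists>H. H \<in> smooth_funs N \<and> (\<forall>w\<in>W. e w = H (X w))" if e: "e \<in> elems R" for e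
      by (rule fun_of_gens[OF c e]) (auto simp: X_def x_def)
    then obtain Hf where Hf: "\<And>e. e \<in> elems R \<Longrightarrow> Hf e \<in> smooth_funs N"
      "\<And>e w. e \<in> elems R \<Longrightarrow> w \<in> W \<Longrightarrow> e w = Hf e (X w)" by metis
    define P where "P k = Hf (\<rho> k)" for k
    define H where "H k l = Hf (u k l)" for k l
    have P: "P k \<in> smooth_funs N" for k unfolding P_def by (rule Hf(1)[OF \<rho>])
    have H: "H k l \<in> smooth_funs N" if "l < n" for k l unfolding H_def by (rule Hf(1)[OF u[OF that]])
    have WT: "w \<in> topspace T" if "w \<in> W" for w using that W_sub by blast
    have PW: "\<rho> k w = P k (X w)" if "w \<in> W" for k w unfolding P_def by (rule Hf(2)[OF \<rho> that])
    have HW: "(\<lambda>l\<in>{..<n}. u k l w) = (\<lambda>l\<in>{..<n}. H k l (X w))" if "w \<in> W" for k w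
      by (rule restrict_ext) (simp add: H_def Hf(2)[OF u that])
    \<comment> \<open>\<open>E k\<close> measures the failure of the relation through chart
      \<open>k\<close>, switched off where \<open>P k\<close> vanishes. Squares let one sum with
      positive coefficients control all the terms.\<close>
    define E where "E k y = (\<Sum>a<N. (P k y * (y a - G k a (\<lambda>l\<in>{..<n}. H k l y)))\<^sup>2)" for k y
    have E: "smooth_on N (Rn N) (E k)" for k
      unfolding E_def power2_eq_square
      by (intro smooth_on_sum smooth_on_mult smooth_on_diff smooth_on_coord smooth_funsD[OF P] ropen_Rn
            smooth_on_tuple_compose G smooth_funsD[OF H]) auto
    have E0: "E k (X w) = 0" if w: "w \<in> W" for k w
      unfolding E_def
    proof (rule sum.neutral, rule ballI)
      fix a assume "a \<in> {..<N}"
      then show "(P k (X w) * (X w a - G k a (\<lambda>l\<in>{..<n}. H k l (X w))))\<^sup>2 = 0"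
        using rel[OF WT[OF w], of k a] PW[OF w, of k] HW[OF w, of k] by (cases "\<rho> k w = 0") (simp_all add: Xa)
    qed
    \<comment> \<open>\<open>smooth_series\<close> treats all domains together: index 0 is the sum
      of the squares of the \<open>P k\<close>, index 1 the sum of the \<open>E k\<close>, and index
      \<open>l \<ge> 2\<close> the sum of the squares of the \<open>\<rho> k\<close> in chart
      \<open>l - 2\<close>. Common coefficients matter, as the first and the last are compared on
      \<open>W\<close>.\<close>
    define d where "d l = (if l < 2 then N else n)" for l :: nat
    define V where "V l = (if l < 2 then Rn N else \<phi> (l - 2) ` U (l - 2))" for l :: nat
    define f where "f k l y = (if l = 0 then (P k y)\<^sup>2 else if l = 1 then E k y
        else (\<rho> k (inv_into (U (l - 2)) (\<phi> (l - 2)) y))\<^sup>2)" for k l :: nat and y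
    have fs: "smooth_on (d l) (V l) (f k l)" for k l
    proof -
      have 0: "smooth_on N (Rn N) (\<lambda>y. (P k y)\<^sup>2)"
        unfolding power2_eq_square by (intro smooth_on_mult smooth_funsD[OF P] ropen_Rn)
      have 2: "smooth_on n (\<phi> (l - 2) ` U (l - 2)) (\<lambda>y. (\<rho> k (inv_into (U (l - 2)) (\<phi> (l - 2)) y))\<^sup>2)"
        unfolding power2_eq_square by (intro smooth_on_mult chart(2)[OF chr] funD[OF \<rho> chr])
      consider "l = 0" | "l = 1" | "l \<ge> 2" by linarith
      then show ?thesis
      proof cases
        case 1 then show ?thesis using 0 by (simp add: d_def V_def f_def[abs_def])
      next
        case 2 then show ?thesis using E by (simp add: d_def V_def f_def[abs_def])
      next
        case 3 then show ?thesis using 2 by (simp add: d_def V_def f_def[abs_def])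
      qed
    qed
    have Vo: "ropen (d l) (V l)" for l using chart(2)[OF chr] by (simp add: d_def V_def)
    show thesis
    proof (rule smooth_series[where d = d and U = V and f = f, OF Vo fs])
      fix \<epsilon> :: "nat \<Rightarrow> real"
      assume pos: "\<And>k. \<epsilon> k > 0" and ss: "\<And>l. smooth_on (d l) (V l) (\<lambda>y. suminf (\<lambda>k. \<epsilon> k * f k l y))"
        and sm: "\<And>l y. y \<in> V l \<Longrightarrow> summable (\<lambda>k. \<epsilon> k * f k l y)"
      define A where "A y = suminf (\<lambda>k. \<epsilon> k * (P k y)\<^sup>2)" for y
      define B where "B y = suminf (\<lambda>k. \<epsilon> k * E k y)" for y
      define h where "h s = suminf (\<lambda>k. \<epsilon> k * (\<rho> k s)\<^sup>2)" for s
      have A: "smooth_on N (Rn N) A" using ss[of 0] by (simp add: d_def V_def f_def A_def[abs_def])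
      have B: "smooth_on N (Rn N) B" using ss[of 1] by (simp add: d_def V_def f_def B_def[abs_def])
      have Bs: "summable (\<lambda>k. \<epsilon> k * E k y)" if "y \<in> Rn N" for y
        using sm[of y 1] that by (simp add: V_def f_def)
      have hc: "smooth_on n (\<phi> i ` U i) (\<lambda>y. h (inv_into (U i) (\<phi> i) y))" for i
        using ss[of "i + 2"] by (simp add: d_def V_def f_def h_def[abs_def])
      have h_pos: "h s > 0" if s: "s \<in> topspace T" for s
      proof -
        obtain k where k: "s \<in> U k" "\<rho> k s \<noteq> 0" using cov[OF s] by blast
        have "\<phi> k s \<in> V (k + 2)" using k(1) by (simp add: V_def)
        from sm[OF this] have "summable (\<lambda>i. \<epsilon> i * (\<rho> i s)\<^sup>2)"
          using inv_chart[OF chr k(1)] by (simp add: f_def)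
        moreover have "0 \<le> \<epsilon> i * (\<rho> i s)\<^sup>2" for i using pos[of i] by simp
        moreover have "0 < \<epsilon> k * (\<rho> k s)\<^sup>2" using pos[of k] k(2) by simp
        ultimately show ?thesis unfolding h_def by (rule suminf_pos2)
      qed
      \<comment> \<open>A homomorphism preserves equations, not the statement that a value is
        non-zero. The reciprocal of the positive function \<open>h\<close> is smooth on the
        manifold, and its expression in the generators turns the covering property into the equation
        \<open>A * Hf ?g = 1\<close>.\<close>
      let ?g = "\<lambda>s\<in>topspace T. inverse (h s)"
      have g: "?g \<in> elems R"
      proof (rule funI_cover)
        fix p assume p: "p \<in> topspace T"
        obtain k where k: "p \<in> U k" using cov[OF p] by blast
        have "smooth_on n (\<phi> k ` U k) (\<lambda>y. inverse (h (inv_into (U k) (\<phi> k) y)))"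
        proof (rule smooth_on_inverse[OF chart(2)[OF chr] hc])
          fix y assume "y \<in> \<phi> k ` U k"
          then have "inv_into (U k) (\<phi> k) y \<in> U k" by (rule inv_into_into)
          then have "inv_into (U k) (\<phi> k) y \<in> topspace T" using chart(3)[OF chr[of k]] by (rule rev_subsetD)
          from h_pos[OF this] show "h (inv_into (U k) (\<phi> k) y) \<noteq> 0" by simp
        qed
        then show "\<exists>U \<phi>. (U, \<phi>) \<in> \<A> \<and> p \<in> U \<and> smooth_on n (\<phi> ` U) (\<lambda>x. inverse (h (inv_into U \<phi> x)))"
          using chr[of k] k by blast
      qed
      have hA: "h w = A (X w)" if "w \<in> W" for w unfolding h_def A_def by (simp only: PW[OF that])
      have 1: "smooth_on N (Rn N) (\<lambda>y. A y * Hf ?g y - 1)"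
        by (intro smooth_on_diff smooth_on_mult A smooth_funsD[OF Hf(1)[OF g]] smooth_on_const ropen_Rn)
      have 2: "A (X w) * Hf ?g (X w) - 1 = 0" if w: "w \<in> W" for w
      proof -
        have "Hf ?g (X w) = inverse (A (X w))" using Hf(2)[OF g w] hA[OF w] WT[OF w] by simp
        then show ?thesis using hA[OF w] h_pos[OF WT[OF w]] by simp
      qed
      have 3: "B (X w) = 0" if w: "w \<in> W" for w unfolding B_def by (simp add: E0[OF w])
      note rel' = germ_point_relation[OF c \<Psi> \<xi>]
      have Xl: "(\<lambda>a\<in>{..<N}. lift (c a) w) = X w" for w by (simp add: X_def x_def)
      have ev1: "eventually (\<lambda>p. A (\<lambda>a\<in>{..<N}. \<xi> a p) * Hf ?g (\<lambda>a\<in>{..<N}. \<xi> a p) - 1 = 0) F"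
        by (rule rel'[OF _ 1]) (simp_all only: Xl 2)
      have ev2: "eventually (\<lambda>p. B (\<lambda>a\<in>{..<N}. \<xi> a p) = 0) F"
        by (rule rel'[OF _ B]) (simp_all only: Xl 3)
      show thesis
      proof (rule that[of P H G])
        show "eventually (\<lambda>p. (\<exists>k. P k (\<lambda>a\<in>{..<N}. \<xi> a p) \<noteq> 0) \<and>
         (\<forall>k. P k (\<lambda>a\<in>{..<N}. \<xi> a p) \<noteq> 0 \<longrightarrow>
          (\<forall>a<N. \<xi> a p = G k a (\<lambda>l\<in>{..<n}. H k l (\<lambda>a\<in>{..<N}. \<xi> a p))))) F"
          using ev1 ev2
        proof eventually_elim
          case (elim p)
          let ?y = "\<lambda>a\<in>{..<N}. \<xi> a p"
          have yR: "?y \<in> Rn N" by auto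
          have "A ?y \<noteq> 0" using elim(1) by auto
          have ex: "\<exists>k. P k ?y \<noteq> 0"
          proof (rule ccontr)
            assume "\<nexists>k. P k ?y \<noteq> 0"
            then have "A ?y = 0" unfolding A_def by simp
            then show False using \<open>A ?y \<noteq> 0\<close> by contradiction
          qed
          have En: "0 \<le> E k ?y" for k unfolding E_def by (rule sum_nonneg) simp
          then have "0 \<le> \<epsilon> k * E k ?y" for k using pos[of k] by (simp add: less_imp_le)
          \<comment> \<open>A convergent series of non-negative terms with sum zero; the single
            equation \<open>B = 0\<close> thus gives back all the countably many relations.\<close>
          then have "\<forall>k. \<epsilon> k * E k ?y = 0"
            using suminf_eq_zero_iff[OF Bs[OF yR]] elim(2) unfolding B_def by blast
          then have Ez: "E k ?y = 0" for k using pos[of k] by (metis less_irrefl mult_eq_0_iff)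
          have "\<xi> a p = G k a (\<lambda>l\<in>{..<n}. H k l ?y)" if k: "P k ?y \<noteq> 0" and a: "a < N" for k a
          proof -
            have "\<forall>a\<in>{..<N}. (P k ?y * (?y a - G k a (\<lambda>l\<in>{..<n}. H k l ?y)))\<^sup>2 = 0"
              using Ez[of k] unfolding E_def by (subst (asm) sum_nonneg_eq_0_iff) simp_all
            then have "(P k ?y * (?y a - G k a (\<lambda>l\<in>{..<n}. H k l ?y)))\<^sup>2 = 0" using a by (simp only: lessThan_iff)
            then show ?thesis using k a by simp
          qed
          then show ?case using ex by blast
        qed
      qed (rule P, rule H)
    qed
  qed
qed

text \<open>Thickness turns the eventual properties into properties of a non-empty open set of
  source points. Near one of its points a single chart of the target is active, and there the
  generators are functions of \<open>n\<close> chart coordinates. Since the generators separate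
  points, these coordinates do so as well.\<close>

theorem germ_point_dim_le:
  fixes T' :: "'s topology"
  assumes T': "smooth_mfd m T' \<B>" and thick: "thick T' F"
    and \<Psi>: "\<Psi> \<in> cinf_hom C (germ_ring F)" and tame: "tame T' F C \<Psi>" and sep: "separating F C \<Psi>"
  shows "m \<le> n"
proof -
  obtain N c where c: "gens C N c" by (rule fin_gen_gens[OF C])
  have "\<exists>g S. \<Psi> (c a) = germ F g \<and> openin T' S \<and> eventually (\<lambda>p. p \<in> S) F \<and> continuous_map (subtopology T' S) euclideanreal g"
    if "a < N" for a using tame tup_mem[OF gens_tup[OF c] that] unfolding tame_def by blast
  then obtain \<xi> S where \<xi>: "\<And>a. a < N \<Longrightarrow> \<Psi> (c a) = germ F (\<xi> a)"
    and Se: "\<And>a. a < N \<Longrightarrow> eventually (\<lambda>p. p \<in> S a) F"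
    and Sc: "\<And>a. a < N \<Longrightarrow> continuous_map (subtopology T' (S a)) euclideanreal (\<xi> a)" by metis
  define y where "y p = (\<lambda>a\<in>{..<N}. \<xi> a p)" for p
  have ya: "y p a = \<xi> a p" if "a < N" for p a using that by (simp add: y_def)
  show ?thesis
  proof (rule germ_point_charts[OF c \<Psi> \<xi>], assumption)
    fix P H G
    assume P: "\<And>k::nat. P k \<in> smooth_funs N" and H: "\<And>k l. l < n \<Longrightarrow> H k l \<in> smooth_funs N"
      and ev: "eventually (\<lambda>p. (\<exists>k. P k (\<lambda>a\<in>{..<N}. \<xi> a p) \<noteq> 0) \<and>
       (\<forall>k. P k (\<lambda>a\<in>{..<N}. \<xi> a p) \<noteq> 0 \<longrightarrow>
          (\<forall>a<N. \<xi> a p = G k a (\<lambda>l\<in>{..<n}. H k l (\<lambda>a\<in>{..<N}. \<xi> a p))))) F"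
    obtain S' where S': "eventually (\<lambda>p. p \<in> S') F"
      "\<And>p p'. p \<in> S' \<Longrightarrow> p' \<in> S' \<Longrightarrow> (\<And>a. a < N \<Longrightarrow> \<xi> a p = \<xi> a p') \<Longrightarrow> p = p'"
      using separating_gens[OF \<Psi> sep c \<xi>] by metis
    have "eventually (\<lambda>p. \<forall>a\<in>{..<N}. p \<in> S a) F" by (rule eventually_ball_finite) (auto intro: Se)
    then have e: "eventually (\<lambda>p. p \<in> S' \<and> (\<forall>a<N. p \<in> S a) \<and> (\<exists>k. P k (y p) \<noteq> 0) \<and>
       (\<forall>k. P k (y p) \<noteq> 0 \<longrightarrow> (\<forall>a<N. \<xi> a p = G k a (\<lambda>l\<in>{..<n}. H k l (y p))))) F"
      using S'(1) ev unfolding y_def by eventually_elim blast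
    obtain S0 where S0: "openin T' S0" "S0 \<noteq> {}"
      and all: "\<forall>p\<in>S0. p \<in> S' \<and> (\<forall>a<N. p \<in> S a) \<and> (\<exists>k. P k (y p) \<noteq> 0) \<and>
       (\<forall>k. P k (y p) \<noteq> 0 \<longrightarrow> (\<forall>a<N. \<xi> a p = G k a (\<lambda>l\<in>{..<n}. H k l (y p))))"
      using thick[unfolded thick_def, THEN spec, THEN mp, OF e] by (elim exE conjE)
    obtain p0 where p0: "p0 \<in> S0" using S0(2) by blast
    \<comment> \<open>Only now is a chart of the target fixed; by continuity of \<open>P k\<close>
      it remains active on the open set \<open>S1\<close> around \<open>p0\<close>.\<close>
    obtain k where k: "P k (y p0) \<noteq> 0" using all p0 by blast
    have \<xi>c: "continuous_map (subtopology T' S0) euclideanreal (\<xi> a)" if "a < N" for a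
      by (rule continuous_map_from_subtopology_mono[OF Sc[OF that]]) (use all that in blast)
    have Kc: "continuous_map (subtopology T' S0) euclideanreal (\<lambda>p. K (y p))" if "K \<in> smooth_funs N" for K
      unfolding y_def by (rule continuous_map_smooth_tuple[OF that \<xi>c])
    define S1 where "S1 = {p \<in> S0. P k (y p) \<noteq> 0}"
    have "openin (subtopology T' S0) {p \<in> topspace (subtopology T' S0). P k (y p) \<in> - {0}}"
      by (rule openin_continuous_map_preimage[OF Kc[OF P]]) (simp add: open_Compl)
    moreover have "{p \<in> topspace (subtopology T' S0). P k (y p) \<in> - {0}} = S1"
      using openin_subset[OF S0(1)] by (auto simp: S1_def)
    ultimately have S1: "openin T' S1" using openin_trans_full[OF _ S0(1)] by simp
    let ?\<eta> = "\<lambda>p. \<lambda>l\<in>{..<n}. H k l (y p)"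
    have \<eta>c: "continuous_map (subtopology T' S1) (powertop_real {..<n}) ?\<eta>"
    proof (rule continuous_map_coordinatewise_then_product)
      fix l assume "l \<in> {..<n}"
      then have l: "l < n" by simp
      have "continuous_map (subtopology T' S1) euclideanreal (\<lambda>p. H k l (y p))"
        by (rule continuous_map_from_subtopology_mono[OF Kc[OF H[OF l]]]) (auto simp: S1_def)
      then show "continuous_map (subtopology T' S1) euclideanreal (\<lambda>p. ?\<eta> p l)" using l by simp
    qed auto
    have \<eta>i: "inj_on ?\<eta> S1"
    proof (rule inj_onI)
      fix p p' assume p: "p \<in> S1" "p' \<in> S1" and eq: "?\<eta> p = ?\<eta> p'"
      have "\<xi> a r = G k a (?\<eta> r)" if "r \<in> S1" "a < N" for r a using all that unfolding S1_def by blast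
      then have "\<xi> a p = \<xi> a p'" if "a < N" for a using p that eq by metis
      moreover have "p \<in> S'" "p' \<in> S'" using p all unfolding S1_def by blast+
      ultimately show "p = p'" using S'(2) by blast
    qed
    have "S1 \<noteq> {}" using p0 k unfolding S1_def by blast
    then show "m \<le> n" by (rule smooth_mfd.continuous_injection_dim_le[OF T' S1 _ \<eta>c \<eta>i])
  qed
qed

end

section \<open>Comparison of two asymptotic manifolds\<close>

lemma asymptotic_manifoldE:
  assumes "asymptotic_manifold_with_corners TYPE('i) n X"
  obtains "n = -1" "is_empty_scheme X"
  | M :: "univ spec" and D :: "'i set" and r U j and Z :: "univ spec" where "n \<ge> 0" "manifold_with_corners (nat n) M"
    "regular_sys M D r U j" "is_limit M D r U j Z" "fin_gen (Cinf Z)" "isomorphic (red X) Z"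
proof -
  have 2: thesis if a: "n \<ge> 0" "manifold_with_corners (nat n) M" "regular_system M D r U j" "is_limit M D r U j Z"
    "isomorphic (red X) Z"
    and th: "n \<ge> 0 \<Longrightarrow> manifold_with_corners (nat n) M \<Longrightarrow> regular_sys M D r U j \<Longrightarrow> is_limit M D r U j Z \<Longrightarrow>
      fin_gen (Cinf Z) \<Longrightarrow> isomorphic (red X) Z \<Longrightarrow> thesis"
    for M Z :: "univ spec" and D :: "'i set" and r U j thesis
  proof (rule th[OF a(1,2) _ a(4) _ a(5)])
    have "fin_gen (Cinf M)" using a(2) by (simp add: manifold_with_corners_def cinf_scheme_def)
    with a(3) show "regular_sys M D r U j" by (simp add: regular_sys_def)
    show "fin_gen (Cinf Z)" by (rule is_limitE[OF a(4)]) (rule is_coneD(1))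
  qed
  show thesis using assms that 2 unfolding asymptotic_manifold_with_corners_def by metis
qed

theorem proposition1:
  fixes X :: "'a spec" and X' :: "'b spec" and \<Phi> :: "'b \<Rightarrow> 'a" and m n :: int
  assumes "cinf_scheme X'"
    and "cinf_scheme X"
    and "locally_closed_subscheme X X' \<Phi>"
    and "asymptotic_manifold_with_corners TYPE('i) m X"
    and "asymptotic_manifold_with_corners TYPE('j) n X'"
  shows "m \<le> n"
proof -
  have X: "fin_gen (Cinf X)" and X': "fin_gen (Cinf X')" using assms(1,2) by (simp_all add: cinf_scheme_def)
  have n: "n \<ge> -1" using assms(5) by (auto simp: asymptotic_manifold_with_corners_def)
  from assms(4) show ?thesis
  proof (cases rule: asymptotic_manifoldE)
    case 1
    then show ?thesis using n by simp
  next
    case (2 M D r U j Z)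
    obtain T :: "(nat \<Rightarrow> real) topology" and \<A> W q where cr: "corner_ring (nat m) T \<A> W q (Cinf M)"
      by (rule corner_ring_exists[OF 2(2)])
    interpret S: corner_system "nat m" T \<A> W q M D r U j
      unfolding corner_system_def using cr 2(3) by (rule conjI)
    obtain \<Psi>\<^sub>Z where Z: "\<Psi>\<^sub>Z \<in> cinf_hom (Cinf Z) (germ_ring S.F)" "tame T S.F (Cinf Z) \<Psi>\<^sub>Z" "separating S.F (Cinf Z) \<Psi>\<^sub>Z"
      by (rule S.limit_germ_point[OF 2(4)])
    obtain \<Psi>\<^sub>X where X: "\<Psi>\<^sub>X \<in> cinf_hom (Cinf X) (germ_ring S.F)" "tame T S.F (Cinf X) \<Psi>\<^sub>X" "separating S.F (Cinf X) \<Psi>\<^sub>X"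
      by (rule red_germ_point[OF X 2(5,6) Z])
    obtain \<Psi> where \<Psi>: "\<Psi> \<in> cinf_hom (Cinf X') (germ_ring S.F)" "tame T S.F (Cinf X') \<Psi>" "separating S.F (Cinf X') \<Psi>"
      by (rule locally_closed_germ_point[OF X' assms(3) X])
    from assms(5) show ?thesis
    proof (cases rule: asymptotic_manifoldE)
      case 1
      \<comment> \<open>A germ point of the empty scheme forces a zero germ ring and with it a
        trivial filter, which thickness excludes.\<close>
      then have "is_zero_ring (Cinf X')" by (simp add: is_empty_scheme_def)
      from hom_from_zero_ring[OF fin_gen_cinf_ring[OF X'] cinf_ring_germ_ring \<Psi>(1) this]
      have "eventually (\<lambda>_. False) S.F" by (simp add: germ_ring_zero_iff)
      then show ?thesis using S.thick_F unfolding thick_def by blast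
    next
      case N: (2 M' D' r' U' j' Z')
      \<comment> \<open>The filter on the source manifold stays fixed; only the ring carrying the
        germ point moves, down to that of the target manifold with corners.\<close>
      obtain \<Psi>' where \<Psi>': "\<Psi>' \<in> cinf_hom (Cinf Z') (germ_ring S.F)" "tame T S.F (Cinf Z') \<Psi>'" "separating S.F (Cinf Z') \<Psi>'"
        by (rule germ_point_red[OF X' N(5,6) \<Psi>])
      obtain \<Psi>'' where \<Psi>'': "\<Psi>'' \<in> cinf_hom (Cinf M') (germ_ring S.F)" "tame T S.F (Cinf M') \<Psi>''" "separating S.F (Cinf M') \<Psi>''"
        by (rule regular_sys.limit_descend[OF N(3,4) \<Psi>'])
      obtain T' :: "(nat \<Rightarrow> real) topology" and \<B> W' q' where "corner_ring (nat n) T' \<B> W' q' (Cinf M')"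
        by (rule corner_ring_exists[OF N(2)])
      then have "nat m \<le> nat n"
        by (rule corner_ring.germ_point_dim_le[OF _ S.smooth_mfd_axioms S.thick_F \<Psi>''])
      then show ?thesis using 2(1) N(1) by simp
    qed
  qed
qed

end
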